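(* If an anti-self-dual vacuum space-time $(\mathcal M,g)$ admits a Killing spinor of type $(0,k)$, then its twistor space $\mathcal{PT}$ is an affine line bundle over (the total space of) $\mathcal O(k)\to\mathbb{CP}^1$ with underlying translation bundle (the pullback of) $\mathcal O(2-k)$.
   Context: All considerations are local and holomorphic. A space-time is a complex 4-manifold with holomorphic metric $g$ and compatible volume form; $T\mathcal M=S^A\otimes S^{A'}$ with $S^A,S^{A'}$ rank-two spin bundles carrying symplectic forms $\varepsilon_{AB},\varepsilon_{A'B'}$ whose product gives the metric; $\nabla_{AA'}$ is the Levi-Civita connection. It is anti-self-dual (ASD) vacuum if its Ricci tensor and self-dual Weyl spinor $C_{A'B'C'D'}$ vanish. A Killing spinor of type (valence) $(0,k)$ is a non-constant symmetric spinor field $L_{A'_1\cdots A'_k}$ with $\nabla_{A(A'}L_{A'_1\cdots A'_k)}=0$. The twistor space $\mathcal{PT}$ of an ASD vacuum space-time is the 3-dimensional complex manifold of $\alpha$-surfaces in $\mathcal M$ (totally null 2-surfaces whose tangent bivector is self-dual), i.e. the quotient of the projective primed spin bundle (homogeneous fibre coordinates $\pi_{A'}$) by the distribution spanned by $\pi^{A'}\nabla_{AA'}$. It is equipped with a projection $\mathcal{PT}\to\mathbb{CP}^1$, a four-parameter family of sections with normal bundle $\mathcal O(1)\oplus\mathcal O(1)$, and a symplectic form $\Sigma$ on the fibres with values in $\mathcal O(2)$. $\mathcal O(m)$ denotes the line bundle of Chern class $m$ on $\mathbb{CP}^1$.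
   Formalization: The affine line bundle structure is asserted only on the dense set of twistors where the Killing spinor's function has non-zero derivative along the fibres over CP^1, not on all of PT; at the other points the map to O(k) is not a submersion and the claim fails (flat space, k=2, ω^0π_0'). *)

theory Defs
  imports "HOL-Analysis.Analysis" "HOL-Combinatorics.Combinatorics"
begin

section \<open>Several complex variables\<close>

definition holo_on :: "(complex^'n \<Rightarrow> complex) \<Rightarrow> (complex^'n) set \<Rightarrow> bool" where
  "holo_on f S \<longleftrightarrow>
     (\<forall>x\<in>S. \<exists>a :: complex^'n. (f has_derivative (\<lambda>v. \<Sum>i\<in>UNIV. a $ i * v $ i)) (at x))"

definition pd :: "'n \<Rightarrow> (complex^'n \<Rightarrow> complex) \<Rightarrow> complex^'n \<Rightarrow> complex" where
  "pd i f x = deriv (\<lambda>z. f (x + z *s axis i 1)) 0"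


section \<open>Space-times\<close>

text \<open>
  Everything is local: a space-time is an open set \<open>U\<close> of complex 4-space, with the
  components \<open>g\<close> of the metric and \<open>vol\<close> of the volume form in the coordinate frame.
  The splitting of the tangent bundle as \<open>S\<^sup>A \<otimes> S\<^sup>A\<^sup>'\<close> is given by the null
  tetrad \<open>e x A A'\<close> belonging to a pair of unimodular spin frames; all spinor components
  refer to these frames. Spinor indices take the values 0, 1 in the type \<open>2\<close>.
\<close>

definition eps :: "2 \<Rightarrow> 2 \<Rightarrow> complex" where
  "eps A B = (if A = 0 \<and> B = 1 then 1 else if A = 1 \<and> B = 0 then - 1 else 0)"

definition bilin :: "complex^4^4 \<Rightarrow> complex^4 \<Rightarrow> complex^4 \<Rightarrow> complex" where
  "bilin G u v = (\<Sum>a\<in>UNIV. \<Sum>b\<in>UNIV. G $ a $ b * u $ a * v $ b)"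

text \<open>
  The last clause fixes the orientation: it makes the bivectors
  \<open>\<pi>\<^sup>A\<^sup>' \<pi>\<^sup>B\<^sup>' \<epsilon>\<^sup>A\<^sup>B\<close>, tangent to the planes
  spanned by the \<open>\<pi>\<^sup>A\<^sup>' e\<^sub>A\<^sub>A\<^sub>'\<close>, self-dual (\<open>*F = F\<close>).
\<close>

definition spacetime ::
  "(complex^4) set \<Rightarrow> (complex^4 \<Rightarrow> complex^4^4) \<Rightarrow> (complex^4 \<Rightarrow> complex) \<Rightarrow>
   (complex^4 \<Rightarrow> 2 \<Rightarrow> 2 \<Rightarrow> complex^4) \<Rightarrow> bool" where
  "spacetime U g vol e \<longleftrightarrow>
     open U \<and>
     (\<forall>a b. holo_on (\<lambda>x. g x $ a $ b) U) \<and> holo_on vol U \<and>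
     (\<forall>A A' a. holo_on (\<lambda>x. e x A A' $ a) U) \<and>
     (\<forall>x\<in>U.
        transpose (g x) = g x \<and> det (g x) \<noteq> 0 \<and>
        (vol x)\<^sup>2 = det (g x) \<and>
        (\<forall>A A' B B'. bilin (g x) (e x A A') (e x B B') = eps A B * eps A' B') \<and>
        vol x * det (vector [e x 0 0, e x 1 0, e x 0 1, e x 1 1] :: complex^4^4) = 1)"


section \<open>Levi-Civita connection and curvature\<close>

definition christoffel ::
  "(complex^4 \<Rightarrow> complex^4^4) \<Rightarrow> complex^4 \<Rightarrow> 4 \<Rightarrow> 4 \<Rightarrow> 4 \<Rightarrow> complex" where
  "christoffel g x c a b = (\<Sum>d\<in>UNIV. matrix_inv (g x) $ c $ d *
     (pd a (\<lambda>y. g y $ d $ b) x + pd b (\<lambda>y. g y $ d $ a) x - pd d (\<lambda>y. g y $ a $ b) x)) / 2"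

definition riemann ::
  "(complex^4 \<Rightarrow> complex^4^4) \<Rightarrow> complex^4 \<Rightarrow> 4 \<Rightarrow> 4 \<Rightarrow> 4 \<Rightarrow> 4 \<Rightarrow> complex" where
  \<comment> \<open>\<open>R\<^sup>d\<^sub>c\<^sub>a\<^sub>b\<close>, where \<open>(\<nabla>\<^sub>a \<nabla>\<^sub>b - \<nabla>\<^sub>b \<nabla>\<^sub>a) v\<^sup>d = R\<^sup>d\<^sub>c\<^sub>a\<^sub>b v\<^sup>c\<close>\<close>
  "riemann g x d c a b =
     pd a (\<lambda>y. christoffel g y d b c) x - pd b (\<lambda>y. christoffel g y d a c) x
     + (\<Sum>f\<in>UNIV. christoffel g x d a f * christoffel g x f b c
                 - christoffel g x d b f * christoffel g x f a c)"

definition ricci :: "(complex^4 \<Rightarrow> complex^4^4) \<Rightarrow> complex^4 \<Rightarrow> 4 \<Rightarrow> 4 \<Rightarrow> complex" where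
  "ricci g x c b = (\<Sum>a\<in>UNIV. riemann g x a c a b)"

definition riemann_low ::
  "(complex^4 \<Rightarrow> complex^4^4) \<Rightarrow> complex^4 \<Rightarrow> complex^4 \<Rightarrow> complex^4 \<Rightarrow> complex^4 \<Rightarrow> complex^4 \<Rightarrow> complex" where
  "riemann_low g x p q u v = (\<Sum>f\<in>UNIV. \<Sum>d\<in>UNIV. \<Sum>c\<in>UNIV. \<Sum>a\<in>UNIV. \<Sum>b\<in>UNIV.
     g x $ f $ d * riemann g x d c a b * p $ f * q $ c * u $ a * v $ b)"

definition symmetrise :: "nat \<Rightarrow> (2 list \<Rightarrow> complex) \<Rightarrow> 2 list \<Rightarrow> complex" where
  "symmetrise n T bs = (\<Sum>\<sigma> | \<sigma> permutes {..<n}. T (permute_list \<sigma> bs)) / fact n"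

text \<open>
  The self-dual Weyl spinor is the totally symmetric part of
  \<open>\<epsilon>\<^sup>A\<^sup>B \<epsilon>\<^sup>C\<^sup>D R\<^sub>A\<^sub>A\<^sub>'\<^sub>B\<^sub>B\<^sub>'\<^sub>C\<^sub>C\<^sub>'\<^sub>D\<^sub>D\<^sub>' / 4\<close>.
\<close>

definition sd_weyl ::
  "(complex^4 \<Rightarrow> complex^4^4) \<Rightarrow> (complex^4 \<Rightarrow> 2 \<Rightarrow> 2 \<Rightarrow> complex^4) \<Rightarrow> complex^4 \<Rightarrow> 2 list \<Rightarrow> complex" where
  "sd_weyl g e x = symmetrise 4 (\<lambda>bs.
     (\<Sum>A\<in>UNIV. \<Sum>B\<in>UNIV. \<Sum>C\<in>UNIV. \<Sum>D\<in>UNIV. eps A B * eps C D *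
        riemann_low g x (e x A (bs!0)) (e x B (bs!1)) (e x C (bs!2)) (e x D (bs!3))) / 4)"

definition asd_vacuum ::
  "(complex^4) set \<Rightarrow> (complex^4 \<Rightarrow> complex^4^4) \<Rightarrow> (complex^4 \<Rightarrow> 2 \<Rightarrow> 2 \<Rightarrow> complex^4) \<Rightarrow> bool" where
  "asd_vacuum U g e \<longleftrightarrow>
     (\<forall>x\<in>U. (\<forall>a b. ricci g x a b = 0) \<and> (\<forall>bs. length bs = 4 \<longrightarrow> sd_weyl g e x bs = 0))"


section \<open>Primed spinors and Killing spinors\<close>

definition nabla_tetrad ::
  "(complex^4 \<Rightarrow> complex^4^4) \<Rightarrow> (complex^4 \<Rightarrow> 2 \<Rightarrow> 2 \<Rightarrow> complex^4) \<Rightarrow>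
   complex^4 \<Rightarrow> 4 \<Rightarrow> 2 \<Rightarrow> 2 \<Rightarrow> complex^4" where
  "nabla_tetrad g e x a B B' = (\<chi> c. pd a (\<lambda>y. e y B B' $ c) x
     + (\<Sum>d\<in>UNIV. christoffel g x c a d * e x B B' $ d))"

text \<open>
  The connection \<open>\<gamma>\<^sub>a\<^sub>B\<^sub>'\<^sup>C\<^sup>'\<close> induced on primed spinors:
  the spin connections are the trace-free matrices \<open>\<Gamma>\<close>, \<open>\<gamma>\<close> with
  \<open>\<nabla>\<^sub>a e\<^sub>B\<^sub>B\<^sub>' = \<Gamma>\<^sub>a\<^sub>B\<^sup>C e\<^sub>C\<^sub>B\<^sub>' + \<gamma>\<^sub>a\<^sub>B\<^sub>'\<^sup>C\<^sup>' e\<^sub>B\<^sub>C\<^sub>'\<close>;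
  pairing with \<open>e\<^sub>C\<^sub>C\<^sub>'\<close> and contracting with \<open>\<epsilon>\<^sup>B\<^sup>C\<close>
  removes \<open>\<Gamma>\<close> and leaves
  \<open>2 \<gamma>\<^sub>a\<^sub>B\<^sub>'\<^sup>D\<^sup>' \<epsilon>\<^sub>D\<^sub>'\<^sub>C\<^sub>'\<close>.
\<close>

definition spin_conn ::
  "(complex^4 \<Rightarrow> complex^4^4) \<Rightarrow> (complex^4 \<Rightarrow> 2 \<Rightarrow> 2 \<Rightarrow> complex^4) \<Rightarrow>
   complex^4 \<Rightarrow> 4 \<Rightarrow> 2 \<Rightarrow> 2 \<Rightarrow> complex" where
  "spin_conn g e x a B' C' = (\<Sum>B\<in>UNIV. \<Sum>C\<in>UNIV. \<Sum>D'\<in>UNIV.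
     eps B C * eps C' D' * bilin (g x) (nabla_tetrad g e x a B B') (e x C D')) / 2"

text \<open>
  A spinor field \<open>L\<close> with \<open>k\<close> lower primed indices is given by its components
  \<open>L x bs\<close>, where \<open>bs\<close> is a list of \<open>k\<close> indices; values at lists of other
  lengths are irrelevant. The derivative below is \<open>\<nabla>\<^sub>A\<^sub>A\<^sub>' L\<^sub>b\<^sub>s\<close>.
\<close>

definition nabla_spinor ::
  "(complex^4 \<Rightarrow> complex^4^4) \<Rightarrow> (complex^4 \<Rightarrow> 2 \<Rightarrow> 2 \<Rightarrow> complex^4) \<Rightarrow>
   (complex^4 \<Rightarrow> 2 list \<Rightarrow> complex) \<Rightarrow> complex^4 \<Rightarrow> 2 \<Rightarrow> 2 \<Rightarrow> 2 list \<Rightarrow> complex" where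
  "nabla_spinor g e L x A A' bs = (\<Sum>a\<in>UNIV. e x A A' $ a *
     (pd a (\<lambda>y. L y bs) x
      - (\<Sum>i<length bs. \<Sum>C\<in>UNIV. spin_conn g e x a (bs!i) C * L x (bs[i := C]))))"

definition killing_spinor ::
  "(complex^4) set \<Rightarrow> (complex^4 \<Rightarrow> complex^4^4) \<Rightarrow> (complex^4 \<Rightarrow> 2 \<Rightarrow> 2 \<Rightarrow> complex^4) \<Rightarrow>
   nat \<Rightarrow> (complex^4 \<Rightarrow> 2 list \<Rightarrow> complex) \<Rightarrow> bool" where
  "killing_spinor U g e k L \<longleftrightarrow>
     (\<forall>bs. length bs = k \<longrightarrow> holo_on (\<lambda>x. L x bs) U) \<and>
     (\<forall>x\<in>U. \<forall>bs cs. length bs = k \<and> mset cs = mset bs \<longrightarrow> L x cs = L x bs) \<and>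
     (\<forall>x\<in>U. \<forall>A bs. length bs = Suc k \<longrightarrow>
        symmetrise (Suc k) (\<lambda>cs. nabla_spinor g e L x A (hd cs) (tl cs)) bs = 0) \<and>
     \<not> (\<forall>x\<in>U. \<forall>A A' bs. length bs = k \<longrightarrow> nabla_spinor g e L x A A' bs = 0)"

text \<open>Homogeneous fibre coordinates are \<open>\<pi>\<^sub>A\<^sub>'\<close>, hence the raising of the index
  (\<open>\<pi>\<^sup>A\<^sup>' = \<epsilon>\<^sup>A\<^sup>'\<^sup>B\<^sup>' \<pi>\<^sub>B\<^sub>'\<close>) before contractions.\<close>

definition up :: "complex^2 \<Rightarrow> 2 \<Rightarrow> complex" where
  "up \<pi> A' = (\<Sum>B'\<in>UNIV. eps A' B' * \<pi> $ B')"

definition contract :: "nat \<Rightarrow> (2 list \<Rightarrow> complex) \<Rightarrow> complex^2 \<Rightarrow> complex" where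
  "contract k T \<pi> = (\<Sum>bs | length bs = k. T bs * (\<Prod>i<k. up \<pi> (bs!i)))"


section \<open>Twistor space\<close>

text \<open>
  The projective primed spin bundle is handled through homogeneous coordinates, on
  \<open>U \<times> (\<complex>\<^sup>2 - 0)\<close>: the distribution below is spanned by the
  \<open>\<pi>\<^sup>A\<^sup>' \<nabla>\<^sub>A\<^sub>A\<^sub>'\<close> together with the Euler field, so that its leaves are
  the preimages of the leaves of the twistor distribution downstairs.
\<close>

definition spin_bundle :: "(complex^4) set \<Rightarrow> ((complex^4) \<times> (complex^2)) set" where
  "spin_bundle U = U \<times> (UNIV - {0})"

definition twistor_distribution ::
  "(complex^4 \<Rightarrow> complex^4^4) \<Rightarrow> (complex^4 \<Rightarrow> 2 \<Rightarrow> 2 \<Rightarrow> complex^4) \<Rightarrow>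
   (complex^4) \<times> (complex^2) \<Rightarrow> ((complex^4) \<times> (complex^2)) set" where
  "twistor_distribution g e = (\<lambda>(x, \<pi>). {(u, w).
     (\<exists>\<kappa> :: complex^2. u = (\<Sum>A\<in>UNIV. \<Sum>A'\<in>UNIV. (\<kappa> $ A * up \<pi> A') *s e x A A')) \<and>
     (\<exists>\<mu>. \<forall>B'. w $ B' - (\<Sum>a\<in>UNIV. \<Sum>C'\<in>UNIV. u $ a * spin_conn g e x a B' C' * \<pi> $ C')
               = \<mu> * \<pi> $ B')})"

definition same_leaf ::
  "(complex^4) set \<Rightarrow> (complex^4 \<Rightarrow> complex^4^4) \<Rightarrow> (complex^4 \<Rightarrow> 2 \<Rightarrow> 2 \<Rightarrow> complex^4) \<Rightarrow>
   (((complex^4) \<times> (complex^2)) \<times> ((complex^4) \<times> (complex^2))) set" where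
  "same_leaf U g e = {(s, s'). \<exists>c :: real \<Rightarrow> (complex^4) \<times> (complex^2).
     valid_path c \<and> path_image c \<subseteq> spin_bundle U \<and> pathstart c = s \<and> pathfinish c = s' \<and>
     (\<exists>F. finite F \<and> (\<forall>t\<in>{0..1} - F. \<exists>v \<in> twistor_distribution g e (c t).
        (c has_vector_derivative v) (at t)))}"

definition twistor_space ::
  "(complex^4) set \<Rightarrow> (complex^4 \<Rightarrow> complex^4^4) \<Rightarrow> (complex^4 \<Rightarrow> 2 \<Rightarrow> 2 \<Rightarrow> complex^4) \<Rightarrow>
   ((complex^4) \<times> (complex^2)) set set" where
  "twistor_space U g e = spin_bundle U // same_leaf U g e"

definition twistor_point ::
  "(complex^4) set \<Rightarrow> (complex^4 \<Rightarrow> complex^4^4) \<Rightarrow> (complex^4 \<Rightarrow> 2 \<Rightarrow> 2 \<Rightarrow> complex^4) \<Rightarrow>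
   (complex^4) \<times> (complex^2) \<Rightarrow> ((complex^4) \<times> (complex^2)) set" where
  "twistor_point U g e s = same_leaf U g e `` {s}"

type_synonym 'p chart = "'p set \<times> ('p \<Rightarrow> complex^3)"

definition compatible :: "'p chart \<Rightarrow> 'p chart \<Rightarrow> bool" where
  "compatible = (\<lambda>(V, \<phi>) (W, \<psi>).
     open (\<phi> ` (V \<inter> W)) \<and> open (\<psi> ` (V \<inter> W)) \<and>
     (\<forall>i. holo_on (\<lambda>w. \<psi> (inv_into V \<phi> w) $ i) (\<phi> ` (V \<inter> W))) \<and>
     (\<forall>i. holo_on (\<lambda>w. \<phi> (inv_into W \<psi> w) $ i) (\<psi> ` (V \<inter> W))))"

definition compatible_chart :: "'p set \<Rightarrow> 'p chart set \<Rightarrow> 'p chart \<Rightarrow> bool" where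
  "compatible_chart P \<A> = (\<lambda>(V, \<phi>). V \<subseteq> P \<and> inj_on \<phi> V \<and> open (\<phi> ` V) \<and>
     (\<forall>c\<in>\<A>. compatible (V, \<phi>) c))"

definition atlas_open :: "'p set \<Rightarrow> 'p chart set \<Rightarrow> 'p set \<Rightarrow> bool" where
  "atlas_open P \<A> W \<longleftrightarrow> W \<subseteq> P \<and> (\<forall>(V, \<phi>)\<in>\<A>. open (\<phi> ` (W \<inter> V)))"

definition complex_3_manifold :: "'p set \<Rightarrow> 'p chart set \<Rightarrow> bool" where
  "complex_3_manifold P \<A> \<longleftrightarrow>
     (\<Union>(V, \<phi>)\<in>\<A>. V) = P \<and> (\<forall>c\<in>\<A>. compatible_chart P \<A> c) \<and>
     (\<forall>p\<in>P. \<forall>q\<in>P. p \<noteq> q \<longrightarrow>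
        (\<exists>V W. atlas_open P \<A> V \<and> atlas_open P \<A> W \<and> p \<in> V \<and> q \<in> W \<and> V \<inter> W = {}))"

text \<open>
  \<open>\<A>\<close> makes the leaf space the quotient complex manifold of the spin bundle: the quotient map
  is a holomorphic submersion, which determines the complex structure uniquely.
\<close>

definition twistor_atlas ::
  "(complex^4) set \<Rightarrow> (complex^4 \<Rightarrow> complex^4^4) \<Rightarrow> (complex^4 \<Rightarrow> 2 \<Rightarrow> 2 \<Rightarrow> complex^4) \<Rightarrow>
   ((complex^4) \<times> (complex^2)) set chart set \<Rightarrow> bool" where
  "twistor_atlas U g e \<A> \<longleftrightarrow>
     complex_3_manifold (twistor_space U g e) \<A> \<and>
     (\<forall>(V, \<phi>)\<in>\<A>.
        open {s \<in> spin_bundle U. twistor_point U g e s \<in> V} \<and>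
        (\<forall>s\<in>spin_bundle U. twistor_point U g e s \<in> V \<longrightarrow>
           (\<exists>(D :: complex^4^3) (E :: complex^2^3).
              ((\<lambda>s. \<phi> (twistor_point U g e s)) has_derivative (\<lambda>(u, w). D *v u + E *v w)) (at s) \<and>
              surj (\<lambda>(u, w). D *v u + E *v w))))"

text \<open>
  A unimodular frame of parallel primed spinors \<open>d x i\<close> (upper index). The components
  \<open>\<pi>\<^sub>A\<^sub>' d\<^sub>i\<^sup>A\<^sup>'\<close> are constant up to a common scale along the leaves, and are
  the homogeneous coordinates of the projection of twistor space to the projective line.
\<close>

definition parallel_dyad ::
  "(complex^4) set \<Rightarrow> (complex^4 \<Rightarrow> complex^4^4) \<Rightarrow> (complex^4 \<Rightarrow> 2 \<Rightarrow> 2 \<Rightarrow> complex^4) \<Rightarrow>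
   (complex^4 \<Rightarrow> 2 \<Rightarrow> complex^2) \<Rightarrow> bool" where
  "parallel_dyad U g e d \<longleftrightarrow>
     (\<forall>i A'. holo_on (\<lambda>x. d x i $ A') U) \<and>
     (\<forall>x\<in>U. (\<Sum>A'\<in>UNIV. \<Sum>B'\<in>UNIV. eps A' B' * d x 0 $ A' * d x 1 $ B') = 1 \<and>
        (\<forall>i a B'. pd a (\<lambda>y. d y i $ B') x
                  + (\<Sum>C'\<in>UNIV. spin_conn g e x a C' B' * d x i $ C') = 0))"

definition dyad_coords :: "(2 \<Rightarrow> complex^2) \<Rightarrow> complex^2 \<Rightarrow> complex^2" where
  "dyad_coords d \<pi> = (\<chi> i. \<Sum>A'\<in>UNIV. \<pi> $ A' * d i $ A')"


section \<open>The line bundles over the projective line and affine bundles over them\<close>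

text \<open>
  The point \<open>[\<pi>, l]\<close> of the total space of \<open>\<O>(m)\<close>: the identification is
  \<open>(\<pi>, l) ~ (c \<pi>, c\<^sup>m l)\<close>, so that homogeneous functions of degree \<open>m\<close> are sections.
\<close>

definition O_point :: "int \<Rightarrow> complex^2 \<Rightarrow> complex \<Rightarrow> ((complex^2) \<times> complex) set" where
  "O_point m \<pi> l = {(c *s \<pi>, c powi m * l) | c. c \<noteq> 0}"

definition affine_rep :: "2 \<Rightarrow> complex \<Rightarrow> complex^2" where
  \<comment> \<open>the representative with \<open>\<pi>\<^sub>i = 1\<close> and other component \<open>\<zeta>\<close>\<close>
  "affine_rep i \<zeta> = (\<chi> j. if j = i then 1 else \<zeta>)"

text \<open>
  Over the patch \<open>\<pi>\<^sub>i \<noteq> 0\<close> the fibre coordinate of \<open>\<O>(m)\<close> is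
  \<open>l / \<pi>\<^sub>i\<^sup>m\<close>, so the transition function from patch \<open>i\<close> to patch \<open>j\<close> is
  \<open>(\<pi>\<^sub>i / \<pi>\<^sub>j)\<^sup>m\<close>, here evaluated at the representative with \<open>\<pi>\<^sub>i = 1\<close>.
\<close>

definition O_trans :: "int \<Rightarrow> 2 \<Rightarrow> 2 \<Rightarrow> complex \<Rightarrow> complex" where
  "O_trans m i j \<zeta> = (1 / (affine_rep i \<zeta> $ j)) powi m"

text \<open>
  \<open>p : W \<rightarrow> Tot \<O>(k)\<close> is an affine line bundle with translation bundle the pullback of
  \<open>\<O>(m)\<close>, in the local sense: the base is an open subset of \<open>Tot \<O>(k)\<close> and the
  trivialisations identify \<open>W\<close> with open subsets of base times line. A trivialisation is a
  triple \<open>(i, V, \<phi>)\<close>; the components of \<open>\<phi>\<close> are the base coordinates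
  \<open>\<zeta>\<close> and \<open>l / \<pi>\<^sub>i\<^sup>k\<close> of \<open>p\<close> over the patch \<open>\<pi>\<^sub>i \<noteq> 0\<close>,
  and the affine coordinate on the fibres of \<open>p\<close>.
\<close>

definition affine_line_bundle ::
  "'p set \<Rightarrow> 'p chart set \<Rightarrow> 'p set \<Rightarrow> int \<Rightarrow> int \<Rightarrow> ('p \<Rightarrow> ((complex^2) \<times> complex) set) \<Rightarrow> bool" where
  "affine_line_bundle P \<A> W k m p \<longleftrightarrow>
     (\<exists>\<T> :: (2 \<times> 'p set \<times> ('p \<Rightarrow> complex^3)) set.
        (\<Union>(i, V, \<phi>)\<in>\<T>. V) = W \<and>
        (\<forall>(i, V, \<phi>)\<in>\<T>. compatible_chart P \<A> (V, \<phi>) \<and>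
           (\<forall>z\<in>V. p z = O_point k (affine_rep i (\<phi> z $ 1)) (\<phi> z $ 2))) \<and>
        (\<forall>(i, V, \<phi>)\<in>\<T>. \<forall>(j, V', \<phi>')\<in>\<T>. \<exists>h :: ((complex^2) \<times> complex) set \<Rightarrow> complex.
           holo_on (\<lambda>b. h (O_point k (affine_rep i (b $ 1)) (b $ 2)))
             {b :: complex^2. O_point k (affine_rep i (b $ 1)) (b $ 2) \<in> p ` (V \<inter> V')} \<and>
           (\<forall>z\<in>V \<inter> V'. \<phi>' z $ 3 = O_trans m i j (\<phi> z $ 1) * \<phi> z $ 3 + h (p z))))"

text \<open>
  The twistors at which the function \<open>L\<^sub>A\<^sub>'\<^sub>.\<^sub>.\<^sub>.\<^sub>B\<^sub>' \<pi>\<^sup>A\<^sup>' ... \<pi>\<^sup>B\<^sup>'\<close>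
  has non-zero derivative along the fibre of twistor space over the projective line; elsewhere
  the map it defines to \<open>Tot \<O>(k)\<close> is not a submersion. In flat space the Killing spinor
  with function \<open>\<omega>\<^sup>0 \<pi>\<^sub>0\<^sub>'\<close> has a critical set, \<open>\<pi>\<^sub>0\<^sub>' = 0\<close>, that
  meets every twistor line.
\<close>

definition regular_twistors ::
  "(complex^4) set \<Rightarrow> (complex^4 \<Rightarrow> complex^4^4) \<Rightarrow> (complex^4 \<Rightarrow> 2 \<Rightarrow> 2 \<Rightarrow> complex^4) \<Rightarrow>
   nat \<Rightarrow> (complex^4 \<Rightarrow> 2 list \<Rightarrow> complex) \<Rightarrow> ((complex^4) \<times> (complex^2)) set set" where
  "regular_twistors U g e k L = {twistor_point U g e (x, \<pi>) | x \<pi>. (x, \<pi>) \<in> spin_bundle U \<and>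
     (\<exists>A A'. contract k (\<lambda>bs. nabla_spinor g e L x A A' bs) \<pi> \<noteq> 0)}"

end

theory Submission
  imports Defs "HOL-Complex_Analysis.Conformal_Mappings"
begin

text \<open>
  The primed spin connection of an anti-self-dual vacuum is flat, so a simply connected domain carries
  a parallel dyad. Let \<open>z\<^sub>i\<close> be the components of \<open>\<pi>\<close> in this dyad. In the
  coordinates \<open>(x, z)\<close> of the spin bundle the twistor distribution is spanned by the fields
  \<open>V\<^sub>A = z\<^sub>1 e\<^sub>A\<^sub>0 - z\<^sub>0 e\<^sub>A\<^sub>1\<close> (\<open>e\<^sub>A\<^sub>i\<close> being the tetrad
  contracted with the dyad), and the functions on twistor space are those which are annihilated by
  the \<open>V\<^sub>A\<close> and homogeneous of degree 0 in \<open>z\<close>. The Killing equation says that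
  \<open>V\<^sub>A\<close> annihilates the contraction \<open>Q\<close> of the Killing spinor with \<open>\<pi>\<close>; it is
  homogeneous of degree \<open>k\<close>, and \<open>(z, Q)\<close> defines the projection to the total space of
  \<open>\<O>(k)\<close>.

  The fibrewise symplectic form appears as the bracket
  \<open>{f, h}\<^sub>i = \<epsilon>\<^sup>A\<^sup>B (e\<^sub>A\<^sub>i f) (e\<^sub>B\<^sub>i h)\<close>, which maps twistor functions to twistor
  functions and satisfies \<open>z\<^sub>i\<^sup>2 {f, h}\<^sub>j = z\<^sub>j\<^sup>2 {f, h}\<^sub>i\<close>. Over the patch
  \<open>z\<^sub>i \<noteq> 0\<close>, near a twistor where the fibre derivative of \<open>q = Q / z\<^sub>i\<^sup>k\<close> does not
  vanish, one can solve \<open>{q, s}\<^sub>i = 1\<close>; the affine fibre coordinate is \<open>s\<close>. Two such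
  functions satisfy \<open>\<partial>s' / \<partial>s = (z\<^sub>i / z\<^sub>j)\<^bsup>2-k\<^esup>\<close> along the fibres of the
  projection, hence differ, after this rescaling, by a function on the base. For this the fibre
  discs of two charts must intersect in a connected set; it suffices that every chart extends to a
  fibre disc of four times its radius, because then the smaller of two discs that meet lies in the
  extension of the larger one.
\<close>

section \<open>Several complex variables\<close>

text \<open>Leaves are defined by real piecewise smooth paths and twistor space is a bare quotient
  with some atlas, so the work is done upstairs, on open sets that are unions of leaves. Two
  directions are needed. A function killed by the \<open>V A\<close> and by the Euler field is
  constant along the paths in a leaf. Conversely, a function pulled back from a chart is killed by
  them; this needs curves that stay inside a leaf with prescribed velocity, hence an existence
  theorem for differential equations. The Hausdorff property of the atlas enters where two twistors
  follow corresponding segments in two fibre discs: the times at which they coincide form a closed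
  set. Critical points of \<open>Q\<close> along the fibres can occur, so the bundle lives over the
  regular twistors. These are dense: otherwise the gradient of the Killing spinor, a polynomial in
  the fibre coordinates, would vanish over an open set and then everywhere by analytic continuation.
  Flatness yields parallel spinors on small balls only; transport along paths and lifting of
  homotopies make them global.\<close>

lemma norm_scale_axis [simp]: "norm (c *s (axis i 1 :: complex^'n)) = norm c"
proof -
  have "c *s (axis i 1 :: complex^'n) = axis i c" by (auto simp: vec_eq_iff axis_def)
  moreover have "(\<Sum>j\<in>UNIV. (norm ((axis i c :: complex^'n) $ j))\<^sup>2) = (\<Sum>j\<in>UNIV. if j = i then (norm c)\<^sup>2 else 0)"
    by (rule sum.cong) (auto simp: axis_def)
  ultimately show ?thesis by (simp add: norm_vec_def L2_set_def)
qed

lemma bounded_linear_scale_axis: "bounded_linear (\<lambda>z::complex. z *s axis i 1 :: complex^'n)"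
  by (rule bounded_linear_intro[where K=1]) (auto simp: vec_eq_iff algebra_simps)

lemma has_derivative_axis_sum:
  fixes f :: "complex^'n \<Rightarrow> complex"
  assumes "(f has_derivative (\<lambda>v. \<Sum>i\<in>UNIV. a i * v $ i)) (at x)"
  shows "((\<lambda>z. f (x + z *s axis i 1)) has_field_derivative a i) (at 0)"
proof -
  note b = bounded_linear_scale_axis
  have "((\<lambda>z::complex. x + z *s axis i 1) has_derivative (\<lambda>z. z *s axis i 1)) (at 0)"
    by (auto intro!: derivative_eq_intros bounded_linear_imp_has_derivative[OF b])
  then have "((\<lambda>z. f (x + z *s axis i 1)) has_derivative (\<lambda>z. \<Sum>j\<in>UNIV. a j * (z *s axis i 1 :: complex^'n) $ j)) (at 0)"
    using has_derivative_compose[of "\<lambda>z::complex. x + z *s axis i 1" "\<lambda>z. z *s axis i 1" 0 UNIV f "\<lambda>v. \<Sum>i\<in>UNIV. a i * v $ i"] assms by simp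
  moreover have "(\<lambda>z. \<Sum>j\<in>UNIV. a j * (z *s axis i 1 :: complex^'n) $ j) = (*) (a i)"
    by (auto simp: axis_def if_distrib cong: if_cong)
  ultimately show ?thesis by (simp add: has_field_derivative_def)
qed

lemma pd_eqI:
  assumes "(f has_derivative (\<lambda>v. \<Sum>i\<in>UNIV. a i * v $ i)) (at x)"
  shows "pd i f x = a i"
  unfolding pd_def using has_derivative_axis_sum[OF assms] by (rule DERIV_imp_deriv)

text \<open>The gradient in \<open>holo_on\<close> is existential. This makes the partial
  derivatives \<open>pd\<close> its canonical value, and all later calculus is done with
  them.\<close>

lemma holo_onD:
  assumes "holo_on f S" "x \<in> S"
  shows "(f has_derivative (\<lambda>v. \<Sum>i\<in>UNIV. pd i f x * v $ i)) (at x)"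
proof -
  obtain a where a: "(f has_derivative (\<lambda>v. \<Sum>i\<in>UNIV. a $ i * v $ i)) (at x)"
    using assms by (auto simp: holo_on_def)
  show ?thesis using a by (simp add: pd_eqI[OF a])
qed

lemma holo_onI:
  assumes "\<And>x. x \<in> S \<Longrightarrow> (f has_derivative (\<lambda>v. \<Sum>i\<in>UNIV. a x i * v $ i)) (at x)"
  shows "holo_on f S"
  unfolding holo_on_def
proof
  fix x assume "x \<in> S"
  then show "\<exists>b::complex^'a. (f has_derivative (\<lambda>v. \<Sum>i\<in>UNIV. b $ i * v $ i)) (at x)"
    using assms by (intro exI[of _ "\<chi> i. a x i"]) auto
qed

lemma holo_on_pd:
  assumes "holo_on f S" "x \<in> S"
  shows "((\<lambda>z. f (x + z *s axis i 1)) has_field_derivative pd i f x) (at 0)"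
  by (rule has_derivative_axis_sum[OF holo_onD[OF assms]])

lemma holo_on_subset: "holo_on f S \<Longrightarrow> T \<subseteq> S \<Longrightarrow> holo_on f T"
  by (auto simp: holo_on_def)

text \<open>Holomorphy asks for a derivative in the full space at each point, not for one within the
  set, so it is a pointwise condition and can be collected from pieces of any shape.\<close>

lemma holo_on_UN: "(\<And>x. x \<in> S \<Longrightarrow> \<exists>T. x \<in> T \<and> holo_on f T) \<Longrightarrow> holo_on f S"
  unfolding holo_on_def by blast

lemma holo_on_imp_continuous_on: "holo_on f S \<Longrightarrow> continuous_on S f"
  by (meson continuous_at_imp_continuous_on has_derivative_continuous holo_onD)

lemma holo_on_transform:
  assumes "holo_on f S" "open S" "\<And>x. x \<in> S \<Longrightarrow> f x = g x"
  shows "holo_on g S"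
proof (rule holo_onI)
  fix x assume "x \<in> S"
  show "(g has_derivative (\<lambda>v. \<Sum>i\<in>UNIV. pd i f x * v $ i)) (at x)"
    by (rule has_derivative_transform_within_open[OF holo_onD[OF assms(1) \<open>x\<in>S\<close>] assms(2) \<open>x\<in>S\<close> assms(3)])
qed

lemma pd_cong:
  assumes "open S" "x \<in> S" "\<And>x. x \<in> S \<Longrightarrow> f x = g x"
  shows "pd i f x = pd i g x"
  unfolding pd_def
proof (rule deriv_cong_ev)
  have "isCont (\<lambda>z::complex. x + z *s axis i 1) 0"
    by (intro continuous_intros linear_continuous_at bounded_linear_scale_axis)
  then have "((\<lambda>z::complex. x + z *s axis i 1) \<longlongrightarrow> x) (nhds 0)"
    unfolding isCont_def tendsto_nhds_iff by simp
  then have "\<forall>\<^sub>F z in nhds 0. x + z *s axis i 1 \<in> S"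
    using assms(1,2) by (simp add: topological_tendstoD)
  then show "\<forall>\<^sub>F z in nhds 0. f (x + z *s axis i 1) = g (x + z *s axis i 1)"
    by eventually_elim (use assms(3) in auto)
qed auto

lemma holo_on_const [simp]: "holo_on (\<lambda>x. c) S"
  by (rule holo_onI[where a="\<lambda>_ _. 0"]) auto

lemma pd_const [simp]: "pd i (\<lambda>x. c) x = 0"
  by (rule pd_eqI) auto

lemma has_derivative_nth: "((\<lambda>x::complex^'n. x $ j) has_derivative (\<lambda>v. v $ j)) F"
  by (rule bounded_linear_imp_has_derivative) auto

lemma sum_delta_mult: "(\<Sum>i\<in>UNIV. (if i = j then 1 else 0) * v $ i) = (v :: complex^'n) $ j"
  by (simp add: if_distrib[of "\<lambda>a. a * _"] cong: if_cong)

lemma holo_on_nth [simp]: "holo_on (\<lambda>x. x $ j) S"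
  by (rule holo_onI[where a="\<lambda>_ i. if i = j then 1 else 0"]) (simp add: sum_delta_mult has_derivative_nth)

lemma pd_nth [simp]: "pd i (\<lambda>x. x $ j) x = (if i = j then 1 else 0)"
  by (rule pd_eqI) (simp add: sum_delta_mult has_derivative_nth)

lemma pd_add':
  assumes "holo_on f S" "holo_on g S" "x \<in> S"
  shows "((\<lambda>x. f x + g x) has_derivative (\<lambda>v. \<Sum>i\<in>UNIV. (pd i f x + pd i g x) * v $ i)) (at x)"
  using has_derivative_add[OF holo_onD[OF assms(1,3)] holo_onD[OF assms(2,3)]]
  by (simp add: distrib_right sum.distrib)

lemma pd_mult':
  assumes "holo_on f S" "holo_on g S" "x \<in> S"
  shows "((\<lambda>x. f x * g x) has_derivative (\<lambda>v. \<Sum>i\<in>UNIV. (f x * pd i g x + pd i f x * g x) * v $ i)) (at x)"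
  using has_derivative_mult[OF holo_onD[OF assms(1,3)] holo_onD[OF assms(2,3)]]
  by (simp add: distrib_right sum.distrib sum_distrib_left sum_distrib_right mult.assoc mult.left_commute[of _ "g x"] mult.commute[of _ "g x"])

lemma holo_on_add: "holo_on f S \<Longrightarrow> holo_on g S \<Longrightarrow> holo_on (\<lambda>x. f x + g x) S"
  by (rule holo_onI[OF pd_add'])
lemma pd_add: "holo_on f S \<Longrightarrow> holo_on g S \<Longrightarrow> x \<in> S \<Longrightarrow> pd i (\<lambda>x. f x + g x) x = pd i f x + pd i g x"
  by (rule pd_eqI[OF pd_add'])
lemma holo_on_mult: "holo_on f S \<Longrightarrow> holo_on g S \<Longrightarrow> holo_on (\<lambda>x. f x * g x) S"
  by (rule holo_onI[OF pd_mult'])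
lemma pd_mult: "holo_on f S \<Longrightarrow> holo_on g S \<Longrightarrow> x \<in> S \<Longrightarrow> pd i (\<lambda>x. f x * g x) x = f x * pd i g x + pd i f x * g x"
  by (rule pd_eqI[OF pd_mult'])

lemma pd_cmult: "holo_on f S \<Longrightarrow> x \<in> S \<Longrightarrow> pd i (\<lambda>x. c * f x) x = c * pd i f x"
  using pd_mult[of "\<lambda>_. c" S f x i] by simp

lemma holo_on_minus: "holo_on f S \<Longrightarrow> holo_on (\<lambda>x. - f x) S"
  using holo_on_mult[of "\<lambda>_. -1" S f] by simp
lemma pd_minus: "holo_on f S \<Longrightarrow> x \<in> S \<Longrightarrow> pd i (\<lambda>x. - f x) x = - pd i f x"
  using pd_cmult[of f S x i "-1"] by simp
lemma holo_on_diff: "holo_on f S \<Longrightarrow> holo_on g S \<Longrightarrow> holo_on (\<lambda>x. f x - g x) S"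
  using holo_on_add[of f S "\<lambda>x. - g x"] holo_on_minus[of g S] by simp
lemma pd_diff: "holo_on f S \<Longrightarrow> holo_on g S \<Longrightarrow> x \<in> S \<Longrightarrow> pd i (\<lambda>x. f x - g x) x = pd i f x - pd i g x"
  using pd_add[of f S "\<lambda>x. - g x" x i] holo_on_minus[of g S] by (simp add: pd_minus)

lemma holo_on_sum: "(\<And>j. j \<in> J \<Longrightarrow> holo_on (f j) S) \<Longrightarrow> holo_on (\<lambda>x. \<Sum>j\<in>J. f j x) S"
  by (induction J rule: infinite_finite_induct) (auto intro: holo_on_add)
lemma pd_sum:
  assumes "\<And>j. j \<in> J \<Longrightarrow> holo_on (f j) S" "x \<in> S"
  shows "pd i (\<lambda>x. \<Sum>j\<in>J. f j x) x = (\<Sum>j\<in>J. pd i (f j) x)"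
  using assms(1)
proof (induction J rule: infinite_finite_induct)
  case (insert j J)
  then show ?case by (simp add: pd_add[where S=S] holo_on_sum assms(2))
qed auto

lemma holo_on_prod: "(\<And>j. j \<in> J \<Longrightarrow> holo_on (f j) S) \<Longrightarrow> holo_on (\<lambda>x. \<Prod>j\<in>J. f j x) S"
  by (induction J rule: infinite_finite_induct) (auto intro: holo_on_mult)

lemma holo_on_power: "holo_on f S \<Longrightarrow> holo_on (\<lambda>x. f x ^ n) S"
  by (induction n) (auto intro: holo_on_mult)

lemma holo_on_compose_field:
  assumes "holo_on f S" "\<And>x. x \<in> S \<Longrightarrow> (h has_field_derivative h' (f x)) (at (f x))"
  shows "holo_on (\<lambda>x. h (f x)) S"
proof (rule holo_onI)
  fix x assume x: "x \<in> S"
  show "((\<lambda>x. h (f x)) has_derivative (\<lambda>v. \<Sum>i\<in>UNIV. (h' (f x) * pd i f x) * v $ i)) (at x)"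
    using has_derivative_compose[OF holo_onD[OF assms(1) x] assms(2)[OF x, unfolded has_field_derivative_def]]
    by (simp add: sum_distrib_left mult.assoc)
qed

lemma holo_on_inverse:
  assumes "holo_on f S" "\<And>x. x \<in> S \<Longrightarrow> f x \<noteq> 0"
  shows "holo_on (\<lambda>x. inverse (f x)) S"
  by (rule holo_on_compose_field[OF assms(1), where h'="\<lambda>z. - (inverse z ^ Suc (Suc 0))"])
     (use assms(2) DERIV_inverse in blast)

lemma holo_on_divide:
  "holo_on f S \<Longrightarrow> holo_on g S \<Longrightarrow> (\<And>x. x \<in> S \<Longrightarrow> g x \<noteq> 0) \<Longrightarrow> holo_on (\<lambda>x. f x / g x) S"
  unfolding divide_inverse by (intro holo_on_mult holo_on_inverse)

lemma holo_on_powi: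
  assumes "holo_on f S" "\<And>x. x \<in> S \<Longrightarrow> f x \<noteq> 0"
  shows "holo_on (\<lambda>x. f x powi n) S"
  unfolding power_int_def using assms
  by (cases "n \<ge> 0") (auto intro!: holo_on_power holo_on_inverse)

lemma has_derivative_vec:
  fixes F :: "'a::real_normed_vector \<Rightarrow> complex^'m"
  assumes "\<And>i. ((\<lambda>x. F x $ i) has_derivative (\<lambda>v. F' v $ i)) (at x within S)"
  shows "(F has_derivative F') (at x within S)"
proof (subst has_derivative_componentwise_within, intro ballI)
  fix b :: "complex^'m" assume "b \<in> Basis"
  then obtain i u where b: "b = axis i u" "u \<in> Basis" by (auto simp: Basis_vec_def)
  have "((\<lambda>x. F x $ i \<bullet> u) has_derivative (\<lambda>v. F' v $ i \<bullet> u)) (at x within S)"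
    by (intro has_derivative_inner_left assms)
  then show "((\<lambda>x. F x \<bullet> b) has_derivative (\<lambda>v. F' v \<bullet> b)) (at x within S)"
    by (simp add: b inner_axis)
qed

definition hmap_on :: "(complex^'n \<Rightarrow> complex^'m) \<Rightarrow> (complex^'n) set \<Rightarrow> bool" where
  "hmap_on F S \<longleftrightarrow> (\<forall>i. holo_on (\<lambda>x. F x $ i) S)"

definition jac :: "(complex^'n \<Rightarrow> complex^'m) \<Rightarrow> complex^'n \<Rightarrow> complex^'n^'m" where
  "jac F x = (\<chi> i j. pd j (\<lambda>x. F x $ i) x)"

lemma hmap_onD: "hmap_on F S \<Longrightarrow> holo_on (\<lambda>x. F x $ i) S"
  by (simp add: hmap_on_def)

lemma hmap_on_subset: "hmap_on f S \<Longrightarrow> T \<subseteq> S \<Longrightarrow> hmap_on f T"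
  unfolding hmap_on_def using holo_on_subset by blast

lemma hmap_on_derivative:
  assumes "hmap_on F S" "x \<in> S"
  shows "(F has_derivative (\<lambda>v. jac F x *v v)) (at x)"
  by (rule has_derivative_vec)
     (use holo_onD[OF hmap_onD[OF assms(1)] assms(2)] in \<open>simp add: jac_def matrix_vector_mult_def\<close>)

lemma hmap_onI:
  assumes "\<And>x. x \<in> S \<Longrightarrow> (F has_derivative (\<lambda>v. A x *v v)) (at x)"
  shows "hmap_on F S"
  unfolding hmap_on_def
proof (intro allI holo_onI)
  fix i x assume "x \<in> S"
  from has_derivative_compose[OF assms[OF this] has_derivative_nth]
  show "((\<lambda>x. F x $ i) has_derivative (\<lambda>v. \<Sum>j\<in>UNIV. A x $ i $ j * v $ j)) (at x)"
    by (simp add: matrix_vector_mult_def)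
qed

lemma jac_eqI:
  assumes "(F has_derivative (\<lambda>v. A *v v)) (at x)"
  shows "jac F x = A"
proof -
  have "pd j (\<lambda>x. F x $ i) x = A $ i $ j" for i j
  proof (rule pd_eqI)
    show "((\<lambda>x. F x $ i) has_derivative (\<lambda>v. \<Sum>j\<in>UNIV. A $ i $ j * v $ j)) (at x)"
      using has_derivative_compose[OF assms has_derivative_nth] by (simp add: matrix_vector_mult_def)
  qed
  then show ?thesis by (simp add: jac_def vec_eq_iff)
qed

lemma hmap_on_continuous: "hmap_on F S \<Longrightarrow> continuous_on S F"
  by (meson continuous_at_imp_continuous_on has_derivative_continuous hmap_on_derivative)

lemma holo_on_compose':
  assumes "holo_on f T" "hmap_on G S" "G x \<in> T" "x \<in> S"
  shows "((\<lambda>x. f (G x)) has_derivative (\<lambda>v. \<Sum>j\<in>UNIV. (\<Sum>i\<in>UNIV. pd i f (G x) * pd j (\<lambda>x. G x $ i) x) * v $ j)) (at x)"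
proof -
  have "(\<Sum>i\<in>UNIV. pd i f (G x) * (jac G x *v v) $ i)
     = (\<Sum>j\<in>UNIV. (\<Sum>i\<in>UNIV. pd i f (G x) * pd j (\<lambda>x. G x $ i) x) * v $ j)" for v
    unfolding matrix_vector_mult_def jac_def sum_distrib_right vec_lambda_beta sum_distrib_left
    by (subst sum.swap) (simp add: mult_ac)
  then show ?thesis
    using has_derivative_compose[OF hmap_on_derivative[OF assms(2,4)] holo_onD[OF assms(1,3)]] by simp
qed

lemma holo_on_compose:
  assumes "holo_on f T" "hmap_on G S" "\<And>x. x \<in> S \<Longrightarrow> G x \<in> T"
  shows "holo_on (\<lambda>x. f (G x)) S"
  by (rule holo_onI[OF holo_on_compose'[OF assms(1,2)]]) (use assms(3) in auto)

lemma pd_compose: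
  assumes "holo_on f T" "hmap_on G S" "G x \<in> T" "x \<in> S"
  shows "pd j (\<lambda>x. f (G x)) x = (\<Sum>i\<in>UNIV. pd i f (G x) * pd j (\<lambda>x. G x $ i) x)"
  by (rule pd_eqI[OF holo_on_compose'[OF assms]])

lemma hmap_on_compose:
  assumes "hmap_on F T" "hmap_on G S" "\<And>x. x \<in> S \<Longrightarrow> G x \<in> T"
  shows "hmap_on (\<lambda>x. F (G x)) S"
  unfolding hmap_on_def
  by (intro allI holo_on_compose[OF hmap_onD[OF assms(1)] assms(2,3)])

lemma hmap_on_affine: "hmap_on (\<lambda>x. a + A *v x) S"
  unfolding hmap_on_def
  by (auto simp: matrix_vector_mult_def intro!: holo_on_add holo_on_sum holo_on_mult)

section \<open>Cauchy's formula, integrals with a parameter and higher derivatives\<close>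

lemma continuous_on_scale_axis [continuous_intros]:
  "continuous_on S f \<Longrightarrow> continuous_on S (\<lambda>x. f x *s (v :: complex^'n))"
  unfolding vector_scalar_mult_def by (intro continuous_intros)

text \<open>Cauchy's formula on a circle in one coordinate direction, parametrised by the unit
  interval. The point \<open>x\<close> enters only as a shift in the argument of \<open>f\<close>,
  so that regularity of \<open>pd i f\<close> becomes regularity of an integral with a
  parameter.\<close>

lemma pd_cauchy:
  fixes f :: "complex^'n \<Rightarrow> complex"
  assumes f: "holo_on f S" and sub: "cball x r \<subseteq> S" and r: "0 < r"
  shows "((\<lambda>t. f (x + (of_real r * cis (2*pi*t)) *s axis i 1) * cis (-2*pi*t) / of_real r) has_integral pd i f x) {0..1}"
proof -
  let ?g = "\<lambda>z. f (x + z *s axis i 1)"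
  have dg: "(?g has_field_derivative pd i f (x + z *s axis i 1)) (at z)" if "z \<in> cball 0 r" for z
  proof -
    have "x + z *s axis i 1 \<in> S" using that sub by (auto simp: dist_norm)
    from holo_on_pd[OF f this, of i]
    have "((\<lambda>w. ?g (z + w)) has_field_derivative pd i f (x + z *s axis i 1)) (at 0)"
      by (simp add: add.assoc vector_sadd_rdistrib)
    then show ?thesis by (simp add: DERIV_shift[of _ _ 0 z, simplified] add.commute)
  qed
  have holo: "?g holomorphic_on ball 0 r"
    unfolding holomorphic_on_open[OF open_ball] using dg ball_subset_cball by blast
  have cont: "continuous_on (cball 0 r) ?g"
    using DERIV_isCont[OF dg] by (intro continuous_at_imp_continuous_on) blast
  have "((\<lambda>u. ?g u / (u - 0) ^ Suc 1) has_contour_integral (2 * pi * \<i>) / (fact 1) * (deriv ^^ 1) ?g 0) (circlepath 0 r)"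
    by (rule Cauchy_has_contour_integral_higher_derivative_circlepath[OF cont holo]) (use r in auto)
  then have "((\<lambda>t. ?g (circlepath 0 r t) / circlepath 0 r t ^ 2 * vector_derivative (circlepath 0 r) (at t within {0..1}))
     has_integral 2 * pi * \<i> * pd i f x) {0..1}"
    by (simp add: has_contour_integral_def pd_def power2_eq_square)
  then have "((\<lambda>t. (1/(2 * pi * \<i>)) * (?g (circlepath 0 r t) / circlepath 0 r t ^ 2 * vector_derivative (circlepath 0 r) (at t within {0..1})))
     has_integral (1/(2 * pi * \<i>)) * (2 * pi * \<i> * pd i f x)) {0..1}"
    by (rule has_integral_mult_right)
  then show ?thesis
  proof (rule has_integral_eq_rhs[OF has_integral_eq, rotated])
    fix t :: real assume t: "t \<in> {0..1}"
    have c: "circlepath 0 r t = of_real r * cis (2*pi*t)"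
      by (simp add: circlepath cis_conv_exp mult_ac)
    have "cis (2*pi*t) * cis (-2*pi*t) = 1" by (simp add: cis_mult)
    then have ci: "cis (-2*pi*t) = inverse (cis (2*pi*t))"
      by (metis inverse_unique)
    have "vector_derivative (circlepath 0 r) (at t within {0..1}) = 2 * pi * \<i> * r * exp (2 * of_real pi * \<i> * t)"
      using t by (simp add: vector_derivative_circlepath01)
    then show "(1/(2 * pi * \<i>)) * (?g (circlepath 0 r t) / circlepath 0 r t ^ 2 * vector_derivative (circlepath 0 r) (at t within {0..1}))
     = f (x + (of_real r * cis (2*pi*t)) *s axis i 1) * cis (-2*pi*t) / of_real r"
      using r unfolding c ci by (simp add: cis_conv_exp field_simps power2_eq_square)
  qed auto
qed

lemma continuous_on_locally:
  fixes f :: "'a::t2_space \<Rightarrow> 'b::topological_space"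
  assumes "\<And>x. x \<in> A \<Longrightarrow> \<exists>W. open W \<and> x \<in> W \<and> continuous_on (A \<inter> W) f"
  shows "continuous_on A f"
  unfolding continuous_on_eq_continuous_within
proof
  fix x assume x: "x \<in> A"
  then obtain W where W: "open W" "x \<in> W" "continuous_on (A \<inter> W) f" using assms by blast
  have "at x within (A \<inter> W) = at x within A"
    by (rule at_within_nhd[OF W(2,1)]) auto
  with W x show "continuous (at x within A) f"
    unfolding continuous_on_eq_continuous_within by (metis Int_iff)
qed

text \<open>The Leibniz rule asks for joint continuity of the derivative in the point and the
  parameter. Near a given point one radius serves all Cauchy circles, which makes the derivative an
  integral with a jointly continuous integrand.\<close>

lemma pd_continuous_param:
  fixes f :: "complex^'n \<Rightarrow> 'b::t2_space \<Rightarrow> complex"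
  assumes S: "open S" and h: "\<And>t. t \<in> T \<Longrightarrow> holo_on (\<lambda>x. f x t) S"
    and c: "continuous_on (S \<times> T) (\<lambda>(x,t). f x t)"
  shows "continuous_on (S \<times> T) (\<lambda>(x,t). pd i (\<lambda>x. f x t) x)"
proof (rule continuous_on_locally)
  fix p assume "p \<in> S \<times> T"
  then obtain r where r: "r > 0" "cball (fst p) r \<subseteq> S"
    using S open_contains_cball by (metis mem_Sigma_iff prod.collapse)
  let ?B = "ball (fst p) (r/2)"
  have sub: "x + (of_real (r/2) * cis (2*pi*t)) *s axis i 1 \<in> S" if "x \<in> ?B" for x t
  proof -
    have "dist (fst p) (x + (of_real (r/2) * cis (2*pi*t)) *s axis i 1) \<le> dist (fst p) x + r/2"
      using dist_triangle[of "fst p" "x + (of_real (r/2) * cis (2*pi*t)) *s axis i 1" x] r(1)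
      by (simp add: dist_norm norm_mult del: of_real_divide)
    then show ?thesis using that r by auto
  qed
  have Bs: "x \<in> S" if "x \<in> ?B" for x using that r by (auto simp: subset_iff)
  have *: "continuous_on (?B \<times> T) (\<lambda>p. integral (cbox 0 (1::real)) (\<lambda>t. f (fst p + (of_real (r/2) * cis (2*pi*t)) *s axis i 1) (snd p) * cis (-2*pi*t) / of_real (r/2)))"
  proof (rule integral_continuous_on_param)
    have 1: "continuous_on ((?B \<times> T) \<times> cbox 0 (1::real)) (\<lambda>q. case (fst (fst q) + (of_real (r/2) * cis (2*pi* snd q)) *s axis i 1, snd (fst q)) of (x,t) \<Rightarrow> f x t)"
      by (rule continuous_on_compose2[OF c]) (use sub in \<open>auto intro!: continuous_intros simp: cis_conv_exp\<close>)
    show "continuous_on ((?B \<times> T) \<times> cbox 0 (1::real)) (\<lambda>(p,t). f (fst p + (of_real (r/2) * cis (2*pi*t)) *s axis i 1) (snd p) * cis (-2*pi*t) / of_real (r/2))"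
      using 1 r(1) unfolding split_beta
      by (auto intro!: continuous_intros simp: cis_conv_exp)
  qed
  have "continuous_on (?B \<times> T) (\<lambda>(x,t). pd i (\<lambda>x. f x t) x)"
  proof (subst continuous_on_cong[OF refl]; (rule *)?)
    fix q assume q: "q \<in> ?B \<times> T"
    obtain x t where [simp]: "q = (x,t)" by (cases q)
    have "cball x (r/2) \<subseteq> cball (fst p) r"
      using q by (subst cball_subset_cball_iff) (auto simp: dist_commute)
    then have "cball x (r/2) \<subseteq> S" using r by auto
    from integral_unique[OF pd_cauchy[OF h this]] q r
    show "(case q of (x, t) \<Rightarrow> pd i (\<lambda>x. f x t) x) = integral (cbox 0 (1::real)) (\<lambda>t. f (fst q + (of_real (r/2) * cis (2*pi*t)) *s axis i 1) (snd q) * cis (-2*pi*t) / of_real (r/2))"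
      by (auto simp: box_real)
  qed
  moreover have "S \<times> T \<inter> ?B \<times> UNIV = ?B \<times> T" using Bs by auto
  ultimately show "\<exists>W. open W \<and> p \<in> W \<and> continuous_on (S \<times> T \<inter> W) (\<lambda>(x,t). pd i (\<lambda>x. f x t) x)"
    using r by (intro exI[of _ "?B \<times> UNIV"]) (auto intro: open_Times simp: mem_Times_iff)
qed

lemma pd_continuous:
  assumes "open S" "holo_on f S"
  shows "continuous_on S (pd i f)"
proof -
  have c: "continuous_on (S \<times> {0::real}) (\<lambda>(x,t). f x)"
    using continuous_on_compose2[OF holo_on_imp_continuous_on[OF assms(2)] continuous_on_fst[OF continuous_on_id], of "S \<times> {0}"]
    by (auto simp: split_beta)
  have 1: "continuous_on (S \<times> {0::real}) (\<lambda>(x,t). pd i f x)"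
    using pd_continuous_param[OF assms(1), of "{0::real}" "\<lambda>x t. f x" i] assms(2) c by simp
  have "continuous_on S (\<lambda>x. case (x, 0::real) of (x,t) \<Rightarrow> pd i f x)"
    by (rule continuous_on_compose2[OF 1]) (auto intro!: continuous_intros)
  then show ?thesis by simp
qed

text \<open>Gradients as bounded linear maps: the Leibniz rule wants the derivative as a continuous
  function with values in this space.\<close>

lift_definition cform :: "complex^'n \<Rightarrow> (complex^'n) \<Rightarrow>\<^sub>L complex" is "\<lambda>a v. \<Sum>i\<in>UNIV. a $ i * v $ i"
  by (intro bounded_linear_sum bounded_linear_const_mult bounded_linear_vec_nth)

lemma continuous_on_cform:
  fixes a :: "'a::t2_space \<Rightarrow> complex^'n"
  assumes "\<And>i. continuous_on S (\<lambda>x. a x $ i)"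
  shows "continuous_on S (\<lambda>x. cform (a x))"
  by (rule continuous_on_blinfun_componentwise) (auto simp: cform.rep_eq intro!: continuous_intros assms)

lemma holo_on_integral':
  fixes f :: "complex^'n \<Rightarrow> real \<Rightarrow> complex"
  assumes S: "open S" and h: "\<And>t. t \<in> {0..1} \<Longrightarrow> holo_on (\<lambda>x. f x t) S"
    and c: "continuous_on (S \<times> {0..1}) (\<lambda>(x,t). f x t)" and x: "x \<in> S"
  shows "((\<lambda>x. integral {0..1} (f x)) has_derivative
     (\<lambda>v. \<Sum>i\<in>UNIV. integral {0..1} (\<lambda>t. pd i (\<lambda>x. f x t) x) * v $ i)) (at x)"
proof -
  obtain r where r: "r > 0" "ball x r \<subseteq> S" using S x open_contains_ball by blast
  define fx where "fx = (\<lambda>x t. cform (\<chi> i. pd i (\<lambda>x. f x t) x))"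
  have cx: "continuous_on {0..1} (\<lambda>t. g y t)" if "continuous_on (S \<times> {0..1}) (\<lambda>(x,t). g x t)" "y \<in> S" for g :: "complex^'n \<Rightarrow> real \<Rightarrow> complex" and y
  proof -
    have "continuous_on {0..1} (\<lambda>t. case (y,t) of (x,t) \<Rightarrow> g x t)"
      by (rule continuous_on_compose2[OF that(1)]) (use that(2) in \<open>auto intro!: continuous_intros\<close>)
    then show ?thesis by simp
  qed
  note cp = pd_continuous_param[OF S h c]
  have cfx: "continuous_on (S \<times> {0..1}) (\<lambda>(x, t). fx x t)"
    unfolding fx_def split_beta by (rule continuous_on_cform) (use cp in \<open>simp add: split_beta\<close>)
  have cfx1: "continuous_on {0..1} (fx x)"
    unfolding fx_def by (rule continuous_on_cform) (use cx[OF cp x] in simp)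
  have "((\<lambda>x. integral (cbox 0 1) (f x)) has_derivative integral (cbox 0 1) (fx x)) (at x within ball x r)"
  proof (rule leibniz_rule)
    fix y t assume y: "y \<in> ball x r" "t \<in> cbox 0 (1::real)"
    then have "((\<lambda>x. f x t) has_derivative fx y t) (at y)"
      using holo_onD[OF h, of t y] r by (auto simp: fx_def cform.rep_eq)
    then show "((\<lambda>x. f x t) has_derivative fx y t) (at y within ball x r)"
      by (rule has_derivative_at_withinI)
  next
    fix y assume "y \<in> ball x r"
    then have "y \<in> S" using r by auto
    from cx[OF c this] show "f y integrable_on cbox 0 1"
      by (simp add: integrable_continuous_real)
  next
    show "continuous_on (ball x r \<times> cbox 0 1) (\<lambda>(x, t). fx x t)"
      by (rule continuous_on_subset[OF cfx]) (use r in auto)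
  qed (use r in auto)
  then have d: "((\<lambda>x. integral {0..1} (f x)) has_derivative integral {0..1} (fx x)) (at x)"
    using at_within_open[of x "ball x r"] r by (simp add: box_real)
  have "integral {0..1} (fx x) v = (\<Sum>i\<in>UNIV. integral {0..1} (\<lambda>t. pd i (\<lambda>x. f x t) x) * v $ i)" for v
  proof -
    have "integral {0..1} (fx x) v = integral {0..1} (\<lambda>t. fx x t v)"
      by (rule blinfun_apply_integral) (simp add: integrable_continuous_real cfx1)
    also have "\<dots> = integral {0..1} (\<lambda>t. \<Sum>i\<in>UNIV. pd i (\<lambda>x. f x t) x * v $ i)"
      by (simp add: fx_def cform.rep_eq)
    also have "\<dots> = (\<Sum>i\<in>UNIV. integral {0..1} (\<lambda>t. pd i (\<lambda>x. f x t) x * v $ i))"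
      by (rule integral_sum) (auto intro!: integrable_continuous_real continuous_intros cx[OF cp x])
    finally show ?thesis by simp
  qed
  then have "blinfun_apply (integral {0..1} (fx x)) = (\<lambda>v. \<Sum>i\<in>UNIV. integral {0..1} (\<lambda>t. pd i (\<lambda>x. f x t) x) * v $ i)"
    by (rule ext)
  with d show ?thesis by simp
qed

lemma holo_on_integral:
  fixes f :: "complex^'n \<Rightarrow> real \<Rightarrow> complex"
  assumes S: "open S" and h: "\<And>t. t \<in> {0..1} \<Longrightarrow> holo_on (\<lambda>x. f x t) S"
    and c: "continuous_on (S \<times> {0..1}) (\<lambda>(x,t). f x t)"
  shows "holo_on (\<lambda>x. integral {0..1} (f x)) S"
  by (rule holo_onI[OF holo_on_integral'[OF assms]])

lemma pd_integral:
  fixes f :: "complex^'n \<Rightarrow> real \<Rightarrow> complex"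
  assumes S: "open S" and h: "\<And>t. t \<in> {0..1} \<Longrightarrow> holo_on (\<lambda>x. f x t) S"
    and c: "continuous_on (S \<times> {0..1}) (\<lambda>(x,t). f x t)" and x: "x \<in> S"
  shows "pd i (\<lambda>x. integral {0..1} (f x)) x = integral {0..1} (\<lambda>t. pd i (\<lambda>x. f x t) x)"
  by (rule pd_eqI[OF holo_on_integral'[OF assms]])

lemma hmap_on_shift: "hmap_on (\<lambda>x. x + c) S"
  by (simp add: hmap_on_def holo_on_add)

lemma holo_on_shift: "holo_on f T \<Longrightarrow> (\<And>x. x \<in> S \<Longrightarrow> x + c \<in> T) \<Longrightarrow> holo_on (\<lambda>x. f (x + c)) S"
  by (rule holo_on_compose[OF _ hmap_on_shift])

lemma pd_shift:
  assumes "holo_on f T" "x + c \<in> T"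
  shows "pd j (\<lambda>x. f (x + c)) x = pd j f (x + c)"
proof -
  have "pd j (\<lambda>x. f (x + c)) x = (\<Sum>i\<in>UNIV. pd i f (x + c) * pd j (\<lambda>x. (x + c) $ i) x)"
    using pd_compose[OF assms(1) hmap_on_shift[of c "{x}"] assms(2)] by simp
  moreover have "pd j (\<lambda>x. (x + c) $ i) x = (if j = i then 1 else 0)" for i
    using pd_add[of "\<lambda>x. x $ i" "{x}" "\<lambda>_. c $ i" x j] by simp
  ultimately show ?thesis by (simp only: if_distrib[of "\<lambda>a. _ * a"]) (simp cong: if_cong)
qed

text \<open>Circles of radius \<open>r/2\<close> about the points of the half ball stay in the ball
  of radius \<open>r\<close>. One radius therefore serves an open set, on which the derivative is a
  single integral with a parameter that can be differentiated again.\<close>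

lemma pd_local_formula:
  fixes f :: "complex^'n \<Rightarrow> complex" and r :: real and j :: 'n
  defines "K \<equiv> \<lambda>x t. f (x + (of_real (r/2) * cis (2*pi*t)) *s axis j 1) * (cis (-2*pi*t) / of_real (r/2))"
  assumes f: "holo_on f S" and r: "r > 0" "cball x r \<subseteq> S"
  shows "\<And>t. holo_on (\<lambda>y. K y t) (ball x (r/2))"
    and "continuous_on (ball x (r/2) \<times> {0..1}) (\<lambda>(y,t). K y t)"
    and "\<And>y. y \<in> ball x (r/2) \<Longrightarrow> pd j f y = integral {0..1} (K y)"
    and "\<And>y t. y \<in> ball x (r/2) \<Longrightarrow> y + (of_real (r/2) * cis (2*pi*t)) *s axis j 1 \<in> S"
proof -
  have sub: "y + (of_real (r/2) * cis (2*pi*t)) *s axis i 1 \<in> S" if "y \<in> ball x (r/2)" for y t i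
  proof -
    have "dist x (y + (of_real (r/2) * cis (2*pi*t)) *s axis i 1) \<le> dist x y + r/2"
      using dist_triangle[of x "y + (of_real (r/2) * cis (2*pi*t)) *s axis i 1" y] r(1)
      by (simp add: dist_norm norm_mult del: of_real_divide)
    then show ?thesis using that r by auto
  qed
  then show "\<And>y t. y \<in> ball x (r/2) \<Longrightarrow> y + (of_real (r/2) * cis (2*pi*t)) *s axis j 1 \<in> S" .
  show "holo_on (\<lambda>y. K y t) (ball x (r/2))" for t
    unfolding K_def by (intro holo_on_mult holo_on_const holo_on_shift[OF f] sub)
  have "continuous_on (ball x (r/2) \<times> {0..1}) (\<lambda>p. f (fst p + (of_real (r/2) * cis (2*pi* snd p)) *s axis j 1))"
    by (rule continuous_on_compose2[OF holo_on_imp_continuous_on[OF f]])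
       (use sub in \<open>auto intro!: continuous_intros simp: cis_conv_exp\<close>)
  then show "continuous_on (ball x (r/2) \<times> {0..1}) (\<lambda>(y,t). K y t)"
    unfolding K_def split_beta using r by (auto intro!: continuous_intros simp: cis_conv_exp)
  show "pd j f y = integral {0..1} (K y)" if "y \<in> ball x (r/2)" for y
  proof -
    have "cball y (r/2) \<subseteq> cball x r"
      using that by (subst cball_subset_cball_iff) (auto simp: dist_commute)
    then have "cball y (r/2) \<subseteq> S" using r by auto
    from integral_unique[OF pd_cauchy[OF f this, of j]] r
    show ?thesis unfolding K_def by (simp only: times_divide_eq_right)
  qed
qed

lemma holo_on_pd_holo:
  assumes S: "open S" and f: "holo_on f S"
  shows "holo_on (pd i f) S"
proof (rule holo_on_UN)
  fix x assume "x \<in> S"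
  then obtain r where r: "r > 0" "cball x r \<subseteq> S" using S open_contains_cball by blast
  note K = pd_local_formula[OF f r, where j=i]
  have "holo_on (pd i f) (ball x (r/2))"
    by (rule holo_on_transform[OF holo_on_integral[OF open_ball K(1,2)] open_ball K(3)[symmetric]])
  then show "\<exists>T. x \<in> T \<and> holo_on (pd i f) T" using r by (intro exI[of _ "ball x (r/2)"]) auto
qed

text \<open>Write the inner derivative as a Cauchy integral, move the outer one under the integral
  sign, and read the result as the Cauchy integral of \<open>pd i f\<close>.\<close>

lemma pd_commute:
  assumes S: "open S" and f: "holo_on f S" and x: "x \<in> S"
  shows "pd i (pd j f) x = pd j (pd i f) x"
proof -
  obtain r where r: "r > 0" "cball x r \<subseteq> S" using S x open_contains_cball by blast
  have xb: "x \<in> ball x (r/2)" using r by auto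
  note K = pd_local_formula[OF f r, where j=j]
  note K' = pd_local_formula[OF holo_on_pd_holo[OF S f, of i] r, where j=j]
  have "pd i (pd j f) x = pd i (\<lambda>y. integral {0..1} (\<lambda>t. f (y + (of_real (r/2) * cis (2*pi*t)) *s axis j 1) * (cis (-2*pi*t) / of_real (r/2)))) x"
    by (rule pd_cong[OF open_ball xb K(3)])
  also have "\<dots> = integral {0..1} (\<lambda>t. pd i (\<lambda>y. f (y + (of_real (r/2) * cis (2*pi*t)) *s axis j 1) * (cis (-2*pi*t) / of_real (r/2))) x)"
    by (rule pd_integral[OF open_ball K(1,2) xb])
  also have "\<dots> = integral {0..1} (\<lambda>t. pd i f (x + (of_real (r/2) * cis (2*pi*t)) *s axis j 1) * (cis (-2*pi*t) / of_real (r/2)))"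
  proof (rule integral_cong)
    fix t
    have h: "holo_on (\<lambda>y. f (y + (of_real (r/2) * cis (2*pi*t)) *s axis j 1)) (ball x (r/2))"
      by (rule holo_on_shift[OF f]) (rule K(4))
    show "pd i (\<lambda>y. f (y + (of_real (r/2) * cis (2*pi*t)) *s axis j 1) * (cis (-2*pi*t) / of_real (r/2))) x
       = pd i f (x + (of_real (r/2) * cis (2*pi*t)) *s axis j 1) * (cis (-2*pi*t) / of_real (r/2))"
      by (subst pd_mult[OF h holo_on_const xb]) (subst pd_shift[OF f K(4)[OF xb]], simp)
  qed
  also have "\<dots> = pd j (pd i f) x"
    by (rule K'(3)[OF xb, symmetric])
  finally show ?thesis .
qed

section \<open>Limits, uniqueness and inversion of holomorphic maps\<close>

lemma holo_on_uniform_limit: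
  fixes f :: "nat \<Rightarrow> complex^'n \<Rightarrow> complex"
  assumes S: "open S" and h: "\<And>n. holo_on (f n) S" and u: "uniform_limit S f l sequentially"
  shows "holo_on l S"
proof (rule holo_on_UN)
  fix x assume "x \<in> S"
  then obtain r where r: "r > 0" "cball x r \<subseteq> S" using S open_contains_cball by blast
  let ?B = "ball x (r/2)"
  define K where "K g j y t = g (y + (of_real (r/2) * cis (2*pi*t)) *s axis j 1) * (cis (-2*pi*t) / of_real (r/2))"
    for g :: "complex^'n \<Rightarrow> complex" and j :: 'n and y :: "complex^'n" and t :: real
  have fK: "pd j (f n) y = integral {0..1} (K (f n) j y)"
    and fS: "y + (of_real (r/2) * cis (2*pi*t)) *s axis j 1 \<in> S"
    and fc: "continuous_on (?B \<times> {0..1}) (\<lambda>(y,t). K (f n) j y t)" if "y \<in> ?B" for j n y t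
    using pd_local_formula[OF h[of n] r, where j=j] that unfolding K_def by (auto simp: fun_eq_iff)
  define a where "a j y = integral {0..1} (K l j y)" for j y
  have lc: "continuous_on S l"
    by (rule uniform_limit_theorem[OF _ u]) (simp_all add: holo_on_imp_continuous_on[OF h])
  have Kc: "K g j y integrable_on {0..1}" if g: "continuous_on S g" and y: "y \<in> ?B" for g j y
  proof (rule integrable_continuous_real)
    have "continuous_on {0..1} (\<lambda>t. g (y + (of_real (r/2) * cis (2*pi*t)) *s axis j 1))"
      by (rule continuous_on_compose2[OF g]) (use fS[OF y] in \<open>auto intro!: continuous_intros simp: cis_conv_exp\<close>)
    then show "continuous_on {0..1} (K g j y)"
      unfolding K_def using r by (auto intro!: continuous_intros simp: cis_conv_exp)
  qed
  \<comment> \<open>Cauchy's formula bounds derivatives on the half ball by the functions on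
    \<open>S\<close>, so uniform convergence passes to the partial derivatives.\<close>
  have est: "norm (pd j (f n) y - a j y) \<le> e * (2 / r)"
    if y: "y \<in> ?B" and e: "\<And>z. z \<in> S \<Longrightarrow> norm (f n z - l z) \<le> e" for j n y e
  proof -
    have "pd j (f n) y - a j y = integral {0..1} (\<lambda>t. K (f n) j y t - K l j y t)"
      unfolding a_def fK[OF y]
      by (rule integral_diff[symmetric]) (auto intro!: Kc y lc holo_on_imp_continuous_on h)
    also have "norm \<dots> \<le> integral {0..1} (\<lambda>t::real. e * (2/r))"
    proof (rule integral_norm_bound_integral)
      fix t assume "t \<in> {0..1::real}"
      have "norm (K (f n) j y t - K l j y t) = norm (f n (y + (of_real (r/2) * cis (2*pi*t)) *s axis j 1) - l (y + (of_real (r/2) * cis (2*pi*t)) *s axis j 1)) * (2/r)"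
        unfolding K_def left_diff_distrib[symmetric] norm_mult using r by (simp add: norm_divide del: of_real_divide)
      also have "\<dots> \<le> e * (2/r)"
        by (rule mult_right_mono[OF e[OF fS[OF y]]]) (use r in auto)
      finally show "norm (K (f n) j y t - K l j y t) \<le> e * (2/r)" .
    qed (auto intro!: integrable_diff Kc y lc holo_on_imp_continuous_on h)
    finally show ?thesis by simp
  qed
  have "\<exists>g. \<forall>y\<in>?B. (\<lambda>n. f n y) \<longlonglongrightarrow> g y \<and> (g has_derivative (\<lambda>v. \<Sum>j\<in>UNIV. a j y * v $ j)) (at y within ?B)"
  proof (rule has_derivative_sequence)
    show "(f n has_derivative (\<lambda>v. \<Sum>j\<in>UNIV. pd j (f n) y * v $ j)) (at y within ?B)" if "y \<in> ?B" for n y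
    proof -
      have "y \<in> S" using that r(1) subsetD[OF r(2), of y] by simp
      then show ?thesis
        by (rule has_derivative_at_withinI[OF holo_onD[OF h]])
    qed
    show "\<forall>\<^sub>F n in sequentially. \<forall>y\<in>?B. \<forall>v. norm ((\<Sum>j\<in>UNIV. pd j (f n) y * v $ j) - (\<Sum>j\<in>UNIV. a j y * v $ j)) \<le> e * norm v"
      if e: "e > 0" for e
    proof -
      \<comment> \<open>Each of the \<open>CARD('n)\<close> partial derivatives is off by at most
        \<open>c * (2 / r)\<close>; their sum is then at most \<open>e\<close>.\<close>
      define c where "c = e * r / (2 * real CARD('n))"
      have cp: "c > 0" using e r by (simp add: c_def)
      from uniform_limitD[OF u this] have "\<forall>\<^sub>F n in sequentially. \<forall>z\<in>S. dist (f n z) (l z) < c" .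
      then show ?thesis
      proof eventually_elim
        case (elim n)
        show ?case
        proof (intro ballI allI)
          fix y and v :: "complex^'n" assume y: "y \<in> ?B"
          have "norm ((\<Sum>j\<in>UNIV. pd j (f n) y * v $ j) - (\<Sum>j\<in>UNIV. a j y * v $ j))
             = norm (\<Sum>j\<in>UNIV. (pd j (f n) y - a j y) * v $ j)"
            by (simp add: left_diff_distrib sum_subtractf)
          also have "\<dots> \<le> (\<Sum>j\<in>(UNIV::'n set). c * (2 / r) * norm v)"
          proof (rule sum_norm_le)
            fix j
            have "norm (f n z - l z) \<le> c" if "z \<in> S" for z
              using elim that by (simp add: dist_norm less_imp_le)
            from est[OF y this] have "norm (pd j (f n) y - a j y) \<le> c * (2 / r)" .
            moreover have "norm (v $ j) \<le> norm v" by (rule Finite_Cartesian_Product.norm_nth_le)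
            ultimately show "norm ((pd j (f n) y - a j y) * v $ j) \<le> c * (2 / r) * norm v"
              unfolding norm_mult using cp r by (intro mult_mono) auto
          qed
          also have "\<dots> = e * norm v" using r by (simp add: c_def)
          finally show "norm ((\<Sum>j\<in>UNIV. pd j (f n) y * v $ j) - (\<Sum>j\<in>UNIV. a j y * v $ j)) \<le> e * norm v" .
        qed
      qed
    qed
    show "(\<lambda>n. f n x) \<longlonglongrightarrow> l x"
      by (rule tendsto_uniform_limitI[OF u \<open>x \<in> S\<close>])
  qed (use r in auto)
  then obtain g where g: "\<And>y. y \<in> ?B \<Longrightarrow> (\<lambda>n. f n y) \<longlonglongrightarrow> g y"
      "\<And>y. y \<in> ?B \<Longrightarrow> (g has_derivative (\<lambda>v. \<Sum>j\<in>UNIV. a j y * v $ j)) (at y within ?B)" by blast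
  have gl: "g y = l y" if "y \<in> ?B" for y
  proof -
    have "y \<in> S" using that r(1) subsetD[OF r(2), of y] by simp
    from LIMSEQ_unique[OF g(1)[OF that] tendsto_uniform_limitI[OF u this]] show ?thesis .
  qed
  have "holo_on g ?B"
  proof (rule holo_onI)
    fix y assume "y \<in> ?B"
    with g(2)[OF this] show "(g has_derivative (\<lambda>v. \<Sum>j\<in>UNIV. a j y * v $ j)) (at y)"
      by (simp only: at_within_open[OF _ open_ball])
  qed
  then have "holo_on l ?B" using gl by (rule holo_on_transform[OF _ open_ball])
  moreover have "x \<in> ?B" using r(1) by simp
  ultimately show "\<exists>T. x \<in> T \<and> holo_on l T" by blast
qed

lemma holo_on_line:
  fixes f :: "complex^'n \<Rightarrow> complex"
  assumes f: "holo_on f S" and that: "y + z *s v \<in> S"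
  shows "(\<lambda>z. f (y + z *s v)) field_differentiable (at z)"
proof -
  have "((\<lambda>z::complex. y + z *s v) has_derivative (\<lambda>w. w *s v)) (at z)"
    by (rule has_derivative_vec) (auto intro!: derivative_eq_intros)
  from has_derivative_compose[OF this holo_onD[OF f that]]
  have "((\<lambda>z. f (y + z *s v)) has_derivative (\<lambda>w. \<Sum>i\<in>UNIV. pd i f (y + z *s v) * (w *s v) $ i)) (at z)" .
  moreover have "(\<lambda>w. \<Sum>i\<in>UNIV. pd i f (y + z *s v) * (w *s v) $ i) = (*) (\<Sum>i\<in>UNIV. pd i f (y + z *s v) * v $ i)"
    by (auto simp: sum_distrib_right sum_distrib_left mult_ac)
  ultimately show ?thesis unfolding field_differentiable_def has_field_derivative_def by metis
qed

text \<open>The interior of the zero set is relatively closed: a ball that meets it is filled by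
  complex lines through one of its points, and on each of them the identity theorem in one variable
  applies.\<close>

theorem holo_on_identity:
  fixes f :: "complex^'n \<Rightarrow> complex"
  assumes f: "holo_on f S" and S: "open S" "connected S"
    and O: "open W" "W \<noteq> {}" "W \<subseteq> S" and z: "\<And>x. x \<in> W \<Longrightarrow> f x = 0" and x: "x \<in> S"
  shows "f x = 0"
proof -
  define Z where "Z = interior {x\<in>S. f x = 0}"
  have WZ: "W \<subseteq> Z" unfolding Z_def by (rule interior_maximal) (use O z in auto)
  have ZS: "Z \<subseteq> S" unfolding Z_def using interior_subset by blast
  have key: "ball y r \<subseteq> Z" if y: "y \<in> S" and r: "r > 0" "ball y r \<subseteq> S" and m: "Z \<inter> ball y r \<noteq> {}" for y r
  proof -
    obtain u where u: "u \<in> Z" "u \<in> ball y r" using m by blast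
    have "f w = 0" if w: "w \<in> ball y r" for w
    proof -
      \<comment> \<open>The part of the complex line through \<open>u\<close> and \<open>w\<close>
        inside the ball is convex, hence a connected domain for the one-variable theorem.\<close>
      define D where "D = {z::complex. u + z *s (w - u) \<in> ball y r}"
      have cl: "continuous_on UNIV (\<lambda>z::complex. u + z *s (w - u))"
        by (intro continuous_intros)
      have oD: "open D"
        using open_vimage[OF open_ball cl, of y r] unfolding D_def vimage_def .
      have cD: "convex D"
      proof (rule convexI)
        fix a b :: complex and s t :: real assume ab: "a \<in> D" "b \<in> D" "0 \<le> s" "0 \<le> t" "s + t = 1"
        have "u + (s *\<^sub>R a + t *\<^sub>R b) *s (w - u) = s *\<^sub>R (u + a *s (w - u)) + t *\<^sub>R (u + b *s (w - u))"
        proof -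
          have "u = s *\<^sub>R u + t *\<^sub>R u" using ab by (simp add: scaleR_add_left[symmetric])
          then show ?thesis by (auto simp: vec_eq_iff algebra_simps)
        qed
        also have "\<dots> \<in> ball y r"
          by (rule convexD[OF convex_ball]) (use ab in \<open>auto simp: D_def\<close>)
        finally show "s *\<^sub>R a + t *\<^sub>R b \<in> D" by (simp add: D_def)
      qed
      define N where "N = {z::complex. u + z *s (w - u) \<in> Z} \<inter> D"
      have "open Z" by (simp add: Z_def)
      from open_Int[OF open_vimage[OF this cl] oD] have oN: "open N"
        unfolding N_def vimage_def .
      have e: "u + 0 *s (w - u) = u" "u + 1 *s (w - u) = w" by simp_all
      have 0: "0 \<in> N" unfolding N_def D_def Int_iff mem_Collect_eq e using u by (rule conjI)
      have 1: "1 \<in> D" unfolding D_def mem_Collect_eq e by (rule w)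
      define h where "h z = f (u + z *s (w - u))" for z
      have hol: "h holomorphic_on D"
        unfolding holomorphic_on_def h_def
      proof
        fix z assume "z \<in> D"
        then have "u + z *s (w - u) \<in> S" using r(2) unfolding D_def by blast
        from field_differentiable_at_within[OF holo_on_line[OF f this]]
        show "(\<lambda>z. f (u + z *s (w - u))) field_differentiable at z within D" .
      qed
      have hz: "h z = 0" if "z \<in> N" for z
        using that interior_subset[of "{x\<in>S. f x = 0}"] unfolding N_def Z_def h_def by blast
      have N: "N \<noteq> {}" "N \<subseteq> D" using 0 unfolding N_def by blast+
      have "h 1 = (\<lambda>_. 0) (1::complex)"
        by (rule analytic_continuation_open[OF oN oD N(1) convex_connected[OF cD] N(2) hol holomorphic_on_const hz 1])
      then show ?thesis unfolding h_def e by simp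
    qed
    then show ?thesis unfolding Z_def by (intro interior_maximal) (use r in auto)
  qed
  have "openin (top_of_set S) Z"
    using ZS by (simp add: Z_def open_openin_trans S)
  moreover have "closedin (top_of_set S) Z"
  proof -
    have "y \<in> Z" if y: "y \<in> S" "y \<in> closure Z" for y
    proof -
      obtain r where r: "r > 0" "ball y r \<subseteq> S" using S y open_contains_ball by blast
      have "Z \<inter> ball y r \<noteq> {}" using y r
        by (metis Int_commute centre_in_ball closure_iff_nhds_not_empty open_ball order_refl)
      from key[OF y(1) r this] r show ?thesis by auto
    qed
    then have "Z = S \<inter> closure Z" using ZS closure_subset by blast
    then show ?thesis by (metis closedin_closed_Int closed_closure)
  qed
  ultimately have "Z = S" using S(2) WZ O by (auto simp: connected_clopen)
  then show ?thesis using x interior_subset[of "{x\<in>S. f x = 0}"] unfolding Z_def by blast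
qed

lemma matrix_blinfun_continuous:
  fixes A :: "'a::t2_space \<Rightarrow> complex^'n^'m"
  assumes "\<And>i j. continuous_on S (\<lambda>x. A x $ i $ j)"
  shows "continuous_on S (\<lambda>x. Blinfun (\<lambda>v. A x *v v))"
proof (rule continuous_on_blinfun_componentwise)
  fix b :: "complex^'n"
  show "continuous_on S (\<lambda>x. blinfun_apply (Blinfun (\<lambda>v. A x *v v)) b)"
    unfolding bounded_linear_Blinfun_apply[OF matrix_vector_mul_bounded_linear]
    by (simp add: matrix_vector_mult_def) (intro continuous_intros assms)
qed

text \<open>The real inverse function theorem gives the inverse map. Its derivative is the inverse
  of a complex matrix, hence again complex linear, and this is all that holomorphy requires.\<close>

theorem holo_inverse_function:
  fixes F :: "complex^'n \<Rightarrow> complex^'n"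
  assumes F: "hmap_on F S" and S: "open S" and x0: "x0 \<in> S" and inv: "B ** jac F x0 = mat 1"
  obtains U' V G where "open U'" "U' \<subseteq> S" "x0 \<in> U'" "open V" "F x0 \<in> V" "homeomorphism U' V F G" "hmap_on G V"
proof -
  define f' where "f' x = Blinfun (\<lambda>v. jac F x *v v)" for x
  note bl = bounded_linear_Blinfun_apply[OF matrix_vector_mul_bounded_linear]
  have f'a: "blinfun_apply (f' x) = (\<lambda>v. jac F x *v v)" for x
    unfolding f'_def by (rule bl)
  have d: "(F has_derivative blinfun_apply (f' x)) (at x)" if "x \<in> S" for x
    unfolding f'a by (rule hmap_on_derivative[OF F that])
  have c: "continuous_on S f'" unfolding f'_def
    by (rule matrix_blinfun_continuous) (simp add: jac_def pd_continuous[OF S hmap_onD[OF F]])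
  have i: "Blinfun (\<lambda>v. B *v v) o\<^sub>L f' x0 = id_blinfun"
    by (rule blinfun_eqI) (simp add: f'a bl matrix_vector_mul_assoc inv)
  obtain U' V G G' where *: "open U'" "U' \<subseteq> S" "x0 \<in> U'" "open V" "F x0 \<in> V" "homeomorphism U' V F G"
    "\<And>y. y \<in> V \<Longrightarrow> (G has_derivative (G' y)) (at y)"
    "\<And>y. y \<in> V \<Longrightarrow> G' y = Hilbert_Choice.inv (blinfun_apply (f' (G y)))"
    "\<And>y. y \<in> V \<Longrightarrow> bij (blinfun_apply (f' (G y)))"
    using inverse_function_theorem[OF S d c x0 i] by metis
  have "hmap_on G V"
  proof (rule hmap_onI)
    define C' where "C' y = (SOME C. C ** jac F (G y) = mat 1)" for y
    fix y assume y: "y \<in> V"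
    let ?A = "jac F (G y)"
    have b: "bij (\<lambda>v. ?A *v v)" using *(9)[OF y] by (simp add: f'a)
    then have "\<exists>C. C ** ?A = mat 1"
      using matrix_left_invertible_injective bij_is_inj by blast
    then have C: "C' y ** ?A = mat 1" unfolding C'_def by (rule someI_ex)
    then have C': "?A ** C' y = mat 1" by (simp add: matrix_left_right_inverse)
    have "Hilbert_Choice.inv (\<lambda>v. ?A *v v) = (\<lambda>v. C' y *v v)"
      by (rule inv_equality) (simp_all add: matrix_vector_mul_assoc C C')
    with *(7,8)[OF y] show "(G has_derivative (\<lambda>v. C' y *v v)) (at y)" by (simp add: f'a)
  qed
  with * that show ?thesis by blast
qed

section \<open>The spin connection of a tetrad\<close>

lemma UNIV_2_01: "(UNIV :: 2 set) = {0, 1}"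
proof -
  have "(2::2) = 0" by simp
  then show ?thesis using UNIV_2 by (metis insert_commute)
qed

lemma sum_2_01: "(\<Sum>i\<in>(UNIV::2 set). f i) = f 0 + f 1"
  by (simp add: UNIV_2_01)

lemma forall_2_01: "(\<forall>i::2. P i) \<longleftrightarrow> P 0 \<and> P 1"
  using UNIV_2_01 by (metis UNIV_I insertE singletonD)

lemma exhaust_2_01: obtains "(i::2) = 0" | "i = 1"
  using UNIV_2_01 by (metis UNIV_I insertE singletonD)

lemma eps_simps [simp]: "eps 0 0 = 0" "eps 0 1 = 1" "eps 1 0 = -1" "eps 1 1 = 0"
  by (auto simp: eps_def)

lemma eps_swap: "eps B A = - eps A B"
  by (cases A rule: exhaust_2_01; cases B rule: exhaust_2_01) auto

lemma sum_UNIV_prod: "(\<Sum>I\<in>(UNIV::('a::finite \<times> 'b::finite) set). f I) = (\<Sum>a\<in>UNIV. \<Sum>b\<in>UNIV. f (a,b))"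
  by (simp add: sum.cartesian_product UNIV_Times_UNIV[symmetric] del: UNIV_Times_UNIV)

text \<open>The structure equation of a moving frame: \<open>\<Gamma>\<close> is the connection in coordinates,
  \<open>\<omega>\<close> the connection in the frame \<open>E\<close>.\<close>

lemma frame_curvature:
  fixes E :: "complex^'n \<Rightarrow> 'j::finite \<Rightarrow> 'n \<Rightarrow> complex"
    and \<Gamma> :: "complex^'n \<Rightarrow> 'n \<Rightarrow> 'n \<Rightarrow> 'n \<Rightarrow> complex"
    and \<omega> :: "complex^'n \<Rightarrow> 'n \<Rightarrow> 'j \<Rightarrow> 'j \<Rightarrow> complex"
  assumes S: "open S" and x: "x \<in> S"
    and hE: "\<And>I c. holo_on (\<lambda>y. E y I c) S"
    and hG: "\<And>c a b. holo_on (\<lambda>y. \<Gamma> y c a b) S"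
    and hw: "\<And>a I J. holo_on (\<lambda>y. \<omega> y a I J) S"
    and eq: "\<And>y a I c. y \<in> S \<Longrightarrow>
      pd a (\<lambda>y. E y I c) y = - (\<Sum>d\<in>UNIV. \<Gamma> y c a d * E y I d) + (\<Sum>J\<in>UNIV. \<omega> y a I J * E y J c)"
  shows "(\<Sum>d\<in>UNIV. (pd a (\<lambda>y. \<Gamma> y c b d) x - pd b (\<lambda>y. \<Gamma> y c a d) x
       + (\<Sum>f\<in>UNIV. \<Gamma> x c a f * \<Gamma> x f b d - \<Gamma> x c b f * \<Gamma> x f a d)) * E x I d)
     = (\<Sum>J\<in>UNIV. (pd a (\<lambda>y. \<omega> y b I J) x - pd b (\<lambda>y. \<omega> y a I J) x
       + (\<Sum>K\<in>UNIV. \<omega> x b I K * \<omega> x a K J - \<omega> x a I K * \<omega> x b K J)) * E x J c)"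
proof -
  define X where "X a b = (\<Sum>d\<in>UNIV. \<Sum>f\<in>UNIV. \<Gamma> x c a f * \<Gamma> x f b d * E x I d)" for a b
  define Y where "Y a b = (\<Sum>d\<in>UNIV. \<Sum>K\<in>UNIV. \<Gamma> x c a d * \<omega> x b I K * E x K d)" for a b
  define Z where "Z a b = (\<Sum>J\<in>UNIV. \<Sum>K\<in>UNIV. \<omega> x b I K * \<omega> x a K J * E x J c)" for a b
  define P where "P a b = (\<Sum>d\<in>UNIV. pd a (\<lambda>y. \<Gamma> y c b d) x * E x I d)" for a b
  define Q where "Q a b = (\<Sum>J\<in>UNIV. pd a (\<lambda>y. \<omega> y b I J) x * E x J c)" for a b
  have second: "pd b (pd a (\<lambda>y. E y I c)) x = - P b a + X a b - Y a b + Q b a - Y b a + Z b a" for a b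
  proof -
    have "pd b (pd a (\<lambda>y. E y I c)) x
       = pd b (\<lambda>y. - (\<Sum>d\<in>UNIV. \<Gamma> y c a d * E y I d) + (\<Sum>J\<in>UNIV. \<omega> y a I J * E y J c)) x"
      by (rule pd_cong[OF S x eq])
    also have "\<dots> = - (\<Sum>d\<in>UNIV. \<Gamma> x c a d * pd b (\<lambda>y. E y I d) x + pd b (\<lambda>y. \<Gamma> y c a d) x * E x I d)
        + (\<Sum>J\<in>UNIV. \<omega> x a I J * pd b (\<lambda>y. E y J c) x + pd b (\<lambda>y. \<omega> y a I J) x * E x J c)"
      by (simp add: pd_add[where S=S] pd_minus[where S=S] pd_diff[where S=S] pd_sum[where S=S] pd_mult[where S=S]
          holo_on_minus holo_on_diff holo_on_sum holo_on_mult hE hG hw x)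
    also have "\<dots> = - P b a - (\<Sum>d\<in>UNIV. \<Gamma> x c a d * pd b (\<lambda>y. E y I d) x)
        + (\<Sum>J\<in>UNIV. \<omega> x a I J * pd b (\<lambda>y. E y J c) x) + Q b a"
      by (simp add: sum.distrib P_def Q_def)
    also have "(\<Sum>d\<in>UNIV. \<Gamma> x c a d * pd b (\<lambda>y. E y I d) x) = - X a b + Y a b"
    proof -
      have "(\<Sum>d\<in>UNIV. \<Gamma> x c a d * pd b (\<lambda>y. E y I d) x)
         = - (\<Sum>d\<in>UNIV. \<Sum>f\<in>UNIV. \<Gamma> x c a d * \<Gamma> x d b f * E x I f) + Y a b"
        by (simp add: eq[OF x] Y_def distrib_left right_diff_distrib sum_subtractf sum_distrib_left mult.assoc sum.distrib)
      also have "(\<Sum>d\<in>UNIV. \<Sum>f\<in>UNIV. \<Gamma> x c a d * \<Gamma> x d b f * E x I f) = X a b"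
        unfolding X_def by (rule sum.swap)
      finally show ?thesis .
    qed
    also have "(\<Sum>J\<in>UNIV. \<omega> x a I J * pd b (\<lambda>y. E y J c) x) = - Y b a + Z b a"
    proof -
      have "(\<Sum>J\<in>UNIV. \<omega> x a I J * pd b (\<lambda>y. E y J c) x)
         = - (\<Sum>J\<in>UNIV. \<Sum>d\<in>UNIV. \<Gamma> x c b d * \<omega> x a I J * E x J d)
           + (\<Sum>K\<in>UNIV. \<Sum>J\<in>UNIV. \<omega> x a I K * \<omega> x b K J * E x J c)"
        by (simp add: eq[OF x] distrib_left right_diff_distrib sum_subtractf sum_distrib_left mult_ac sum.distrib)
      also have "(\<Sum>J\<in>UNIV. \<Sum>d\<in>UNIV. \<Gamma> x c b d * \<omega> x a I J * E x J d) = Y b a"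
        unfolding Y_def by (rule sum.swap)
      also have "(\<Sum>K\<in>UNIV. \<Sum>J\<in>UNIV. \<omega> x a I K * \<omega> x b K J * E x J c) = Z b a"
        unfolding Z_def by (rule sum.swap)
      finally show ?thesis .
    qed
    finally show ?thesis by simp
  qed
  have "P a b - P b a + X a b - X b a = Q a b - Q b a + Z a b - Z b a"
    using pd_commute[OF S hE x, of b a I c] by (simp add: second algebra_simps)
  then show ?thesis
    by (simp add: P_def Q_def X_def Z_def distrib_right left_diff_distrib sum.distrib sum_subtractf sum_distrib_right add_diff_eq)
qed

definition eta :: "2 \<times> 2 \<Rightarrow> 2 \<times> 2 \<Rightarrow> complex" where
  "eta I J = eps (fst I) (fst J) * eps (snd I) (snd J)"

lemma eta_sym: "eta J I = eta I J"
  by (simp add: eta_def eps_swap[of "fst I"] eps_swap[of "snd I"])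

text \<open>The Gram matrix of the tetrad is symmetric and its own inverse, so \<open>eta\<close>
  both lowers and raises tetrad indices.\<close>

lemma eta_inv: "(\<Sum>K\<in>UNIV. eta I K * eta J K) = (if I = J then 1 else 0)"
  by (cases I; cases J; cases "fst I" rule: exhaust_2_01; cases "snd I" rule: exhaust_2_01;
      cases "fst J" rule: exhaust_2_01; cases "snd J" rule: exhaust_2_01)
     (auto simp: sum_UNIV_prod sum_2_01 eta_def)

section \<open>Tetrad, inverse metric and connection coefficients\<close>

locale tetrad =
  fixes U :: "(complex^4) set" and g :: "complex^4 \<Rightarrow> complex^4^4"
    and e :: "complex^4 \<Rightarrow> 2 \<Rightarrow> 2 \<Rightarrow> complex^4"
  assumes open_U: "open U"
    and holo_g: "holo_on (\<lambda>x. g x $ a $ b) U"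
    and holo_e: "holo_on (\<lambda>x. e x A A' $ c) U"
    and g_transpose: "x \<in> U \<Longrightarrow> transpose (g x) = g x"
    and det_g: "x \<in> U \<Longrightarrow> det (g x) \<noteq> 0"
    and gram: "x \<in> U \<Longrightarrow> bilin (g x) (e x A A') (e x B B') = eps A B * eps A' B'"
    and det_e: "x \<in> U \<Longrightarrow> det (vector [e x 0 0, e x 1 0, e x 0 1, e x 1 1] :: complex^4^4) \<noteq> 0"

lemma spacetime_tetrad: "spacetime U g vol e \<Longrightarrow> tetrad U g e"
  unfolding spacetime_def by unfold_locales (force+)

lemma bilin_add_left: "bilin G (u + v) w = bilin G u w + bilin G v w"
  by (simp add: bilin_def algebra_simps sum.distrib)
lemma bilin_scale_left: "bilin G (c *s u) w = c * bilin G u w"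
  by (simp add: bilin_def sum_distrib_left mult_ac)
lemma bilin_sum_left: "bilin G (\<Sum>i\<in>I. f i) w = (\<Sum>i\<in>I. bilin G (f i) w)"
  by (induction I rule: infinite_finite_induct) (auto simp: bilin_add_left, auto simp: bilin_def)
lemma bilin_diff_left: "bilin G (u - v) w = bilin G u w - bilin G v w"
  using bilin_add_left[of G "u - v" v w] by simp

context tetrad begin

lemma g_sym: assumes "x \<in> U" shows "g x $ a $ b = g x $ b $ a"
proof -
  have "transpose (g x) $ a $ b = g x $ b $ a" by (simp add: transpose_def)
  then show ?thesis by (simp add: g_transpose[OF assms])
qed

lemma bilin_sym: "x \<in> U \<Longrightarrow> bilin (g x) u v = bilin (g x) v u"
  unfolding bilin_def by (subst sum.swap) (simp add: g_sym mult_ac)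

definition E :: "complex^4 \<Rightarrow> 2 \<times> 2 \<Rightarrow> complex^4" where "E x I = e x (fst I) (snd I)"

lemma gram': "x \<in> U \<Longrightarrow> bilin (g x) (E x I) (E x J) = eta I J"
  by (simp add: E_def gram eta_def)

lemma holo_E: "holo_on (\<lambda>x. E x I $ c) U"
  by (simp add: E_def holo_e)

text \<open>Nondegeneracy is used twice: the tetrad is a basis, and the metric has nonzero
  determinant.\<close>

lemma tetrad_separates:
  assumes x: "x \<in> U" and z: "\<And>I. bilin (g x) w (E x I) = 0"
  shows "w = 0"
proof -
  define M :: "complex^4^4" where "M = vector [e x 0 0, e x 1 0, e x 0 1, e x 1 1]"
  have r: "M $ 1 = E x (0,0)" "M $ 2 = E x (1,0)" "M $ 3 = E x (0,1)" "M $ 4 = E x (1,1)"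
    by (simp_all add: M_def vector_def E_def)
  have "bilin (g x) w u = (\<Sum>b\<in>UNIV. u $ b * (g x *v w) $ b)" for u
    unfolding bilin_def matrix_vector_mult_def
    by (subst sum.swap) (simp add: sum_distrib_left g_sym[OF x] mult_ac)
  then have "(M *v (g x *v w)) $ i = 0" for i
    using z r exhaust_4[of i] by (auto simp: matrix_vector_mult_def[of M])
  then have "M *v (g x *v w) = 0" by (simp add: vec_eq_iff)
  then have "g x *v w = 0"
    using det_e[OF x] by (metis M_def invertible_det_nz matrix_vector_mult_0_right inj_matrix_vector_mult injD invertible_def)
  then show ?thesis
    using det_g[OF x] by (metis invertible_det_nz matrix_vector_mult_0_right inj_matrix_vector_mult injD)
qed

text \<open>The difference of the two sides is orthogonal to the whole tetrad, because
  \<open>eta\<close> is inverse to the Gram matrix.\<close>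

lemma tetrad_expand:
  assumes x: "x \<in> U"
  shows "v = (\<Sum>I\<in>UNIV. (\<Sum>J\<in>UNIV. eta I J * bilin (g x) v (E x J)) *s E x I)"
proof -
  let ?w = "v - (\<Sum>I\<in>UNIV. (\<Sum>J\<in>UNIV. eta I J * bilin (g x) v (E x J)) *s E x I)"
  have "bilin (g x) ?w (E x K) = 0" for K
  proof -
    have "bilin (g x) ?w (E x K) = bilin (g x) v (E x K) - (\<Sum>I\<in>UNIV. \<Sum>J\<in>UNIV. bilin (g x) v (E x J) * (eta J I * eta K I))"
      by (simp add: bilin_diff_left bilin_sum_left bilin_scale_left gram'[OF x] sum_distrib_left sum_distrib_right eta_sym mult_ac)
    also have "(\<Sum>I\<in>UNIV. \<Sum>J\<in>UNIV. bilin (g x) v (E x J) * (eta J I * eta K I)) = (\<Sum>J\<in>UNIV. bilin (g x) v (E x J) * (if J = K then 1 else 0))"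
      by (subst sum.swap) (simp add: sum_distrib_left[symmetric] eta_inv)
    finally show ?thesis by (simp add: if_distrib cong: if_cong)
  qed
  from tetrad_separates[OF x this] show ?thesis by simp
qed

text \<open>The inverse metric assembled from the tetrad. Unlike the choice behind
  \<open>matrix_inv\<close>, this expression is visibly holomorphic.\<close>

definition ginv :: "complex^4 \<Rightarrow> complex^4^4" where
  "ginv x = (\<chi> a b. \<Sum>I\<in>UNIV. \<Sum>J\<in>UNIV. eta I J * E x I $ a * E x J $ b)"

lemma ginv_left:
  assumes x: "x \<in> U" shows "ginv x ** g x = mat 1"
proof (rule vec_eq_iff[THEN iffD2], rule allI, rule vec_eq_iff[THEN iffD2], rule allI)
  fix a b
  have "bilin (g x) (axis b 1) (E x J) = (\<Sum>c\<in>UNIV. E x J $ c * g x $ c $ b)" for J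
  proof -
    have "bilin (g x) (axis b 1) (E x J) = (\<Sum>p\<in>UNIV. if p = b then (\<Sum>q\<in>UNIV. g x $ b $ q * E x J $ q) else 0)"
      unfolding bilin_def by (rule sum.cong) (auto simp: axis_def)
    then show ?thesis by (simp add: g_sym[OF x, of b] mult.commute)
  qed
  then have "(axis b 1 :: complex^4) = (\<Sum>I\<in>UNIV. (\<Sum>J\<in>UNIV. eta I J * (\<Sum>c\<in>UNIV. E x J $ c * g x $ c $ b)) *s E x I)"
    using tetrad_expand[OF x, of "axis b 1"] by simp
  then have "(axis b 1 :: complex^4) $ a = (\<Sum>I\<in>UNIV. \<Sum>J\<in>UNIV. \<Sum>c\<in>UNIV. eta I J * E x I $ a * E x J $ c * g x $ c $ b)"
    by (simp add: sum_distrib_left sum_distrib_right mult_ac)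
  also have "\<dots> = (\<Sum>c\<in>UNIV. \<Sum>I\<in>UNIV. \<Sum>J\<in>UNIV. eta I J * E x I $ a * E x J $ c * g x $ c $ b)"
    by (subst (2) sum.swap, subst sum.swap, rule refl)
  also have "\<dots> = (ginv x ** g x) $ a $ b"
    by (simp add: matrix_matrix_mult_def ginv_def sum_distrib_right)
  finally show "(ginv x ** g x) $ a $ b = mat 1 $ a $ b"
    by (simp add: axis_def mat_def eq_commute)
qed

lemma ginv_right: "x \<in> U \<Longrightarrow> g x ** ginv x = mat 1"
  using ginv_left matrix_left_right_inverse by blast

lemma matrix_inv_g: assumes x: "x \<in> U" shows "matrix_inv (g x) = ginv x"
proof -
  have "g x ** matrix_inv (g x) = mat 1 \<and> matrix_inv (g x) ** g x = mat 1"
    unfolding matrix_inv_def by (rule someI[of _ "ginv x"]) (simp add: ginv_left ginv_right x)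
  then show ?thesis by (metis ginv_left matrix_mul_assoc matrix_mul_lid matrix_mul_rid x)
qed

lemma holo_ginv: "holo_on (\<lambda>x. ginv x $ a $ b) U"
  by (auto simp: ginv_def intro!: holo_on_sum holo_on_mult holo_E)

abbreviation "Gam \<equiv> christoffel g"

lemma holo_pd_g: "holo_on (\<lambda>x. pd c (\<lambda>y. g y $ a $ b) x) U"
  by (rule holo_on_pd_holo[OF open_U holo_g])

end

lemma sum_rotate3: "(\<Sum>c\<in>C. \<Sum>a\<in>A. \<Sum>b\<in>B. h c a b) = (\<Sum>a\<in>A. \<Sum>b\<in>B. \<Sum>c\<in>C. h c a b)"
  by (subst sum.swap, rule sum.cong[OF refl], rule sum.swap)

context tetrad begin

lemma Gam_eq: "x \<in> U \<Longrightarrow> Gam x c a b = (\<Sum>d\<in>UNIV. ginv x $ c $ d *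
     (pd a (\<lambda>y. g y $ d $ b) x + pd b (\<lambda>y. g y $ d $ a) x - pd d (\<lambda>y. g y $ a $ b) x)) / 2"
  by (simp add: christoffel_def matrix_inv_g)

lemma holo_Gam: "holo_on (\<lambda>x. Gam x c a b) U"
proof (rule holo_on_transform[OF _ open_U Gam_eq[symmetric]])
  show "holo_on (\<lambda>x. (\<Sum>d\<in>UNIV. ginv x $ c $ d *
     (pd a (\<lambda>y. g y $ d $ b) x + pd b (\<lambda>y. g y $ d $ a) x - pd d (\<lambda>y. g y $ a $ b) x)) / 2) U"
    by (intro holo_on_divide holo_on_sum holo_on_mult holo_on_add holo_on_diff holo_ginv holo_pd_g holo_on_const) simp
qed

lemma pd_g_sym: "x \<in> U \<Longrightarrow> pd c (\<lambda>y. g y $ a $ b) x = pd c (\<lambda>y. g y $ b $ a) x"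
  by (rule pd_cong[OF open_U]) (auto simp: g_sym)

lemma Gam_sym: assumes x: "x \<in> U" shows "Gam x c a b = Gam x c b a"
  unfolding Gam_eq[OF x] pd_g_sym[OF x, of _ a b] by (simp only: add.commute)

lemma Gam_lower:
  assumes x: "x \<in> U"
  shows "(\<Sum>c\<in>UNIV. g x $ f $ c * Gam x c a b) =
    (pd a (\<lambda>y. g y $ f $ b) x + pd b (\<lambda>y. g y $ f $ a) x - pd f (\<lambda>y. g y $ a $ b) x) / 2"
proof -
  define k where "k d = pd a (\<lambda>y. g y $ d $ b) x + pd b (\<lambda>y. g y $ d $ a) x - pd d (\<lambda>y. g y $ a $ b) x" for d
  have G: "Gam x c a b = (\<Sum>d\<in>UNIV. ginv x $ c $ d * k d) / 2" for c
    using Gam_eq[OF x, of c a b] by (simp only: k_def)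
  have "(\<Sum>c\<in>UNIV. g x $ f $ c * Gam x c a b) = (\<Sum>c\<in>UNIV. g x $ f $ c * (\<Sum>d\<in>UNIV. ginv x $ c $ d * k d)) / 2"
    by (simp only: G times_divide_eq_right sum_divide_distrib[symmetric])
  also have "(\<Sum>c\<in>UNIV. g x $ f $ c * (\<Sum>d\<in>UNIV. ginv x $ c $ d * k d)) = (\<Sum>c\<in>UNIV. \<Sum>d\<in>UNIV. g x $ f $ c * ginv x $ c $ d * k d)"
    by (simp only: sum_distrib_left mult.assoc)
  also have "(\<Sum>c\<in>UNIV. \<Sum>d\<in>UNIV. g x $ f $ c * ginv x $ c $ d * k d) = (\<Sum>d\<in>UNIV. (g x ** ginv x) $ f $ d * k d)"
    unfolding matrix_matrix_mult_def vec_lambda_beta sum_distrib_right by (rule sum.swap)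
  also have "\<dots> = (\<Sum>d\<in>UNIV. (if f = d then k d else 0))"
    by (rule sum.cong) (simp_all add: ginv_right[OF x] mat_def)
  also have "\<dots> = k f" by simp
  finally show ?thesis by (simp only: k_def)
qed

lemma metric_compatible:
  assumes x: "x \<in> U"
  shows "pd a (\<lambda>y. g y $ b $ c) x = (\<Sum>d\<in>UNIV. g x $ b $ d * Gam x d a c + g x $ c $ d * Gam x d a b)"
  unfolding sum.distrib Gam_lower[OF x] pd_g_sym[OF x, of _ c b] pd_g_sym[OF x, of _ c a] pd_g_sym[OF x, of _ b a]
  by (simp add: field_simps)

definition nab :: "complex^4 \<Rightarrow> 4 \<Rightarrow> 2 \<times> 2 \<Rightarrow> complex^4" where
  "nab x a I = nabla_tetrad g e x a (fst I) (snd I)"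

lemma nab_nth: "nab x a I $ c = pd a (\<lambda>y. E y I $ c) x + (\<Sum>d\<in>UNIV. Gam x c a d * E x I $ d)"
  by (simp add: nab_def nabla_tetrad_def E_def)

lemma holo_nab: "holo_on (\<lambda>x. nab x a I $ c) U"
  unfolding nab_nth by (intro holo_on_sum holo_on_mult holo_on_add holo_Gam holo_E holo_on_pd_holo open_U)

definition om :: "complex^4 \<Rightarrow> 4 \<Rightarrow> 2 \<times> 2 \<Rightarrow> 2 \<times> 2 \<Rightarrow> complex" where
  "om x a I J = bilin (g x) (nab x a I) (E x J)"

lemma holo_om: "holo_on (\<lambda>x. om x a I J) U"
  unfolding om_def bilin_def by (intro holo_on_sum holo_on_mult holo_nab holo_E holo_g)

text \<open>Differentiate the constant Gram matrix of the tetrad; the derivative of the metric is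
  absorbed by the Christoffel terms through \<open>metric_compatible\<close>.\<close>

lemma om_antisym:
  assumes x: "x \<in> U" shows "om x a J I = - om x a I J"
proof -
  have "0 = pd a (\<lambda>y. \<Sum>b\<in>UNIV. \<Sum>c\<in>UNIV. g y $ b $ c * E y I $ b * E y J $ c) x"
    using pd_cong[OF open_U x, of "\<lambda>y. \<Sum>b\<in>UNIV. \<Sum>c\<in>UNIV. g y $ b $ c * E y I $ b * E y J $ c" "\<lambda>y. eta I J" a] gram'
    by (simp add: bilin_def)
  also have "\<dots> = (\<Sum>b\<in>UNIV. \<Sum>c\<in>UNIV. g x $ b $ c * E x I $ b * pd a (\<lambda>y. E y J $ c) x
     + (g x $ b $ c * pd a (\<lambda>y. E y I $ b) x + pd a (\<lambda>y. g y $ b $ c) x * E x I $ b) * E x J $ c)"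
    by (simp add: pd_sum[where S=U] pd_mult[where S=U] holo_on_sum holo_on_mult holo_E holo_g x)
  also have "\<dots> = (\<Sum>b\<in>UNIV. \<Sum>c\<in>UNIV. g x $ b $ c * E x I $ b * pd a (\<lambda>y. E y J $ c) x)
     + (\<Sum>b\<in>UNIV. \<Sum>c\<in>UNIV. g x $ b $ c * pd a (\<lambda>y. E y I $ b) x * E x J $ c)
     + (\<Sum>b\<in>UNIV. \<Sum>c\<in>UNIV. pd a (\<lambda>y. g y $ b $ c) x * E x I $ b * E x J $ c)"
    by (simp add: sum.distrib distrib_right add.assoc)
  also have "(\<Sum>b\<in>UNIV. \<Sum>c\<in>UNIV. pd a (\<lambda>y. g y $ b $ c) x * E x I $ b * E x J $ c)
     = (\<Sum>b\<in>UNIV. \<Sum>c\<in>UNIV. (\<Sum>d\<in>UNIV. g x $ b $ d * Gam x d a c) * E x I $ b * E x J $ c)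
     + (\<Sum>b\<in>UNIV. \<Sum>c\<in>UNIV. (\<Sum>d\<in>UNIV. g x $ c $ d * Gam x d a b) * E x I $ b * E x J $ c)"
    by (simp only: metric_compatible[OF x] sum.distrib distrib_right)
  also have "(\<Sum>b\<in>UNIV. \<Sum>c\<in>UNIV. (\<Sum>d\<in>UNIV. g x $ b $ d * Gam x d a c) * E x I $ b * E x J $ c)
     = (\<Sum>b\<in>UNIV. \<Sum>c\<in>UNIV. g x $ b $ c * E x I $ b * (\<Sum>d\<in>UNIV. Gam x c a d * E x J $ d))"
    unfolding sum_distrib_left sum_distrib_right
    by (rule sum.cong[OF refl], subst sum.swap) (simp only: mult_ac)
  also have "(\<Sum>b\<in>UNIV. \<Sum>c\<in>UNIV. (\<Sum>d\<in>UNIV. g x $ c $ d * Gam x d a b) * E x I $ b * E x J $ c)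
     = (\<Sum>c\<in>UNIV. \<Sum>b\<in>UNIV. \<Sum>d\<in>UNIV. g x $ c $ d * Gam x d a b * E x I $ b * E x J $ c)"
    unfolding sum_distrib_left sum_distrib_right by (rule sum.swap)
  also have "\<dots> = (\<Sum>c\<in>UNIV. \<Sum>d\<in>UNIV. \<Sum>b\<in>UNIV. g x $ c $ d * Gam x d a b * E x I $ b * E x J $ c)"
    by (rule sum.cong[OF refl], rule sum.swap)
  also have "\<dots> = (\<Sum>d\<in>UNIV. \<Sum>c\<in>UNIV. \<Sum>b\<in>UNIV. g x $ c $ d * Gam x d a b * E x I $ b * E x J $ c)"
    by (rule sum.swap)
  also have "\<dots> = (\<Sum>b\<in>UNIV. \<Sum>c\<in>UNIV. g x $ b $ c * (\<Sum>d\<in>UNIV. Gam x b a d * E x I $ d) * E x J $ c)"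
    unfolding sum_distrib_left sum_distrib_right
  proof (intro sum.cong refl)
    fix d c b
    show "g x $ c $ d * Gam x d a b * E x I $ b * E x J $ c = g x $ d $ c * (Gam x d a b * E x I $ b) * E x J $ c"
      unfolding g_sym[OF x, of c d] by (simp only: mult.assoc)
  qed
  finally have "0 = bilin (g x) (nab x a I) (E x J) + bilin (g x) (E x I) (nab x a J)"
    unfolding bilin_def nab_nth distrib_left distrib_right sum.distrib by (simp only: ac_simps)
  then have "om x a J I + om x a I J = 0"
    unfolding om_def bilin_sym[OF x, of "E x I" "nab x a J"] by (simp only: add.commute)
  then show ?thesis by (simp only: eq_neg_iff_add_eq_0)
qed

definition frame_conn :: "complex^4 \<Rightarrow> 4 \<Rightarrow> 2 \<times> 2 \<Rightarrow> 2 \<times> 2 \<Rightarrow> complex" where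
  "frame_conn x a I K = (\<Sum>J\<in>UNIV. eta K J * om x a I J)"

lemma holo_frame_conn: "holo_on (\<lambda>x. frame_conn x a I K) U"
  unfolding frame_conn_def by (intro holo_on_sum holo_on_mult holo_om holo_on_const)

lemma nab_expand: "x \<in> U \<Longrightarrow> nab x a I = (\<Sum>K\<in>UNIV. frame_conn x a I K *s E x K)"
  unfolding frame_conn_def om_def by (rule tetrad_expand)

lemma pd_E:
  assumes x: "x \<in> U"
  shows "pd a (\<lambda>y. E y I $ c) x = - (\<Sum>d\<in>UNIV. Gam x c a d * E x I $ d) + (\<Sum>J\<in>UNIV. frame_conn x a I J * E x J $ c)"
  using nab_nth[of x a I c] nab_expand[OF x, of a I] by simp

abbreviation "gam \<equiv> spin_conn g e"

text \<open>The connection on unprimed spinors: \<open>spin_conn\<close> with the roles of the two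
  kinds of indices exchanged.\<close>

definition unp :: "complex^4 \<Rightarrow> 4 \<Rightarrow> 2 \<Rightarrow> 2 \<Rightarrow> complex" where
  "unp x a B C = (\<Sum>B'\<in>UNIV. \<Sum>C'\<in>UNIV. \<Sum>D\<in>UNIV. eps B' C' * eps C D * om x a (B,B') (D,C')) / 2"

lemma gam_om: "gam x a B' C' = (\<Sum>B\<in>UNIV. \<Sum>C\<in>UNIV. \<Sum>D'\<in>UNIV. eps B C * eps C' D' * om x a (B,B') (C,D')) / 2"
  by (simp add: spin_conn_def om_def nab_def E_def)

lemma holo_gam: "holo_on (\<lambda>x. gam x a B C) U"
  unfolding gam_om by (intro holo_on_divide holo_on_sum holo_on_mult holo_om holo_on_const) simp

lemma holo_unp: "holo_on (\<lambda>x. unp x a B C) U"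
  unfolding unp_def by (intro holo_on_divide holo_on_sum holo_on_mult holo_om holo_on_const) simp

text \<open>The Lie algebra of the complex orthogonal group in dimension four is a sum of two copies
  of sl(2). Antisymmetry of \<open>om\<close> places the frame connection in this Lie algebra, and
  the two traces over the opposite indices extract its two parts.\<close>

lemma frame_conn_split:
  assumes x: "x \<in> U"
  shows "frame_conn x a I J = (if snd I = snd J then unp x a (fst I) (fst J) else 0) + (if fst I = fst J then gam x a (snd I) (snd J) else 0)"
proof -
  have z: "om x a I I = 0" for I
  proof -
    have "om x a I I + om x a I I = 0"
      by (subst (2) om_antisym[OF x, of a I I]) (rule add.right_inverse)
    then show ?thesis by simp
  qed
  note an = om_antisym[OF x, of a "(0,1)" "(0,0)"] om_antisym[OF x, of a "(1,0)" "(0,0)"] om_antisym[OF x, of a "(1,1)" "(0,0)"]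
    om_antisym[OF x, of a "(1,0)" "(0,1)"] om_antisym[OF x, of a "(1,1)" "(0,1)"] om_antisym[OF x, of a "(1,1)" "(1,0)"]
  note [simp] = z
  have c: "frame_conn x a (B,B') (C,C') = (\<Sum>D\<in>UNIV. \<Sum>D'\<in>UNIV. eps C D * eps C' D' * om x a (B,B') (D,D'))" for B B' C C'
    by (simp only: frame_conn_def sum_UNIV_prod eta_def fst_conv snd_conv)
  have "frame_conn x a (B,B') (C,C') = (if B' = C' then unp x a B C else 0) + (if B = C then gam x a B' C' else 0)" for B B' C C'
    unfolding c gam_om unp_def sum_2_01
    by (cases B rule: exhaust_2_01; cases B' rule: exhaust_2_01; cases C rule: exhaust_2_01; cases C' rule: exhaust_2_01;
        hypsubst; simp; (simp add: an)?; (simp add: diff_divide_distrib add_divide_distrib)?)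
  from this[of "fst I" "snd I" "fst J" "snd J"] show ?thesis by simp
qed

lemma gam_tr: "x \<in> U \<Longrightarrow> gam x a 1 1 = - gam x a 0 0"
  using om_antisym[of x a "(0,1)" "(1,0)"] om_antisym[of x a "(1,1)" "(0,0)"]
  by (simp add: gam_om sum_2_01 field_simps)

lemma unp_tr: "x \<in> U \<Longrightarrow> unp x a 1 1 = - unp x a 0 0"
  using om_antisym[of x a "(1,0)" "(0,1)"] om_antisym[of x a "(1,1)" "(0,0)"]
  by (simp add: unp_def sum_2_01 field_simps)

end

section \<open>Curvature of the frame connection and of the spin connections\<close>

definition conn_curv :: "(complex^4 \<Rightarrow> 4 \<Rightarrow> 2 \<Rightarrow> 2 \<Rightarrow> complex) \<Rightarrow> complex^4 \<Rightarrow> 4 \<Rightarrow> 4 \<Rightarrow> 2 \<Rightarrow> 2 \<Rightarrow> complex" where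
  "conn_curv G x a b B C = pd a (\<lambda>y. G y b B C) x - pd b (\<lambda>y. G y a B C) x
     + (\<Sum>D\<in>UNIV. G x b B D * G x a D C - G x a B D * G x b D C)"

context tetrad begin

definition frame_curv :: "complex^4 \<Rightarrow> 4 \<Rightarrow> 4 \<Rightarrow> 2 \<times> 2 \<Rightarrow> 2 \<times> 2 \<Rightarrow> complex" where
  "frame_curv x a b I J = pd a (\<lambda>y. frame_conn y b I J) x - pd b (\<lambda>y. frame_conn y a I J) x
     + (\<Sum>K\<in>UNIV. frame_conn x b I K * frame_conn x a K J - frame_conn x a I K * frame_conn x b K J)"

text \<open>The structure equation turns the Riemann tensor into the curvature of the frame
  connection, where the splitting into two spin connections becomes available.\<close>

lemma riemann_frame:
  assumes x: "x \<in> U"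
  shows "(\<Sum>c\<in>UNIV. riemann g x d c a b * E x I $ c) = (\<Sum>J\<in>UNIV. frame_curv x a b I J * E x J $ d)"
  unfolding frame_curv_def riemann_def
  by (rule frame_curvature[OF open_U x, where E="\<lambda>x I c. E x I $ c" and \<Gamma>="Gam" and \<omega>=frame_conn, OF holo_E holo_Gam holo_frame_conn pd_E])

lemma curv_tr:
  assumes x: "x \<in> U" and G: "\<And>y a. y \<in> U \<Longrightarrow> G y a 1 1 = - G y a 0 0" "\<And>a B C. holo_on (\<lambda>y. G y a B C) U"
  shows "conn_curv G x a b 1 1 = - conn_curv G x a b 0 0"
proof -
  have "pd a (\<lambda>y. G y b 1 1) x = - pd a (\<lambda>y. G y b 0 0) x" for a b
    using pd_cong[OF open_U x, of "\<lambda>y. G y b 1 1" "\<lambda>y. - G y b 0 0" a] G(1) pd_minus[OF G(2) x] by simp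
  then show ?thesis by (simp add: conn_curv_def sum_2_01 G(1)[OF x] algebra_simps)
qed

text \<open>The two parts of the frame connection act on different indices and therefore commute, so
  the mixed quadratic terms cancel.\<close>

lemma frame_curv_split:
  assumes x: "x \<in> U"
  shows "frame_curv x a b I J = (if snd I = snd J then conn_curv unp x a b (fst I) (fst J) else 0)
     + (if fst I = fst J then conn_curv gam x a b (snd I) (snd J) else 0)"
proof -
  have p: "pd a (\<lambda>y. frame_conn y b I J) x = (if snd I = snd J then pd a (\<lambda>y. unp y b (fst I) (fst J)) x else 0)
     + (if fst I = fst J then pd a (\<lambda>y. gam y b (snd I) (snd J)) x else 0)" for a b I J
    by (subst pd_cong[OF open_U x frame_conn_split]) (auto simp: pd_add[OF holo_unp holo_gam x])
  have "frame_curv x a b (B,B') (C,C') = (if B' = C' then conn_curv unp x a b B C else 0) + (if B = C then conn_curv gam x a b B' C' else 0)" for B B' C C'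
    unfolding frame_curv_def p conn_curv_def frame_conn_split[OF x] sum_UNIV_prod sum_2_01 fst_conv snd_conv
    by (cases B rule: exhaust_2_01; cases B' rule: exhaust_2_01; cases C rule: exhaust_2_01; cases C' rule: exhaust_2_01)
      (simp_all add: algebra_simps)
  from this[of "fst I" "snd I" "fst J" "snd J"] show ?thesis by simp
qed

lemma riemann_low_frame:
  assumes x: "x \<in> U"
  shows "riemann_low g x (E x J) (E x I) u v = (\<Sum>a\<in>UNIV. \<Sum>b\<in>UNIV. u $ a * v $ b * (\<Sum>K\<in>UNIV. frame_curv x a b I K * eta J K))"
proof -
  have "riemann_low g x (E x J) (E x I) u v
     = (\<Sum>f\<in>UNIV. \<Sum>d\<in>UNIV. \<Sum>a\<in>UNIV. \<Sum>b\<in>UNIV. g x $ f $ d * E x J $ f * u $ a * v $ b * (\<Sum>c\<in>UNIV. riemann g x d c a b * E x I $ c))"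
    unfolding riemann_low_def sum_distrib_left
    by (rule sum.cong[OF refl], rule sum.cong[OF refl], subst sum_rotate3, intro sum.cong refl, simp only: mult_ac)
  also have "\<dots> = (\<Sum>f\<in>UNIV. \<Sum>d\<in>UNIV. \<Sum>a\<in>UNIV. \<Sum>b\<in>UNIV. \<Sum>K\<in>UNIV. u $ a * v $ b * frame_curv x a b I K * (g x $ f $ d * E x J $ f * E x K $ d))"
    unfolding riemann_frame[OF x] sum_distrib_left by (intro sum.cong refl) (simp only: mult_ac)
  also have "\<dots> = (\<Sum>a\<in>UNIV. \<Sum>b\<in>UNIV. \<Sum>K\<in>UNIV. \<Sum>f\<in>UNIV. \<Sum>d\<in>UNIV. u $ a * v $ b * frame_curv x a b I K * (g x $ f $ d * E x J $ f * E x K $ d))"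
  proof -
    have sw: "(\<Sum>f\<in>UNIV. \<Sum>d\<in>UNIV. \<Sum>a\<in>UNIV. \<Sum>b\<in>UNIV. \<Sum>K\<in>UNIV. h f d a b K) = (\<Sum>a\<in>UNIV. \<Sum>b\<in>UNIV. \<Sum>K\<in>UNIV. \<Sum>f\<in>UNIV. \<Sum>d\<in>UNIV. h f d a b K)"
      for h :: "4 \<Rightarrow> 4 \<Rightarrow> 4 \<Rightarrow> 4 \<Rightarrow> 2 \<times> 2 \<Rightarrow> complex"
    proof -
      \<comment> \<open>Grouping the indices into a pair and a triple reduces the reordering to one
        exchange of two sums.\<close>
      have "(\<Sum>p\<in>UNIV. \<Sum>q\<in>UNIV. h (fst p) (snd p) (fst q) (fst (snd q)) (snd (snd q))) = (\<Sum>q\<in>UNIV. \<Sum>p\<in>UNIV. h (fst p) (snd p) (fst q) (fst (snd q)) (snd (snd q)))"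
        by (rule sum.swap)
      then show ?thesis by (simp only: sum_UNIV_prod fst_conv snd_conv)
    qed
    show ?thesis by (rule sw)
  qed
  also have "\<dots> = (\<Sum>a\<in>UNIV. \<Sum>b\<in>UNIV. \<Sum>K\<in>UNIV. u $ a * v $ b * frame_curv x a b I K * bilin (g x) (E x J) (E x K))"
    by (simp add: bilin_def sum_distrib_left)
  finally show ?thesis by (simp add: gram'[OF x] sum_distrib_left mult_ac)
qed

end

section \<open>Contraction of all indices with one spinor\<close>

lemma up_simps: "up \<pi> 0 = \<pi> $ 1" "up \<pi> 1 = - \<pi> $ 0"
  by (simp_all add: up_def sum_2_01)

lemma contract_0 [simp]: "contract 0 T \<pi> = T []"
  by (simp add: contract_def)

text \<open>Splitting off the first index makes contractions accessible to induction on the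
  valence.\<close>

lemma contract_Suc: "contract (Suc k) T \<pi> = (\<Sum>b\<in>UNIV. up \<pi> b * contract k (\<lambda>bs. T (b # bs)) \<pi>)"
proof -
  have s: "{bs :: 2 list. length bs = Suc k} = (\<lambda>(b, bs). b # bs) ` (UNIV \<times> {bs. length bs = k})"
    by (auto simp: length_Suc_conv image_iff)
  have i: "inj_on (\<lambda>(b, bs). b # bs) (UNIV \<times> {bs :: 2 list. length bs = k})"
    by (auto simp: inj_on_def)
  have "contract (Suc k) T \<pi> = (\<Sum>p\<in>UNIV \<times> {bs. length bs = k}. T (fst p # snd p) * (\<Prod>i<Suc k. up \<pi> ((fst p # snd p) ! i)))"
    unfolding contract_def s by (subst sum.reindex[OF i]) (simp add: case_prod_beta)
  also have "\<dots> = (\<Sum>p\<in>UNIV \<times> {bs. length bs = k}. up \<pi> (fst p) * (T (fst p # snd p) * (\<Prod>i<k. up \<pi> (snd p ! i))))"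
    by (rule sum.cong[OF refl]) (simp only: prod.lessThan_Suc_shift nth_Cons_0 nth_Cons_Suc mult_ac)
  also have "\<dots> = (\<Sum>b\<in>UNIV. \<Sum>bs | length bs = k. up \<pi> b * (T (b # bs) * (\<Prod>i<k. up \<pi> (bs ! i))))"
    by (simp only: sum.cartesian_product case_prod_unfold)
  finally show ?thesis by (simp only: contract_def sum_distrib_left)
qed

lemma contract_cong: "(\<And>bs. length bs = k \<Longrightarrow> S bs = T bs) \<Longrightarrow> contract k S \<pi> = contract k T \<pi>"
  by (simp add: contract_def)

lemma permute_list_bij:
  assumes s: "\<sigma> permutes {..<n}"
  shows "bij_betw (permute_list \<sigma>) {bs. length bs = n} {bs. length bs = n}"
proof (rule bij_betw_byWitness[where f'="permute_list (inv \<sigma>)"])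
  have i: "inv \<sigma> permutes {..<n}" using permutes_inv[OF s] .
  show "\<forall>bs\<in>{bs. length bs = n}. permute_list (inv \<sigma>) (permute_list \<sigma> bs) = bs"
    using i by (simp add: permutes_inv_o(1)[OF s] flip: permute_list_compose)
  show "\<forall>bs\<in>{bs. length bs = n}. permute_list \<sigma> (permute_list (inv \<sigma>) bs) = bs"
    using s by (simp add: permutes_inv_o(2)[OF s] flip: permute_list_compose)
qed auto

text \<open>All slots receive the same spinor, so each of the \<open>fact n\<close> permutations
  contributes the same number. A full contraction thus sees only the symmetric part, which is how
  both the Weyl condition and the Killing equation are exploited.\<close>

lemma contract_symmetrise: "contract n (symmetrise n T) \<pi> = contract n T \<pi>"
proof -
  let ?L = "{bs :: 2 list. length bs = n}" and ?P = "{\<sigma>. \<sigma> permutes {..<n}}"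
  define w where "w bs = (\<Prod>i<n. up \<pi> (bs ! i))" for bs
  have one: "(\<Sum>bs\<in>?L. T (permute_list \<sigma> bs) * w bs) = contract n T \<pi>" if s: "\<sigma> permutes {..<n}" for \<sigma>
  proof -
    have ww: "w (permute_list \<sigma> bs) = w bs" if "length bs = n" for bs
    proof -
      have "w (permute_list \<sigma> bs) = (\<Prod>i<n. up \<pi> (bs ! \<sigma> i))"
        unfolding w_def by (rule prod.cong) (use that s in \<open>auto simp: permute_list_nth\<close>)
      also have "\<dots> = w bs"
        unfolding w_def using prod.permute[OF s, of "\<lambda>i. up \<pi> (bs ! i)"] by (simp add: o_def)
      finally show ?thesis .
    qed
    have "(\<Sum>bs\<in>?L. T (permute_list \<sigma> bs) * w bs) = (\<Sum>bs\<in>?L. T (permute_list \<sigma> bs) * w (permute_list \<sigma> bs))"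
      by (rule sum.cong) (simp_all add: ww)
    also have "\<dots> = (\<Sum>bs\<in>?L. T bs * w bs)"
      by (rule sum.reindex_bij_betw[OF permute_list_bij[OF s], where g="\<lambda>bs. T bs * w bs"])
    finally show ?thesis by (simp add: contract_def w_def)
  qed
  have "contract n (symmetrise n T) \<pi> = (\<Sum>bs\<in>?L. \<Sum>\<sigma>\<in>?P. T (permute_list \<sigma> bs) * w bs) / fact n"
    by (simp add: contract_def symmetrise_def w_def sum_distrib_right sum_divide_distrib)
  also have "\<dots> = (\<Sum>\<sigma>\<in>?P. \<Sum>bs\<in>?L. T (permute_list \<sigma> bs) * w bs) / fact n"
    by (subst sum.swap) (rule refl)
  also have "(\<Sum>\<sigma>\<in>?P. \<Sum>bs\<in>?L. T (permute_list \<sigma> bs) * w bs) = (\<Sum>\<sigma>\<in>?P. contract n T \<pi>)"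
    by (rule sum.cong) (simp_all add: one)
  also have "\<dots> / fact n = contract n T \<pi>"
    using card_permutations[of "{..<n}" n] by simp
  finally show ?thesis .
qed

lemma contract_zero: "(\<And>bs. length bs = k \<Longrightarrow> T bs = 0) \<Longrightarrow> contract k T \<pi> = 0"
  by (simp add: contract_def)

section \<open>Algebra of anti-self-dual Ricci-flat curvature tensors\<close>

lemma riemann_pair_sym:
  fixes r :: "'i \<Rightarrow> 'i \<Rightarrow> 'i \<Rightarrow> 'i \<Rightarrow> complex"
  assumes a: "\<And>I J K L. r J I K L = - r I J K L" and b: "\<And>I J K L. r I J L K = - r I J K L"
    and c: "\<And>I J K L. r I J K L + r I K L J + r I L J K = 0"
  shows "r I J K L = r K L I J"
proof -
  \<comment> \<open>Four cyclic identities, one for each index in first place; after the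
    antisymmetries are applied only the two pair exchanges survive in their combination.\<close>
  have "r I J K L + r I K L J + r I L J K = 0" "r J K L I + r J L I K + r J I K L = 0"
    "r K L I J + r K I J L + r K J L I = 0" "r L I J K + r L J K I + r L K I J = 0"
    by (rule c)+
  moreover have "r J I K L = - r I J K L" "r L K I J = - r K L I J" "r K I J L = r I K L J" "r J L I K = r L J K I"
     "r L I J K = - r I L J K" "r K J L I = - r J K L I"
    using a[of _ _ I J] a[of _ _ K L] a[of _ _ _ _] b by (metis minus_minus)+
  ultimately show ?thesis by algebra
qed

text \<open>The combinations of the first index pair in the conclusion form the primed part of the
  curvature. It is made of the self-dual Weyl spinor and of the trace-free part and the trace of the
  Ricci tensor, all of which vanish. This is verified on components: the symmetries leave few
  independent ones, and the hypotheses are linear equations for them.\<close>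

lemma asd_ricci_flat_algebra:
  fixes r :: "2 \<times> 2 \<Rightarrow> 2 \<times> 2 \<Rightarrow> 2 \<times> 2 \<Rightarrow> 2 \<times> 2 \<Rightarrow> complex"
  assumes a: "\<And>I J K L. r J I K L = - r I J K L" and b: "\<And>I J K L. r I J L K = - r I J K L"
    and c: "\<And>I J K L. r I J K L + r I K L J + r I L J K = 0"
    and ric: "\<And>J L. (\<Sum>I\<in>UNIV. \<Sum>K\<in>UNIV. eta I K * r I J K L) = 0"
    and weyl: "\<And>\<pi>. contract 4 (\<lambda>bs. (\<Sum>A\<in>UNIV. \<Sum>B\<in>UNIV. \<Sum>C\<in>UNIV. \<Sum>D\<in>UNIV. eps A B * eps C D *
        r (A, bs!0) (B, bs!1) (C, bs!2) (D, bs!3)) / 4) \<pi> = 0"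
  shows "r (1,0) (0,0) K L = 0 \<and> r (1,1) (0,1) K L = 0 \<and> r (1,0) (0,1) K L = r (0,0) (1,1) K L"
proof -
  note ps = riemann_pair_sym[of r, OF a b c]
  have z: "r I I K L = 0" for I K L
  proof -
    have "r I I K L + r I I K L = 0" by (subst (2) a) (rule add.right_inverse)
    then show ?thesis by simp
  qed
  have z': "r K L I I = 0" for I K L using z ps[of K L I I] by simp
  let ?a = "(0,0) :: 2 \<times> 2" and ?b = "(0,1) :: 2 \<times> 2" and ?c = "(1,0) :: 2 \<times> 2" and ?d = "(1,1) :: 2 \<times> 2"
  note n2 = b[of _ _ ?a ?b] b[of _ _ ?a ?c] b[of _ _ ?a ?d] b[of _ _ ?b ?c] b[of _ _ ?b ?d] b[of _ _ ?c ?d]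
  note n1 = a[of ?a ?b] a[of ?a ?c] a[of ?a ?d] a[of ?b ?c] a[of ?b ?d] a[of ?c ?d]
  note n3 = ps[of ?c ?a ?b ?a] ps[of ?d ?a ?b ?a] ps[of ?c ?b ?b ?a] ps[of ?d ?b ?b ?a] ps[of ?d ?c ?b ?a]
    ps[of ?d ?a ?c ?a] ps[of ?c ?b ?c ?a] ps[of ?d ?b ?c ?a] ps[of ?d ?c ?c ?a]
    ps[of ?c ?b ?d ?a] ps[of ?d ?b ?d ?a] ps[of ?d ?c ?d ?a]
    ps[of ?d ?b ?c ?b] ps[of ?d ?c ?c ?b] ps[of ?d ?c ?d ?b]
  \<comment> \<open>Rewriting to a normal form, with every index pair ordered and the two pairs
    ordered as well, so that each independent component has a single name.\<close>
  note nf = z z' n1 n2 n3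
  have R: "r ?a J ?d L + r ?d J ?a L - r ?b J ?c L - r ?c J ?b L = 0" for J L
    using ric[of J L] by (simp add: sum_UNIV_prod sum_2_01 eta_def algebra_simps)
  note B = c[of ?a ?b ?c ?d, simplified nf]
  define T where "T p q s t = (\<Sum>A\<in>UNIV. \<Sum>B\<in>UNIV. \<Sum>C\<in>UNIV. \<Sum>D\<in>UNIV. eps A B * eps C D * r (A, p) (B, q) (C, s) (D, t))" for p q s t
  \<comment> \<open>The contraction is a binary quartic in the components of the raised spinor; its
    coefficients are the Weyl components up to numerical factors.\<close>
  have W: "T 0 0 0 0 * u^4 + (T 0 0 0 1 + T 0 0 1 0 + T 0 1 0 0 + T 1 0 0 0) * u^3 * v
     + (T 0 0 1 1 + T 1 1 0 0 + T 0 1 0 1 + T 0 1 1 0 + T 1 0 0 1 + T 1 0 1 0) * u^2 * v^2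
     + (T 1 1 1 0 + T 1 1 0 1 + T 1 0 1 1 + T 0 1 1 1) * u * v^3 + T 1 1 1 1 * v^4 = 0" (is "?w u v") for u v
  proof -
    define \<pi> :: "complex^2" where "\<pi> = (\<chi> i. if i = 0 then - v else u)"
    have u: "up \<pi> 0 = u" "up \<pi> 1 = v" by (simp_all add: up_simps \<pi>_def)
    have "contract 4 (\<lambda>bs. T (bs!0) (bs!1) (bs!2) (bs!3) / 4) \<pi> = 0"
      using weyl[of \<pi>] by (simp only: T_def)
    then have "(\<Sum>p\<in>UNIV. up \<pi> p * (\<Sum>q\<in>UNIV. up \<pi> q * (\<Sum>s\<in>UNIV. up \<pi> s * (\<Sum>t\<in>UNIV. up \<pi> t * T p q s t)))) = 0"
      by (simp add: numeral_eq_Suc contract_Suc sum_distrib_left[symmetric] sum_divide_distrib[symmetric])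
    then show ?thesis
      unfolding sum_2_01 u by (simp add: algebra_simps power_numeral_reduce)
  qed
  have W0: "T 0 0 0 0 = 0" using W[of 1 0] by simp
  have W4: "T 1 1 1 1 = 0" using W[of 0 1] by simp
  define t1 where "t1 = T 0 0 0 1 + T 0 0 1 0 + T 0 1 0 0 + T 1 0 0 0"
  define t2 where "t2 = T 0 0 1 1 + T 1 1 0 0 + T 0 1 0 1 + T 0 1 1 0 + T 1 0 0 1 + T 1 0 1 0"
  define t3 where "t3 = T 1 1 1 0 + T 1 1 0 1 + T 1 0 1 1 + T 0 1 1 1"
  \<comment> \<open>The two outer coefficients are already zero, so the values at the ratios 1, -1
    and 2 determine the three inner ones.\<close>
  have "t1 + t2 + t3 = 0" "- t1 + t2 - t3 = 0" "2 * t1 + 4 * t2 + 8 * t3 = 0"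
    using W[of 1 1] W[of 1 "-1"] W[of 1 2] W0 W4 unfolding t1_def[symmetric] t2_def[symmetric] t3_def[symmetric]
    by (simp_all add: mult.commute)
  then have t: "t1 = 0" "t2 = 0" "t3 = 0" by algebra+
  have Tx: "T p q s t = r (0,p) (1,q) (0,s) (1,t) - r (0,p) (1,q) (1,s) (0,t) - r (1,p) (0,q) (0,s) (1,t) + r (1,p) (0,q) (1,s) (0,t)" for p q s t
    by (simp add: T_def sum_2_01)
  let ?BA = "r ?b ?a" and ?CA = "r ?c ?a" and ?DA = "r ?d ?a" and ?CB = "r ?c ?b" and ?DB = "r ?d ?b" and ?DC = "r ?d ?c"
  note T0 = t(1)[unfolded t1_def Tx, simplified nf] and T1 = t(2)[unfolded t2_def Tx, simplified nf] and T2 = t(3)[unfolded t3_def Tx, simplified nf]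
  have e1: "?BA ?c ?a = 0" using R[of ?a ?a, simplified nf] by algebra
  have e2: "?BA ?d ?b = 0" using R[of ?b ?b, simplified nf] by algebra
  have e3: "?CA ?d ?c = 0" using R[of ?c ?c, simplified nf] by algebra
  have e4: "?DB ?d ?c = 0" using R[of ?d ?d, simplified nf] by algebra
  have e5: "?BA ?c ?b = - ?BA ?d ?a" using R[of ?a ?b, simplified nf] by algebra
  have e6: "?CB ?d ?c = - ?DA ?d ?c" using R[of ?c ?d, simplified nf] by algebra
  have e7: "?CA ?d ?a = ?CA ?c ?b" using R[of ?a ?c, simplified nf] by algebra
  have e8: "?DA ?d ?b = ?CB ?d ?b" using R[of ?b ?d, simplified nf] by algebra
  have w0: "?CA ?c ?a = 0" using W0[unfolded Tx, simplified nf] by algebra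
  have w4: "?DB ?d ?b = 0" using W4[unfolded Tx, simplified nf] by algebra
  \<comment> \<open>The Weyl condition gives the sum of these two components and the Ricci condition
    \<open>e7\<close> their difference.\<close>
  have "?CA ?d ?a + ?CA ?c ?b = 0" using T0 by algebra
  then have w1: "?CA ?d ?a = 0" "?CA ?c ?b = 0" using e7 by algebra+
  have "?DA ?d ?b + ?CB ?d ?b = 0" using T2 by algebra
  then have w3: "?DA ?d ?b = 0" "?CB ?d ?b = 0" using e8 by algebra+
  have 1: "?DA ?d ?a = ?BA ?d ?c + ?CA ?d ?b" using R[of ?a ?d, simplified nf] by algebra
  have 2: "?CB ?c ?b = ?BA ?d ?c + ?CA ?d ?b" using R[of ?b ?c, simplified nf] by algebra
  have 3: "?DA ?c ?b = ?CA ?d ?b - ?BA ?d ?c" using B by algebra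
  have 4: "2 * ?CA ?d ?b + ?DA ?d ?a + ?CB ?c ?b + 2 * ?DA ?c ?b = 0" using T1 by algebra
  \<comment> \<open>Inserting the first three relations into the fourth leaves six times this
    component.\<close>
  have w2: "?CA ?d ?b = 0" using 1 2 3 4 by algebra
  note nn = nf e1 e2 e3 e4 e5 e6 w0 w4 w1 w3 1 2 3 w2
  have "\<forall>u v w t. ?CA (u,v) (w,t) = 0 \<and> ?DB (u,v) (w,t) = 0 \<and> ?CB (u,v) (w,t) = r ?a ?d (u,v) (w,t)"
    unfolding forall_2_01
    by (simp only: nn minus_zero minus_minus add_0_left add_0_right diff_self diff_0 simp_thms)
  then show ?thesis by (cases K, cases L) (simp only: simp_thms)
qed

context tetrad begin

lemma riemann_antisym: "riemann g x d c b a = - riemann g x d c a b"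
  by (simp add: riemann_def sum_subtractf)

text \<open>The Christoffel symbols are symmetric in their lower indices, so the derivative terms
  and the quadratic terms cancel in the cyclic sum.\<close>

lemma riemann_bianchi:
  assumes x: "x \<in> U"
  shows "riemann g x d c a b + riemann g x d a b c + riemann g x d b c a = 0"
proof -
  have p: "pd i (\<lambda>y. Gam y d b c) x = pd i (\<lambda>y. Gam y d c b) x" for i b c
    by (rule pd_cong[OF open_U x]) (rule Gam_sym)
  show ?thesis
    unfolding riemann_def sum_subtractf p[of _ c b] p[of _ c a] p[of _ b a] Gam_sym[OF x, of _ c b] Gam_sym[OF x, of _ c a] Gam_sym[OF x, of _ b a]
    by simp
qed

lemma riemann_low_antisym: "riemann_low g x p q v u = - riemann_low g x p q u v"
proof -
  have "riemann_low g x p q v u = (\<Sum>f\<in>UNIV. \<Sum>d\<in>UNIV. \<Sum>c\<in>UNIV. \<Sum>b\<in>UNIV. \<Sum>a\<in>UNIV.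
     g x $ f $ d * riemann g x d c a b * p $ f * q $ c * v $ a * u $ b)"
    unfolding riemann_low_def by (intro sum.cong refl sum.swap)
  also have "\<dots> = - riemann_low g x p q u v"
    unfolding riemann_low_def sum_negf[symmetric]
  proof (intro sum.cong refl)
    fix f d c b a
    show "g x $ f $ d * riemann g x d c a b * p $ f * q $ c * v $ a * u $ b
      = - (g x $ f $ d * riemann g x d c b a * p $ f * q $ c * u $ b * v $ a)"
      by (subst riemann_antisym) (simp only: minus_mult_left[symmetric] minus_mult_right[symmetric] mult_ac)
  qed
  finally show ?thesis .
qed

lemma riemann_low_bianchi:
  assumes x: "x \<in> U"
  shows "riemann_low g x p q u v + riemann_low g x p u v q + riemann_low g x p v q u = 0"
proof -
  have 2: "riemann_low g x p u v q = (\<Sum>f\<in>UNIV. \<Sum>d\<in>UNIV. \<Sum>c\<in>UNIV. \<Sum>a\<in>UNIV. \<Sum>b\<in>UNIV.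
     g x $ f $ d * riemann g x d a b c * p $ f * q $ c * u $ a * v $ b)"
    unfolding riemann_low_def
    by (rule sum.cong[OF refl], rule sum.cong[OF refl], subst sum_rotate3[symmetric], intro sum.cong refl) (simp only: mult_ac)
  have 3: "riemann_low g x p v q u = (\<Sum>f\<in>UNIV. \<Sum>d\<in>UNIV. \<Sum>c\<in>UNIV. \<Sum>a\<in>UNIV. \<Sum>b\<in>UNIV.
     g x $ f $ d * riemann g x d b c a * p $ f * q $ c * u $ a * v $ b)"
    unfolding riemann_low_def
    by (rule sum.cong[OF refl], rule sum.cong[OF refl], subst sum_rotate3, intro sum.cong refl) (simp only: mult_ac)
  have "riemann_low g x p q u v + riemann_low g x p u v q + riemann_low g x p v q u
    = (\<Sum>f\<in>UNIV. \<Sum>d\<in>UNIV. \<Sum>c\<in>UNIV. \<Sum>a\<in>UNIV. \<Sum>b\<in>UNIV.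
     g x $ f $ d * (riemann g x d c a b + riemann g x d a b c + riemann g x d b c a) * p $ f * q $ c * u $ a * v $ b)"
    unfolding 2 3 unfolding riemann_low_def by (simp only: sum.distrib distrib_left distrib_right)
  then show ?thesis by (simp only: riemann_bianchi[OF x] mult_zero_right mult_zero_left sum.neutral_const)
qed

lemma frame_functional:
  assumes x: "x \<in> U" and z: "\<And>K. (\<Sum>a\<in>UNIV. E x K $ a * m a) = 0"
  shows "m a = 0"
proof -
  define \<theta> where "\<theta> I = (\<Sum>J\<in>UNIV. eta I J * bilin (g x) (axis a 1) (E x J))" for I
  have e: "(axis a 1 :: complex^4) $ b = (\<Sum>I\<in>UNIV. \<theta> I * E x I $ b)" for b
    using arg_cong[OF tetrad_expand[OF x, of "axis a 1"], of "\<lambda>v. v $ b"] by (simp add: \<theta>_def)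
  have "m a = (\<Sum>b\<in>UNIV. (axis a 1 :: complex^4) $ b * m b)"
    by (simp add: axis_def if_distrib[of "\<lambda>t. t * _"] cong: if_cong)
  also have "\<dots> = (\<Sum>I\<in>UNIV. \<theta> I * (\<Sum>b\<in>UNIV. E x I $ b * m b))"
    unfolding e sum_distrib_right sum_distrib_left by (subst sum.swap) (simp only: mult.assoc)
  finally show ?thesis by (simp only: z mult_zero_right sum.neutral_const)
qed

text \<open>Both spin curvatures are trace free, which after lowering with the symplectic form means
  symmetric. Multiplied by the antisymmetric form on the other kind of index they become
  antisymmetric in the tetrad pair.\<close>

lemma frame_curv_low_antisym:
  assumes x: "x \<in> U"
  shows "(\<Sum>K\<in>UNIV. frame_curv x a b J K * eta I K) = - (\<Sum>K\<in>UNIV. frame_curv x a b I K * eta J K)"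
proof -
  define u where "u = conn_curv unp x a b"
  define v where "v = conn_curv gam x a b"
  have t: "u 1 1 = - u 0 0" "v 1 1 = - v 0 0"
    unfolding u_def v_def using curv_tr[OF x, where G=unp, OF unp_tr holo_unp] curv_tr[OF x, where G="gam", OF gam_tr holo_gam] by blast+
  have "(\<Sum>K\<in>UNIV. frame_curv x a b (C,C') K * eta (B,B') K) = - (\<Sum>K\<in>UNIV. frame_curv x a b (B,B') K * eta (C,C') K)" for B B' C C'
    unfolding frame_curv_split[OF x] sum_UNIV_prod sum_2_01 eta_def fst_conv snd_conv u_def[symmetric] v_def[symmetric]
    by (cases B rule: exhaust_2_01; cases B' rule: exhaust_2_01; cases C rule: exhaust_2_01; cases C' rule: exhaust_2_01;
        hypsubst; simp add: t)
  from this[of "fst J" "snd J" "fst I" "snd I"] show ?thesis unfolding prod.collapse .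
qed

lemma riemann_frame_antisym:
  assumes x: "x \<in> U"
  shows "riemann_low g x (E x J) (E x I) u v = - riemann_low g x (E x I) (E x J) u v"
  unfolding riemann_low_frame[OF x] frame_curv_low_antisym[OF x, of _ _ J I]
  by (simp only: mult_minus_right sum_negf minus_minus)

text \<open>By the formula \<open>ginv\<close>, summing with \<open>eta\<close> over the tetrad is
  taking the trace with the inverse metric.\<close>

lemma ricci_frame:
  assumes x: "x \<in> U"
  shows "(\<Sum>I\<in>UNIV. \<Sum>K\<in>UNIV. eta I K * riemann_low g x (E x I) q (E x K) v)
    = (\<Sum>c\<in>UNIV. \<Sum>b\<in>UNIV. ricci g x c b * q $ c * v $ b)"
proof -
  define h where "h p a = (\<Sum>c\<in>UNIV. \<Sum>b\<in>UNIV. \<Sum>d\<in>UNIV. g x $ p $ d * riemann g x d c a b * q $ c * v $ b)" for p a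
  have rl: "riemann_low g x u q w v = (\<Sum>p\<in>UNIV. \<Sum>a\<in>UNIV. u $ p * w $ a * h p a)" for u w
  proof -
    have "riemann_low g x u q w v = (\<Sum>f\<in>UNIV. \<Sum>d\<in>UNIV. \<Sum>a\<in>UNIV. \<Sum>c\<in>UNIV. \<Sum>b\<in>UNIV.
       g x $ f $ d * riemann g x d c a b * u $ f * q $ c * w $ a * v $ b)"
      unfolding riemann_low_def by (rule sum.cong[OF refl], rule sum.cong[OF refl], rule sum.swap)
    also have "\<dots> = (\<Sum>f\<in>UNIV. \<Sum>a\<in>UNIV. \<Sum>d\<in>UNIV. \<Sum>c\<in>UNIV. \<Sum>b\<in>UNIV.
       g x $ f $ d * riemann g x d c a b * u $ f * q $ c * w $ a * v $ b)"
      by (rule sum.cong[OF refl], rule sum.swap)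
    also have "\<dots> = (\<Sum>f\<in>UNIV. \<Sum>a\<in>UNIV. \<Sum>c\<in>UNIV. \<Sum>b\<in>UNIV. \<Sum>d\<in>UNIV.
       g x $ f $ d * riemann g x d c a b * u $ f * q $ c * w $ a * v $ b)"
      by (rule sum.cong[OF refl], rule sum.cong[OF refl], rule sum_rotate3)
    finally show ?thesis
      unfolding h_def sum_distrib_left by (simp only: mult_ac)
  qed
  have "(\<Sum>I\<in>UNIV. \<Sum>K\<in>UNIV. eta I K * riemann_low g x (E x I) q (E x K) v)
     = (\<Sum>I\<in>UNIV. \<Sum>K\<in>UNIV. \<Sum>p\<in>UNIV. \<Sum>a\<in>UNIV. eta I K * E x I $ p * E x K $ a * h p a)"
    unfolding rl sum_distrib_left by (simp only: mult.assoc)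
  also have "\<dots> = (\<Sum>I\<in>UNIV. \<Sum>p\<in>UNIV. \<Sum>a\<in>UNIV. \<Sum>K\<in>UNIV. eta I K * E x I $ p * E x K $ a * h p a)"
    by (rule sum.cong[OF refl], rule sum_rotate3)
  also have "\<dots> = (\<Sum>p\<in>UNIV. \<Sum>a\<in>UNIV. \<Sum>I\<in>UNIV. \<Sum>K\<in>UNIV. eta I K * E x I $ p * E x K $ a * h p a)"
    by (rule sum_rotate3)
  also have "\<dots> = (\<Sum>p\<in>UNIV. \<Sum>a\<in>UNIV. ginv x $ p $ a * h p a)"
    by (simp only: ginv_def vec_lambda_beta sum_distrib_right)
  also have "\<dots> = (\<Sum>p\<in>UNIV. \<Sum>a\<in>UNIV. \<Sum>c\<in>UNIV. \<Sum>b\<in>UNIV. \<Sum>d\<in>UNIV. ginv x $ p $ a * (g x $ p $ d * riemann g x d c a b * q $ c * v $ b))"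
    by (simp only: h_def sum_distrib_left)
  also have "\<dots> = (\<Sum>a\<in>UNIV. \<Sum>c\<in>UNIV. \<Sum>p\<in>UNIV. \<Sum>b\<in>UNIV. \<Sum>d\<in>UNIV. ginv x $ p $ a * (g x $ p $ d * riemann g x d c a b * q $ c * v $ b))"
    by (rule sum_rotate3)
  also have "\<dots> = (\<Sum>a\<in>UNIV. \<Sum>c\<in>UNIV. \<Sum>b\<in>UNIV. \<Sum>d\<in>UNIV. \<Sum>p\<in>UNIV. ginv x $ p $ a * (g x $ p $ d * riemann g x d c a b * q $ c * v $ b))"
    by (rule sum.cong[OF refl], rule sum.cong[OF refl], rule sum_rotate3)
  also have "\<dots> = (\<Sum>a\<in>UNIV. \<Sum>c\<in>UNIV. \<Sum>b\<in>UNIV. \<Sum>d\<in>UNIV. (if d = a then riemann g x d c a b * q $ c * v $ b else 0))"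
  proof (intro sum.cong refl)
    fix a c b d
    have "(\<Sum>p\<in>UNIV. ginv x $ p $ a * (g x $ p $ d * riemann g x d c a b * q $ c * v $ b))
      = (\<Sum>p\<in>UNIV. g x $ d $ p * ginv x $ p $ a) * (riemann g x d c a b * q $ c * v $ b)"
      unfolding sum_distrib_right g_sym[OF x, of _ d] by (simp only: mult_ac)
    also have "(\<Sum>p\<in>UNIV. g x $ d $ p * ginv x $ p $ a) = (g x ** ginv x) $ d $ a"
      by (simp only: matrix_matrix_mult_def vec_lambda_beta)
    finally show "(\<Sum>p\<in>UNIV. ginv x $ p $ a * (g x $ p $ d * riemann g x d c a b * q $ c * v $ b))
      = (if d = a then riemann g x d c a b * q $ c * v $ b else 0)"
      by (simp add: ginv_right[OF x] mat_def)
  qed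
  also have "\<dots> = (\<Sum>a\<in>UNIV. \<Sum>c\<in>UNIV. \<Sum>b\<in>UNIV. riemann g x a c a b * q $ c * v $ b)"
    by simp
  also have "\<dots> = (\<Sum>c\<in>UNIV. \<Sum>b\<in>UNIV. ricci g x c b * q $ c * v $ b)"
    by (subst sum_rotate3) (simp only: ricci_def sum_distrib_right)
  finally show ?thesis .
qed

theorem gam_flat:
  assumes asd: "asd_vacuum U g e" and x: "x \<in> U"
  shows "conn_curv gam x a b B C = 0"
proof -
  define r where "r I J K L = riemann_low g x (E x I) (E x J) (E x K) (E x L)" for I J K L
  have fl: "r (1,0) (0,0) K L = 0 \<and> r (1,1) (0,1) K L = 0 \<and> r (1,0) (0,1) K L = r (0,0) (1,1) K L" for K L
  proof (rule asd_ricci_flat_algebra)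
    show "r J I K L = - r I J K L" for I J K L unfolding r_def by (rule riemann_frame_antisym[OF x])
    show "r I J L K = - r I J K L" for I J K L unfolding r_def by (rule riemann_low_antisym)
    show "r I J K L + r I K L J + r I L J K = 0" for I J K L unfolding r_def by (rule riemann_low_bianchi[OF x])
    show "(\<Sum>I\<in>UNIV. \<Sum>K\<in>UNIV. eta I K * r I J K L) = 0" for J L
      unfolding r_def ricci_frame[OF x] using asd x by (simp add: asd_vacuum_def)
    fix \<pi>
    let ?T = "\<lambda>bs. (\<Sum>A\<in>UNIV. \<Sum>B\<in>UNIV. \<Sum>C\<in>UNIV. \<Sum>D\<in>UNIV. eps A B * eps C D *
        r (A, bs ! 0) (B, bs ! 1) (C, bs ! 2) (D, bs ! 3)) / 4"
    have "symmetrise 4 ?T = sd_weyl g e x"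
      by (simp only: sd_weyl_def r_def E_def fst_conv snd_conv)
    then have "symmetrise 4 ?T bs = 0" if "length bs = 4" for bs
      using asd x that by (simp add: asd_vacuum_def)
    then have "contract 4 (symmetrise 4 ?T) \<pi> = 0" by (rule contract_zero)
    then show "contract 4 ?T \<pi> = 0" by (simp only: contract_symmetrise)
  qed
  define m where "m P Q K L = (\<Sum>a\<in>UNIV. \<Sum>b\<in>UNIV. E x K $ a * E x L $ b * conn_curv gam x a b P Q)" for P Q K L
  have low: "r J I K L = (\<Sum>a\<in>UNIV. \<Sum>b\<in>UNIV. E x K $ a * E x L $ b * (\<Sum>M\<in>UNIV. frame_curv x a b I M * eta J M))" for I J K L
    unfolding r_def by (rule riemann_low_frame[OF x])
  \<comment> \<open>The index pairs in \<open>fl\<close> single out the three independent components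
    of the primed curvature: in two of them the unprimed curvature is absent, in the third it is the
    same on both sides.\<close>
  have i1: "(\<Sum>M\<in>UNIV. frame_curv x a b (0,0) M * eta (1,0) M) = - conn_curv gam x a b 0 1" for a b
    by (simp add: frame_curv_split[OF x] sum_UNIV_prod sum_2_01 eta_def)
  have i2: "(\<Sum>M\<in>UNIV. frame_curv x a b (0,1) M * eta (1,1) M) = conn_curv gam x a b 1 0" for a b
    by (simp add: frame_curv_split[OF x] sum_UNIV_prod sum_2_01 eta_def)
  have i3: "(\<Sum>M\<in>UNIV. frame_curv x a b (0,1) M * eta (1,0) M) = (\<Sum>M\<in>UNIV. frame_curv x a b (1,1) M * eta (0,0) M) + 2 * conn_curv gam x a b 0 0" for a b
  proof -
    define u where "u = conn_curv unp x a b"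
    define v where "v = conn_curv gam x a b"
    have t: "u 1 1 = - u 0 0" "v 1 1 = - v 0 0"
      unfolding u_def v_def using curv_tr[OF x, where G=unp, OF unp_tr holo_unp] curv_tr[OF x, where G="gam", OF gam_tr holo_gam] by blast+
    show ?thesis
      unfolding frame_curv_split[OF x] sum_UNIV_prod sum_2_01 eta_def fst_conv snd_conv u_def[symmetric] v_def[symmetric]
      by (simp add: t)
  qed
  have "m 0 1 K L = 0" "m 1 0 K L = 0" "m 0 0 K L = 0" for K L
  proof -
    show "m 0 1 K L = 0" using fl[of K L] unfolding low i1 m_def by (simp add: sum_negf)
    show "m 1 0 K L = 0" using fl[of K L] unfolding low i2 m_def by simp
    have "r (1,0) (0,1) K L = r (0,0) (1,1) K L + 2 * m 0 0 K L"
      unfolding low i3 m_def by (simp only: distrib_left sum.distrib sum_distrib_left mult.left_commute[of _ 2])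
    then show "m 0 0 K L = 0" using fl[of K L] by simp
  qed
  moreover have "conn_curv gam x a b P Q = 0" if m0: "\<And>K L. m P Q K L = 0" for P Q
  proof (rule frame_functional[OF x, where m="\<lambda>b. conn_curv gam x a b P Q"])
    fix L
    show "(\<Sum>b\<in>UNIV. E x L $ b * conn_curv gam x a b P Q) = 0"
    proof (rule frame_functional[OF x, where m="\<lambda>a. \<Sum>b\<in>UNIV. E x L $ b * conn_curv gam x a b P Q"])
      fix K
      show "(\<Sum>a\<in>UNIV. E x K $ a * (\<Sum>b\<in>UNIV. E x L $ b * conn_curv gam x a b P Q)) = 0"
        using m0[of K L] by (simp only: m_def sum_distrib_left mult.assoc)
    qed
  qed
  ultimately have "conn_curv gam x a b 0 1 = 0" "conn_curv gam x a b 1 0 = 0" "conn_curv gam x a b 0 0 = 0"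
    by blast+
  then show ?thesis using curv_tr[OF x, where G="gam", OF gam_tr holo_gam, of a b]
    by (cases B rule: exhaust_2_01; cases C rule: exhaust_2_01) simp_all
qed

end

section \<open>Flat connections on simply connected domains\<close>

definition parallel_on :: "(complex^4 \<Rightarrow> 4 \<Rightarrow> 2 \<Rightarrow> 2 \<Rightarrow> complex) \<Rightarrow> (complex^4 \<Rightarrow> complex^2) \<Rightarrow> (complex^4) set \<Rightarrow> bool" where
  "parallel_on G s S \<longleftrightarrow> hmap_on s S \<and>
     (\<forall>x\<in>S. \<forall>a B. pd a (\<lambda>y. s y $ B) x + (\<Sum>C\<in>UNIV. G x a C B * s x $ C) = 0)"

locale flat_conn =
  fixes U :: "(complex^4) set" and G :: "complex^4 \<Rightarrow> 4 \<Rightarrow> 2 \<Rightarrow> 2 \<Rightarrow> complex"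
  assumes open_dom: "open U" and holo_G: "holo_on (\<lambda>x. G x a B C) U"
    and flat: "x \<in> U \<Longrightarrow> conn_curv G x a b B C = 0"

section \<open>Integration along rays in a ball\<close>

lemma segment_in_ball:
  fixes x0 :: "complex^'n"
  assumes "x \<in> ball x0 r" "t \<in> {0..1}"
  shows "x0 + of_real t *s (x - x0) \<in> ball x0 r"
proof -
  have "of_real t *s (x - x0) = t *\<^sub>R (x - x0)" unfolding vec_eq_iff vector_scaleR_component vector_smult_component by (simp add: scaleR_conv_of_real)
  then have "norm (of_real t *s (x - x0)) = t * norm (x - x0)" using assms by simp
  also have "\<dots> \<le> 1 * norm (x - x0)" using assms by (intro mult_right_mono) auto
  finally show ?thesis using assms by (simp add: dist_norm norm_minus_commute)
qed

lemma continuous_ball_segment: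
  fixes x0 :: "complex^'n"
  assumes h: "continuous_on (ball x0 r) h"
  shows "continuous_on (ball x0 r \<times> {0..1::real}) (\<lambda>(x,t). h (x0 + of_real t *s (x - x0)))"
  unfolding case_prod_unfold
proof (rule continuous_on_compose2[OF h])
  show "continuous_on (ball x0 r \<times> {0..1}) (\<lambda>p. x0 + of_real (snd p) *s (fst p - x0))"
    unfolding vector_scalar_mult_def by (intro continuous_intros)
  show "(\<lambda>p. x0 + of_real (snd p) *s (fst p - x0)) ` (ball x0 r \<times> {0..1}) \<subseteq> ball x0 r"
  proof (rule image_subsetI)
    fix p assume "p \<in> ball x0 r \<times> {0..1::real}"
    then show "x0 + of_real (snd p) *s (fst p - x0) \<in> ball x0 r"
      by (intro segment_in_ball) (simp_all add: mem_Times_iff)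
  qed
qed

lemma hmap_on_segment: "hmap_on (\<lambda>x. x0 + of_real t *s (x - x0)) S"
  by (simp add: hmap_on_def holo_on_add holo_on_mult holo_on_diff)

text \<open>The integral of the one-form \<open>W\<close> along the segment from \<open>x0\<close>,
  as in the Poincare lemma.\<close>

definition ray_integral :: "complex^'n \<Rightarrow> (complex^'n \<Rightarrow> complex^'n \<Rightarrow> complex) \<Rightarrow> complex^'n \<Rightarrow> complex" where
  "ray_integral x0 W x = integral {0..1} (\<lambda>t. W (x0 + of_real t *s (x - x0)) (x - x0))"

lemma ray_integral_holo:
  assumes W: "\<And>a. holo_on (w a) (ball x0 r)"
  shows "holo_on (ray_integral x0 (\<lambda>x v. \<Sum>a\<in>UNIV. v $ a * w a x)) (ball x0 r)"
  unfolding ray_integral_def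
proof (rule holo_on_integral)
  fix t :: real assume t: "t \<in> {0..1}"
  show "holo_on (\<lambda>x. \<Sum>a\<in>UNIV. (x - x0) $ a * w a (x0 + of_real t *s (x - x0))) (ball x0 r)"
    by (intro holo_on_sum holo_on_mult holo_on_compose[OF W hmap_on_segment] segment_in_ball[OF _ t])
       (simp_all add: holo_on_diff)
next
  show "continuous_on (ball x0 r \<times> {0..1}) (\<lambda>(x,t). \<Sum>a\<in>UNIV. (x - x0) $ a * w a (x0 + of_real t *s (x - x0)))"
    unfolding case_prod_unfold
    by (intro continuous_intros continuous_ball_segment[OF holo_on_imp_continuous_on[OF W], unfolded case_prod_unfold])
qed auto

lemma ray_integral_bound:
  fixes B r :: real
  assumes W: "\<And>a. continuous_on (ball x0 r) (w a)" and x: "x \<in> ball x0 r"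
    and b: "\<And>y a. y \<in> ball x0 r \<Longrightarrow> norm (w a y) \<le> B"
  shows "norm (ray_integral x0 (\<lambda>x v. \<Sum>a\<in>(UNIV::'n::finite set). v $ a * w a x) x) \<le> CARD('n) * r * B"
proof -
  have x': "norm (x - x0) < r"
    using x by (simp add: dist_norm norm_minus_commute)
  then have r: "r > 0" using norm_ge_zero[of "x - x0"] by linarith
  have "norm (ray_integral x0 (\<lambda>x v. \<Sum>a\<in>(UNIV::'n set). v $ a * w a x) x) \<le> integral {0..1} (\<lambda>t::real. CARD('n) * r * B)"
    unfolding ray_integral_def
  proof (rule integral_norm_bound_integral)
    have "continuous_on {0..1} (\<lambda>t. case (x,t) of (x,t) \<Rightarrow> w a (x0 + of_real t *s (x - x0)))" for a
      by (rule continuous_on_compose2[OF continuous_ball_segment[OF W]]) (use x in \<open>auto intro!: continuous_intros\<close>)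
    then show "(\<lambda>t. \<Sum>a\<in>UNIV. (x - x0) $ a * w a (x0 + of_real t *s (x - x0))) integrable_on {0..1}"
      by (intro integrable_continuous_real continuous_intros) auto
    fix t :: real assume t: "t \<in> {0..1}"
    have "norm (\<Sum>a\<in>(UNIV::'n set). (x - x0) $ a * w a (x0 + of_real t *s (x - x0))) \<le> (\<Sum>a\<in>(UNIV::'n set). r * B)"
    proof (rule sum_norm_le)
      fix a
      have "norm ((x - x0) $ a) \<le> r"
        using Finite_Cartesian_Product.norm_nth_le[of "x - x0" a] x' by linarith
      then show "norm ((x - x0) $ a * w a (x0 + of_real t *s (x - x0))) \<le> r * B"
        unfolding norm_mult using r by (intro mult_mono b segment_in_ball[OF x t]) auto
    qed
    then show "norm (\<Sum>a\<in>(UNIV::'n set). (x - x0) $ a * w a (x0 + of_real t *s (x - x0))) \<le> CARD('n) * r * B"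
      by (simp add: mult.assoc)
  qed auto
  then show ?thesis by simp
qed

text \<open>On the ray through \<open>x\<close> the integral is, after rescaling, the primitive of a
  function of one real variable. Its derivative at the end of the ray is the radial
  derivative.\<close>

lemma ray_integral_radial:
  assumes W: "\<And>a. holo_on (w a) (ball x0 r)" and x: "x \<in> ball x0 r"
  shows "(\<Sum>a\<in>UNIV. (x - x0) $ a * pd a (ray_integral x0 (\<lambda>x v. \<Sum>a\<in>UNIV. v $ a * w a x)) x)
     = (\<Sum>a\<in>UNIV. (x - x0) $ a * w a x)"
proof -
  define y where "y = x - x0"
  define F where "F = ray_integral x0 (\<lambda>x v. \<Sum>a\<in>UNIV. v $ a * w a x)"
  define \<psi> where "\<psi> t = (\<Sum>a\<in>UNIV. y $ a * w a (x0 + of_real t *s y))" for t :: real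
  have seg: "x0 + of_real t *s y \<in> ball x0 r" if "t \<in> {0..1}" for t :: real
    unfolding y_def by (rule segment_in_ball[OF x that])
  have sc: "of_real s *s (of_real t *s y) = of_real (s * t) *s y" for s t :: real
    by (simp add: vec_eq_iff)
  have "continuous_on {0..1} (\<lambda>t. case (x,t) of (x,t) \<Rightarrow> w a (x0 + of_real t *s (x - x0)))" for a
    by (rule continuous_on_compose2[OF continuous_ball_segment[OF holo_on_imp_continuous_on[OF W]]])
       (use x in \<open>auto intro!: continuous_intros\<close>)
  then have c: "continuous_on {0..1} \<psi>"
    unfolding \<psi>_def y_def by (intro continuous_intros) auto
  define \<Psi> where "\<Psi> u = integral {0..u} \<psi>" for u
  have d\<Psi>: "(\<Psi> has_vector_derivative \<psi> u) (at u within {0..1})" if "u \<in> {0..1}" for u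
    unfolding \<Psi>_def by (rule integral_has_vector_derivative[OF c that])
  have F: "F (x0 + of_real \<tau> *s y) = \<Psi> \<tau>" if \<tau>: "\<tau> \<in> {0..1}" for \<tau>
  proof -
    have "((\<lambda>t. \<tau> *\<^sub>R \<psi> (\<tau> * t)) has_integral (\<Psi> \<circ> (\<lambda>t. \<tau> * t)) 1 - (\<Psi> \<circ> (\<lambda>t. \<tau> * t)) 0) {0..1}"
    proof (rule fundamental_theorem_of_calculus)
      fix t :: real assume t: "t \<in> {0..1}"
      have m: "\<tau> * t \<in> {0..1}" using t \<tau> by (simp add: mult_le_one)
      have im: "(\<lambda>t. \<tau> * t) ` {0..1} \<subseteq> {0..1}" using \<tau> by (auto simp: mult_le_one)
      have "((\<lambda>t. \<tau> * t) has_vector_derivative \<tau>) (at t within {0..1})"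
        by (auto intro!: derivative_eq_intros)
      then show "((\<Psi> \<circ> (\<lambda>t. \<tau> * t)) has_vector_derivative \<tau> *\<^sub>R \<psi> (\<tau> * t)) (at t within {0..1})"
        by (rule vector_diff_chain_within) (rule has_vector_derivative_within_subset[OF d\<Psi>[OF m] im])
    qed auto
    then have "((\<lambda>t. \<tau> *\<^sub>R \<psi> (\<tau> * t)) has_integral \<Psi> \<tau>) {0..1}" by (simp add: \<Psi>_def)
    moreover have "\<tau> *\<^sub>R \<psi> (\<tau> * t) = (\<Sum>a\<in>UNIV. (of_real \<tau> *s y) $ a * w a (x0 + of_real t *s (of_real \<tau> *s y)))" for t
      by (simp add: \<psi>_def sc mult.commute[of \<tau>] scaleR_conv_of_real sum_distrib_left mult.assoc)
    ultimately show ?thesis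
      unfolding F_def ray_integral_def by (simp add: integral_unique)
  qed
  have hF: "holo_on F (ball x0 r)" unfolding F_def by (rule ray_integral_holo[OF W])
  have "((\<lambda>t::real. x0 + of_real t *s y) has_derivative (\<lambda>h. of_real h *s y)) (at 1 within {0..1})"
    by (rule has_derivative_vec) (auto intro!: derivative_eq_intros)
  moreover have "x0 + of_real 1 *s y = x" by (simp add: y_def)
  ultimately have "((\<lambda>t::real. F (x0 + of_real t *s y)) has_derivative (\<lambda>h. \<Sum>a\<in>UNIV. pd a F x * (of_real h *s y) $ a)) (at 1 within {0..1})"
    using has_derivative_compose[of "\<lambda>t::real. x0 + of_real t *s y" "\<lambda>h. of_real h *s y" 1 "{0..1}" F "\<lambda>v. \<Sum>a\<in>UNIV. pd a F x * v $ a"]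
      holo_onD[OF hF x] by simp
  then have "((\<lambda>t::real. F (x0 + of_real t *s y)) has_vector_derivative (\<Sum>a\<in>UNIV. pd a F x * y $ a)) (at 1 within {0..1})"
    unfolding has_vector_derivative_def by (rule has_derivative_eq_rhs) (auto simp: scaleR_conv_of_real sum_distrib_left mult_ac)
  moreover have "((\<lambda>t::real. F (x0 + of_real t *s y)) has_vector_derivative \<psi> 1) (at 1 within {0..1})"
    by (rule has_vector_derivative_transform[OF _ F d\<Psi>]) auto
  ultimately have "(\<Sum>a\<in>UNIV. pd a F x * y $ a) = \<psi> 1"
    by (rule vector_derivative_unique_within[rotated]) (simp add: trivial_limit_within islimpt_Icc)
  then show ?thesis by (simp add: F_def \<psi>_def y_def mult.commute)
qed

lemma ray_integral_diff:
  assumes 1: "\<And>a. continuous_on (ball x0 r) (w a)" and 2: "\<And>a. continuous_on (ball x0 r) (w' a)" and x: "x \<in> ball x0 r"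
  shows "ray_integral x0 (\<lambda>x v. \<Sum>a\<in>UNIV. v $ a * w a x) x - ray_integral x0 (\<lambda>x v. \<Sum>a\<in>UNIV. v $ a * w' a x) x
    = ray_integral x0 (\<lambda>x v. \<Sum>a\<in>(UNIV::'n::finite set). v $ a * (w a x - w' a x)) x"
proof -
  have c: "continuous_on {0..1} (\<lambda>t. case (x,t) of (x,t) \<Rightarrow> w a (x0 + of_real t *s (x - x0)))"
    if "\<And>a. continuous_on (ball x0 r) (w a)" for a and w :: "'n \<Rightarrow> complex^'n \<Rightarrow> complex"
    by (rule continuous_on_compose2[OF continuous_ball_segment[OF that]]) (use x in \<open>auto intro!: continuous_intros\<close>)
  have i: "(\<lambda>t. \<Sum>a\<in>UNIV. (x - x0) $ a * w a (x0 + of_real t *s (x - x0))) integrable_on {0..1}"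
    if "\<And>a. continuous_on (ball x0 r) (w a)" for w :: "'n \<Rightarrow> complex^'n \<Rightarrow> complex"
    using c[OF that] by (intro integrable_continuous_real continuous_intros) auto
  show ?thesis
    unfolding ray_integral_def right_diff_distrib sum_subtractf
    by (rule integral_diff[symmetric]) (rule i[OF 1], rule i[OF 2])
qed

context flat_conn begin

text \<open>Parallelism is first imposed along rays only. There it is an integral equation, solved
  by Picard iteration with holomorphic iterates and a uniform limit. Flatness then carries the
  equation from the radial direction to all directions.\<close>

lemma local_section:
  assumes x0: "x0 \<in> U"
  obtains r where "r > 0" "ball x0 r \<subseteq> U" "\<And>v. \<exists>s. parallel_on G s (ball x0 r) \<and> s x0 = v"
proof -
  obtain R where R: "R > 0" "cball x0 R \<subseteq> U" using open_dom x0 open_contains_cball by blast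
  define h where "h x = (\<Sum>a\<in>UNIV. \<Sum>B\<in>UNIV. \<Sum>C\<in>UNIV. norm (G x a B C))" for x
  have "continuous_on (cball x0 R) h"
    unfolding h_def by (intro continuous_intros continuous_on_subset[OF holo_on_imp_continuous_on[OF holo_G] R(2)])
  then have "bounded (h ` cball x0 R)"
    by (intro compact_imp_bounded compact_continuous_image) auto
  then obtain M where M: "M > 0" "\<And>x. x \<in> cball x0 R \<Longrightarrow> norm (h x) \<le> M"
    by (metis bounded_pos imageI)
  have GM: "norm (G x a B C) \<le> M" if "x \<in> cball x0 R" for x a B C
  proof -
    have "norm (G x a B C) \<le> (\<Sum>C\<in>UNIV. norm (G x a B C))"
      by (rule member_le_sum) auto
    also have "\<dots> \<le> (\<Sum>B\<in>UNIV. \<Sum>C\<in>UNIV. norm (G x a B C))"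
      by (rule member_le_sum[where f="\<lambda>B. \<Sum>C\<in>UNIV. norm (G x a B C)"]) (auto intro: sum_nonneg)
    also have "\<dots> \<le> h x"
      unfolding h_def by (rule member_le_sum[where f="\<lambda>a. \<Sum>B\<in>UNIV. \<Sum>C\<in>UNIV. norm (G x a B C)"]) (auto intro!: sum_nonneg)
    also have "\<dots> \<le> M" using M(2)[OF that] by simp
    finally show ?thesis .
  qed
  \<comment> \<open>There are four directions and two spinor components, so one iteration multiplies
    differences by at most \<open>8 * (r * M)\<close>, and this is at most one half.\<close>
  define r where "r = min R (1 / (16 * M))"
  have r: "r > 0" "r \<le> R" "16 * (r * M) \<le> 1"
    using R M by (auto simp: r_def min_def field_simps)
  let ?D = "ball x0 r"
  have DR: "?D \<subseteq> cball x0 R" using r(2) by auto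
  have DU: "?D \<subseteq> U" using DR R(2) by blast
  have GD: "norm (G x a B C) \<le> M" if "x \<in> ?D" for x a B C using GM DR that by blast
  have hG: "holo_on (\<lambda>x. G x a B C) ?D" for a B C by (rule holo_on_subset[OF holo_G DU])
  have "\<exists>s. parallel_on G s ?D \<and> s x0 = v" for v
  proof -
    define W where "W f B a x = (\<Sum>C\<in>UNIV. G x a C B * f C x)" for f :: "2 \<Rightarrow> complex^4 \<Rightarrow> complex" and B a x
    define I where "I f B = ray_integral x0 (\<lambda>x u. \<Sum>a\<in>UNIV. u $ a * W f B a x)" for f B
    have Wh: "holo_on (W f B a) ?D" if "\<And>C. holo_on (f C) ?D" for f B a
      unfolding W_def by (intro holo_on_sum holo_on_mult hG that)
    have Wc: "continuous_on ?D (W f B a)" if "\<And>C. continuous_on ?D (f C)" for f B a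
      unfolding W_def by (intro continuous_intros holo_on_imp_continuous_on[OF hG] that)
    have Ibd: "norm (I f B x - I f' B x) \<le> c / 2"
      if f: "\<And>C. continuous_on ?D (f C)" "\<And>C. continuous_on ?D (f' C)" and x: "x \<in> ?D"
        and c: "\<And>C y. y \<in> ?D \<Longrightarrow> norm (f C y - f' C y) \<le> c" for f f' B x c
    proof -
      have c0: "c \<ge> 0" using c[OF x, of 0] norm_ge_zero order_trans by blast
      have "norm (I f B x - I f' B x) \<le> CARD(4) * r * (2 * M * c)"
        unfolding I_def ray_integral_diff[OF Wc[OF f(1)] Wc[OF f(2)] x]
      proof (rule ray_integral_bound[OF _ x])
        show "continuous_on ?D (\<lambda>y. W f B a y - W f' B a y)" for a
          by (intro continuous_intros Wc f)
        fix y a assume y: "y \<in> ?D"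
        have "W f B a y - W f' B a y = (\<Sum>C\<in>UNIV. G y a C B * (f C y - f' C y))"
          by (simp add: W_def right_diff_distrib sum_subtractf)
        also have "norm \<dots> \<le> (\<Sum>C\<in>(UNIV::2 set). M * c)"
          by (rule sum_norm_le) (use y c GD M in \<open>auto simp: norm_mult intro!: mult_mono\<close>)
        finally show "norm (W f B a y - W f' B a y) \<le> 2 * M * c" by simp
      qed
      also have "\<dots> = (16 * (r * M)) * (c / 2)" by simp
      also have "\<dots> \<le> 1 * (c / 2)" by (rule mult_right_mono) (use r c0 in auto)
      finally show ?thesis by simp
    qed
    \<comment> \<open>The iteration for the integral equation \<open>F = v - I F\<close>, started at
      the constant \<open>v\<close>.\<close>
    define s where "s = rec_nat (\<lambda>B x. v $ B) (\<lambda>n sn B x. v $ B - I sn B x)"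
    have s0: "s 0 = (\<lambda>B x. v $ B)" and sS: "s (Suc n) = (\<lambda>B x. v $ B - I (s n) B x)" for n
      by (simp_all add: s_def)
    have sh: "holo_on (s n B) ?D" for n B
    proof (induction n arbitrary: B)
      case (Suc n)
      show ?case unfolding sS I_def
        by (intro holo_on_diff holo_on_const ray_integral_holo Wh Suc)
    qed (simp add: s0)
    have sc: "continuous_on ?D (s n B)" for n B by (rule holo_on_imp_continuous_on[OF sh])
    have I0: "I (\<lambda>B x. 0) B x = 0" for B x by (simp add: I_def W_def ray_integral_def)
    have sd: "norm (s (Suc n) B x - s n B x) \<le> norm v * (1/2)^n" if "x \<in> ?D" for n B x
      using that
    proof (induction n arbitrary: B x)
      case 0
      have "norm (I (s 0) B x - I (\<lambda>B x. 0) B x) \<le> norm v / 2"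
        by (rule Ibd) (use 0 in \<open>auto simp: s0 Finite_Cartesian_Product.norm_nth_le intro: continuous_intros\<close>)
      then have "norm (I (s 0) B x) \<le> norm v" using norm_ge_zero[of v] unfolding I0 diff_zero by linarith
      then show ?case by (simp add: sS s0)
    next
      case (Suc n)
      have "s (Suc (Suc n)) B x - s (Suc n) B x = I (s n) B x - I (s (Suc n)) B x"
        by (simp only: sS) simp
      then have "norm (s (Suc (Suc n)) B x - s (Suc n) B x) = norm (I (s (Suc n)) B x - I (s n) B x)"
        by (simp only: norm_minus_commute)
      also have "\<dots> \<le> (norm v * (1/2)^n) / 2"
        by (rule Ibd[OF sc sc Suc.prems Suc.IH])
      finally show ?case by simp
    qed
    define F where "F B x = v $ B + (\<Sum>i. s (Suc i) B x - s i B x)" for B x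
    have ul: "uniform_limit ?D (\<lambda>n. s n B) (F B) sequentially" for B
    proof -
      have "uniform_limit ?D (\<lambda>n x. \<Sum>i<n. s (Suc i) B x - s i B x) (\<lambda>x. \<Sum>i. s (Suc i) B x - s i B x) sequentially"
        by (rule Weierstrass_m_test[OF sd]) (auto intro: summable_mult summable_geometric)
      then have "uniform_limit ?D (\<lambda>n x. v $ B + (\<Sum>i<n. s (Suc i) B x - s i B x)) (F B) sequentially"
        unfolding F_def[abs_def] by (intro uniform_limit_add uniform_limit_const)
      moreover have "(\<lambda>n x. v $ B + (\<Sum>i<n. s (Suc i) B x - s i B x)) = (\<lambda>n. s n B)"
        by (intro ext) (simp add: sum_lessThan_telescope[where f="\<lambda>i. s i B _"] s0)
      ultimately show ?thesis by simp
    qed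
    have Fh: "holo_on (F B) ?D" for B by (rule holo_on_uniform_limit[OF open_ball sh ul])
    have Fc: "continuous_on ?D (F B)" for B by (rule holo_on_imp_continuous_on[OF Fh])
    have Fe: "F B x = v $ B - I F B x" if x: "x \<in> ?D" for B x
    proof -
      have "(\<lambda>n. I (s n) B x) \<longlonglongrightarrow> I F B x"
      proof (rule LIMSEQ_I)
        fix e :: real assume e: "e > 0"
        have "\<forall>\<^sub>F n in sequentially. \<forall>C\<in>UNIV. \<forall>y\<in>?D. dist (s n C y) (F C y) < e"
          by (rule eventually_ball_finite) (use uniform_limitD[OF ul e] in auto)
        then obtain N where N: "\<And>n C y. n \<ge> N \<Longrightarrow> y \<in> ?D \<Longrightarrow> dist (s n C y) (F C y) < e"
          unfolding eventually_sequentially by blast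
        have "norm (I (s n) B x - I F B x) < e" if "n \<ge> N" for n
        proof -
          have "norm (I (s n) B x - I F B x) \<le> e / 2"
            by (rule Ibd[OF sc Fc x]) (use N[OF that] in \<open>auto simp: dist_norm intro: less_imp_le\<close>)
          then show ?thesis using e by linarith
        qed
        then show "\<exists>no. \<forall>n\<ge>no. norm (I (s n) B x - I F B x) < e" by blast
      qed
      then have "(\<lambda>n. s (Suc n) B x) \<longlonglongrightarrow> v $ B - I F B x"
        unfolding sS by (intro tendsto_intros)
      moreover have "(\<lambda>n. s (Suc n) B x) \<longlonglongrightarrow> F B x"
        by (rule LIMSEQ_Suc[OF tendsto_uniform_limitI[OF ul x]])
      ultimately show ?thesis by (rule LIMSEQ_unique[rotated])
    qed
    define Err where "Err a B x = pd a (F B) x + (\<Sum>C\<in>UNIV. G x a C B * F C x)" for a B x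
    have Eh: "holo_on (Err a B) ?D" for a B
      unfolding Err_def[abs_def] by (intro holo_on_add holo_on_sum holo_on_mult hG Fh holo_on_pd_holo[OF open_ball])
    have rad: "(\<Sum>a\<in>UNIV. (x - x0) $ a * Err a B x) = 0" if x: "x \<in> ?D" for B x
    proof -
      have IFh: "holo_on (I F B) ?D" unfolding I_def by (intro ray_integral_holo Wh Fh)
      have "pd a (F B) x = - pd a (I F B) x" for a
        using pd_cong[OF open_ball x, where f="F B" and g="\<lambda>x. v $ B - I F B x" and i=a, OF Fe] pd_diff[OF holo_on_const IFh x, of a "v $ B"] by simp
      then have "(\<Sum>a\<in>UNIV. (x - x0) $ a * Err a B x) = (\<Sum>a\<in>UNIV. (x - x0) $ a * W F B a x) - (\<Sum>a\<in>UNIV. (x - x0) $ a * pd a (I F B) x)"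
        unfolding Err_def W_def sum_subtractf[symmetric] right_diff_distrib[symmetric] by simp
      also have "\<dots> = 0"
        unfolding I_def by (subst ray_integral_radial[OF Wh[OF Fh] x]) simp
      finally show ?thesis .
    qed
    \<comment> \<open>Flatness says that the covariant derivative of the error is symmetric in its
      two directions, since the mixed partial derivatives of \<open>F\<close> agree.\<close>
    have fl: "pd b (Err a B) x + (\<Sum>C\<in>UNIV. G x b C B * Err a C x) = pd a (Err b B) x + (\<Sum>C\<in>UNIV. G x a C B * Err b C x)"
      if x: "x \<in> ?D" for a b B x
    proof -
      have p: "pd b (Err a B) x = pd b (pd a (F B)) x + (\<Sum>C\<in>UNIV. G x a C B * pd b (F C) x + pd b (\<lambda>x. G x a C B) x * F C x)" for a b
      proof -
        have h: "holo_on (\<lambda>x. \<Sum>C\<in>UNIV. G x a C B * F C x) ?D"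
          by (intro holo_on_sum holo_on_mult hG Fh)
        have "pd b (Err a B) x = pd b (\<lambda>x. pd a (F B) x + (\<Sum>C\<in>UNIV. G x a C B * F C x)) x"
          by (simp only: Err_def[abs_def])
        also have "\<dots> = pd b (pd a (F B)) x + pd b (\<lambda>x. \<Sum>C\<in>UNIV. G x a C B * F C x) x"
          by (rule pd_add[OF holo_on_pd_holo[OF open_ball Fh] h x])
        also have "pd b (\<lambda>x. \<Sum>C\<in>UNIV. G x a C B * F C x) x = (\<Sum>C\<in>UNIV. pd b (\<lambda>x. G x a C B * F C x) x)"
          by (rule pd_sum[OF holo_on_mult[OF hG Fh] x])
        finally show ?thesis by (simp only: pd_mult[OF hG Fh x])
      qed
      have c: "pd b (pd a (F B)) x = pd a (pd b (F B)) x" by (rule pd_commute[OF open_ball Fh x])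
      have cc: "conn_curv G x a b C B = 0" for C using flat x DU by blast
      have gen: "p = q - z" if "p - q + z = 0" for p q z :: complex using that by algebra
      have k: "pd a (\<lambda>x. G x b C B) x = pd b (\<lambda>x. G x a C B) x - (G x b C 0 * G x a 0 B - G x a C 0 * G x b 0 B + (G x b C 1 * G x a 1 B - G x a C 1 * G x b 1 B))" for C
        by (rule gen[OF cc[of C, unfolded conn_curv_def sum_2_01]])
      show ?thesis unfolding p Err_def sum_2_01 k c by (simp add: algebra_simps)
    qed
    \<comment> \<open>Differentiate the identity \<open>rad\<close> in the direction
      \<open>b\<close>, then exchange the derivatives by \<open>fl\<close>: the result is a linear
      differential equation for the error along each ray.\<close>
    have main: "Err b B x + (\<Sum>a\<in>UNIV. (x - x0) $ a * pd a (Err b B) x) = - (\<Sum>a\<in>UNIV. (x - x0) $ a * (\<Sum>C\<in>UNIV. G x a C B * Err b C x))"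
      if x: "x \<in> ?D" for b B x
    proof -
      have A: "pd b (\<lambda>x. \<Sum>a\<in>UNIV. (x - x0) $ a * Err a B x) x = 0"
        using pd_cong[OF open_ball x, where f="\<lambda>x. \<Sum>a\<in>UNIV. (x - x0) $ a * Err a B x" and g="\<lambda>_. 0" and i=b, OF rad] by simp
      have "pd b (\<lambda>x. \<Sum>a\<in>UNIV. (x - x0) $ a * Err a B x) x
         = (\<Sum>a\<in>UNIV. (x - x0) $ a * pd b (Err a B) x + (if b = a then 1 else 0) * Err a B x)"
      proof -
        have h: "holo_on (\<lambda>x. (x - x0) $ a) ?D" for a by (simp add: holo_on_diff)
        have p: "pd b (\<lambda>x. (x - x0) $ a) x = (if b = a then 1 else 0)" for a
          using pd_diff[OF holo_on_nth holo_on_const x, of b a "x0 $ a"] by simp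
        have "pd b (\<lambda>x. \<Sum>a\<in>UNIV. (x - x0) $ a * Err a B x) x = (\<Sum>a\<in>UNIV. pd b (\<lambda>x. (x - x0) $ a * Err a B x) x)"
          by (rule pd_sum[OF holo_on_mult[OF h Eh] x])
        then show ?thesis by (simp only: pd_mult[OF h Eh x] p)
      qed
      also have "\<dots> = (\<Sum>a\<in>UNIV. (x - x0) $ a * pd b (Err a B) x) + Err b B x"
        by (simp add: sum.distrib if_distrib[of "\<lambda>t. t * _"] cong: if_cong)
      also have "(\<Sum>a\<in>UNIV. (x - x0) $ a * pd b (Err a B) x)
         = (\<Sum>a\<in>UNIV. (x - x0) $ a * (pd a (Err b B) x + (\<Sum>C\<in>UNIV. G x a C B * Err b C x) - (\<Sum>C\<in>UNIV. G x b C B * Err a C x)))"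
        by (simp add: fl[OF x, of b _ B, symmetric])
      also have "\<dots> = (\<Sum>a\<in>UNIV. (x - x0) $ a * pd a (Err b B) x) + (\<Sum>a\<in>UNIV. (x - x0) $ a * (\<Sum>C\<in>UNIV. G x a C B * Err b C x))
           - (\<Sum>a\<in>UNIV. (x - x0) $ a * (\<Sum>C\<in>UNIV. G x b C B * Err a C x))"
        by (simp only: distrib_left right_diff_distrib sum.distrib sum_subtractf)
      also have "(\<Sum>a\<in>UNIV. (x - x0) $ a * (\<Sum>C\<in>UNIV. G x b C B * Err a C x))
           = (\<Sum>C\<in>UNIV. G x b C B * (\<Sum>a\<in>UNIV. (x - x0) $ a * Err a C x))"
        unfolding sum_distrib_left by (subst sum.swap) (simp only: mult_ac)
      finally have "(\<Sum>a\<in>UNIV. (x - x0) $ a * pd a (Err b B) x) + (\<Sum>a\<in>UNIV. (x - x0) $ a * (\<Sum>C\<in>UNIV. G x a C B * Err b C x)) + Err b B x = 0"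
        unfolding A rad[OF x] mult_zero_right sum.neutral_const diff_zero by (rule sym)
      then show ?thesis unfolding eq_neg_iff_add_eq_0 by (simp only: ac_simps)
    qed
    have zero: "Err b B x = 0" if x: "x \<in> ?D" for b B x
    proof -
      define y where "y = x - x0"
      have seg: "x0 + of_real t *s y \<in> ?D" if "t \<in> {0..1}" for t :: real
        unfolding y_def by (rule segment_in_ball[OF x that])
      \<comment> \<open>The factor \<open>t\<close> absorbs the undifferentiated term of
        \<open>main\<close> and makes the initial value zero.\<close>
      define w where "w B t = of_real t * Err b B (x0 + of_real t *s y)" for B and t :: real
      define w' where "w' B t = - (\<Sum>a\<in>UNIV. y $ a * (\<Sum>C\<in>UNIV. G (x0 + of_real t *s y) a C B * w C t))" for B t
      have dw: "(w B has_vector_derivative w' B t) (at t within {0..1})" if t: "t \<in> {0..1}" for B t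
      proof -
        let ?z = "x0 + of_real t *s y"
        have "((\<lambda>t::real. x0 + of_real t *s y) has_derivative (\<lambda>h. of_real h *s y)) (at t within {0..1})"
          by (rule has_derivative_vec) (auto intro!: derivative_eq_intros)
        from has_derivative_compose[OF this holo_onD[OF Eh[of b B] seg[OF t]]]
        have "((\<lambda>t::real. Err b B (x0 + of_real t *s y)) has_derivative (\<lambda>h. \<Sum>a\<in>UNIV. pd a (Err b B) ?z * (of_real h *s y) $ a)) (at t within {0..1})" .
        then have 1: "((\<lambda>t::real. Err b B (x0 + of_real t *s y)) has_vector_derivative (\<Sum>a\<in>UNIV. pd a (Err b B) ?z * y $ a)) (at t within {0..1})"
          unfolding has_vector_derivative_def by (rule has_derivative_eq_rhs) (auto simp: scaleR_conv_of_real sum_distrib_left mult_ac)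
        have 2: "((\<lambda>t::real. of_real t :: complex) has_vector_derivative 1) (at t within {0..1})"
          by (auto intro!: derivative_eq_intros simp: has_vector_derivative_def scaleR_conv_of_real)
        have "(w B has_vector_derivative of_real t * (\<Sum>a\<in>UNIV. pd a (Err b B) ?z * y $ a) + 1 * Err b B ?z) (at t within {0..1})"
          unfolding w_def by (rule has_vector_derivative_mult[OF 2 1])
        moreover have "of_real t * (\<Sum>a\<in>UNIV. pd a (Err b B) ?z * y $ a) + 1 * Err b B ?z = w' B t"
          using main[OF seg[OF t], of b B]
          by (simp add: w'_def w_def sum_distrib_left mult_ac add.commute)
        ultimately show ?thesis by simp
      qed
      \<comment> \<open>In place of Gronwall's inequality: at a maximum \<open>m\<close> of the sum
        of the two norms, the integral of the derivative bounds each summand by \<open>m/4\<close>,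
        so \<open>m\<close> is at most \<open>m/2\<close>.\<close>
      have "\<exists>\<tau>\<in>{0..1}. \<forall>t\<in>{0..1}. norm (w 0 t) + norm (w 1 t) \<le> norm (w 0 \<tau>) + norm (w 1 \<tau>)"
      proof (rule continuous_attains_sup)
        show "continuous_on {0..1} (\<lambda>t. norm (w 0 t) + norm (w 1 t))"
          by (intro continuous_intros continuous_on_vector_derivative[OF dw])
      qed auto
      then obtain \<tau> where \<tau>: "\<tau> \<in> {0..1}" "\<And>t. t \<in> {0..1} \<Longrightarrow> norm (w 0 t) + norm (w 1 t) \<le> norm (w 0 \<tau>) + norm (w 1 \<tau>)" by blast
      define m where "m = norm (w 0 \<tau>) + norm (w 1 \<tau>)"
      have m0: "m \<ge> 0" by (simp add: m_def)
      have yr: "norm (y $ a) \<le> r" for a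
        using Finite_Cartesian_Product.norm_nth_le[of y a] x by (simp add: y_def dist_norm norm_minus_commute)
      have w'b: "norm (w' B t) \<le> m / 4" if t: "t \<in> {0..1}" for B t
      proof -
        have "norm (w' B t) \<le> (\<Sum>a\<in>(UNIV::4 set). r * (M * m))"
          unfolding w'_def norm_minus_cancel
        proof (rule sum_norm_le)
          fix a
          have "norm (\<Sum>C\<in>UNIV. G (x0 + of_real t *s y) a C B * w C t) \<le> (\<Sum>C\<in>UNIV. M * norm (w C t))"
            by (rule sum_norm_le) (use GD[OF seg[OF t]] M in \<open>auto simp: norm_mult intro!: mult_right_mono\<close>)
          also have "\<dots> \<le> M * m"
            using \<tau>(2)[OF t] M(1) by (simp add: sum_2_01 m_def flip: distrib_left)
          finally show "norm (y $ a * (\<Sum>C\<in>UNIV. G (x0 + of_real t *s y) a C B * w C t)) \<le> r * (M * m)"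
            unfolding norm_mult using yr[of a] r by (intro mult_mono) auto
        qed
        also have "\<dots> = (16 * (r * M)) * (m / 4)" by simp
        also have "\<dots> \<le> 1 * (m / 4)" by (rule mult_right_mono) (use r m0 in auto)
        finally show ?thesis by simp
      qed
      have "norm (w B \<tau>) \<le> m / 4" for B
      proof -
        have "(w' B has_integral (w B \<tau> - w B 0)) {0..\<tau>}"
          by (rule fundamental_theorem_of_calculus)
             (use \<tau>(1) in \<open>auto intro!: has_vector_derivative_within_subset[OF dw]\<close>)
        then have "(w' B has_integral (w B \<tau>)) {0..\<tau>}" by (simp add: w_def)
        from has_integral_bound_real[OF _ _ this, of "m/4" "{}"] w'b \<tau>(1) m0
        have "norm (w B \<tau>) \<le> m / 4 * \<tau>" by auto
        also have "\<dots> \<le> m / 4 * 1" by (rule mult_left_mono) (use \<tau>(1) m0 in auto)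
        finally show ?thesis by simp
      qed
      from this[of 0] this[of 1] have "m \<le> m / 2" unfolding m_def by simp
      then have "m = 0" using m0 by simp
      moreover have "norm (w 0 1) + norm (w 1 1) \<le> m" unfolding m_def by (rule \<tau>(2)) simp
      ultimately have "norm (w 0 1) \<le> 0" "norm (w 1 1) \<le> 0"
        using norm_ge_zero[of "w 0 1"] norm_ge_zero[of "w 1 1"] by linarith+
      then have "w 0 1 = 0" "w 1 1 = 0" by simp_all
      then have "w B 1 = 0" by (cases B rule: exhaust_2_01) auto
      then show ?thesis by (simp add: w_def y_def)
    qed
    define S where "S x = (\<chi> B. F B x)" for x
    have "parallel_on G S ?D"
      unfolding parallel_on_def hmap_on_def S_def vec_lambda_beta
      using Fh zero unfolding Err_def by simp
    moreover have "S x0 = v"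
    proof -
      have "I F B x0 = 0" for B by (simp add: I_def ray_integral_def)
      then show ?thesis using Fe[of x0] r(1) by (simp add: S_def vec_eq_iff)
    qed
    ultimately show ?thesis by blast
  qed
  with r(1) DU that show ?thesis by blast
qed

end

section \<open>Parallel transport for flat trace-free connections\<close>

definition wronskian :: "(complex^'n \<Rightarrow> complex^2) \<Rightarrow> (complex^'n \<Rightarrow> complex^2) \<Rightarrow> complex^'n \<Rightarrow> complex" where
  "wronskian s t x = s x $ 0 * t x $ 1 - s x $ 1 * t x $ 0"

lemma holo_pd_zero_constant:
  assumes f: "holo_on f S" and S: "open S" "connected S" and z: "\<And>x i. x \<in> S \<Longrightarrow> pd i f x = 0"
    and xy: "x \<in> S" "y \<in> S"
  shows "f x = f y"
proof -
  have "(f has_derivative (\<lambda>h. 0)) (at w within S)" if "w \<in> S" for w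
    using has_derivative_at_withinI[OF holo_onD[OF f that]] z[OF that] by simp
  then show ?thesis
    using has_derivative_zero_unique_strong_connected[OF S(2,1) finite.emptyI holo_on_imp_continuous_on[OF f] xy(1) refl _ xy(2)]
    by simp
qed

locale flat_sl2_conn = flat_conn +
  assumes tr: "x \<in> U \<Longrightarrow> G x a 1 1 = - G x a 0 0"
begin

abbreviation "par \<equiv> parallel_on G"

lemma par_subset: "par s S \<Longrightarrow> T \<subseteq> S \<Longrightarrow> par s T"
  unfolding parallel_on_def using hmap_on_subset by blast

lemma par_pd: "par s S \<Longrightarrow> x \<in> S \<Longrightarrow> pd a (\<lambda>y. s y $ B) x = - (\<Sum>C\<in>UNIV. G x a C B * s x $ C)"
  unfolding parallel_on_def by (simp add: eq_neg_iff_add_eq_0)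

text \<open>The Wronskian is the symplectic form evaluated on two spinors, and a trace-free
  connection preserves it.\<close>

lemma wronskian_constant:
  assumes s: "par s S" and t: "par t S" and S: "open S" "connected S" "S \<subseteq> U" and xy: "x \<in> S" "y \<in> S"
  shows "wronskian s t x = wronskian s t y"
proof (rule holo_pd_zero_constant[OF _ S(1,2) _ xy])
  have h: "holo_on (\<lambda>y. s y $ B) S" "holo_on (\<lambda>y. t y $ B) S" for B
    using s t by (auto simp: parallel_on_def hmap_on_def)
  show "holo_on (wronskian s t) S"
    unfolding wronskian_def[abs_def] by (intro holo_on_diff holo_on_mult h)
  fix x i assume x: "x \<in> S"
  have "pd i (wronskian s t) x = pd i (\<lambda>x. s x $ 0 * t x $ 1) x - pd i (\<lambda>x. s x $ 1 * t x $ 0) x"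
    unfolding wronskian_def[abs_def] by (rule pd_diff[OF _ _ x]) (intro holo_on_mult h)+
  also have "\<dots> = 0"
    unfolding pd_mult[OF h(1) h(2) x] par_pd[OF s x] par_pd[OF t x] sum_2_01
    using tr[of x i] x S(3) by (auto simp: algebra_simps)
  finally show "pd i (wronskian s t) x = 0" .
qed

lemma par_combine:
  assumes "par s S" "par t S"
  shows "par (\<lambda>x. c *s s x + d *s t x) S"
proof -
  have h: "holo_on (\<lambda>y. s y $ B) S" "holo_on (\<lambda>y. t y $ B) S" for B
    using assms by (auto simp: parallel_on_def hmap_on_def)
  have "pd a (\<lambda>y. (c *s s y + d *s t y) $ B) x + (\<Sum>C\<in>UNIV. G x a C B * (c *s s x + d *s t x) $ C) = 0"
    if x: "x \<in> S" for a B x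
  proof -
    have "pd a (\<lambda>y. (c *s s y + d *s t y) $ B) x = c * pd a (\<lambda>y. s y $ B) x + d * pd a (\<lambda>y. t y $ B) x"
      using pd_add[OF holo_on_mult[OF holo_on_const h(1)] holo_on_mult[OF holo_on_const h(2)] x, of a c B d B]
      by (simp add: pd_cmult[OF h(1) x] pd_cmult[OF h(2) x])
    then show ?thesis
      unfolding par_pd[OF assms(1) x] par_pd[OF assms(2) x] sum_2_01 by (simp add: algebra_simps)
  qed
  moreover have "hmap_on (\<lambda>x. c *s s x + d *s t x) S"
    using h by (simp add: hmap_on_def holo_on_add holo_on_mult)
  ultimately show ?thesis by (simp add: parallel_on_def)
qed

lemma trivialising_ball:
  assumes x: "x \<in> U"
  obtains r \<sigma>\<^sub>0 \<sigma>\<^sub>1 where "r > 0" "ball x r \<subseteq> U" "par \<sigma>\<^sub>0 (ball x r)" "par \<sigma>\<^sub>1 (ball x r)"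
    "\<And>y. y \<in> ball x r \<Longrightarrow> wronskian \<sigma>\<^sub>0 \<sigma>\<^sub>1 y = 1"
proof -
  obtain r where r: "r > 0" "ball x r \<subseteq> U" "\<And>v. \<exists>s. par s (ball x r) \<and> s x = v"
    using local_section[OF x] by blast
  obtain s t where s: "par s (ball x r)" "s x = axis 0 1" and t: "par t (ball x r)" "t x = axis 1 1"
    using r(3) by blast
  have "wronskian s t y = 1" if "y \<in> ball x r" for y
    using wronskian_constant[OF s(1) t(1) open_ball connected_ball r(2) that, of x] r(1)
    by (simp add: wronskian_def s t axis_def)
  with r s t that show ?thesis by blast
qed

text \<open>Near each point there is a parallel basis. The difference of the two sections vanishes
  exactly where its Wronskians with this basis vanish, and these are constant; so vanishing is a
  locally constant property.\<close>

lemma par_unique: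
  assumes s: "par s S" "par t S" and S: "open S" "connected S" "S \<subseteq> U"
    and x: "x \<in> S" "s x = t x" and y: "y \<in> S"
  shows "s y = t y"
proof -
  define d where "d x = 1 *s s x + (-1) *s t x" for x
  have d: "par d S" unfolding d_def by (rule par_combine[OF s])
  have d0: "d w = 0 \<longleftrightarrow> s w = t w" for w by (simp add: d_def)
  have "(d a = 0) = (d b = 0)" if "a \<in> S" "b \<in> S" for a b
  proof (rule connected_local_const[OF S(2) that])
    show "\<forall>a\<in>S. \<forall>\<^sub>F b in at a within S. (d a = 0) = (d b = 0)"
    proof
      fix a assume a: "a \<in> S"
      obtain r \<sigma>\<^sub>0 \<sigma>\<^sub>1 where r: "r > 0" "ball a r \<subseteq> U" "par \<sigma>\<^sub>0 (ball a r)" "par \<sigma>\<^sub>1 (ball a r)"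
        "\<And>y. y \<in> ball a r \<Longrightarrow> wronskian \<sigma>\<^sub>0 \<sigma>\<^sub>1 y = 1"
        using trivialising_ball[of a] a S(3) by blast
      obtain q where q: "q > 0" "ball a q \<subseteq> S" using S(1) a open_contains_ball by blast
      define p where "p = min q r"
      have p: "p > 0" "ball a p \<subseteq> S" "ball a p \<subseteq> ball a r" using q r by (auto simp: p_def)
      have aw: "a \<in> ball a p" using p by simp
      have z: "(d w = 0) = (wronskian d \<sigma>\<^sub>0 w = 0 \<and> wronskian d \<sigma>\<^sub>1 w = 0)" if "w \<in> ball a p" for w
      proof -
        have w1: "\<sigma>\<^sub>0 w $ 0 * \<sigma>\<^sub>1 w $ 1 - \<sigma>\<^sub>0 w $ 1 * \<sigma>\<^sub>1 w $ 0 = 1"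
          using r(5)[of w] that p by (auto simp: wronskian_def)
        have "d w $ 0 = 0 \<and> d w $ 1 = 0" if "d w $ 0 * \<sigma>\<^sub>0 w $ 1 - d w $ 1 * \<sigma>\<^sub>0 w $ 0 = 0" "d w $ 0 * \<sigma>\<^sub>1 w $ 1 - d w $ 1 * \<sigma>\<^sub>1 w $ 0 = 0"
          using that w1 by algebra
        moreover have "d w = 0 \<longleftrightarrow> d w $ 0 = 0 \<and> d w $ 1 = 0"
          by (simp add: vec_eq_iff forall_2_01)
        ultimately show ?thesis unfolding wronskian_def by auto
      qed
      have c: "wronskian d \<sigma> w = wronskian d \<sigma> a" if "w \<in> ball a p" "par \<sigma> (ball a r)" for w \<sigma>
        by (rule wronskian_constant[OF par_subset[OF d p(2)] par_subset[OF that(2) p(3)] open_ball connected_ball _ that(1) aw])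
           (use p(3) r(2) in blast)
      have "(d a = 0) = (d w = 0)" if "w \<in> ball a p" for w
        unfolding z[OF that] z[OF aw] c[OF that r(3)] c[OF that r(4)] by (rule refl)
      then show "\<forall>\<^sub>F b in at a within S. (d a = 0) = (d b = 0)"
        using p(1) unfolding eventually_at by (auto simp: dist_commute)
    qed
  qed
  then show ?thesis using d0 x y by blast
qed

text \<open>The value may be prescribed at every point of the ball, not only at the centre. The
  coefficients come from Cramer's rule, the Wronskian of the basis being one.\<close>

lemma par_through:
  assumes x: "x \<in> U"
  obtains r where "r > 0" "ball x r \<subseteq> U" "\<And>y w. y \<in> ball x r \<Longrightarrow> \<exists>s. par s (ball x r) \<and> s y = w"
proof -
  obtain r \<sigma>\<^sub>0 \<sigma>\<^sub>1 where r: "r > 0" "ball x r \<subseteq> U" "par \<sigma>\<^sub>0 (ball x r)" "par \<sigma>\<^sub>1 (ball x r)"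
    "\<And>y. y \<in> ball x r \<Longrightarrow> wronskian \<sigma>\<^sub>0 \<sigma>\<^sub>1 y = 1"
    using trivialising_ball[OF x] by blast
  have "\<exists>s. par s (ball x r) \<and> s y = w" if y: "y \<in> ball x r" for y w
  proof -
    define c where "c = w $ 0 * \<sigma>\<^sub>1 y $ 1 - w $ 1 * \<sigma>\<^sub>1 y $ 0"
    define d where "d = \<sigma>\<^sub>0 y $ 0 * w $ 1 - \<sigma>\<^sub>0 y $ 1 * w $ 0"
    have e: "\<sigma>\<^sub>0 y $ 0 * \<sigma>\<^sub>1 y $ 1 - \<sigma>\<^sub>0 y $ 1 * \<sigma>\<^sub>1 y $ 0 = 1"
      using r(5)[OF y] by (simp add: wronskian_def)
    have "c * \<sigma>\<^sub>0 y $ 0 + d * \<sigma>\<^sub>1 y $ 0 = w $ 0" "c * \<sigma>\<^sub>0 y $ 1 + d * \<sigma>\<^sub>1 y $ 1 = w $ 1"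
      unfolding c_def d_def using e by algebra+
    then have "c *s \<sigma>\<^sub>0 y + d *s \<sigma>\<^sub>1 y = w" by (simp add: vec_eq_iff forall_2_01)
    then show ?thesis using par_combine[OF r(3,4), of c d] by (intro exI[of _ "\<lambda>y. c *s \<sigma>\<^sub>0 y + d *s \<sigma>\<^sub>1 y"]) simp
  qed
  with r that show ?thesis by blast
qed

text \<open>\<open>D\<close> is the parallel transport along the map \<open>H\<close>, which is merely continuous.\<close>

definition lift_on :: "('k::topological_space \<Rightarrow> complex^4) \<Rightarrow> 'k set \<Rightarrow> ('k \<Rightarrow> complex^2) \<Rightarrow> bool" where
  "lift_on H K D \<longleftrightarrow> (\<forall>k\<in>K. \<exists>N W s. open N \<and> k \<in> N \<and> open W \<and> W \<subseteq> U \<and> par s W \<and> (\<forall>k'\<in>K \<inter> N. H k' \<in> W \<and> D k' = s (H k')))"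

lemma lift_onE:
  assumes "lift_on H K D" "k \<in> K"
  obtains N W s where "open N" "k \<in> N" "open W" "W \<subseteq> U" "par s W" "\<And>k'. k' \<in> K \<inter> N \<Longrightarrow> H k' \<in> W \<and> D k' = s (H k')"
proof -
  from bspec[OF assms(1)[unfolded lift_on_def] assms(2)] obtain N W s
    where *: "open N" "k \<in> N" "open W" "W \<subseteq> U" "par s W" and a: "\<forall>k'\<in>K \<inter> N. H k' \<in> W \<and> D k' = s (H k')"
    by (elim exE conjE)
  show thesis by (rule that[OF *]) (rule bspec[OF a])
qed

lemma lift_onI_section:
  assumes "open W" "W \<subseteq> U" "par s W" "H ` K \<subseteq> W"
  shows "lift_on H K (\<lambda>k. s (H k))"
  unfolding lift_on_def
  by (rule ballI, rule exI[of _ UNIV], rule exI[of _ W], rule exI[of _ s]) (use assms in \<open>simp add: image_subset_iff\<close>)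

lemma lift_on_compose:
  fixes \<iota> :: "'l::topological_space \<Rightarrow> 'k::topological_space"
  assumes D: "lift_on H K D" and c: "continuous_on L \<iota>" and sub: "\<iota> ` L \<subseteq> K"
  shows "lift_on (\<lambda>l. H (\<iota> l)) L (\<lambda>l. D (\<iota> l))"
  unfolding lift_on_def
proof
  fix l assume l: "l \<in> L"
  then have "\<iota> l \<in> K" using sub by blast
  from lift_onE[OF D this] obtain N W s where N: "open N" "\<iota> l \<in> N" "open W" "W \<subseteq> U" "par s W" "\<And>k. k \<in> K \<inter> N \<Longrightarrow> H k \<in> W \<and> D k = s (H k)"
    by metis
  obtain M where M: "open M" "l \<in> M" "\<And>m. m \<in> L \<Longrightarrow> m \<in> M \<Longrightarrow> \<iota> m \<in> N"
    using c[unfolded continuous_on_topological, rule_format, OF l N(1,2)] by blast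
  show "\<exists>N W s. open N \<and> l \<in> N \<and> open W \<and> W \<subseteq> U \<and> par s W \<and> (\<forall>k'\<in>L \<inter> N. H (\<iota> k') \<in> W \<and> D (\<iota> k') = s (H (\<iota> k')))"
    by (rule exI[of _ M], rule exI[of _ W], rule exI[of _ s]) (use M N sub in \<open>simp add: image_subset_iff\<close>)
qed

lemma lift_on_subset: "lift_on H K D \<Longrightarrow> L \<subseteq> K \<Longrightarrow> lift_on H L D"
  using lift_on_compose[of H K D L "\<lambda>l. l"] by auto

lemma lift_on_cong: "lift_on H K D \<Longrightarrow> (\<And>k. k \<in> K \<Longrightarrow> H k = H' k) \<Longrightarrow> lift_on H' K D"
  unfolding lift_on_def by simp

text \<open>Near a common point both lifts come from parallel sections over one ball, and two such
  sections agree on all of it or nowhere. Uniqueness and gluing of lifts both rest on this.\<close>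

lemma lift_agree_locally:
  fixes H :: "'k::topological_space \<Rightarrow> complex^4"
  assumes c: "continuous_on K H" and D: "lift_on H K1 D" "lift_on H K2 D'" and K: "K1 \<subseteq> K" "K2 \<subseteq> K" and k: "k \<in> K1" "k \<in> K2"
  obtains N W s s' where "open N" "k \<in> N" "open W" "W \<subseteq> U" "par s W" "par s' W"
    "\<And>k'. k' \<in> K1 \<inter> N \<Longrightarrow> H k' \<in> W \<and> D k' = s (H k')" "\<And>k'. k' \<in> K2 \<inter> N \<Longrightarrow> H k' \<in> W \<and> D' k' = s' (H k')"
    "\<And>w w'. w \<in> W \<Longrightarrow> w' \<in> W \<Longrightarrow> s w = s' w \<longleftrightarrow> s w' = s' w'"
proof -
  obtain N W s where N: "open N" "k \<in> N" "open W" "W \<subseteq> U" "par s W" "\<And>k'. k' \<in> K1 \<inter> N \<Longrightarrow> H k' \<in> W \<and> D k' = s (H k')"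
    using lift_onE[OF D(1) k(1)] by metis
  obtain N' W' s' where N': "open N'" "k \<in> N'" "open W'" "W' \<subseteq> U" "par s' W'" "\<And>k'. k' \<in> K2 \<inter> N' \<Longrightarrow> H k' \<in> W' \<and> D' k' = s' (H k')"
    using lift_onE[OF D(2) k(2)] by metis
  have "H k \<in> W \<inter> W'" using N N' k by blast
  then obtain r where r: "r > 0" "ball (H k) r \<subseteq> W \<inter> W'" using N(3) N'(3) open_Int open_contains_ball by metis
  have kK: "k \<in> K" using k K by blast
  obtain M where M: "open M" "k \<in> M" "\<And>m. m \<in> K \<Longrightarrow> m \<in> M \<Longrightarrow> H m \<in> ball (H k) r"
    using c[unfolded continuous_on_topological, rule_format, OF kK open_ball, of "H k" r] r(1) by auto
  show ?thesis
  proof (rule that[of "N \<inter> N' \<inter> M" "ball (H k) r" s s'])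
    show p: "par s (ball (H k) r)" "par s' (ball (H k) r)"
      using par_subset[OF N(5)] par_subset[OF N'(5)] r by auto
    show bU: "ball (H k) r \<subseteq> U" using r N(4) by blast
    show "s w = s' w \<longleftrightarrow> s w' = s' w'" if "w \<in> ball (H k) r" "w' \<in> ball (H k) r" for w w'
      using par_unique[OF p open_ball connected_ball bU] that by blast
    show "H k' \<in> ball (H k) r \<and> D k' = s (H k')" if "k' \<in> K1 \<inter> (N \<inter> N' \<inter> M)" for k'
      using that N(6) M(3) K by blast
    show "H k' \<in> ball (H k) r \<and> D' k' = s' (H k')" if "k' \<in> K2 \<inter> (N \<inter> N' \<inter> M)" for k'
      using that N'(6) M(3) K by blast
  qed (use N N' M in auto)
qed

lemma lift_unique:
  fixes H :: "'k::topological_space \<Rightarrow> complex^4"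
  assumes c: "continuous_on K H" and K: "connected K" and D: "lift_on H K D" "lift_on H K D'" and k: "k \<in> K" "D k = D' k" and l: "l \<in> K"
  shows "D l = D' l"
proof -
  have "(D k = D' k) = (D l = D' l)"
  proof (rule connected_local_const[OF K k(1) l])
    show "\<forall>a\<in>K. \<forall>\<^sub>F b in at a within K. (D a = D' a) = (D b = D' b)"
    proof
      fix a assume a: "a \<in> K"
      obtain N W s s' where *: "open N" "a \<in> N" "open W" "W \<subseteq> U" "par s W" "par s' W"
        "\<And>k'. k' \<in> K \<inter> N \<Longrightarrow> H k' \<in> W \<and> D k' = s (H k')" "\<And>k'. k' \<in> K \<inter> N \<Longrightarrow> H k' \<in> W \<and> D' k' = s' (H k')"
        "\<And>w w'. w \<in> W \<Longrightarrow> w' \<in> W \<Longrightarrow> s w = s' w \<longleftrightarrow> s w' = s' w'"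
        by (rule lift_agree_locally[OF c D order_refl order_refl a a], rule that)
      have "(D a = D' a) = (D b = D' b)" if "b \<in> K" "b \<in> N" for b
        using *(7)[of a] *(8)[of a] *(7)[of b] *(8)[of b] *(9)[of "H a" "H b"] that a *(2) by auto
      then show "\<forall>\<^sub>F b in at a within K. (D a = D' a) = (D b = D' b)"
        unfolding eventually_at_topological using *(1,2) by blast
    qed
  qed
  then show ?thesis using k by simp
qed

text \<open>The base point and the value there are both free, so that pieces can be glued in either
  order.\<close>

definition liftable :: "('k::topological_space \<Rightarrow> complex^4) \<Rightarrow> 'k set \<Rightarrow> bool" where
  "liftable H K \<longleftrightarrow> (\<forall>k\<in>K. \<forall>w. \<exists>D. lift_on H K D \<and> D k = w)"

text \<open>Connectedness of the overlap spreads agreement from one point to all of it. At a point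
  of only one piece, the other piece being closed leaves a neighbourhood that avoids it.\<close>

lemma liftable_glue1:
  fixes H :: "'k::topological_space \<Rightarrow> complex^4"
  assumes c: "continuous_on K H" and K: "K1 \<subseteq> K" "K2 \<subseteq> K" "closed K1" "closed K2" "connected (K1 \<inter> K2)" "K1 \<inter> K2 \<noteq> {}"
    and l: "liftable H K1" "liftable H K2" and k: "k \<in> K1"
  shows "\<exists>D. lift_on H (K1 \<union> K2) D \<and> D k = w"
proof -
  obtain D1 where D1: "lift_on H K1 D1" "D1 k = w" using l(1) k by (auto simp: liftable_def)
  obtain m where m: "m \<in> K1" "m \<in> K2" using K(6) by blast
  obtain D2 where D2: "lift_on H K2 D2" "D2 m = D1 m" using l(2) m by (auto simp: liftable_def)
  have agree: "D1 q = D2 q" if q: "q \<in> K1 \<inter> K2" for q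
  proof (rule lift_unique[of "K1 \<inter> K2" H])
    show "continuous_on (K1 \<inter> K2) H" by (rule continuous_on_subset[OF c]) (use K in blast)
    show "lift_on H (K1 \<inter> K2) D1" "lift_on H (K1 \<inter> K2) D2"
      using D1(1) D2(1) lift_on_subset by blast+
    show "m \<in> K1 \<inter> K2" "D1 m = D2 m" using m D2 by auto
  qed (use K q in auto)
  define D where "D q = (if q \<in> K1 then D1 q else D2 q)" for q
  have DD: "D q = D1 q" if "q \<in> K1" for q using that by (simp add: D_def)
  have DD2: "D q = D2 q" if "q \<in> K2" for q using that agree by (auto simp: D_def)
  have "lift_on H (K1 \<union> K2) D"
    unfolding lift_on_def
  proof
    fix q assume q: "q \<in> K1 \<union> K2"
    consider "q \<in> K1" "q \<in> K2" | "q \<notin> K2" "q \<in> K1" | "q \<notin> K1" "q \<in> K2" using q by blast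
    then show "\<exists>N W s. open N \<and> q \<in> N \<and> open W \<and> W \<subseteq> U \<and> par s W \<and> (\<forall>k'\<in>(K1 \<union> K2) \<inter> N. H k' \<in> W \<and> D k' = s (H k'))"
    proof cases
      case 1
      obtain N W s s' where *: "open N" "q \<in> N" "open W" "W \<subseteq> U" "par s W" "par s' W"
        "\<And>k'. k' \<in> K1 \<inter> N \<Longrightarrow> H k' \<in> W \<and> D1 k' = s (H k')" "\<And>k'. k' \<in> K2 \<inter> N \<Longrightarrow> H k' \<in> W \<and> D2 k' = s' (H k')"
        "\<And>w w'. w \<in> W \<Longrightarrow> w' \<in> W \<Longrightarrow> s w = s' w \<longleftrightarrow> s w' = s' w'"
        by (rule lift_agree_locally[OF c D1(1) D2(1) K(1,2) 1], rule that)
      have "s (H q) = s' (H q)" "H q \<in> W" using *(7)[of q] *(8)[of q] agree[of q] 1 *(2) by auto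
      then have ss: "s w = s' w" if "w \<in> W" for w using *(9) that by blast
      have "H k' \<in> W \<and> D k' = s (H k')" if "k' \<in> (K1 \<union> K2) \<inter> N" for k'
        using that *(7)[of k'] *(8)[of k'] ss DD[of k'] DD2[of k'] by auto
      then show ?thesis using *(1-5) by blast
    next
      case 2
      then obtain N W s where N: "open N" "q \<in> N" "open W" "W \<subseteq> U" "par s W" "\<And>k'. k' \<in> K1 \<inter> N \<Longrightarrow> H k' \<in> W \<and> D1 k' = s (H k')"
        using lift_onE[OF D1(1), of q] by metis
      have "H k' \<in> W \<and> D k' = s (H k')" if "k' \<in> (K1 \<union> K2) \<inter> (N \<inter> - K2)" for k'
        using that N(6)[of k'] DD[of k'] by auto
      moreover have "open (N \<inter> - K2)" "q \<in> N \<inter> - K2" using N K 2 by auto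
      ultimately show ?thesis using N(3-5) by blast
    next
      case 3
      then obtain N W s where N: "open N" "q \<in> N" "open W" "W \<subseteq> U" "par s W" "\<And>k'. k' \<in> K2 \<inter> N \<Longrightarrow> H k' \<in> W \<and> D2 k' = s (H k')"
        using lift_onE[OF D2(1), of q] by metis
      have "H k' \<in> W \<and> D k' = s (H k')" if "k' \<in> (K1 \<union> K2) \<inter> (N \<inter> - K1)" for k'
        using that N(6)[of k'] DD2[of k'] by auto
      moreover have "open (N \<inter> - K1)" "q \<in> N \<inter> - K1" using N K 3 by auto
      ultimately show ?thesis using N(3-5) by blast
    qed
  qed
  moreover have "D k = w" using D1 k by (simp add: D_def)
  ultimately show ?thesis by blast
qed

lemma liftable_glue:
  fixes H :: "'k::topological_space \<Rightarrow> complex^4"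
  assumes c: "continuous_on K H" and K: "K1 \<subseteq> K" "K2 \<subseteq> K" "closed K1" "closed K2" "connected (K1 \<inter> K2)" "K1 \<inter> K2 \<noteq> {}"
    and l: "liftable H K1" "liftable H K2"
  shows "liftable H (K1 \<union> K2)"
  unfolding liftable_def
proof (intro ballI allI)
  fix k w assume "k \<in> K1 \<union> K2"
  then show "\<exists>D. lift_on H (K1 \<union> K2) D \<and> D k = w"
    using liftable_glue1[OF assms, of k w]
      liftable_glue1[OF c K(2,1,4,3) _ _ l(2,1), of k w] K(5,6) by (metis Int_commute Un_commute UnE)
qed

lemma liftable_small:
  fixes H :: "'k::topological_space \<Rightarrow> complex^4"
  assumes c: "continuous_on K H" and HU: "H ` K \<subseteq> U" and k: "k \<in> K"
  obtains N where "open N" "k \<in> N" "\<And>L. L \<subseteq> K \<Longrightarrow> L \<subseteq> N \<Longrightarrow> liftable H L"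
proof -
  obtain r where r: "r > 0" "ball (H k) r \<subseteq> U" "\<And>y w. y \<in> ball (H k) r \<Longrightarrow> \<exists>s. par s (ball (H k) r) \<and> s y = w"
    using par_through[of "H k"] HU k by blast
  obtain N where N: "open N" "k \<in> N" "\<And>m. m \<in> K \<Longrightarrow> m \<in> N \<Longrightarrow> H m \<in> ball (H k) r"
    using c[unfolded continuous_on_topological, rule_format, OF k open_ball, of "H k" r] r(1) by auto
  have "liftable H L" if L: "L \<subseteq> K" "L \<subseteq> N" for L
    unfolding liftable_def
  proof (intro ballI allI)
    fix l w assume l: "l \<in> L"
    have HL: "H ` L \<subseteq> ball (H k) r" using N(3) L by blast
    then obtain s where "par s (ball (H k) r)" "s (H l) = w" using r(3) l by blast
    then show "\<exists>D. lift_on H L D \<and> D l = w"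
      using lift_onI_section[OF open_ball r(2) _ HL] by blast
  qed
  with N(1,2) that show ?thesis by blast
qed

text \<open>Compactness in the form of bisection, once in each coordinate: narrow strips of full
  height are liftable, and strips are glued side by side to the square.\<close>

lemma liftable_square:
  fixes H :: "real \<times> real \<Rightarrow> complex^4"
  assumes c: "continuous_on ({0..1} \<times> {0..1}) H" and HU: "H ` ({0..1} \<times> {0..1}) \<subseteq> U"
  shows "liftable H ({0..1} \<times> {0..1})"
proof -
  let ?Q = "{0..1} \<times> {0..1} :: (real \<times> real) set"
  \<comment> \<open>One width has to serve the full height. The property bisected in the second
    coordinate is therefore the existence of a common width, and gluing takes the smaller of
    two.\<close>
  have strip: "\<exists>\<delta>>0. \<forall>a b. 0 \<le> a \<and> a \<le> x \<and> x \<le> b \<and> b \<le> 1 \<and> b - a < \<delta> \<longrightarrow> liftable H ({a..b} \<times> {0..1})" if x: "x \<in> {0..1}" for x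
  proof -
    have "0 \<le> (0::real) \<and> (1::real) \<le> 1 \<longrightarrow> (\<exists>\<delta>>0. \<forall>a b. 0 \<le> a \<and> a \<le> x \<and> x \<le> b \<and> b \<le> 1 \<and> b - a < \<delta> \<longrightarrow> liftable H ({a..b} \<times> {0..1}))"
    proof (rule Bolzano[where P="\<lambda>c d. 0 \<le> c \<and> d \<le> 1 \<longrightarrow> (\<exists>\<delta>>0. \<forall>a b. 0 \<le> a \<and> a \<le> x \<and> x \<le> b \<and> b \<le> 1 \<and> b - a < \<delta> \<longrightarrow> liftable H ({a..b} \<times> {c..d}))"])
      fix p q s :: real
      assume 1: "0 \<le> p \<and> q \<le> 1 \<longrightarrow> (\<exists>\<delta>>0. \<forall>a b. 0 \<le> a \<and> a \<le> x \<and> x \<le> b \<and> b \<le> 1 \<and> b - a < \<delta> \<longrightarrow> liftable H ({a..b} \<times> {p..q}))"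
        and 2: "0 \<le> q \<and> s \<le> 1 \<longrightarrow> (\<exists>\<delta>>0. \<forall>a b. 0 \<le> a \<and> a \<le> x \<and> x \<le> b \<and> b \<le> 1 \<and> b - a < \<delta> \<longrightarrow> liftable H ({a..b} \<times> {q..s}))"
        and 3: "p \<le> q" "q \<le> s"
      show "0 \<le> p \<and> s \<le> 1 \<longrightarrow> (\<exists>\<delta>>0. \<forall>a b. 0 \<le> a \<and> a \<le> x \<and> x \<le> b \<and> b \<le> 1 \<and> b - a < \<delta> \<longrightarrow> liftable H ({a..b} \<times> {p..s}))"
      proof
        assume 4: "0 \<le> p \<and> s \<le> 1"
        obtain \<delta> where \<delta>: "\<delta> > 0" "\<And>a b. 0 \<le> a \<and> a \<le> x \<and> x \<le> b \<and> b \<le> 1 \<and> b - a < \<delta> \<Longrightarrow> liftable H ({a..b} \<times> {p..q})"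
          using 1 3 4 by force
        obtain \<delta>' where \<delta>': "\<delta>' > 0" "\<And>a b. 0 \<le> a \<and> a \<le> x \<and> x \<le> b \<and> b \<le> 1 \<and> b - a < \<delta>' \<Longrightarrow> liftable H ({a..b} \<times> {q..s})"
          using 2 3 4 by force
        have "liftable H ({a..b} \<times> {p..s})" if ab: "0 \<le> a \<and> a \<le> x \<and> x \<le> b \<and> b \<le> 1 \<and> b - a < min \<delta> \<delta>'" for a b
        proof -
          have i: "{a..b} \<times> {p..q} \<inter> {a..b} \<times> {q..s} = {a..b} \<times> {q}" using 3 by auto
          have u: "{a..b} \<times> {p..s} = {a..b} \<times> {p..q} \<union> {a..b} \<times> {q..s}" using 3 by auto
          show ?thesis unfolding u
            by (rule liftable_glue[OF c]; (unfold i)?)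
               (use ab 3 4 \<delta>(2)[of a b] \<delta>'(2)[of a b] in \<open>auto intro!: closed_Times connected_Times\<close>)
        qed
        then show "\<exists>\<delta>>0. \<forall>a b. 0 \<le> a \<and> a \<le> x \<and> x \<le> b \<and> b \<le> 1 \<and> b - a < \<delta> \<longrightarrow> liftable H ({a..b} \<times> {p..s})"
          using \<delta>(1) \<delta>'(1) by (intro exI[of _ "min \<delta> \<delta>'"]) auto
      qed
    next
      fix y :: real assume y: "0 \<le> y" "y \<le> 1"
      then have xy: "(x,y) \<in> ?Q" using x by auto
      obtain N where N: "open N" "(x,y) \<in> N" "\<And>L. L \<subseteq> ?Q \<Longrightarrow> L \<subseteq> N \<Longrightarrow> liftable H L"
        using liftable_small[OF c HU xy] by blast
      obtain A B where AB: "open A" "open B" "x \<in> A" "y \<in> B" "A \<times> B \<subseteq> N" using open_prod_elim[OF N(1,2)] by (metis mem_Sigma_iff)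
      obtain d1 where d1: "d1 > 0" "ball x d1 \<subseteq> A" using AB open_contains_ball by blast
      obtain d2 where d2: "d2 > 0" "ball y d2 \<subseteq> B" using AB open_contains_ball by blast
      have "liftable H ({a..b} \<times> {p..q})"
        if "p \<le> y" "y \<le> q" "q - p < d2" "0 \<le> p" "q \<le> 1" "0 \<le> a \<and> a \<le> x \<and> x \<le> b \<and> b \<le> 1 \<and> b - a < d1" for p q a b
      proof (rule N(3))
        show "{a..b} \<times> {p..q} \<subseteq> ?Q" using that by auto
        have "{a..b} \<subseteq> ball x d1" "{p..q} \<subseteq> ball y d2" using that by (auto simp: dist_real_def)
        then show "{a..b} \<times> {p..q} \<subseteq> N" using AB d1 d2 by blast
      qed
      then show "\<exists>d>0. \<forall>p q. p \<le> y \<and> y \<le> q \<and> q - p < d \<longrightarrow> 0 \<le> p \<and> q \<le> 1 \<longrightarrow>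
          (\<exists>\<delta>>0. \<forall>a b. 0 \<le> a \<and> a \<le> x \<and> x \<le> b \<and> b \<le> 1 \<and> b - a < \<delta> \<longrightarrow> liftable H ({a..b} \<times> {p..q}))"
        using d1(1) d2(1) by blast
    qed auto
    then show ?thesis by simp
  qed
  have "0 \<le> (0::real) \<and> (1::real) \<le> 1 \<longrightarrow> liftable H ({0..1} \<times> {0..1})"
  proof (rule Bolzano[where P="\<lambda>a b. 0 \<le> a \<and> b \<le> 1 \<longrightarrow> liftable H ({a..b} \<times> {0..1})"])
    fix p q s :: real
    assume 1: "0 \<le> p \<and> q \<le> 1 \<longrightarrow> liftable H ({p..q} \<times> {0..1})" "0 \<le> q \<and> s \<le> 1 \<longrightarrow> liftable H ({q..s} \<times> {0..1})" "p \<le> q" "q \<le> s"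
    show "0 \<le> p \<and> s \<le> 1 \<longrightarrow> liftable H ({p..s} \<times> {0..1})"
    proof
      assume 4: "0 \<le> p \<and> s \<le> 1"
      have i: "{p..q} \<times> {0..1} \<inter> {q..s} \<times> {0..1} = {q} \<times> {0..1::real}" using 1 by auto
      have u: "{p..s} \<times> {0..1::real} = {p..q} \<times> {0..1} \<union> {q..s} \<times> {0..1}" using 1 by auto
      show "liftable H ({p..s} \<times> {0..1})" unfolding u
        by (rule liftable_glue[OF c]; (unfold i)?) (use 4 1 in \<open>auto intro!: closed_Times connected_Times\<close>)
    qed
  next
    fix x :: real assume x: "0 \<le> x" "x \<le> 1"
    then obtain \<delta> where "\<delta> > 0" "\<And>a b. 0 \<le> a \<and> a \<le> x \<and> x \<le> b \<and> b \<le> 1 \<and> b - a < \<delta> \<Longrightarrow> liftable H ({a..b} \<times> {0..1})"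
      using strip[of x] by auto
    then show "\<exists>d>0. \<forall>a b. a \<le> x \<and> x \<le> b \<and> b - a < d \<longrightarrow> 0 \<le> a \<and> b \<le> 1 \<longrightarrow> liftable H ({a..b} \<times> {0..1})"
      by blast
  qed auto
  then show ?thesis by simp
qed

end

context flat_sl2_conn begin

lemma square_lift:
  fixes H :: "real \<times> real \<Rightarrow> complex^4"
  assumes c: "continuous_on ({0..1} \<times> {0..1}) H" and HU: "H ` ({0..1} \<times> {0..1}) \<subseteq> U"
  shows "\<exists>D. lift_on H ({0..1} \<times> {0..1}) D \<and> D (0,0) = w"
  using liftable_square[OF c HU] unfolding liftable_def by force

text \<open>A path is treated as a square that is constant in its first coordinate.\<close>

lemma path_lift:
  assumes p: "path p" "path_image p \<subseteq> U"
  shows "\<exists>D. lift_on p {0..1} D \<and> D (0::real) = w"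
proof -
  have 1: "continuous_on ({0..1} \<times> {0..1}) (\<lambda>q::real\<times>real. p (snd q))"
    by (rule continuous_on_compose2[OF p(1)[unfolded path_def]]) (auto intro!: continuous_intros)
  have 2: "(\<lambda>q::real\<times>real. p (snd q)) ` ({0..1} \<times> {0..1}) \<subseteq> U"
    using p(2) by (auto simp: path_image_def)
  obtain D where D0: "lift_on (\<lambda>q::real \<times> real. p (snd q)) ({0..1} \<times> {0..1}) D \<and> D (0,0) = w" using square_lift[OF 1 2, where w=w] by (rule exE)
  note D = D0[THEN conjunct1] D0[THEN conjunct2]
  have "lift_on (\<lambda>t. p (snd (0::real, t))) {0..1} (\<lambda>t. D (0,t))"
    by (rule lift_on_compose[OF D(1)]) (auto intro!: continuous_intros)
  then show ?thesis using D(2) by (intro exI[of _ "\<lambda>t. D (0,t)"]) simp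
qed

lemma const_lift: "x \<in> U \<Longrightarrow> lift_on (\<lambda>k. x) K (\<lambda>k. w)"
proof -
  assume x: "x \<in> U"
  obtain r where r: "r > 0" "ball x r \<subseteq> U" "\<And>y w. y \<in> ball x r \<Longrightarrow> \<exists>s. par s (ball x r) \<and> s y = w"
    using par_through[OF x] by blast
  have xb: "x \<in> ball x r" using r(1) by simp
  from r(3)[OF xb] obtain s where s: "par s (ball x r)" "s x = w" by blast
  have "lift_on (\<lambda>k. x) K (\<lambda>k. s x)"
    by (rule lift_onI_section[OF open_ball r(2) s(1)]) (use xb in blast)
  then show ?thesis by (simp only: s(2))
qed

text \<open>Lift the whole homotopy. On the two sides where it is constant the lift is constant by
  uniqueness, and on the other two it is one of the given lifts, so the end values agree.\<close>

lemma homotopic_lifts: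
  assumes h: "homotopic_paths U p q" and D: "lift_on p {0..1} D" "lift_on q {0..1} D'" and i: "D 0 = D' (0::real)"
  shows "D 1 = D' (1::real)"
proof -
  obtain H where H: "continuous_on ({0..1} \<times> {0..1}) H" "H \<in> ({0..1} \<times> {0..1}) \<rightarrow> U"
    "\<And>t. t \<in> {0..1} \<Longrightarrow> H (0,t) = p t" "\<And>t. t \<in> {0..1} \<Longrightarrow> H (1,t) = q t"
    "\<And>t. t \<in> {0..1::real} \<Longrightarrow> H (t,0) = p 0" "\<And>t. t \<in> {0..1} \<Longrightarrow> H (t,1) = p 1"
    using h unfolding homotopic_paths pathstart_def pathfinish_def o_def by auto
  have HU: "H ` ({0..1} \<times> {0..1}) \<subseteq> U" using H(2) by blast
  obtain E where E0: "lift_on H ({0..1} \<times> {0..1}) E \<and> E (0,0) = D 0" using square_lift[OF H(1) HU, where w="D 0"] by (rule exE)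
  note E = E0[THEN conjunct1] E0[THEN conjunct2]
  have u: "E (\<iota> 1) = F 1" if c: "continuous_on {0..1} \<iota>" and im: "\<iota> ` {0..1} \<subseteq> {0..1} \<times> {0..1}"
    and F: "lift_on (\<lambda>t. H (\<iota> t)) {0..1} F" "F 0 = E (\<iota> 0)" for \<iota> :: "real \<Rightarrow> real \<times> real" and F
  proof -
    have "continuous_on {0..1} (\<lambda>t. H (\<iota> t))" by (rule continuous_on_compose2[OF H(1) c im])
    from lift_unique[OF this _ lift_on_compose[OF E(1) c im] F(1), of 0 1] F(2) show ?thesis by simp
  qed
  have "H (0,0) \<in> U" "H (0,1) \<in> U" using HU unfolding image_subset_iff by auto
  then have p0: "p 0 \<in> U" "p 1 \<in> U" using H(3)[of 0] H(3)[of 1] by simp_all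
  have "E (0, 1) = D 1"
    by (rule u[of "\<lambda>t. (0,t)"]) (use H E in \<open>auto intro!: continuous_intros lift_on_cong[OF D(1)]\<close>)
  moreover have "E (1, 0) = D 0"
    by (rule u[of "\<lambda>t. (t,0)"]) (use H E p0 in \<open>auto intro!: continuous_intros lift_on_cong[OF const_lift[OF p0(1)]]\<close>)
  moreover have "E (1, 1) = E (0, 1)"
    by (rule u[of "\<lambda>t. (t,1)"]) (use H E p0 in \<open>auto intro!: continuous_intros lift_on_cong[OF const_lift[OF p0(2)]]\<close>)
  moreover have "E (1, 1) = D' 1"
    by (rule u[of "\<lambda>t. (1,t)"]) (use H E i \<open>E (1, 0) = D 0\<close> in \<open>auto intro!: continuous_intros lift_on_cong[OF D(2)]\<close>)
  ultimately show ?thesis by simp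
qed

text \<open>The value at \<open>x\<close> is the one transported from \<open>x0\<close> along any
  path. Two paths with the same ends are homotopic in a simply connected set, so the choice does not
  matter.\<close>

theorem global_section:
  assumes sc: "simply_connected U" and x0: "x0 \<in> U"
  shows "\<exists>s. par s U \<and> s x0 = w"
proof -
  have pc: "path_connected U" and hp: "\<And>p q. path p \<Longrightarrow> path_image p \<subseteq> U \<Longrightarrow> path q \<Longrightarrow> path_image q \<subseteq> U \<Longrightarrow>
      pathstart q = pathstart p \<Longrightarrow> pathfinish q = pathfinish p \<Longrightarrow> homotopic_paths U p q"
    using sc unfolding simply_connected_eq_homotopic_paths by blast+
  define ok where "ok x v \<longleftrightarrow> (\<exists>p D. path p \<and> path_image p \<subseteq> U \<and> pathstart p = x0 \<and> pathfinish p = x \<and> lift_on p {0..1} D \<and> D (0::real) = w \<and> D 1 = v)" for x v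
  have ex: "\<exists>v. ok x v" if x: "x \<in> U" for x
  proof -
    obtain p where p: "path p" "path_image p \<subseteq> U" "pathstart p = x0" "pathfinish p = x"
      using pc x x0 unfolding path_connected_def by blast
    obtain D where DD0: "lift_on p {0..1} D \<and> D 0 = w" using path_lift[OF p(1,2), where w=w] by (rule exE)
    note DD = DD0[THEN conjunct1] DD0[THEN conjunct2]
    from p DD show ?thesis unfolding ok_def by blast
  qed
  have un: "v = v'" if v: "ok x v" "ok x v'" for x v v'
  proof -
    obtain p D where p: "path p" "path_image p \<subseteq> U" "pathstart p = x0" "pathfinish p = x" "lift_on p {0..1} D" "D 0 = w" "D 1 = v"
      using v(1) unfolding ok_def by blast
    obtain q D' where q: "path q" "path_image q \<subseteq> U" "pathstart q = x0" "pathfinish q = x" "lift_on q {0..1} D'" "D' 0 = w" "D' 1 = v'"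
      using v(2) unfolding ok_def by blast
    have "homotopic_paths U p q" by (rule hp) (use p q in auto)
    from homotopic_lifts[OF this p(5) q(5)] p q show ?thesis by simp
  qed
  define S where "S x = (SOME v. ok x v)" for x
  have S: "ok x (S x)" if "x \<in> U" for x unfolding S_def by (rule someI_ex[OF ex[OF that]])
  have loc: "\<exists>r>0. par S (ball x r)" if x: "x \<in> U" for x
  proof -
    obtain r where r: "r > 0" "ball x r \<subseteq> U" "\<And>y w. y \<in> ball x r \<Longrightarrow> \<exists>s. par s (ball x r) \<and> s y = w"
      using par_through[OF x] by blast
    have xb: "x \<in> ball x r" using r(1) by simp
    from r(3)[OF xb] obtain s where s: "par s (ball x r)" "s x = S x" by blast
    obtain p D where p: "path p" "path_image p \<subseteq> U" "pathstart p = x0" "pathfinish p = x" "lift_on p {0..1} D" "D 0 = w" "D 1 = S x"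
      using S[OF x] unfolding ok_def by blast
    have "S y = s y" if y: "y \<in> ball x r" for y
    proof -
      define l where "l = linepath x y"
      have l: "path l" "path_image l \<subseteq> ball x r" "pathstart l = x" "pathfinish l = y"
        unfolding l_def using closed_segment_subset[OF xb y convex_ball] by simp_all
      \<comment> \<open>Prolonging the path to \<open>x\<close> by a segment inside the ball
        compares the transported value at \<open>y\<close> with the local parallel section through
        \<open>S x\<close>.\<close>
      define q where "q = p +++ l"
      have q: "path q" "path_image q \<subseteq> U" "pathstart q = x0" "pathfinish q = y"
        unfolding q_def using p l r(2) by (auto simp: path_image_join)
      obtain D' where D'0: "lift_on q {0..1} D' \<and> D' 0 = w" using path_lift[OF q(1,2), where w=w] by (rule exE)
      note D' = D'0[THEN conjunct1] D'0[THEN conjunct2]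
      have cp: "continuous_on {0..1} p" "continuous_on {0..1} l" using p(1) l(1) by (simp_all add: path_def)
      have "lift_on (\<lambda>t. q (t / 2)) {0..1} (\<lambda>t. D' (t / 2))"
        by (rule lift_on_compose[OF D'(1)]) (auto intro!: continuous_intros)
      then have "lift_on p {0..1} (\<lambda>t. D' (t / 2))"
        by (rule lift_on_cong) (auto simp: q_def joinpaths_def)
      from lift_unique[OF cp(1) _ this p(5), of 0 1] have half: "D' (1/2) = S x" using D' p by simp
      have "lift_on (\<lambda>t. q ((1 + t) / 2)) {0..1} (\<lambda>t. D' ((1 + t) / 2))"
        by (rule lift_on_compose[OF D'(1)]) (auto intro!: continuous_intros)
      then have lift2: "lift_on l {0..1} (\<lambda>t. D' ((1 + t) / 2))"
      proof (rule lift_on_cong)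
        fix t :: real assume t: "t \<in> {0..1}"
        show "q ((1 + t) / 2) = l t"
        proof (cases "t = 0")
          case True
          then show ?thesis using p(4) l(3) by (simp add: q_def joinpaths_def pathfinish_def pathstart_def)
        next
          case False
          have "2 * ((1 + t) / 2) - 1 = t" "((1 + t) / 2 \<le> 1 / 2) = False" using False t by (simp_all add: field_simps)
          then show ?thesis by (simp only: q_def joinpaths_def if_False)
        qed
      qed
      have "lift_on l {0..1} (\<lambda>t. s (l t))"
        by (rule lift_onI_section[OF open_ball r(2) s(1)]) (use l(2) in \<open>simp add: path_image_def\<close>)
      from lift_unique[OF cp(2) _ lift2 this, of 0 1] have "D' 1 = s y"
        using half s(2) l(3,4) by (simp add: pathfinish_def pathstart_def)
      then have "ok y (s y)" unfolding ok_def using q D' by blast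
      moreover have "y \<in> U" using y r(2) by blast
      ultimately show ?thesis using un S by blast
    qed
    then have e: "s y = S y" if "y \<in> ball x r" for y using that by simp
    have h: "holo_on (\<lambda>x. s x $ B) (ball x r)" for B using s(1) by (simp add: parallel_on_def hmap_on_def)
    have "holo_on (\<lambda>x. S x $ B) (ball x r)" for B
      by (rule holo_on_transform[OF h open_ball]) (simp add: e del: mem_ball)
    moreover have "pd a (\<lambda>y. S y $ B) z = pd a (\<lambda>y. s y $ B) z" if "z \<in> ball x r" for a B z
      by (rule pd_cong[OF open_ball that]) (simp add: e del: mem_ball)
    ultimately have "par S (ball x r)"
      using s(1) e unfolding parallel_on_def hmap_on_def by simp
    then show ?thesis using r(1) by blast
  qed
  have "par S U"
    unfolding parallel_on_def hmap_on_def
  proof (intro conjI allI ballI)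
    fix B
    show "holo_on (\<lambda>x. S x $ B) U"
    proof (rule holo_on_UN)
      fix x assume "x \<in> U"
      from loc[OF this] obtain r where "r > 0" "par S (ball x r)" by blast
      then show "\<exists>T. x \<in> T \<and> holo_on (\<lambda>x. S x $ B) T"
        by (intro exI[of _ "ball x r"]) (simp add: parallel_on_def hmap_on_def)
    qed
  next
    fix x a B assume "x \<in> U"
    from loc[OF this] obtain r where "r > 0" "par S (ball x r)" by blast
    then show "pd a (\<lambda>y. S y $ B) x + (\<Sum>C\<in>UNIV. G x a C B * S x $ C) = 0"
      by (simp add: parallel_on_def)
  qed
  moreover have "S x0 = w"
  proof -
    have "ok x0 w" unfolding ok_def
      using const_lift[OF x0, of "{0..1}" w] x0
      by (intro exI[of _ "\<lambda>t. x0"] exI[of _ "\<lambda>t. w"]) (auto simp: path_def path_image_def pathstart_def pathfinish_def)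
    then show ?thesis using un S[OF x0] by blast
  qed
  ultimately show ?thesis by blast
qed

end

text \<open>Parallel spinors exist with any initial value; a pair that is unimodular at one point
  stays so because the connection is trace free.\<close>

theorem (in tetrad) parallel_dyad_exists:
  assumes asd: "asd_vacuum U g e" and sc: "simply_connected U" and ne: "U \<noteq> {}"
  obtains d where "parallel_dyad U g e d"
proof -
  interpret G: flat_sl2_conn U gam
    by unfold_locales (use open_U holo_gam gam_flat[OF asd] gam_tr in auto)
  obtain x0 where x0: "x0 \<in> U" using ne by blast
  obtain s where s0: "parallel_on gam s U \<and> s x0 = axis 0 1" using G.global_section[OF sc x0, where w="axis 0 1"] by (rule exE)
  note s = s0[THEN conjunct1] s0[THEN conjunct2]
  obtain t where t0: "parallel_on gam t U \<and> t x0 = axis 1 1" using G.global_section[OF sc x0, where w="axis 1 1"] by (rule exE)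
  note t = t0[THEN conjunct1] t0[THEN conjunct2]
  have con: "connected U" using sc simply_connected_imp_connected by blast
  define d where "d x i = (if i = (0::2) then s x else t x)" for x i
  have w: "wronskian s t x = 1" if x: "x \<in> U" for x
    using G.wronskian_constant[OF s(1) t(1) open_U con order_refl x x0]
    by (simp add: wronskian_def s(2) t(2) axis_def)
  have "parallel_dyad U g e d"
    unfolding parallel_dyad_def
  proof (intro conjI allI ballI)
    show "holo_on (\<lambda>x. d x i $ A') U" for i A'
      using s(1) t(1) by (cases "i = 0") (simp_all add: d_def parallel_on_def hmap_on_def)
    show "(\<Sum>A'\<in>UNIV. \<Sum>B'\<in>UNIV. eps A' B' * d x 0 $ A' * d x 1 $ B') = 1" if "x \<in> U" for x
      using w[OF that] by (simp add: d_def sum_2_01 wronskian_def)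
    show "pd a (\<lambda>y. d y i $ B') x + (\<Sum>C'\<in>UNIV. gam x a C' B' * d x i $ C') = 0" if "x \<in> U" for x i a B'
      using s(1) t(1) that by (cases "i = 0") (simp_all add: d_def parallel_on_def)
  qed
  with that show ?thesis .
qed

section \<open>The twistor distribution in a parallel dyad\<close>

text \<open>The calculus above is for functions on \<open>complex^'n\<close>, so a point of the spin
  bundle is encoded as one vector with six components.\<close>

definition sx :: "complex^(4+2) \<Rightarrow> complex^4" where "sx s = (\<chi> a. s $ Inl a)"
definition sz :: "complex^(4+2) \<Rightarrow> complex^2" where "sz s = (\<chi> i. s $ Inr i)"
definition mk :: "complex^4 \<Rightarrow> complex^2 \<Rightarrow> complex^(4+2)" where
  "mk x z = (\<chi> j. case j of Inl a \<Rightarrow> x $ a | Inr i \<Rightarrow> z $ i)"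

lemma mk_simps [simp]: "sx (mk x z) = x" "sz (mk x z) = z" "mk x z $ Inl a = x $ a" "mk x z $ Inr i = z $ i"
  by (simp_all add: sx_def sz_def mk_def vec_eq_iff)

lemma sx_nth: "sx s $ a = s $ Inl a" and sz_nth: "sz s $ i = s $ Inr i"
  by (simp_all add: sx_def sz_def)

lemma mk_sx_sz [simp]: "mk (sx s) (sz s) = s"
proof -
  have "mk (sx s) (sz s) $ j = s $ j" for j by (cases j) (simp_all add: sx_nth sz_nth)
  then show ?thesis by (simp add: vec_eq_iff)
qed

lemma sum_UNIV_Plus: "(\<Sum>j\<in>(UNIV::('a::finite+'b::finite) set). f j) = (\<Sum>a\<in>UNIV. f (Inl a)) + (\<Sum>i\<in>UNIV. f (Inr i))"
  by (simp add: UNIV_Plus_UNIV[symmetric] sum.Plus del: UNIV_Plus_UNIV)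

lemma hmap_sx: "hmap_on sx S" and hmap_sz: "hmap_on sz S"
  by (simp_all add: hmap_on_def sx_nth sz_nth)

lemma pd_sx: "pd j (\<lambda>s. sx s $ a) x = (if j = Inl a then 1 else 0)"
  by (simp add: sx_nth)
lemma pd_sz: "pd j (\<lambda>s. sz s $ a) x = (if j = Inr a then 1 else 0)"
  by (simp add: sz_nth)

lemma holo_sz: "holo_on (\<lambda>s. sz s $ a) S" by (simp add: sz_nth)

lemma holo_on_sx: "holo_on f U \<Longrightarrow> (\<And>s. s \<in> S \<Longrightarrow> sx s \<in> U) \<Longrightarrow> holo_on (\<lambda>s. f (sx s)) S"
  by (rule holo_on_compose[OF _ hmap_sx])

lemma pd_comp_sx:
  assumes "holo_on f U" "sx s \<in> U"
  shows "pd (Inl a) (\<lambda>s. f (sx s)) s = pd a f (sx s)" "pd (Inr i) (\<lambda>s. f (sx s)) s = 0"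
  using pd_compose[OF assms(1) hmap_sx[of "{s}"] assms(2), of _]
  by (simp_all add: pd_sx if_distrib[of "\<lambda>t. _ * t"] cong: if_cong)

lemma continuous_on_sx: "continuous_on S sx" and continuous_on_sz: "continuous_on S sz"
  by (rule hmap_on_continuous[OF hmap_sx], rule hmap_on_continuous[OF hmap_sz])

text \<open>The derivative along the horizontal lift of \<open>Y\<close>: components in a parallel
  dyad are constant along horizontal curves, so the lift has no component in the direction of
  \<open>z\<close>.\<close>

definition along :: "(complex^4 \<Rightarrow> complex^4) \<Rightarrow> (complex^(4+2) \<Rightarrow> complex) \<Rightarrow> complex^(4+2) \<Rightarrow> complex" where
  "along Y f s = (\<Sum>a\<in>UNIV. Y (sx s) $ a * pd (Inl a) f s)"

definition euler :: "(complex^(4+2) \<Rightarrow> complex) \<Rightarrow> complex^(4+2) \<Rightarrow> complex" where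
  "euler f s = (\<Sum>i\<in>UNIV. sz s $ i * pd (Inr i) f s)"

lemma along_mult: "holo_on f S \<Longrightarrow> holo_on h S \<Longrightarrow> s \<in> S \<Longrightarrow> along Y (\<lambda>s. f s * h s) s = f s * along Y h s + along Y f s * h s"
  by (simp add: along_def pd_mult[where S=S] distrib_left sum.distrib sum_distrib_left sum_distrib_right mult_ac)
lemma along_diff: "holo_on f S \<Longrightarrow> holo_on h S \<Longrightarrow> s \<in> S \<Longrightarrow> along Y (\<lambda>s. f s - h s) s = along Y f s - along Y h s"
  by (simp add: along_def pd_diff[where S=S] right_diff_distrib sum_subtractf)
lemma euler_mult: "holo_on f S \<Longrightarrow> holo_on h S \<Longrightarrow> s \<in> S \<Longrightarrow> euler (\<lambda>s. f s * h s) s = f s * euler h s + euler f s * h s"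
  by (simp add: euler_def pd_mult[where S=S] distrib_left sum.distrib sum_distrib_left sum_distrib_right mult_ac)
lemma euler_diff: "holo_on f S \<Longrightarrow> holo_on h S \<Longrightarrow> s \<in> S \<Longrightarrow> euler (\<lambda>s. f s - h s) s = euler f s - euler h s"
  by (simp add: euler_def pd_diff[where S=S] right_diff_distrib sum_subtractf)

lemma along_cong: "open S \<Longrightarrow> s \<in> S \<Longrightarrow> (\<And>s. s \<in> S \<Longrightarrow> f s = h s) \<Longrightarrow> along Y f s = along Y h s"
  unfolding along_def using pd_cong[of S s f h] by simp
lemma along_sz [simp]: "along Y (\<lambda>s. sz s $ i) s = 0"
  by (simp add: along_def pd_sz)
lemma along_const [simp]: "along Y (\<lambda>s. c) s = 0" "euler (\<lambda>s. c) s = 0"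
  by (simp_all add: along_def euler_def)

lemma holo_along:
  assumes "open S" "hmap_on Y U" "holo_on f S" "\<And>s. s \<in> S \<Longrightarrow> sx s \<in> U"
  shows "holo_on (along Y f) S"
  unfolding along_def[abs_def]
  by (intro holo_on_sum holo_on_mult holo_on_sx[OF hmap_onD[OF assms(2)]] assms(4) holo_on_pd_holo[OF assms(1,3)])

text \<open>The second derivatives commute and cancel; what remains are the components of the Lie
  bracket of the two fields.\<close>

lemma along_commutator:
  assumes S: "open S" and Y: "hmap_on Y U" and Z: "hmap_on Z U" and f: "holo_on f S"
    and sub: "\<And>s. s \<in> S \<Longrightarrow> sx s \<in> U" and s: "s \<in> S"
  shows "along Y (along Z f) s - along Z (along Y f) s
    = (\<Sum>b\<in>UNIV. (\<Sum>a\<in>UNIV. Y (sx s) $ a * pd a (\<lambda>x. Z x $ b) (sx s) - Z (sx s) $ a * pd a (\<lambda>x. Y x $ b) (sx s)) * pd (Inl b) f s)"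
proof -
  have e: "along Y (along Z f) s = (\<Sum>a\<in>UNIV. \<Sum>b\<in>UNIV. Y (sx s) $ a * Z (sx s) $ b * pd (Inl a) (pd (Inl b) f) s)
      + (\<Sum>b\<in>UNIV. (\<Sum>a\<in>UNIV. Y (sx s) $ a * pd a (\<lambda>x. Z x $ b) (sx s)) * pd (Inl b) f s)"
    if Z: "hmap_on Z U" for Y Z
  proof -
    have hZ: "holo_on (\<lambda>s. Z (sx s) $ b) S" for b
      by (rule holo_on_sx[OF hmap_onD[OF Z] sub])
    have hf: "holo_on (pd (Inl b) f) S" for b by (rule holo_on_pd_holo[OF S f])
    have "pd (Inl a) (along Z f) s = (\<Sum>b\<in>UNIV. Z (sx s) $ b * pd (Inl a) (pd (Inl b) f) s + pd a (\<lambda>x. Z x $ b) (sx s) * pd (Inl b) f s)" for a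
    proof -
      have "pd (Inl a) (along Z f) s = pd (Inl a) (\<lambda>s. \<Sum>b\<in>UNIV. Z (sx s) $ b * pd (Inl b) f s) s"
        by (simp only: along_def[abs_def])
      also have "\<dots> = (\<Sum>b\<in>UNIV. pd (Inl a) (\<lambda>s. Z (sx s) $ b * pd (Inl b) f s) s)"
        by (rule pd_sum[OF holo_on_mult[OF hZ hf] s])
      finally show ?thesis
        by (simp only: pd_mult[OF hZ hf s] pd_comp_sx(1)[OF hmap_onD[OF Z] sub[OF s]])
    qed
    then have "along Y (along Z f) s = (\<Sum>a\<in>UNIV. \<Sum>b\<in>UNIV. Y (sx s) $ a * Z (sx s) $ b * pd (Inl a) (pd (Inl b) f) s
        + Y (sx s) $ a * pd a (\<lambda>x. Z x $ b) (sx s) * pd (Inl b) f s)"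
      by (simp only: along_def[of Y] sum_distrib_left distrib_left mult.assoc)
    also have "\<dots> = (\<Sum>a\<in>UNIV. \<Sum>b\<in>UNIV. Y (sx s) $ a * Z (sx s) $ b * pd (Inl a) (pd (Inl b) f) s)
        + (\<Sum>a\<in>UNIV. \<Sum>b\<in>UNIV. Y (sx s) $ a * pd a (\<lambda>x. Z x $ b) (sx s) * pd (Inl b) f s)"
      by (simp only: sum.distrib)
    also have "(\<Sum>a\<in>UNIV. \<Sum>b\<in>UNIV. Y (sx s) $ a * pd a (\<lambda>x. Z x $ b) (sx s) * pd (Inl b) f s)
       = (\<Sum>b\<in>UNIV. (\<Sum>a\<in>UNIV. Y (sx s) $ a * pd a (\<lambda>x. Z x $ b) (sx s)) * pd (Inl b) f s)"
      unfolding sum_distrib_right by (rule sum.swap)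
    finally show ?thesis .
  qed
  have "(\<Sum>a\<in>UNIV. \<Sum>b\<in>UNIV. Z (sx s) $ a * Y (sx s) $ b * pd (Inl a) (pd (Inl b) f) s)
     = (\<Sum>a\<in>UNIV. \<Sum>b\<in>UNIV. Y (sx s) $ a * Z (sx s) $ b * pd (Inl a) (pd (Inl b) f) s)"
    by (subst sum.swap, intro sum.cong refl) (simp only: pd_commute[OF S f s] mult_ac)
  then show ?thesis
    unfolding e[OF Z] e[OF Y] by (simp add: left_diff_distrib sum_subtractf)
qed

text \<open>The coefficients of \<open>Y\<close> do not depend on \<open>z\<close>, nor those of the
  Euler field on \<open>x\<close>, so the two derivations commute.\<close>

lemma euler_along:
  assumes S: "open S" and Y: "hmap_on Y U" and f: "holo_on f S"
    and sub: "\<And>s. s \<in> S \<Longrightarrow> sx s \<in> U" and s: "s \<in> S" and z: "\<And>s. s \<in> S \<Longrightarrow> euler f s = 0"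
  shows "euler (along Y f) s = 0"
proof -
  have hY: "holo_on (\<lambda>s. Y (sx s) $ b) S" for b
    by (rule holo_on_sx[OF hmap_onD[OF Y] sub])
  have hf: "holo_on (pd j f) S" for j by (rule holo_on_pd_holo[OF S f])
  have 1: "pd (Inr i) (along Y f) s = (\<Sum>b\<in>UNIV. Y (sx s) $ b * pd (Inr i) (pd (Inl b) f) s)" for i
  proof -
    have "pd (Inr i) (along Y f) s = pd (Inr i) (\<lambda>s. \<Sum>b\<in>UNIV. Y (sx s) $ b * pd (Inl b) f s) s"
      by (simp only: along_def[abs_def])
    also have "\<dots> = (\<Sum>b\<in>UNIV. pd (Inr i) (\<lambda>s. Y (sx s) $ b * pd (Inl b) f s) s)"
      by (rule pd_sum[OF holo_on_mult[OF hY hf] s])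
    finally show ?thesis
      by (simp only: pd_mult[OF hY hf s] pd_comp_sx(2)[OF hmap_onD[OF Y] sub[OF s]] mult_zero_left add_0_right)
  qed
  have 2: "pd (Inl b) (euler f) s = (\<Sum>i\<in>UNIV. sz s $ i * pd (Inl b) (pd (Inr i) f) s)" for b
  proof -
    have "pd (Inl b) (euler f) s = pd (Inl b) (\<lambda>s. \<Sum>i\<in>UNIV. sz s $ i * pd (Inr i) f s) s"
      by (simp only: euler_def[abs_def])
    also have "\<dots> = (\<Sum>i\<in>UNIV. pd (Inl b) (\<lambda>s. sz s $ i * pd (Inr i) f s) s)"
      by (rule pd_sum[OF holo_on_mult[OF holo_sz hf] s])
    finally show ?thesis
      by (simp add: pd_mult[OF holo_sz hf s] pd_sz)
  qed
  have "euler (along Y f) s = (\<Sum>i\<in>UNIV. \<Sum>b\<in>UNIV. sz s $ i * Y (sx s) $ b * pd (Inr i) (pd (Inl b) f) s)"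
    by (simp only: euler_def[of "along Y f"] 1 sum_distrib_left mult.assoc)
  also have "\<dots> = (\<Sum>b\<in>UNIV. Y (sx s) $ b * pd (Inl b) (euler f) s)"
    unfolding 2 sum_distrib_left by (subst sum.swap, intro sum.cong refl) (simp only: pd_commute[OF S f s] mult_ac)
  finally show ?thesis
    using pd_cong[OF S s, where f="euler f" and g="\<lambda>_. 0", OF z] by simp
qed

lemma contract_diff: "contract k (\<lambda>bs. S bs - T bs) \<pi> = contract k S \<pi> - contract k T \<pi>"
  by (simp add: contract_def left_diff_distrib sum_subtractf)
lemma contract_cmult: "contract k (\<lambda>bs. c * T bs) \<pi> = c * contract k T \<pi>"
  by (simp add: contract_def sum_distrib_left mult.assoc)
lemma contract_sum: "contract k (\<lambda>bs. \<Sum>j\<in>J. T j bs) \<pi> = (\<Sum>j\<in>J. contract k (T j) \<pi>)"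
  unfolding contract_def sum_distrib_right by (rule sum.swap)

section \<open>The tetrad and the bracket in a parallel dyad\<close>

locale twistor_geometry = tetrad +
  fixes d :: "complex^4 \<Rightarrow> 2 \<Rightarrow> complex^2"
  assumes dyad: "parallel_dyad U g e d"
begin

lemma holo_d: "holo_on (\<lambda>x. d x i $ A) U"
  using dyad by (simp add: parallel_dyad_def)
lemma d_unimodular: "x \<in> U \<Longrightarrow> d x 0 $ 0 * d x 1 $ 1 - d x 0 $ 1 * d x 1 $ 0 = 1"
  using dyad by (simp add: parallel_dyad_def sum_2_01)
lemma pd_d: assumes "x \<in> U" shows "pd a (\<lambda>y. d y i $ B) x = - (\<Sum>C\<in>UNIV. gam x a C B * d x i $ C)"
  using dyad assms by (simp add: parallel_dyad_def eq_neg_iff_add_eq_0)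

text \<open>The inverse of \<open>dyad_coords\<close>, written as the inverse of a matrix with
  determinant one.\<close>

definition spinor_at :: "complex^4 \<Rightarrow> complex^2 \<Rightarrow> complex^2" where
  "spinor_at x z = (\<chi> A. if A = 0 then z $ 0 * d x 1 $ 1 - z $ 1 * d x 0 $ 1 else z $ 1 * d x 0 $ 0 - z $ 0 * d x 1 $ 0)"

lemma up_spinor_at: "up (spinor_at x z) A = z $ 1 * d x 0 $ A - z $ 0 * d x 1 $ A"
  by (cases A rule: exhaust_2_01) (simp_all add: up_simps spinor_at_def)

lemma dyad_coords_spinor_at: "x \<in> U \<Longrightarrow> dyad_coords (d x) (spinor_at x z) = z"
  using d_unimodular[of x] unfolding dyad_coords_def vec_eq_iff forall_2_01 spinor_at_def sum_2_01 vec_lambda_beta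
  by simp algebra

lemma spinor_at_dyad_coords: "x \<in> U \<Longrightarrow> spinor_at x (dyad_coords (d x) \<pi>) = \<pi>"
  using d_unimodular[of x] unfolding dyad_coords_def vec_eq_iff forall_2_01 spinor_at_def sum_2_01 vec_lambda_beta
  by simp algebra

definition eh :: "2 \<Rightarrow> 2 \<Rightarrow> complex^4 \<Rightarrow> complex^4" where
  "eh A i x = (\<Sum>A'\<in>UNIV. d x i $ A' *s e x A A')"

lemma eh_nth: "eh A i x $ c = (\<Sum>A'\<in>UNIV. d x i $ A' * E x (A,A') $ c)"
  by (simp add: eh_def E_def)

lemma hmap_eh: "hmap_on (eh A i) U"
  unfolding hmap_on_def eh_nth by (intro allI holo_on_sum holo_on_mult holo_d holo_E)

text \<open>The dyad is parallel, so the primed connection cancels and the fields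
  \<open>eh A i\<close> are rotated by the unprimed connection alone.\<close>

lemma pd_eh:
  assumes x: "x \<in> U"
  shows "pd a (\<lambda>y. eh A i y $ c) x = - (\<Sum>b\<in>UNIV. Gam x c a b * eh A i x $ b) + (\<Sum>C\<in>UNIV. unp x a A C * eh C i x $ c)"
proof -
  have pE: "pd a (\<lambda>y. E y (A,A') $ c) x = - (\<Sum>b\<in>UNIV. Gam x c a b * E x (A,A') $ b)
      + (\<Sum>C\<in>UNIV. unp x a A C * E x (C,A') $ c) + (\<Sum>C'\<in>UNIV. gam x a A' C' * E x (A,C') $ c)" for A'
  proof -
    have "\<forall>A A'. (\<Sum>J\<in>UNIV. frame_conn x a (A,A') J * E x J $ c)
       = (\<Sum>C\<in>UNIV. unp x a A C * E x (C,A') $ c) + (\<Sum>C'\<in>UNIV. gam x a A' C' * E x (A,C') $ c)"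
      unfolding frame_conn_split[OF x] sum_UNIV_prod sum_2_01 fst_conv snd_conv forall_2_01
      by (simp add: algebra_simps)
    then show ?thesis using pd_E[OF x, of a "(A,A')" c] by (simp only: add.assoc)
  qed
  have "pd a (\<lambda>y. eh A i y $ c) x = (\<Sum>A'\<in>UNIV. d x i $ A' * pd a (\<lambda>y. E y (A,A') $ c) x + pd a (\<lambda>y. d y i $ A') x * E x (A,A') $ c)"
    unfolding eh_nth by (subst pd_sum[OF holo_on_mult[OF holo_d holo_E] x]) (simp only: pd_mult[OF holo_d holo_E x])
  also have "\<dots> = - (\<Sum>A'\<in>UNIV. d x i $ A' * (\<Sum>b\<in>UNIV. Gam x c a b * E x (A,A') $ b)) + (\<Sum>C\<in>UNIV. unp x a A C * eh C i x $ c)"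
    unfolding pE pd_d[OF x] eh_nth sum_2_01 by (simp add: algebra_simps)
  also have "(\<Sum>A'\<in>UNIV. d x i $ A' * (\<Sum>b\<in>UNIV. Gam x c a b * E x (A,A') $ b)) = (\<Sum>b\<in>UNIV. Gam x c a b * eh A i x $ b)"
    unfolding eh_nth sum_distrib_left by (subst sum.swap) (simp only: mult_ac)
  finally show ?thesis .
qed

text \<open>The fields \<open>V A\<close> span the twistor distribution, modulo the Euler field, in the
  coordinates \<open>(x, z)\<close> in which the primed connection is trivial.\<close>

definition V :: "2 \<Rightarrow> (complex^(4+2) \<Rightarrow> complex) \<Rightarrow> complex^(4+2) \<Rightarrow> complex" where
  "V A f s = sz s $ 1 * along (eh A 0) f s - sz s $ 0 * along (eh A 1) f s"

definition bracket :: "2 \<Rightarrow> (complex^(4+2) \<Rightarrow> complex) \<Rightarrow> (complex^(4+2) \<Rightarrow> complex) \<Rightarrow> complex^(4+2) \<Rightarrow> complex" where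
  "bracket i f h s = along (eh 0 i) f s * along (eh 1 i) h s - along (eh 1 i) f s * along (eh 0 i) h s"

definition total :: "(complex^(4+2)) set" where
  "total = {s. sx s \<in> U \<and> sz s \<noteq> 0}"

lemma open_total: "open total"
proof -
  have "total = sx -` U \<inter> sz -` (- {0})" by (auto simp: total_def)
  then show ?thesis
    using open_vimage[OF open_U continuous_on_sx] open_vimage[OF open_Compl[OF closed_singleton] continuous_on_sz] by (metis open_Int)
qed

lemma total_sx: "S \<subseteq> total \<Longrightarrow> s \<in> S \<Longrightarrow> sx s \<in> U"
  by (auto simp: total_def)

text \<open>The Levi-Civita connection has no torsion: the Christoffel terms are symmetric and drop
  out of the commutator.\<close>

lemma along_eh_commutator:
  assumes S: "open S" "S \<subseteq> total" and f: "holo_on f S" and s: "s \<in> S"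
  shows "along (eh C j) (along (eh A i) f) s - along (eh A i) (along (eh C j) f) s
    = (\<Sum>D\<in>UNIV. (\<Sum>a\<in>UNIV. eh C j (sx s) $ a * unp (sx s) a A D) * along (eh D i) f s)
      - (\<Sum>D\<in>UNIV. (\<Sum>a\<in>UNIV. eh A i (sx s) $ a * unp (sx s) a C D) * along (eh D j) f s)"
proof -
  let ?x = "sx s"
  have x: "?x \<in> U" by (rule total_sx[OF S(2) s])
  have t: "(\<Sum>a\<in>UNIV. eh C j ?x $ a * pd a (\<lambda>x. eh A i x $ b) ?x)
     = - (\<Sum>a\<in>UNIV. \<Sum>c\<in>UNIV. eh C j ?x $ a * Gam ?x b a c * eh A i ?x $ c)
       + (\<Sum>D\<in>UNIV. (\<Sum>a\<in>UNIV. eh C j ?x $ a * unp ?x a A D) * eh D i ?x $ b)" for b A i C j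
  proof -
    have "(\<Sum>a\<in>UNIV. eh C j ?x $ a * pd a (\<lambda>x. eh A i x $ b) ?x)
      = - (\<Sum>a\<in>UNIV. \<Sum>c\<in>UNIV. eh C j ?x $ a * Gam ?x b a c * eh A i ?x $ c)
        + (\<Sum>a\<in>UNIV. \<Sum>D\<in>UNIV. eh C j ?x $ a * unp ?x a A D * eh D i ?x $ b)"
      unfolding pd_eh[OF x] by (simp only: distrib_left mult_minus_right sum.distrib sum_negf sum_distrib_left mult.assoc)
    also have "(\<Sum>a\<in>UNIV. \<Sum>D\<in>UNIV. eh C j ?x $ a * unp ?x a A D * eh D i ?x $ b)
       = (\<Sum>D\<in>UNIV. (\<Sum>a\<in>UNIV. eh C j ?x $ a * unp ?x a A D) * eh D i ?x $ b)"
      unfolding sum_distrib_right by (rule sum.swap)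
    finally show ?thesis .
  qed
  have sw: "(\<Sum>a\<in>UNIV. \<Sum>c\<in>UNIV. eh A i ?x $ a * Gam ?x b a c * eh C j ?x $ c) = (\<Sum>a\<in>UNIV. \<Sum>c\<in>UNIV. eh C j ?x $ a * Gam ?x b a c * eh A i ?x $ c)" for b A i C j
  proof -
    have "(\<Sum>a\<in>UNIV. \<Sum>c\<in>UNIV. eh A i ?x $ a * Gam ?x b a c * eh C j ?x $ c) = (\<Sum>c\<in>UNIV. \<Sum>a\<in>UNIV. eh A i ?x $ a * Gam ?x b a c * eh C j ?x $ c)"
      by (rule sum.swap)
    also have "\<dots> = (\<Sum>c\<in>UNIV. \<Sum>a\<in>UNIV. eh C j ?x $ c * Gam ?x b c a * eh A i ?x $ a)"
    proof (intro sum.cong refl)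
      fix c a
      show "eh A i ?x $ a * Gam ?x b a c * eh C j ?x $ c = eh C j ?x $ c * Gam ?x b c a * eh A i ?x $ a"
        unfolding Gam_sym[OF x, of b a c] by (simp only: mult_ac)
    qed
    finally show ?thesis .
  qed
  have fin: "(\<Sum>b\<in>UNIV. (\<Sum>D\<in>UNIV. k D * eh D i ?x $ b) * pd (Inl b) f s) = (\<Sum>D\<in>UNIV. k D * along (eh D i) f s)" for k i
    unfolding along_def sum_distrib_left sum_distrib_right by (subst sum.swap) (simp only: mult.assoc)
  have "along (eh C j) (along (eh A i) f) s - along (eh A i) (along (eh C j) f) s
    = (\<Sum>b\<in>UNIV. (\<Sum>a\<in>UNIV. eh C j ?x $ a * pd a (\<lambda>x. eh A i x $ b) ?x - eh A i ?x $ a * pd a (\<lambda>x. eh C j x $ b) ?x) * pd (Inl b) f s)"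
    by (rule along_commutator[OF S(1) hmap_eh[of C j] hmap_eh[of A i] f total_sx[OF S(2)] s])
  also have "\<dots> = (\<Sum>b\<in>UNIV. ((\<Sum>D\<in>UNIV. (\<Sum>a\<in>UNIV. eh C j ?x $ a * unp ?x a A D) * eh D i ?x $ b)
      - (\<Sum>D\<in>UNIV. (\<Sum>a\<in>UNIV. eh A i ?x $ a * unp ?x a C D) * eh D j ?x $ b)) * pd (Inl b) f s)"
    unfolding sum_subtractf t by (simp add: sw[where A=A and i=i and C=C and j=j])
  finally show ?thesis
    unfolding left_diff_distrib sum_subtractf fin .
qed

lemma holo_along_eh: "open S \<Longrightarrow> S \<subseteq> total \<Longrightarrow> holo_on f S \<Longrightarrow> holo_on (along (eh A i) f) S"
  by (rule holo_along[OF _ hmap_eh]) (auto simp: total_sx)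

text \<open>As \<open>V C f\<close> vanishes identically, only the commutator of \<open>V C\<close>
  with \<open>eh A i\<close> acts on \<open>f\<close>. Its part that rotates the index
  \<open>C\<close> is a combination of the \<open>V D f\<close> and vanishes too; the part that
  rotates the free index \<open>A\<close> is left.\<close>

lemma V_along:
  assumes S: "open S" "S \<subseteq> total" and f: "holo_on f S" and s: "s \<in> S" and z: "\<And>s C. s \<in> S \<Longrightarrow> V C f s = 0"
  shows "V C (along (eh A i) f) s = (\<Sum>D\<in>UNIV. (\<Sum>a\<in>UNIV. (sz s $ 1 * eh C 0 (sx s) $ a - sz s $ 0 * eh C 1 (sx s) $ a) * unp (sx s) a A D) * along (eh D i) f s)"
proof -
  have h: "holo_on (along (eh C j) f) S" for C j by (rule holo_along_eh[OF S f])
  have "0 = along (eh A i) (V C f) s"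
    using along_cong[OF S(1) s, of "V C f" "\<lambda>_. 0" "eh A i"] z by simp
  also have "\<dots> = sz s $ 1 * along (eh A i) (along (eh C 0) f) s - sz s $ 0 * along (eh A i) (along (eh C 1) f) s"
    unfolding V_def[abs_def]
    by (subst along_diff[OF holo_on_mult[OF holo_sz h] holo_on_mult[OF holo_sz h] s], simp add: along_mult[OF holo_sz h s])
  finally have 1: "sz s $ 1 * along (eh A i) (along (eh C 0) f) s = sz s $ 0 * along (eh A i) (along (eh C 1) f) s" by simp
  define K where "K j D = (\<Sum>a\<in>UNIV. eh C j (sx s) $ a * unp (sx s) a A D)" for j D
  define N where "N D = (\<Sum>a\<in>UNIV. eh A i (sx s) $ a * unp (sx s) a C D)" for D
  have c: "along (eh C j) (along (eh A i) f) s = along (eh A i) (along (eh C j) f) s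
     + (K j 0 * along (eh 0 i) f s + K j 1 * along (eh 1 i) f s) - (N 0 * along (eh 0 j) f s + N 1 * along (eh 1 j) f s)" for j
    using along_eh_commutator[OF S f s, of C j A i] unfolding K_def N_def sum_2_01 by (simp add: algebra_simps)
  have v: "sz s $ 1 * along (eh D 0) f s = sz s $ 0 * along (eh D 1) f s" for D
    using z[OF s, of D] by (simp add: V_def)
  have "V C (along (eh A i) f) s = (sz s $ 1 * K 0 0 - sz s $ 0 * K 1 0) * along (eh 0 i) f s + (sz s $ 1 * K 0 1 - sz s $ 0 * K 1 1) * along (eh 1 i) f s"
    using 1 v[of 0] v[of 1] unfolding V_def c by algebra
  moreover have "sz s $ 1 * K 0 D - sz s $ 0 * K 1 D = (\<Sum>a\<in>UNIV. (sz s $ 1 * eh C 0 (sx s) $ a - sz s $ 0 * eh C 1 (sx s) $ a) * unp (sx s) a A D)" for D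
    unfolding K_def by (simp add: left_diff_distrib sum_subtractf sum_distrib_left mult.assoc)
  ultimately show ?thesis by (simp only: sum_2_01)
qed

lemma V_mult: "holo_on f S \<Longrightarrow> holo_on h S \<Longrightarrow> s \<in> S \<Longrightarrow> V C (\<lambda>s. f s * h s) s = f s * V C h s + V C f s * h s"
  by (simp add: V_def along_mult[of f S h] algebra_simps)
lemma V_diff: "holo_on f S \<Longrightarrow> holo_on h S \<Longrightarrow> s \<in> S \<Longrightarrow> V C (\<lambda>s. f s - h s) s = V C f s - V C h s"
  by (simp add: V_def along_diff[of f S h] algebra_simps)

lemma holo_bracket: "open S \<Longrightarrow> S \<subseteq> total \<Longrightarrow> holo_on f S \<Longrightarrow> holo_on h S \<Longrightarrow> holo_on (bracket i f h) S"
  unfolding bracket_def[abs_def] by (intro holo_on_diff holo_on_mult holo_along_eh)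

text \<open>The fibrewise symplectic form descends to twistor space: \<open>\<Gamma>\<close> acts on the two
  unprimed indices of the bracket through its trace, which vanishes.\<close>

lemma V_bracket:
  assumes S: "open S" "S \<subseteq> total" and f: "holo_on f S" "\<And>s C. s \<in> S \<Longrightarrow> V C f s = 0"
    and h: "holo_on h S" "\<And>s C. s \<in> S \<Longrightarrow> V C h s = 0" and s: "s \<in> S"
  shows "V C (bracket i f h) s = 0"
proof -
  note hf = holo_along_eh[OF S f(1)] and hh = holo_along_eh[OF S h(1)]
  have x: "sx s \<in> U" by (rule total_sx[OF S(2) s])
  define k where "k A D = (\<Sum>a\<in>UNIV. (sz s $ 1 * eh C 0 (sx s) $ a - sz s $ 0 * eh C 1 (sx s) $ a) * unp (sx s) a A D)" for A D
  have k: "k 1 1 = - k 0 0" by (simp add: k_def unp_tr[OF x] sum_negf)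
  have "V C (bracket i f h) s = along (eh 0 i) f s * V C (along (eh 1 i) h) s + V C (along (eh 0 i) f) s * along (eh 1 i) h s
     - (along (eh 1 i) f s * V C (along (eh 0 i) h) s + V C (along (eh 1 i) f) s * along (eh 0 i) h s)"
    unfolding bracket_def[abs_def] by (simp only: V_diff[OF holo_on_mult[OF hf hh] holo_on_mult[OF hf hh] s] V_mult[OF hf hh s])
  also have "\<dots> = 0"
  proof -
    have "V C (along (eh A i) f) s = k A 0 * along (eh 0 i) f s + k A 1 * along (eh 1 i) f s" for A
      using V_along[OF S f(1) s f(2), of C A i] unfolding k_def sum_2_01 by blast
    moreover have "V C (along (eh A i) h) s = k A 0 * along (eh 0 i) h s + k A 1 * along (eh 1 i) h s" for A
      using V_along[OF S h(1) s h(2), of C A i] unfolding k_def sum_2_01 by blast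
    ultimately show ?thesis by (simp add: k algebra_simps)
  qed
  finally show ?thesis .
qed

lemma euler_bracket:
  assumes S: "open S" "S \<subseteq> total" and f: "holo_on f S" "\<And>s. s \<in> S \<Longrightarrow> euler f s = 0"
    and h: "holo_on h S" "\<And>s. s \<in> S \<Longrightarrow> euler h s = 0" and s: "s \<in> S"
  shows "euler (bracket i f h) s = 0"
proof -
  note hf = holo_along_eh[OF S f(1)] and hh = holo_along_eh[OF S h(1)]
  have z: "euler (along (eh A i) f) s = 0" "euler (along (eh A i) h) s = 0" for A
    using euler_along[OF S(1) hmap_eh f(1) total_sx[OF S(2)] s f(2)] euler_along[OF S(1) hmap_eh h(1) total_sx[OF S(2)] s h(2)] by blast+
  show ?thesis
    unfolding bracket_def[abs_def] by (simp only: euler_diff[OF holo_on_mult[OF hf hh] holo_on_mult[OF hf hh] s] euler_mult[OF hf hh s] z) simp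
qed

text \<open>If the \<open>V A\<close> annihilate a function, its derivatives along
  \<open>eh A 0\<close> and \<open>eh A 1\<close> are in the ratio of \<open>sz s $ 0\<close> to
  \<open>sz s $ 1\<close>. The bracket has two such factors, whence the squares; this is the weight
  two of the symplectic form.\<close>

lemma bracket_patch:
  assumes f: "V 0 f s = 0" "V 1 f s = 0" and h: "V 0 h s = 0" "V 1 h s = 0"
  shows "(sz s $ i)\<^sup>2 * bracket j f h s = (sz s $ j)\<^sup>2 * bracket i f h s"
proof -
  have v: "sz s $ 1 * along (eh D 0) f s = sz s $ 0 * along (eh D 1) f s" "sz s $ 1 * along (eh D 0) h s = sz s $ 0 * along (eh D 1) h s" for D
    using f h by (cases D rule: exhaust_2_01; simp add: V_def)+
  have "(sz s $ 0)\<^sup>2 * bracket 1 f h s = (sz s $ 1)\<^sup>2 * bracket 0 f h s"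
    unfolding bracket_def using v[of 0] v[of 1] by algebra
  then show ?thesis by (cases i rule: exhaust_2_01; cases j rule: exhaust_2_01) simp_all
qed

end

section \<open>Curves, homogeneity and the passage to dyad coordinates\<close>

lemma holo_on_curve:
  fixes f :: "complex^'n \<Rightarrow> complex" and \<gamma> :: "real \<Rightarrow> complex^'n"
  assumes f: "holo_on f S" and s: "\<gamma> t \<in> S" and g: "(\<gamma> has_vector_derivative v) (at t within T)"
  shows "((\<lambda>t. f (\<gamma> t)) has_vector_derivative (\<Sum>j\<in>UNIV. pd j f (\<gamma> t) * v $ j)) (at t within T)"
proof -
  have "((\<lambda>t. f (\<gamma> t)) has_derivative (\<lambda>h. \<Sum>j\<in>UNIV. pd j f (\<gamma> t) * (h *\<^sub>R v) $ j)) (at t within T)"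
    by (rule has_derivative_compose[OF g[unfolded has_vector_derivative_def] holo_onD[OF f s]])
  then show ?thesis
    unfolding has_vector_derivative_def
    by (rule has_derivative_eq_rhs) (simp add: scaleR_sum_right fun_eq_iff)
qed

lemma has_vector_derivative_vec:
  fixes \<gamma> :: "real \<Rightarrow> complex^'n"
  assumes "\<And>i. ((\<lambda>t. \<gamma> t $ i) has_vector_derivative v $ i) (at t within T)"
  shows "(\<gamma> has_vector_derivative v) (at t within T)"
  unfolding has_vector_derivative_def
  by (rule has_derivative_vec) (use assms in \<open>simp add: has_vector_derivative_def\<close>)

lemma O_point_scale:
  assumes "c \<noteq> 0" shows "O_point m (c *s \<pi>) (c powi m * l) = O_point m \<pi> l"
proof (intro set_eqI iffI)
  fix q assume "q \<in> O_point m (c *s \<pi>) (c powi m * l)"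
  then obtain b where "b \<noteq> 0" "q = (b *s (c *s \<pi>), b powi m * (c powi m * l))" by (auto simp: O_point_def)
  then show "q \<in> O_point m \<pi> l"
    unfolding O_point_def using assms by (intro CollectI exI[of _ "b * c"]) (simp add: power_int_mult_distrib)
next
  fix q assume "q \<in> O_point m \<pi> l"
  then obtain b where "b \<noteq> 0" "q = (b *s \<pi>, b powi m * l)" by (auto simp: O_point_def)
  then show "q \<in> O_point m (c *s \<pi>) (c powi m * l)"
    unfolding O_point_def using assms
    by (intro CollectI exI[of _ "b / c"]) (simp add: power_int_divide_distrib)
qed

lemma O_point_eqD:
  assumes "O_point m \<pi> l = O_point m \<pi>' l'"
  obtains c where "c \<noteq> 0" "\<pi>' = c *s \<pi>" "l' = c powi m * l"
proof -
  have "(\<pi>', l') \<in> O_point m \<pi>' l'" unfolding O_point_def by (intro CollectI exI[of _ 1]) simp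
  then have "(\<pi>', l') \<in> O_point m \<pi> l" by (simp only: assms)
  then show ?thesis using that by (auto simp: O_point_def)
qed

lemma contract_scale: "contract k T (c *s \<pi>) = c ^ k * contract k T \<pi>"
proof -
  have "up (c *s \<pi>) b = c * up \<pi> b" for b by (cases b rule: exhaust_2_01) (simp_all add: up_simps)
  then show ?thesis by (simp add: contract_def prod.distrib sum_distrib_left mult_ac)
qed

text \<open>Euler's theorem: differentiate the scaling law at \<open>c = 1\<close>.\<close>

lemma euler_homogeneous:
  assumes f: "holo_on f S" "s \<in> S" and h: "\<And>c. c \<noteq> 0 \<Longrightarrow> f (mk (sx s) (c *s sz s)) = c ^ k * f s"
  shows "euler f s = of_nat k * f s"
proof -
  have d: "((\<lambda>c::complex. mk (sx s) (c *s sz s)) has_derivative (\<lambda>c. mk 0 (c *s sz s))) (at 1)"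
  proof (rule has_derivative_vec)
    fix j :: "4+2"
    show "((\<lambda>c::complex. mk (sx s) (c *s sz s) $ j) has_derivative (\<lambda>c. mk 0 (c *s sz s) $ j)) (at 1)"
      by (cases j) (auto intro!: derivative_eq_intros)
  qed
  have "((\<lambda>c. f (mk (sx s) (c *s sz s))) has_derivative (\<lambda>c. \<Sum>j\<in>UNIV. pd j f s * mk 0 (c *s sz s) $ j)) (at 1)"
    using has_derivative_compose[OF d, of f "\<lambda>v. \<Sum>j\<in>UNIV. pd j f s * v $ j"] holo_onD[OF f] by simp
  moreover have "(\<lambda>c. \<Sum>j\<in>UNIV. pd j f s * mk 0 (c *s sz s) $ j) = (*) (euler f s)"
    by (simp add: sum_UNIV_Plus euler_def fun_eq_iff sum_distrib_left sum_distrib_right mult_ac)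
  ultimately have "((\<lambda>c. f (mk (sx s) (c *s sz s))) has_field_derivative euler f s) (at 1)"
    by (simp add: has_field_derivative_def)
  moreover have "((\<lambda>c. f (mk (sx s) (c *s sz s))) has_field_derivative (of_nat k * f s)) (at 1)"
  proof (rule has_field_derivative_transform_within_open)
    show "((\<lambda>c. c ^ k * f s) has_field_derivative of_nat k * f s) (at 1)"
      by (auto intro!: derivative_eq_intros)
    show "open (- {0::complex})" by auto
  qed (simp_all add: h)
  ultimately show ?thesis by (rule DERIV_unique)
qed

context twistor_geometry begin

lemma spinor_at_scale: "spinor_at x (c *s z) = c *s spinor_at x z"
  by (simp add: spinor_at_def vec_eq_iff algebra_simps)

text \<open>For fixed \<open>z\<close> the spinor \<open>spinor_at x z\<close> is parallel, so the
  derivative of the contraction is the contraction of the covariant derivative. The induction peels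
  off one index at a time; the derivative of the spinor in that slot supplies the connection term of
  that index.\<close>

lemma pd_contract:
  assumes T: "\<And>bs. length bs = k \<Longrightarrow> holo_on (\<lambda>x. T x bs) U"
  shows "holo_on (\<lambda>x. contract k (T x) (spinor_at x z)) U"
    and "x \<in> U \<Longrightarrow> pd a (\<lambda>x. contract k (T x) (spinor_at x z)) x
      = contract k (\<lambda>bs. pd a (\<lambda>x. T x bs) x - (\<Sum>i<k. \<Sum>C\<in>UNIV. gam x a (bs!i) C * T x (bs[i := C]))) (spinor_at x z)"
proof -
  define W where "W b x = z $ 1 * d x 0 $ b - z $ 0 * d x 1 $ b" for b x
  have W: "up (spinor_at x z) b = W b x" for x b by (simp add: W_def up_spinor_at)
  have hW: "holo_on (W b) U" for b
    unfolding W_def[abs_def] by (intro holo_on_diff holo_on_mult holo_d holo_on_const)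
  have pW: "pd a (W b) x = - (\<Sum>C\<in>UNIV. gam x a C b * W C x)" if x: "x \<in> U" for a b x
    unfolding W_def[abs_def]
    by (simp add: pd_diff[where S=U] pd_mult[where S=U] holo_on_mult holo_d x pd_d sum_2_01 algebra_simps)
  have "holo_on (\<lambda>x. contract k (T x) (spinor_at x z)) U \<and>
    (\<forall>x\<in>U. pd a (\<lambda>x. contract k (T x) (spinor_at x z)) x
      = contract k (\<lambda>bs. pd a (\<lambda>x. T x bs) x - (\<Sum>i<k. \<Sum>C\<in>UNIV. gam x a (bs!i) C * T x (bs[i := C]))) (spinor_at x z))"
    using T
  proof (induction k arbitrary: T)
    case 0
    then show ?case by simp
  next
    case (Suc k)
    have hT: "holo_on (\<lambda>x. contract k (\<lambda>bs. T x (b # bs)) (spinor_at x z)) U" for b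
      using Suc.IH[of "\<lambda>x bs. T x (b # bs)"] Suc.prems by simp
    have pT: "pd a (\<lambda>x. contract k (\<lambda>bs. T x (b # bs)) (spinor_at x z)) x
      = contract k (\<lambda>bs. pd a (\<lambda>x. T x (b # bs)) x - (\<Sum>i<k. \<Sum>C\<in>UNIV. gam x a (bs!i) C * T x (b # bs[i := C]))) (spinor_at x z)"
      if "x \<in> U" for b x
      using Suc.IH[of "\<lambda>x bs. T x (b # bs)"] Suc.prems that by simp
    have "holo_on (\<lambda>x. contract (Suc k) (T x) (spinor_at x z)) U"
      unfolding contract_Suc W by (intro holo_on_sum holo_on_mult hW hT)
    moreover have "pd a (\<lambda>x. contract (Suc k) (T x) (spinor_at x z)) x
      = contract (Suc k) (\<lambda>bs. pd a (\<lambda>x. T x bs) x - (\<Sum>i<Suc k. \<Sum>C\<in>UNIV. gam x a (bs!i) C * T x (bs[i := C]))) (spinor_at x z)"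
      if x: "x \<in> U" for x
    proof -
      define c where "c b = contract k (\<lambda>bs. T x (b # bs)) (spinor_at x z)" for b
      have "pd a (\<lambda>x. contract (Suc k) (T x) (spinor_at x z)) x
         = (\<Sum>b\<in>UNIV. W b x * contract k (\<lambda>bs. pd a (\<lambda>x. T x (b # bs)) x - (\<Sum>i<k. \<Sum>C\<in>UNIV. gam x a (bs!i) C * T x (b # bs[i := C]))) (spinor_at x z)
             - (\<Sum>C\<in>UNIV. gam x a C b * W C x) * c b)"
        unfolding contract_Suc W
        by (subst pd_sum[OF holo_on_mult[OF hW hT] x]) (simp add: pd_mult[OF hW hT x] pW[OF x] pT[OF x] c_def)
      also have "\<dots> = (\<Sum>b\<in>UNIV. W b x * (contract k (\<lambda>bs. pd a (\<lambda>x. T x (b # bs)) x - (\<Sum>i<k. \<Sum>C\<in>UNIV. gam x a (bs!i) C * T x (b # bs[i := C]))) (spinor_at x z)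
             - (\<Sum>C\<in>UNIV. gam x a b C * c C)))"
        unfolding sum_2_01 by (simp add: algebra_simps)
      also have "\<dots> = (\<Sum>b\<in>UNIV. W b x * contract k (\<lambda>bs. pd a (\<lambda>x. T x (b # bs)) x - (\<Sum>i<Suc k. \<Sum>C\<in>UNIV. gam x a ((b # bs)!i) C * T x ((b # bs)[i := C]))) (spinor_at x z))"
        unfolding sum.lessThan_Suc_shift nth_Cons_0 nth_Cons_Suc list_update.simps nat.case diff_diff_eq2 c_def
          contract_cmult[symmetric] contract_sum[symmetric] contract_diff[symmetric]
        by (simp add: algebra_simps)
      finally show ?thesis unfolding contract_Suc W .
    qed
    ultimately show ?case by blast
  qed
  then show "holo_on (\<lambda>x. contract k (T x) (spinor_at x z)) U"
    and "x \<in> U \<Longrightarrow> pd a (\<lambda>x. contract k (T x) (spinor_at x z)) x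
      = contract k (\<lambda>bs. pd a (\<lambda>x. T x bs) x - (\<Sum>i<k. \<Sum>C\<in>UNIV. gam x a (bs!i) C * T x (bs[i := C]))) (spinor_at x z)"
    by blast+
qed

text \<open>\<open>hat\<close> passes from the given spin frame to the parallel dyad, in which the
  connection disappears; \<open>unhat\<close> goes back.\<close>

definition hat :: "(complex^4) \<times> (complex^2) \<Rightarrow> complex^(4+2)" where
  "hat s = mk (fst s) (dyad_coords (d (fst s)) (snd s))"

definition unhat :: "complex^(4+2) \<Rightarrow> (complex^4) \<times> (complex^2)" where
  "unhat s = (sx s, spinor_at (sx s) (sz s))"

lemma hat_unhat: "s \<in> total \<Longrightarrow> hat (unhat s) = s"
  by (simp add: hat_def unhat_def dyad_coords_spinor_at total_def)

lemma unhat_hat: "fst s \<in> U \<Longrightarrow> unhat (hat s) = s"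
  by (simp add: hat_def unhat_def spinor_at_dyad_coords)

lemma hat_total: "s \<in> spin_bundle U \<Longrightarrow> hat s \<in> total"
proof -
  assume "s \<in> spin_bundle U"
  then have s: "fst s \<in> U" "snd s \<noteq> 0" by (auto simp: spin_bundle_def)
  have "dyad_coords (d (fst s)) (snd s) \<noteq> 0"
  proof
    assume "dyad_coords (d (fst s)) (snd s) = 0"
    then have "snd s = spinor_at (fst s) 0" using spinor_at_dyad_coords[OF s(1), of "snd s"] by simp
    then show False using s(2) spinor_at_scale[of "fst s" 0 0] by simp
  qed
  then show ?thesis using s by (simp add: hat_def total_def)
qed

lemma unhat_bundle: "s \<in> total \<Longrightarrow> unhat s \<in> spin_bundle U"
proof -
  assume s: "s \<in> total"
  have "spinor_at (sx s) (sz s) \<noteq> 0"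
  proof
    assume "spinor_at (sx s) (sz s) = 0"
    then have "sz s = dyad_coords (d (sx s)) 0" using dyad_coords_spinor_at[of "sx s" "sz s"] s by (simp add: total_def)
    then show False using s by (simp add: dyad_coords_def total_def zero_vec_def)
  qed
  then show ?thesis using s by (simp add: unhat_def spin_bundle_def total_def)
qed

text \<open>The space-time part of the combination of the fields \<open>V A\<close> with
  coefficients \<open>\<kappa>\<close>.\<close>

definition vel :: "complex^2 \<Rightarrow> complex^(4+2) \<Rightarrow> complex^4" where
  "vel \<kappa> s = (\<Sum>A\<in>UNIV. \<kappa> $ A *s (sz s $ 1 *s eh A 0 (sx s) - sz s $ 0 *s eh A 1 (sx s)))"

definition leaf_velocity :: "complex^(4+2) \<Rightarrow> complex^(4+2) \<Rightarrow> bool" where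
  "leaf_velocity s v \<longleftrightarrow> (\<exists>\<kappa> \<mu>. v = mk (vel \<kappa> s) (\<mu> *s sz s))"

lemma leaf_velocity_derivative:
  assumes "leaf_velocity s v" and V: "\<And>A. V A f s = 0" and E: "euler f s = 0"
  shows "(\<Sum>j\<in>UNIV. pd j f s * v $ j) = 0"
proof -
  obtain \<kappa> \<mu> where v: "v = mk (vel \<kappa> s) (\<mu> *s sz s)" using assms(1) by (auto simp: leaf_velocity_def)
  have "(\<Sum>j\<in>UNIV. pd j f s * v $ j) = (\<Sum>a\<in>UNIV. pd (Inl a) f s * vel \<kappa> s $ a) + (\<Sum>i\<in>UNIV. pd (Inr i) f s * (\<mu> * sz s $ i))"
    by (simp add: v sum_UNIV_Plus)
  also have "(\<Sum>i\<in>UNIV. pd (Inr i) f s * (\<mu> * sz s $ i)) = \<mu> * euler f s"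
    by (simp add: euler_def sum_distrib_left mult_ac)
  also have "(\<Sum>a\<in>UNIV. pd (Inl a) f s * vel \<kappa> s $ a) = (\<Sum>A\<in>UNIV. \<kappa> $ A * V A f s)"
    unfolding vel_def V_def along_def sum_2_01
    by (simp add: algebra_simps sum.distrib sum_subtractf sum_distrib_left)
  finally show ?thesis by (simp add: V E)
qed

text \<open>The derivative of the dyad cancels the connection term in the distribution. In the fibre
  direction only the Euler part remains, a multiple of \<open>z\<close>.\<close>

lemma hat_velocity:
  assumes c: "(c has_vector_derivative v) (at t)" and v: "v \<in> twistor_distribution g e (c t)" and U: "fst (c t) \<in> U"
  shows "\<exists>w. leaf_velocity (hat (c t)) w \<and> ((\<lambda>t. hat (c t)) has_vector_derivative w) (at t)"
proof -
  obtain x \<pi> where ct: "c t = (x, \<pi>)" by (cases "c t")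
  obtain u w where vv: "v = (u, w)" by (cases v)
  obtain \<kappa> \<mu> where u: "u = (\<Sum>A\<in>UNIV. \<Sum>A'\<in>UNIV. (\<kappa> $ A * up \<pi> A') *s e x A A')"
    and w: "\<And>B. w $ B = (\<Sum>a\<in>UNIV. \<Sum>C\<in>UNIV. u $ a * gam x a B C * \<pi> $ C) + \<mu> * \<pi> $ B"
  proof -
    from v obtain \<kappa> \<mu> where 1: "u = (\<Sum>A\<in>UNIV. \<Sum>A'\<in>UNIV. (\<kappa> $ A * up \<pi> A') *s e x A A')"
      and 2: "\<forall>B'. w $ B' - (\<Sum>a\<in>UNIV. \<Sum>C'\<in>UNIV. u $ a * gam x a B' C' * \<pi> $ C') = \<mu> * \<pi> $ B'"
      unfolding ct vv twistor_distribution_def case_prod_conv mem_Collect_eq by blast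
    have "w $ B = (\<Sum>a\<in>UNIV. \<Sum>C\<in>UNIV. u $ a * gam x a B C * \<pi> $ C) + \<mu> * \<pi> $ B" for B
      using 2[rule_format, of B] by (simp only: diff_eq_eq add.commute)
    with 1 that show ?thesis by blast
  qed
  have x: "x \<in> U" using U ct by simp
  have fc: "((\<lambda>t. fst (c t)) has_vector_derivative u) (at t)"
    using bounded_linear.has_vector_derivative[OF bounded_linear_fst c] vv by simp
  have sc: "((\<lambda>t. snd (c t)) has_vector_derivative w) (at t)"
    using bounded_linear.has_vector_derivative[OF bounded_linear_snd c] vv by simp
  define z where "z = dyad_coords (d x) \<pi>"
  have hz: "hat (c t) = mk x z" by (simp add: hat_def ct z_def)
  have "((\<lambda>t. dyad_coords (d (fst (c t))) (snd (c t))) has_vector_derivative \<mu> *s z) (at t)"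
  proof (rule has_vector_derivative_vec)
    fix i
    have dd: "((\<lambda>t. d (fst (c t)) i $ A) has_vector_derivative (\<Sum>a\<in>UNIV. pd a (\<lambda>x. d x i $ A) x * u $ a)) (at t)" for A
      using holo_on_curve[OF holo_d, of "\<lambda>t. fst (c t)" t u UNIV i A] fc ct x by simp
    have pp: "((\<lambda>t. snd (c t) $ A) has_vector_derivative w $ A) (at t)" for A
      using bounded_linear.has_vector_derivative[OF bounded_linear_vec_nth sc] .
    have "((\<lambda>t. \<Sum>A\<in>UNIV. snd (c t) $ A * d (fst (c t)) i $ A) has_vector_derivative
       (\<Sum>A\<in>UNIV. \<pi> $ A * (\<Sum>a\<in>UNIV. pd a (\<lambda>x. d x i $ A) x * u $ a) + w $ A * d x i $ A)) (at t)"
      using has_vector_derivative_mult[OF pp dd] ct by (intro has_vector_derivative_sum) simp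
    moreover have "(\<Sum>A\<in>UNIV. \<pi> $ A * (\<Sum>a\<in>UNIV. pd a (\<lambda>x. d x i $ A) x * u $ a) + w $ A * d x i $ A) = \<mu> * z $ i"
    proof -
      have 1: "(\<Sum>a\<in>UNIV. pd a (\<lambda>x. d x i $ A) x * u $ a) = - (\<Sum>C\<in>UNIV. (\<Sum>a\<in>UNIV. u $ a * gam x a C A) * d x i $ C)" for A
      proof -
        have "(\<Sum>a\<in>UNIV. pd a (\<lambda>x. d x i $ A) x * u $ a) = - (\<Sum>a\<in>UNIV. \<Sum>C\<in>UNIV. u $ a * gam x a C A * d x i $ C)"
          unfolding pd_d[OF x] by (simp add: sum_distrib_right sum_distrib_left sum_negf mult_ac)
        then show ?thesis unfolding sum_distrib_right by (subst sum.swap)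
      qed
      have 2: "w $ A = (\<Sum>C\<in>UNIV. (\<Sum>a\<in>UNIV. u $ a * gam x a A C) * \<pi> $ C) + \<mu> * \<pi> $ A" for A
        unfolding w sum_distrib_right by (subst sum.swap) simp
      show ?thesis
        unfolding 1 2 z_def dyad_coords_def sum_2_01 by (simp add: algebra_simps)
    qed
    ultimately show "((\<lambda>t. dyad_coords (d (fst (c t))) (snd (c t)) $ i) has_vector_derivative (\<mu> *s z) $ i) (at t)"
      by (simp add: dyad_coords_def)
  qed
  then have sz': "((\<lambda>t. dyad_coords (d (fst (c t))) (snd (c t)) $ i) has_vector_derivative (\<mu> *s z) $ i) (at t)" for i
    by (rule bounded_linear.has_vector_derivative[OF bounded_linear_vec_nth])
  have fx': "((\<lambda>t. fst (c t) $ i) has_vector_derivative u $ i) (at t)" for i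
    by (rule bounded_linear.has_vector_derivative[OF bounded_linear_vec_nth fc])
  have "((\<lambda>t. hat (c t)) has_vector_derivative mk u (\<mu> *s z)) (at t)"
  proof (rule has_vector_derivative_vec)
    fix j :: "4+2"
    show "((\<lambda>t. hat (c t) $ j) has_vector_derivative mk u (\<mu> *s z) $ j) (at t)"
      using sz' fx' by (cases j) (simp_all add: hat_def)
  qed
  moreover have "u = vel \<kappa> (mk x z)"
  proof -
    have up: "up \<pi> A' = z $ 1 * d x 0 $ A' - z $ 0 * d x 1 $ A'" for A'
      using up_spinor_at[of x z A'] spinor_at_dyad_coords[OF x, of \<pi>] by (simp add: z_def)
    show ?thesis
      unfolding u up vel_def eh_def sum_2_01 mk_simps by (simp add: vec_eq_iff algebra_simps)
  qed
  ultimately show ?thesis unfolding hz leaf_velocity_def by auto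
qed

end

section \<open>Leaves and twistor functions\<close>

lemma integral_bound_interval:
  fixes f :: "real \<Rightarrow> 'a::euclidean_space"
  assumes "continuous_on {0..t} f" "0 \<le> t" "\<And>s. s \<in> {0..t} \<Longrightarrow> norm (f s) \<le> B"
  shows "norm (integral {0..t} f) \<le> t * B"
  using integral_bound[of 0 t f B] assms by (simp add: mult.commute)

lemma local_lipschitz_bound:
  fixes X :: "complex^'n \<Rightarrow> complex^'n"
  assumes X: "hmap_on X S" and S: "open S" and C: "compact C" "convex C" "C \<subseteq> S"
  obtains K where "K > 0" "\<And>x y. x \<in> C \<Longrightarrow> y \<in> C \<Longrightarrow> norm (X x - X y) \<le> K * norm (x - y)"
proof -
  define f' where "f' x = Blinfun (\<lambda>v. jac X x *v v)" for x
  have f'a: "blinfun_apply (f' x) = (\<lambda>v. jac X x *v v)" for x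
    unfolding f'_def by (rule bounded_linear_Blinfun_apply[OF matrix_vector_mul_bounded_linear])
  have "continuous_on S f'" unfolding f'_def
    by (rule matrix_blinfun_continuous) (simp add: jac_def pd_continuous[OF S hmap_onD[OF X]])
  then have "bounded (f' ` C)"
    using C by (intro compact_imp_bounded compact_continuous_image) (auto intro: continuous_on_subset)
  then obtain K where K: "K > 0" "\<And>x. x \<in> C \<Longrightarrow> norm (f' x) \<le> K" by (metis bounded_pos imageI)
  have "norm (X x - X y) \<le> K * norm (x - y)" if "x \<in> C" "y \<in> C" for x y
  proof (rule differentiable_bound[OF C(2) _ _ that])
    fix z assume z: "z \<in> C"
    then have "z \<in> S" using C(3) by blast
    from hmap_on_derivative[OF X this]
    show "(X has_derivative blinfun_apply (f' z)) (at z within C)"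
      unfolding f'a by (rule has_derivative_at_withinI)
    show "onorm (blinfun_apply (f' z)) \<le> K" using K(2)[OF z] by (simp add: norm_blinfun.rep_eq)
  qed
  with K(1) that show ?thesis by blast
qed

text \<open>Picard iteration on one side of the initial time; a one-sided solution is enough to
  differentiate a function at the start of an orbit.\<close>

lemma ode_solution:
  fixes X :: "complex^'n \<Rightarrow> complex^'n"
  assumes X: "hmap_on X S" and S: "open S" and x0: "x0 \<in> S"
  obtains \<delta> \<xi> where "\<delta> > 0" "\<xi> 0 = x0" "\<And>t. t \<in> {0..\<delta>} \<Longrightarrow> \<xi> t \<in> S"
    "\<And>t. t \<in> {0..\<delta>} \<Longrightarrow> (\<xi> has_vector_derivative X (\<xi> t)) (at t within {0..\<delta>})"
proof -
  obtain r where r: "r > 0" "cball x0 r \<subseteq> S" using S x0 open_contains_cball by blast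
  let ?C = "cball x0 r"
  have Xc: "continuous_on ?C X" by (rule continuous_on_subset[OF hmap_on_continuous[OF X] r(2)])
  then have "bounded (X ` ?C)" by (intro compact_imp_bounded compact_continuous_image) auto
  then obtain B where B: "B > 0" "\<And>x. x \<in> ?C \<Longrightarrow> norm (X x) \<le> B" by (metis bounded_pos imageI)
  obtain K where K: "K > 0" "\<And>x y. x \<in> ?C \<Longrightarrow> y \<in> ?C \<Longrightarrow> norm (X x - X y) \<le> K * norm (x - y)"
    by (rule local_lipschitz_bound[OF X S compact_cball convex_cball r(2)], rule that)
  \<comment> \<open>The first bound keeps the iterates in the ball of radius \<open>r\<close>, the
    second makes the iteration a contraction with factor one half.\<close>
  define \<delta> where "\<delta> = min (r / B) (1 / (2 * K))"
  have \<delta>: "\<delta> > 0" "\<delta> * B \<le> r" "\<delta> * K \<le> 1 / 2"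
    using r B K by (auto simp: \<delta>_def min_def field_simps)
  let ?I = "{0..\<delta>}"
  define T where "T y t = x0 + integral {0..t} (\<lambda>s. X (y s))" for y :: "real \<Rightarrow> complex^'n" and t :: real
  define adm where "adm y \<longleftrightarrow> continuous_on ?I y \<and> y ` ?I \<subseteq> ?C" for y :: "real \<Rightarrow> complex^'n"
  have Xy: "continuous_on ?I (\<lambda>s. X (y s))" if "adm y" for y
    using that continuous_on_compose2[OF Xc] unfolding adm_def by blast
  have sub: "continuous_on {0..t} h" if "continuous_on ?I h" "t \<in> ?I" for h :: "real \<Rightarrow> complex^'n" and t
    by (rule continuous_on_subset[OF that(1)]) (use that(2) in auto)
  have dT: "(T y has_vector_derivative X (y t)) (at t within ?I)" if "adm y" "t \<in> ?I" for y t
    unfolding T_def using integral_has_vector_derivative[OF Xy[OF that(1)] that(2)]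
    by (auto intro!: derivative_eq_intros)
  have admT: "adm (T y)" if y: "adm y" for y
  proof -
    have "continuous_on ?I (T y)" by (rule continuous_on_vector_derivative[OF dT[OF y]])
    moreover have "T y t \<in> ?C" if t: "t \<in> ?I" for t
    proof -
      have "norm (integral {0..t} (\<lambda>s. X (y s))) \<le> t * B"
        by (rule integral_bound_interval[OF sub[OF Xy[OF y] t]]) (use t y B(2) in \<open>auto simp: adm_def image_subset_iff\<close>)
      also have "\<dots> \<le> \<delta> * B" by (rule mult_right_mono) (use t B in auto)
      also have "\<dots> \<le> r" by (rule \<delta>)
      finally show ?thesis by (simp add: T_def dist_norm)
    qed
    ultimately show ?thesis unfolding adm_def by blast
  qed
  have contr: "norm (T y t - T y' t) \<le> c / 2"
    if y: "adm y" "adm y'" and c: "\<And>s. s \<in> ?I \<Longrightarrow> norm (y s - y' s) \<le> c" and t: "t \<in> ?I" for y y' c t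
  proof -
    have c0: "c \<ge> 0" using c[OF t] norm_ge_zero order_trans by blast
    have "T y t - T y' t = integral {0..t} (\<lambda>s. X (y s) - X (y' s))"
      unfolding T_def using sub[OF Xy[OF y(1)] t] sub[OF Xy[OF y(2)] t]
      by (simp add: integral_diff integrable_continuous_real)
    also have "norm \<dots> \<le> t * (K * c)"
    proof (rule integral_bound_interval)
      show "continuous_on {0..t} (\<lambda>s. X (y s) - X (y' s))"
        by (rule continuous_on_diff[OF sub[OF Xy[OF y(1)] t] sub[OF Xy[OF y(2)] t]])
      fix s assume s: "s \<in> {0..t}"
      then have sI: "s \<in> ?I" using t by auto
      have "norm (X (y s) - X (y' s)) \<le> K * norm (y s - y' s)"
        by (rule K(2)) (use y sI in \<open>auto simp: adm_def image_subset_iff\<close>)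
      also have "\<dots> \<le> K * c" by (rule mult_left_mono[OF c[OF sI]]) (use K in auto)
      finally show "norm (X (y s) - X (y' s)) \<le> K * c" .
    qed (use t in auto)
    also have "\<dots> \<le> \<delta> * (K * c)" by (rule mult_right_mono) (use t K c0 in auto)
    also have "\<dots> = (\<delta> * K) * c" by simp
    also have "\<dots> \<le> 1 / 2 * c" by (rule mult_right_mono[OF \<delta>(3) c0])
    finally show ?thesis by simp
  qed
  define y where "y n = (T ^^ n) (\<lambda>_. x0)" for n
  have adm0: "adm (\<lambda>_. x0)" using r by (simp add: adm_def image_subset_iff)
  have admy: "adm (y n)" for n
    unfolding y_def by (induction n) (simp_all add: adm0 admT)
  have step: "norm (y (Suc n) t - y n t) \<le> r * (1/2)^n" if "t \<in> ?I" for n t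
    using that
  proof (induction n arbitrary: t)
    case 0
    then show ?case using admy[of 1] by (auto simp: y_def adm_def image_subset_iff dist_norm norm_minus_commute)
  next
    case (Suc n)
    have "norm (T (y (Suc n)) t - T (y n) t) \<le> (r * (1/2)^n) / 2"
      by (rule contr[OF admy admy Suc.IH Suc.prems])
    then show ?case by (simp add: y_def)
  qed
  define \<xi> where "\<xi> t = x0 + (\<Sum>i. y (Suc i) t - y i t)" for t
  have ul: "uniform_limit ?I y \<xi> sequentially"
  proof -
    have "uniform_limit ?I (\<lambda>n t. \<Sum>i<n. y (Suc i) t - y i t) (\<lambda>t. \<Sum>i. y (Suc i) t - y i t) sequentially"
      by (rule Weierstrass_m_test[OF step]) (auto intro: summable_mult summable_geometric)
    then have "uniform_limit ?I (\<lambda>n t. x0 + (\<Sum>i<n. y (Suc i) t - y i t)) \<xi> sequentially"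
      unfolding \<xi>_def[abs_def] by (intro uniform_limit_add uniform_limit_const)
    moreover have "(\<lambda>n t. x0 + (\<Sum>i<n. y (Suc i) t - y i t)) = y"
    proof (intro ext)
      fix n t
      have "(\<Sum>i<n. y (Suc i) t - y i t) = y n t - y 0 t"
        by (rule sum_lessThan_telescope[where f="\<lambda>i. y i t"])
      moreover have "y 0 t = x0" by (simp add: y_def)
      ultimately show "x0 + (\<Sum>i<n. y (Suc i) t - y i t) = y n t" by simp
    qed
    ultimately show ?thesis by simp
  qed
  have adm: "adm \<xi>"
    unfolding adm_def
  proof
    show "continuous_on ?I \<xi>"
      by (rule uniform_limit_theorem[OF _ ul]) (use admy in \<open>simp_all add: adm_def\<close>)
    show "\<xi> ` ?I \<subseteq> ?C"
    proof (rule image_subsetI)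
      fix t assume t: "t \<in> ?I"
      show "\<xi> t \<in> ?C"
        by (rule closed_sequentially[OF closed_cball _ tendsto_uniform_limitI[OF ul t]])
           (use admy t in \<open>auto simp: adm_def image_subset_iff\<close>)
    qed
  qed
  have fixed: "\<xi> t = T \<xi> t" if t: "t \<in> ?I" for t
  proof -
    have "(\<lambda>n. T (y n) t) \<longlonglongrightarrow> T \<xi> t"
    proof (rule LIMSEQ_I)
      fix e :: real assume e: "e > 0"
      obtain N where N: "\<And>n s. n \<ge> N \<Longrightarrow> s \<in> ?I \<Longrightarrow> dist (y n s) (\<xi> s) < e"
        using uniform_limitD[OF ul e] unfolding eventually_sequentially by blast
      have "norm (T (y n) t - T \<xi> t) < e" if "n \<ge> N" for n
      proof -
        have "norm (T (y n) t - T \<xi> t) \<le> e / 2"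
          by (rule contr[OF admy adm _ t]) (use N[OF that] in \<open>auto simp: dist_norm intro: less_imp_le\<close>)
        then show ?thesis using e by linarith
      qed
      then show "\<exists>no. \<forall>n\<ge>no. norm (T (y n) t - T \<xi> t) < e" by blast
    qed
    moreover have "(\<lambda>n. T (y n) t) \<longlonglongrightarrow> \<xi> t"
      using LIMSEQ_Suc[OF tendsto_uniform_limitI[OF ul t]] by (simp add: y_def)
    ultimately show ?thesis by (rule LIMSEQ_unique[rotated])
  qed
  show ?thesis
  proof (rule that[of \<delta> \<xi>, OF \<delta>(1)])
    show "\<xi> 0 = x0" using fixed[of 0] \<delta>(1) by (simp add: T_def)
    show "\<xi> t \<in> S" if "t \<in> ?I" for t using adm that r(2) by (auto simp: adm_def image_subset_iff subset_iff)
    show "(\<xi> has_vector_derivative X (\<xi> t)) (at t within ?I)" if t: "t \<in> ?I" for t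
      by (rule has_vector_derivative_transform[OF t fixed dT[OF adm t]])
  qed
qed

lemma scaleR_nth: "((r *\<^sub>R v) :: complex^'n) $ i = of_real r * v $ i"
  unfolding vector_scaleR_component by (rule scaleR_conv_of_real)

text \<open>Subpaths, reversed paths and joins all rescale the velocity by a real factor.\<close>

lemma twistor_distribution_scaleR:
  assumes "v \<in> twistor_distribution g e s" shows "r *\<^sub>R v \<in> twistor_distribution g e s"
proof -
  obtain x \<pi> where s: "s = (x, \<pi>)" by (cases s)
  obtain u w where v: "v = (u, w)" by (cases v)
  from assms obtain \<kappa> \<mu> where 1: "u = (\<Sum>A\<in>UNIV. \<Sum>A'\<in>UNIV. (\<kappa> $ A * up \<pi> A') *s e x A A')"
    and 2: "\<And>B. w $ B - (\<Sum>a\<in>UNIV. \<Sum>C'\<in>UNIV. u $ a * spin_conn g e x a B C' * \<pi> $ C') = \<mu> * \<pi> $ B"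
    unfolding s v twistor_distribution_def case_prod_conv mem_Collect_eq by blast
  have "r *\<^sub>R u = (\<Sum>A\<in>UNIV. \<Sum>A'\<in>UNIV. ((r *\<^sub>R \<kappa>) $ A * up \<pi> A') *s e x A A')"
    unfolding 1 by (simp add: vec_eq_iff sum_2_01 scaleR_nth algebra_simps del: vector_scaleR_component)
  moreover have "(r *\<^sub>R w) $ B - (\<Sum>a\<in>UNIV. \<Sum>C'\<in>UNIV. (r *\<^sub>R u) $ a * spin_conn g e x a B C' * \<pi> $ C') = (of_real r * \<mu>) * \<pi> $ B" for B
  proof -
    have "(r *\<^sub>R w) $ B - (\<Sum>a\<in>UNIV. \<Sum>C'\<in>UNIV. (r *\<^sub>R u) $ a * spin_conn g e x a B C' * \<pi> $ C')
      = of_real r * (w $ B - (\<Sum>a\<in>UNIV. \<Sum>C'\<in>UNIV. u $ a * spin_conn g e x a B C' * \<pi> $ C'))"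
      by (simp add: scaleR_nth right_diff_distrib sum_distrib_left mult_ac del: vector_scaleR_component)
    then show ?thesis unfolding 2 by (simp only: mult.assoc)
  qed
  ultimately show ?thesis
    unfolding s v twistor_distribution_def case_prod_conv mem_Collect_eq scaleR_Pair by blast
qed

lemma same_leafI:
  assumes "valid_path c" "\<And>t. t \<in> {0..1} \<Longrightarrow> c t \<in> spin_bundle U" "c 0 = s" "c 1 = s'" "finite F"
    "\<And>t. t \<in> {0..1} - F \<Longrightarrow> \<exists>v \<in> twistor_distribution g e (c t). (c has_vector_derivative v) (at t)"
  shows "(s, s') \<in> same_leaf U g e"
  unfolding same_leaf_def using assms
  by (auto simp: path_image_def pathstart_def pathfinish_def image_subset_iff intro!: exI[of _ c] exI[of _ F])

lemma same_leafE:
  assumes "(s, s') \<in> same_leaf U g e"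
  obtains c F where "valid_path c" "\<And>t. t \<in> {0..1} \<Longrightarrow> c t \<in> spin_bundle U" "c 0 = s" "c 1 = s'" "finite F"
    "\<And>t. t \<in> {0..1} - F \<Longrightarrow> \<exists>v \<in> twistor_distribution g e (c t). (c has_vector_derivative v) (at t)"
  using assms unfolding same_leaf_def
  by (auto simp: path_image_def pathstart_def pathfinish_def image_subset_iff)

lemma same_leaf_refl:
  assumes "s \<in> spin_bundle U" shows "(s, s) \<in> same_leaf U g e"
proof (rule same_leafI[of "\<lambda>_. s" _ _ _ "{}"])
  show "valid_path (\<lambda>_. s)" using valid_path_linepath[of s s] by (simp add: linepath_refl)
  obtain x \<pi> where s: "s = (x, \<pi>)" by (cases s)
  have "(0, 0) \<in> twistor_distribution g e s"
    unfolding s twistor_distribution_def by (auto simp: vec_eq_iff intro!: exI[of _ 0])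
  then show "\<exists>v \<in> twistor_distribution g e s. ((\<lambda>_. s) has_vector_derivative v) (at t)" for t
    unfolding zero_prod_def[symmetric] by (intro bexI[of _ 0] has_vector_derivative_const)
qed (use assms in auto)

lemma same_leaf_subpath:
  assumes c: "valid_path c" "\<And>t. t \<in> {0..1} \<Longrightarrow> c t \<in> spin_bundle U" "finite F"
    and v: "\<And>t. t \<in> {0..1} - F \<Longrightarrow> \<exists>v \<in> twistor_distribution g e (c t). (c has_vector_derivative v) (at t)"
    and r: "r \<in> {0..1}"
  shows "(c 0, c r) \<in> same_leaf U g e"
proof (cases "r = 0")
  case True
  then show ?thesis using c(2)[of 0] by (simp add: same_leaf_refl)
next
  case False
  with r have r0: "r > 0" by simp
  have rt: "r * t \<in> {0..1}" if "t \<in> {0..1}" for t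
    using that r mult_le_one[of r t] by auto
  show ?thesis
  proof (rule same_leafI[of "\<lambda>t. c (r * t)" _ _ _ "(\<lambda>t. r * t) -` F"])
    have "valid_path (subpath 0 r c)" by (rule valid_path_subpath) (use c(1) r in auto)
    then show "valid_path (\<lambda>t. c (r * t))" by (simp add: subpath_def)
    show "finite ((\<lambda>t. r * t) -` F)"
      by (rule finite_vimageI[OF c(3)]) (use r0 in \<open>simp add: inj_on_def\<close>)
    fix t assume t: "t \<in> {0..1} - (\<lambda>t. r * t) -` F"
    then have "r * t \<in> {0..1} - F" using rt by auto
    from v[OF this] obtain v where v: "v \<in> twistor_distribution g e (c (r * t))" "(c has_vector_derivative v) (at (r * t))" by blast
    have "((\<lambda>t. r * t) has_vector_derivative r) (at t)" by (auto intro!: derivative_eq_intros)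
    from vector_diff_chain_at[OF this v(2)]
    have "((\<lambda>t. c (r * t)) has_vector_derivative r *\<^sub>R v) (at t)" by (simp add: o_def)
    then show "\<exists>v \<in> twistor_distribution g e (c (r * t)). ((\<lambda>t. c (r * t)) has_vector_derivative v) (at t)"
      using twistor_distribution_scaleR[OF v(1)] by blast
  qed (use c(2) rt in auto)
qed

context twistor_geometry begin

definition leaf_curve :: "(real \<Rightarrow> complex^(4+2)) \<Rightarrow> real set \<Rightarrow> bool" where
  "leaf_curve \<gamma> F \<longleftrightarrow> continuous_on {0..1} \<gamma> \<and> \<gamma> ` {0..1} \<subseteq> total \<and> finite F \<and>
    (\<forall>t\<in>{0..1} - F. \<exists>w. leaf_velocity (\<gamma> t) w \<and> (\<gamma> has_vector_derivative w) (at t))"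

text \<open>The last clause keeps the intermediate points on the leaf, so that a function defined
  only on a union of leaves can be followed along the curve.\<close>

lemma same_leaf_curve:
  assumes "(s, s') \<in> same_leaf U g e"
  shows "\<exists>\<gamma> F. leaf_curve \<gamma> F \<and> \<gamma> 0 = hat s \<and> \<gamma> 1 = hat s' \<and>
    (\<forall>t\<in>{0..1}. (s, unhat (\<gamma> t)) \<in> same_leaf U g e)"
proof -
  obtain c F where c: "valid_path c" "path_image c \<subseteq> spin_bundle U" "pathstart c = s" "pathfinish c = s'" "finite F"
    and v: "\<And>t. t \<in> {0..1} - F \<Longrightarrow> \<exists>v \<in> twistor_distribution g e (c t). (c has_vector_derivative v) (at t)"
    using assms unfolding same_leaf_def by auto
  have cb: "c t \<in> spin_bundle U" if "t \<in> {0..1}" for t using c(2) that by (auto simp: path_image_def)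
  have cU: "fst (c t) \<in> U" if "t \<in> {0..1}" for t using cb[OF that] by (auto simp: spin_bundle_def)
  have cc: "continuous_on {0..1} c" using valid_path_imp_path[OF c(1)] by (simp add: path_def)
  have "continuous_on {0..1} (\<lambda>t. hat (c t) $ j)" for j :: "4+2"
  proof (cases j)
    case (Inl a)
    then show ?thesis by (simp add: hat_def) (intro continuous_intros cc)
  next
    case (Inr i)
    have "continuous_on {0..1} (\<lambda>t. d (fst (c t)) i $ A)" for A
      by (rule continuous_on_compose2[OF holo_on_imp_continuous_on[OF holo_d]]) (use cU cc in \<open>auto intro!: continuous_intros\<close>)
    note dc = this
    have "continuous_on {0..1} (\<lambda>t. snd (c t) $ A)" for A
      by (intro continuous_intros cc)
    then show ?thesis using Inr
      by (simp add: hat_def dyad_coords_def) (intro continuous_on_sum continuous_on_mult dc)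
  qed
  then have "continuous_on {0..1} (\<lambda>t. \<chi> j. hat (c t) $ j)" by (rule continuous_on_vec_lambda)
  then have "continuous_on {0..1} (\<lambda>t. hat (c t))" by (simp only: vec_nth_inverse)
  then have "leaf_curve (\<lambda>t. hat (c t)) F"
    unfolding leaf_curve_def using hat_total[OF cb] c(5) v hat_velocity cU by blast
  moreover have "(s, unhat (hat (c t))) \<in> same_leaf U g e" if "t \<in> {0..1}" for t
    using same_leaf_subpath[OF c(1) cb c(5) v that] c(3) unhat_hat[OF cU[OF that]]
    by (simp add: pathstart_def)
  ultimately show ?thesis using c(3,4)
    by (intro exI[of _ "\<lambda>t. hat (c t)"] exI[of _ F]) (simp add: pathstart_def pathfinish_def)
qed

definition twistor_fn :: "(complex^(4+2) \<Rightarrow> complex) \<Rightarrow> (complex^(4+2)) set \<Rightarrow> bool" where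
  "twistor_fn f W \<longleftrightarrow> open W \<and> W \<subseteq> total \<and> holo_on f W \<and>
    (\<forall>s\<in>W. (\<forall>A. V A f s = 0) \<and> euler f s = 0)"

lemma twistor_fnD:
  assumes "twistor_fn f W"
  shows "open W" "W \<subseteq> total" "holo_on f W" "\<And>s A. s \<in> W \<Longrightarrow> V A f s = 0" "\<And>s. s \<in> W \<Longrightarrow> euler f s = 0"
  using assms unfolding twistor_fn_def by blast+

lemma twistor_fn_const: "open W \<Longrightarrow> W \<subseteq> total \<Longrightarrow> twistor_fn (\<lambda>_. c) W"
  by (simp add: twistor_fn_def V_def holo_on_const)

lemma leaf_locally_constant:
  assumes \<gamma>: "leaf_curve \<gamma> F" and f: "twistor_fn f W"
    and t0: "t0 \<in> {0..1}" "\<gamma> t0 \<in> W"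
  shows "\<forall>\<^sub>F t in at t0 within {0..1}. \<gamma> t \<in> W \<and> f (\<gamma> t) = f (\<gamma> t0)"
proof -
  have c: "continuous_on {0..1} \<gamma>" and F: "finite F" using \<gamma> by (auto simp: leaf_curve_def)
  obtain N where N: "open N" "t0 \<in> N" "\<And>t. t \<in> {0..1} \<Longrightarrow> t \<in> N \<Longrightarrow> \<gamma> t \<in> W"
    using c[unfolded continuous_on_topological, rule_format, OF t0(1) twistor_fnD(1)[OF f] t0(2)] by blast
  obtain \<delta> where \<delta>: "\<delta> > 0" "ball t0 \<delta> \<subseteq> N" using N open_contains_ball by blast
  let ?J = "{0..1} \<inter> ball t0 \<delta>"
  have J: "\<gamma> t \<in> W" if "t \<in> ?J" for t using that N \<delta> by blast
  \<comment> \<open>The velocity is available outside the finite set \<open>F\<close> only, so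
    constancy is drawn from a derivative that vanishes off a finite set together with
    continuity.\<close>
  have "f (\<gamma> t) = f (\<gamma> t0)" if t: "t \<in> ?J" for t
  proof (rule has_derivative_zero_unique_strong_convex[of ?J F "\<lambda>t. f (\<gamma> t)" t0, OF _ F _ _ refl _ t])
    show "convex ?J" by (intro convex_Int convex_ball) auto
    show "continuous_on ?J (\<lambda>t. f (\<gamma> t))"
      by (rule continuous_on_compose2[OF holo_on_imp_continuous_on[OF twistor_fnD(3)[OF f]] continuous_on_subset[OF c]]) (use J in auto)
    show "t0 \<in> ?J" using t0 \<delta> by auto
    fix u assume u: "u \<in> ?J - F"
    then obtain w where w: "leaf_velocity (\<gamma> u) w" "(\<gamma> has_vector_derivative w) (at u)"
      using \<gamma> unfolding leaf_curve_def by blast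
    have uW: "\<gamma> u \<in> W" using u J by blast
    have "((\<lambda>t. f (\<gamma> t)) has_vector_derivative 0) (at u)"
      using holo_on_curve[OF twistor_fnD(3)[OF f] uW w(2)]
        leaf_velocity_derivative[OF w(1) twistor_fnD(4,5)[OF f uW]] by simp
    then show "((\<lambda>t. f (\<gamma> t)) has_derivative (\<lambda>h. 0)) (at u within ?J)"
      by (simp add: has_vector_derivative_def has_derivative_at_withinI)
  qed
  with J \<delta>(1) show ?thesis
    unfolding eventually_at by (intro exI[of _ \<delta>]) (auto simp: dist_commute)
qed

text \<open>The values of \<open>I\<close> need not be numbers, and the twistor functions that
  determine them locally may change from patch to patch. The projection to a line bundle is an
  invariant of this kind.\<close>

lemma leaf_invariant:
  assumes s: "(s, s') \<in> same_leaf U g e"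
    and I: "\<And>y. y \<in> total \<Longrightarrow> (s, unhat y) \<in> same_leaf U g e \<Longrightarrow> \<exists>W Fs. y \<in> W \<and> open W \<and> W \<subseteq> total \<and> finite Fs \<and>
      (\<forall>f\<in>Fs. twistor_fn f W) \<and> (\<forall>y'\<in>W. (\<forall>f\<in>Fs. f y' = f y) \<longrightarrow> I y' = I y)"
  shows "I (hat s) = I (hat s')"
proof -
  obtain \<gamma> F where \<gamma>: "leaf_curve \<gamma> F" "\<gamma> 0 = hat s" "\<gamma> 1 = hat s'"
    and leaf: "\<And>t. t \<in> {0..1} \<Longrightarrow> (s, unhat (\<gamma> t)) \<in> same_leaf U g e" using same_leaf_curve[OF s] by blast
  have "I (\<gamma> 0) = I (\<gamma> 1)"
  proof (rule connected_local_const[of "{0..1::real}" 0 1 "\<lambda>t. I (\<gamma> t)"])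
    show "\<forall>a\<in>{0..1}. \<forall>\<^sub>F b in at a within {0..1}. I (\<gamma> a) = I (\<gamma> b)"
    proof
      fix a :: real assume a: "a \<in> {0..1}"
      then have "\<gamma> a \<in> total" using \<gamma>(1) by (auto simp: leaf_curve_def)
      from I[OF this leaf[OF a]] obtain W Fs where W: "\<gamma> a \<in> W" "open W" "W \<subseteq> total" "finite Fs"
        and f: "\<forall>f\<in>Fs. twistor_fn f W"
        and i: "\<forall>y'\<in>W. (\<forall>f\<in>Fs. f y' = f (\<gamma> a)) \<longrightarrow> I y' = I (\<gamma> a)" by (elim exE conjE)
      have "\<forall>\<^sub>F t in at a within {0..1}. \<gamma> t \<in> W \<and> f (\<gamma> t) = f (\<gamma> a)" if "f \<in> Fs" for f
        by (rule leaf_locally_constant[OF \<gamma>(1) f[rule_format, OF that] a W(1)])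
      then have "\<forall>\<^sub>F t in at a within {0..1}. \<forall>f\<in>Fs. \<gamma> t \<in> W \<and> f (\<gamma> t) = f (\<gamma> a)"
        by (intro eventually_ball_finite[OF W(4)] ballI)
      moreover have "\<forall>\<^sub>F t in at a within {0..1}. \<gamma> t \<in> W"
        using leaf_locally_constant[OF \<gamma>(1) twistor_fn_const[OF W(2,3)] a W(1), of 0] by simp
      ultimately show "\<forall>\<^sub>F b in at a within {0..1}. I (\<gamma> a) = I (\<gamma> b)"
      proof eventually_elim
        case (elim t)
        have "I (\<gamma> t) = I (\<gamma> a)" by (rule i[rule_format]) (use elim in blast)+
        then show ?case by (rule sym)
      qed
    qed
  qed auto
  then show ?thesis by (simp only: \<gamma>)
qed

end

lemma same_leaf_sym:
  assumes "(s, s') \<in> same_leaf U g e" shows "(s', s) \<in> same_leaf U g e"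
  using assms
proof (rule same_leafE)
  fix c F assume c: "valid_path c" "\<And>t. t \<in> {0..1} \<Longrightarrow> c t \<in> spin_bundle U" "c 0 = s" "c 1 = s'" "finite F"
    and v: "\<And>t. t \<in> {0..1} - F \<Longrightarrow> \<exists>v \<in> twistor_distribution g e (c t). (c has_vector_derivative v) (at t)"
  show ?thesis
  proof (rule same_leafI[of "reversepath c" _ _ _ "(\<lambda>t. 1 - t) ` F"])
    fix t :: real assume t: "t \<in> {0..1} - (\<lambda>t. 1 - t) ` F"
    then have "1 - t \<in> {0..1} - F" by (auto simp: image_iff)
    from v[OF this] obtain v where v: "v \<in> twistor_distribution g e (c (1 - t))" "(c has_vector_derivative v) (at (1 - t))" by blast
    have "((\<lambda>t. 1 - t) has_vector_derivative -1) (at t)" by (auto intro!: derivative_eq_intros)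
    from vector_diff_chain_at[OF this v(2)]
    have "(reversepath c has_vector_derivative -1 *\<^sub>R v) (at t)" by (simp add: reversepath_def o_def)
    then show "\<exists>v \<in> twistor_distribution g e (reversepath c t). (reversepath c has_vector_derivative v) (at t)"
      using twistor_distribution_scaleR[OF v(1), of "-1"] by (auto simp: reversepath_def)
  next
    show "valid_path (reversepath c)" using c(1) by simp
  qed (use c(2-5) in \<open>auto simp: reversepath_def\<close>)
qed

lemma same_leaf_trans:
  assumes "(s, s') \<in> same_leaf U g e" "(s', s'') \<in> same_leaf U g e" shows "(s, s'') \<in> same_leaf U g e"
  using assms(1)
proof (rule same_leafE)
  fix c F assume c: "valid_path c" "\<And>t. t \<in> {0..1} \<Longrightarrow> c t \<in> spin_bundle U" "c 0 = s" "c 1 = s'" "finite F"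
    and v: "\<And>t. t \<in> {0..1} - F \<Longrightarrow> \<exists>v \<in> twistor_distribution g e (c t). (c has_vector_derivative v) (at t)"
  show ?thesis using assms(2)
  proof (rule same_leafE)
    fix b G assume b: "valid_path b" "\<And>t. t \<in> {0..1} \<Longrightarrow> b t \<in> spin_bundle U" "b 0 = s'" "b 1 = s''" "finite G"
      and w: "\<And>t. t \<in> {0..1} - G \<Longrightarrow> \<exists>v \<in> twistor_distribution g e (b t). (b has_vector_derivative v) (at t)"
    show ?thesis
    proof (rule same_leafI[of "c +++ b" _ _ _ "{1/2} \<union> (\<lambda>t. t / 2) ` F \<union> (\<lambda>t. (t + 1) / 2) ` G"])
      show "valid_path (c +++ b)" using c b by (intro valid_path_join) (auto simp: pathstart_def pathfinish_def)
      show "(c +++ b) t \<in> spin_bundle U" if "t \<in> {0..1}" for t using that c(2) b(2) by (auto simp: joinpaths_def)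
      show "(c +++ b) 0 = s" "(c +++ b) 1 = s''" using c b by (auto simp: joinpaths_def)
      show "finite ({1/2} \<union> (\<lambda>t. t / 2) ` F \<union> (\<lambda>t. (t + 1) / 2) ` G)" using c b by auto
      fix t :: real assume t: "t \<in> {0..1} - ({1/2} \<union> (\<lambda>t. t / 2) ` F \<union> (\<lambda>t. (t + 1) / 2) ` G)"
      show "\<exists>v \<in> twistor_distribution g e ((c +++ b) t). ((c +++ b) has_vector_derivative v) (at t)"
      proof (cases "t < 1/2")
        case True
        have "2 * t \<notin> F"
        proof
          assume "2 * t \<in> F"
          then have "(2 * t) / 2 \<in> (\<lambda>t. t / 2) ` F" by (rule imageI)
          then show False using t by simp
        qed
        then obtain v where v: "v \<in> twistor_distribution g e (c (2 * t))" "(c has_vector_derivative v) (at (2 * t))"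
          using v[of "2 * t"] True t by auto
        have "((\<lambda>t. 2 * t) has_vector_derivative 2) (at t)" by (auto intro!: derivative_eq_intros)
        from vector_diff_chain_at[OF this v(2)]
        have "((\<lambda>t. c (2 * t)) has_vector_derivative 2 *\<^sub>R v) (at t)" by (simp add: o_def)
        then have "((c +++ b) has_vector_derivative 2 *\<^sub>R v) (at t)"
          by (rule has_vector_derivative_transform_within_open[of _ _ _ "{..<1/2}"]) (use True in \<open>auto simp: joinpaths_def\<close>)
        then show ?thesis using twistor_distribution_scaleR[OF v(1), of 2] True by (auto simp: joinpaths_def)
      next
        case False
        then have t2: "t > 1/2" using t by auto
        have "2 * t - 1 \<notin> G"
        proof
          assume "2 * t - 1 \<in> G"
          then have "(2 * t - 1 + 1) / 2 \<in> (\<lambda>t. (t + 1) / 2) ` G" by (rule imageI)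
          then show False using t by simp
        qed
        then obtain v where v: "v \<in> twistor_distribution g e (b (2 * t - 1))" "(b has_vector_derivative v) (at (2 * t - 1))"
          using w[of "2 * t - 1"] t2 t by auto
        have "((\<lambda>t. 2 * t - 1) has_vector_derivative 2) (at t)" by (auto intro!: derivative_eq_intros)
        from vector_diff_chain_at[OF this v(2)]
        have "((\<lambda>t. b (2 * t - 1)) has_vector_derivative 2 *\<^sub>R v) (at t)" by (simp add: o_def)
        then have "((c +++ b) has_vector_derivative 2 *\<^sub>R v) (at t)"
          by (rule has_vector_derivative_transform_within_open[of _ _ _ "{1/2<..}"]) (use t2 in \<open>auto simp: joinpaths_def\<close>)
        then show ?thesis using twistor_distribution_scaleR[OF v(1), of 2] t2 by (auto simp: joinpaths_def)
      qed
    qed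
  qed
qed

lemma same_leaf_bundle:
  assumes "(s, s') \<in> same_leaf U g e" shows "s \<in> spin_bundle U" "s' \<in> spin_bundle U"
proof -
  have "s \<in> spin_bundle U \<and> s' \<in> spin_bundle U" using assms
  proof (rule same_leafE)
    fix c assume c: "\<And>t. t \<in> {0..1::real} \<Longrightarrow> c t \<in> spin_bundle U" "c 0 = s" "c 1 = s'"
    show ?thesis using c(1)[of 0] c(1)[of 1] c(2,3) by simp
  qed
  then show "s \<in> spin_bundle U" "s' \<in> spin_bundle U" by auto
qed

lemma equiv_same_leaf: "equiv (spin_bundle U) (same_leaf U g e)"
  by (rule equivI)
     (auto simp: refl_on_def sym_def trans_def
       intro: same_leaf_refl same_leaf_sym same_leaf_trans same_leaf_bundle)

lemma twistor_point_eq_iff: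
  "s \<in> spin_bundle U \<Longrightarrow> s' \<in> spin_bundle U \<Longrightarrow> twistor_point U g e s = twistor_point U g e s' \<longleftrightarrow> (s, s') \<in> same_leaf U g e"
  unfolding twistor_point_def by (rule eq_equiv_class_iff[OF equiv_same_leaf])

lemma twistor_space_eq: "twistor_space U g e = twistor_point U g e ` spin_bundle U"
  by (auto simp: twistor_space_def twistor_point_def quotient_def)

lemma pd_Inl_mk: "pd (Inl a) f s = pd a (\<lambda>x. f (mk x (sz s))) (sx s)"
proof -
  have "mk (sx s + z *s axis a 1) (sz s) = s + z *s axis (Inl a) 1" for z
  proof -
    have "mk (sx s + z *s axis a 1) (sz s) $ j = (s + z *s axis (Inl a) 1) $ j" for j
      by (cases j) (simp_all add: sx_nth sz_nth axis_def)
    then show ?thesis by (simp add: vec_eq_iff)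
  qed
  then show ?thesis by (simp add: pd_def)
qed

context twistor_geometry begin

text \<open>The index of the spinor is lower whereas the dyad has upper indices; trace-freeness of
  the connection translates one parallel equation into the other.\<close>

lemma pd_spinor_at:
  assumes x: "x \<in> U"
  shows "pd a (\<lambda>x. spinor_at x z $ B) x = (\<Sum>C\<in>UNIV. gam x a B C * spinor_at x z $ C)"
proof -
  have "pd a (\<lambda>x. spinor_at x z $ 0) x = z $ 0 * pd a (\<lambda>x. d x 1 $ 1) x - z $ 1 * pd a (\<lambda>x. d x 0 $ 1) x"
    by (simp add: spinor_at_def pd_diff[where S=U] pd_mult[where S=U] holo_on_mult holo_d x)
  moreover have "pd a (\<lambda>x. spinor_at x z $ 1) x = z $ 1 * pd a (\<lambda>x. d x 0 $ 0) x - z $ 0 * pd a (\<lambda>x. d x 1 $ 0) x"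
    by (simp add: spinor_at_def pd_diff[where S=U] pd_mult[where S=U] holo_on_mult holo_d x)
  ultimately show ?thesis
    by (cases B rule: exhaust_2_01) (simp_all add: pd_d[OF x] sum_2_01 gam_tr[OF x] spinor_at_def algebra_simps)
qed

lemma holo_spinor_at: "S \<subseteq> total \<Longrightarrow> holo_on (\<lambda>s. spinor_at (sx s) (sz s) $ B) S"
  by (cases B rule: exhaust_2_01)
     (simp_all add: spinor_at_def, (intro holo_on_diff holo_on_mult holo_sz holo_on_sx[OF holo_d] total_sx, assumption+)+)

lemma hmap_leaf_field: "S \<subseteq> total \<Longrightarrow> hmap_on (\<lambda>s. mk (vel \<kappa> s) (\<mu> *s sz s)) S"
proof -
  assume S: "S \<subseteq> total"
  have "holo_on (\<lambda>s. mk (vel \<kappa> s) (\<mu> *s sz s) $ j) S" for j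
  proof (cases j)
    case (Inl a)
    have "holo_on (\<lambda>s. eh A i (sx s) $ a) S" for A i
      by (rule holo_on_sx[OF hmap_onD[OF hmap_eh]]) (rule total_sx[OF S])
    then show ?thesis
      by (simp add: Inl vel_def) (intro holo_on_sum holo_on_mult holo_on_diff holo_on_const holo_sz)
  next
    case (Inr i)
    then show ?thesis by (simp add: holo_on_mult holo_sz)
  qed
  then show ?thesis by (simp add: hmap_on_def)
qed

definition unhat_deriv :: "complex^(4+2) \<Rightarrow> complex^(4+2) \<Rightarrow> (complex^4) \<times> (complex^2)" where
  "unhat_deriv s w = (sx w, \<chi> B. \<Sum>j\<in>UNIV. pd j (\<lambda>s. spinor_at (sx s) (sz s) $ B) s * w $ j)"

lemma unhat_curve:
  assumes g: "(\<gamma> has_vector_derivative w) (at t)" and s: "\<gamma> t \<in> total"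
  shows "((\<lambda>t. unhat (\<gamma> t)) has_vector_derivative unhat_deriv (\<gamma> t) w) (at t)"
  unfolding unhat_def unhat_deriv_def
proof (rule has_vector_derivative_Pair)
  show "((\<lambda>t. sx (\<gamma> t)) has_vector_derivative sx w) (at t)"
    by (rule has_vector_derivative_vec)
       (simp add: sx_nth bounded_linear.has_vector_derivative[OF bounded_linear_vec_nth g])
  show "((\<lambda>t. spinor_at (sx (\<gamma> t)) (sz (\<gamma> t))) has_vector_derivative
      (\<chi> B. \<Sum>j\<in>UNIV. pd j (\<lambda>s. spinor_at (sx s) (sz s) $ B) (\<gamma> t) * w $ j)) (at t)"
    by (rule has_vector_derivative_vec) (simp add: holo_on_curve[OF holo_spinor_at[OF order_refl] s g])
qed

text \<open>The converse of \<open>hat_velocity\<close>: in the given frame the connection term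
  reappears through the derivative of \<open>spinor_at\<close>.\<close>

lemma unhat_deriv_distribution:
  assumes s: "s \<in> total"
  shows "unhat_deriv s (mk (vel \<kappa> s) (\<mu> *s sz s)) \<in> twistor_distribution g e (unhat s)"
proof -
  let ?x = "sx s" and ?z = "sz s"
  let ?\<pi> = "spinor_at ?x ?z"
  have x: "?x \<in> U" using s by (simp add: total_def)
  have "(\<Sum>j\<in>UNIV. pd j (\<lambda>s. spinor_at (sx s) (sz s) $ B) s * mk (vel \<kappa> s) (\<mu> *s sz s) $ j)
      = (\<Sum>a\<in>UNIV. \<Sum>C\<in>UNIV. vel \<kappa> s $ a * gam ?x a B C * ?\<pi> $ C) + \<mu> * ?\<pi> $ B" for B
  proof -
    have "euler (\<lambda>s. spinor_at (sx s) (sz s) $ B) s = of_nat 1 * ?\<pi> $ B"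
      by (rule euler_homogeneous[OF holo_spinor_at[OF order_refl] s]) (simp add: spinor_at_scale)
    then have "(\<Sum>i\<in>UNIV. pd (Inr i) (\<lambda>s. spinor_at (sx s) (sz s) $ B) s * (\<mu> * ?z $ i)) = \<mu> * ?\<pi> $ B"
      by (simp add: euler_def sum_distrib_left[symmetric] mult_ac)
    moreover have "pd (Inl a) (\<lambda>s. spinor_at (sx s) (sz s) $ B) s = (\<Sum>C\<in>UNIV. gam ?x a B C * ?\<pi> $ C)" for a
      by (simp add: pd_Inl_mk pd_spinor_at[OF x])
    ultimately show ?thesis
      by (simp add: sum_UNIV_Plus sum_distrib_left mult_ac)
  qed
  moreover have "vel \<kappa> s = (\<Sum>A\<in>UNIV. \<Sum>A'\<in>UNIV. (\<kappa> $ A * up ?\<pi> A') *s e ?x A A')"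
    unfolding up_spinor_at vel_def eh_def sum_2_01 by (simp add: vec_eq_iff algebra_simps)
  ultimately show ?thesis
    unfolding unhat_deriv_def unhat_def twistor_distribution_def
    by auto
qed

text \<open>Integral curves of the leaf fields stay in one leaf. As \<open>\<kappa>\<close> and
  \<open>\<mu>\<close> range over all complex values, every direction of the distribution is the
  initial velocity of such a curve.\<close>

lemma orbit:
  assumes W: "open W" "W \<subseteq> total" and s: "s \<in> W"
  shows "\<exists>\<delta> \<xi>. \<delta> > 0 \<and> \<xi> 0 = s \<and> (\<forall>t\<in>{0..\<delta>}. \<xi> t \<in> W \<and> (unhat s, unhat (\<xi> t)) \<in> same_leaf U g e \<and>
    (\<xi> has_vector_derivative mk (vel \<kappa> (\<xi> t)) (\<mu> *s sz (\<xi> t))) (at t within {0..\<delta>}))"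
proof -
  define X where "X s = mk (vel \<kappa> s) (\<mu> *s sz s)" for s
  have hX: "hmap_on X W" unfolding X_def by (rule hmap_leaf_field[OF W(2)])
  obtain \<delta> \<xi> where \<delta>: "\<delta> > 0" "\<xi> 0 = s" and \<xi>W: "\<And>t. t \<in> {0..\<delta>} \<Longrightarrow> \<xi> t \<in> W"
    and d\<xi>: "\<And>t. t \<in> {0..\<delta>} \<Longrightarrow> (\<xi> has_vector_derivative X (\<xi> t)) (at t within {0..\<delta>})"
    by (rule ode_solution[OF hX W(1) s], rule that)
  have c\<xi>: "continuous_on {0..\<delta>} \<xi>" by (rule continuous_on_vector_derivative[OF d\<xi>])
  have "(unhat s, unhat (\<xi> r)) \<in> same_leaf U g e" if r: "r \<in> {0..\<delta>}" for r
  proof (cases "r = 0")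
    case True
    then show ?thesis using \<delta> s W(2) by (simp add: same_leaf_refl unhat_bundle subset_iff)
  next
    case False
    with r have r0: "r > 0" by simp
    have rt: "r * t \<in> {0..\<delta>}" if "t \<in> {0..1}" for t
      using that r mult_left_le[of t r] by auto
    define c where "c t = unhat (\<xi> (r * t))" for t
    define D where "D t = unhat_deriv (\<xi> (r * t)) (r *\<^sub>R X (\<xi> (r * t)))" for t
    \<comment> \<open>The solution has one-sided derivatives at its ends, so the two end points are
      put into the exceptional set of the path.\<close>
    have dc: "(c has_vector_derivative D t) (at t)" if t: "t \<in> {0..1} - {0,1}" for t
      unfolding c_def[abs_def] D_def
    proof (rule unhat_curve)
      have "r * t < r" "0 < r * t" using t r0 by auto
      then have i: "r * t \<in> interior {0..\<delta>}" using r by auto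
      have "(\<xi> has_vector_derivative X (\<xi> (r * t))) (at (r * t))"
        using d\<xi>[OF subsetD[OF interior_subset i]] by (simp only: at_within_interior[OF i])
      moreover have "((\<lambda>t. r * t) has_vector_derivative r) (at t)" by (auto intro!: derivative_eq_intros)
      ultimately show "((\<lambda>t. \<xi> (r * t)) has_vector_derivative r *\<^sub>R X (\<xi> (r * t))) (at t)"
        using vector_diff_chain_at[of "\<lambda>t. r * t" r t \<xi>] by (simp add: o_def)
      show "\<xi> (r * t) \<in> total" using \<xi>W[OF rt] t W(2) by auto
    qed
    have cr: "continuous_on {0..1} (\<lambda>t. \<xi> (r * t))"
      by (rule continuous_on_compose2[OF c\<xi>]) (use rt in \<open>auto intro!: continuous_intros\<close>)
    have crW: "(\<lambda>t. \<xi> (r * t)) ` {0..1} \<subseteq> W" using rt \<xi>W by blast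
    have hsp: "holo_on (\<lambda>s. spinor_at (sx s) (sz s) $ B) W" for B by (rule holo_spinor_at[OF W(2)])
    have "continuous_on W unhat"
    proof -
      have "continuous_on W (\<lambda>s. \<chi> B. spinor_at (sx s) (sz s) $ B)"
        by (rule continuous_on_vec_lambda[OF holo_on_imp_continuous_on[OF hsp]])
      then have "continuous_on W (\<lambda>s. spinor_at (sx s) (sz s))" by (simp only: vec_nth_inverse)
      then show ?thesis unfolding unhat_def[abs_def] by (intro continuous_on_Pair continuous_on_sx)
    qed
    then have cc: "continuous_on {0..1} c"
      unfolding c_def[abs_def] by (rule continuous_on_compose2[OF _ cr crW])
    have "continuous_on W (\<lambda>s. unhat_deriv s (r *\<^sub>R X s))"
      unfolding unhat_deriv_def
    proof (intro continuous_on_Pair continuous_on_vec_lambda)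
      show "continuous_on W (\<lambda>s. sx (r *\<^sub>R X s))"
        by (rule continuous_on_compose2[OF continuous_on_sx[of UNIV]])
           (auto intro!: continuous_intros hmap_on_continuous[OF hX])
      fix B
      show "continuous_on W (\<lambda>s. \<Sum>j\<in>UNIV. pd j (\<lambda>s. spinor_at (sx s) (sz s) $ B) s * (r *\<^sub>R X s) $ j)"
        unfolding vector_scaleR_component
        by (intro continuous_on_sum continuous_on_mult continuous_on_scaleR continuous_on_const
            pd_continuous[OF W(1) hsp] holo_on_imp_continuous_on[OF hmap_onD[OF hX]])
    qed
    then have cD: "continuous_on {0..1} D"
      unfolding D_def[abs_def] by (rule continuous_on_compose2[OF _ cr crW])
    show ?thesis
    proof (rule same_leafI[of c _ _ _ "{0,1}"])
      show "valid_path c"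
        unfolding valid_path_def piecewise_C1_differentiable_on_def C1_differentiable_on_def
      proof (intro conjI exI[of _ "{0,1}"] exI[of _ D] ballI)
        show "continuous_on ({0..1} - {0,1}) D" by (rule continuous_on_subset[OF cD]) auto
      qed (use cc dc in auto)
      show "c t \<in> spin_bundle U" if "t \<in> {0..1}" for t
        unfolding c_def by (rule unhat_bundle) (use \<xi>W[OF rt[OF that]] W(2) in blast)
      show "c 0 = unhat s" "c 1 = unhat (\<xi> r)" by (simp_all add: c_def \<delta>)
      fix t :: real assume t: "t \<in> {0..1} - {0,1}"
      have T: "\<xi> (r * t) \<in> total" using \<xi>W[OF rt] t W(2) by auto
      have "D t = unhat_deriv (\<xi> (r * t)) (mk (vel (r *\<^sub>R \<kappa>) (\<xi> (r * t))) ((of_real r * \<mu>) *s sz (\<xi> (r * t))))"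
      proof -
        have "r *\<^sub>R X y = mk (vel (r *\<^sub>R \<kappa>) y) ((of_real r * \<mu>) *s sz y)" for y
        proof -
          have "(r *\<^sub>R X y) $ j = mk (vel (r *\<^sub>R \<kappa>) y) ((of_real r * \<mu>) *s sz y) $ j" for j
            by (cases j) (simp_all add: X_def vel_def scaleR_nth sum_2_01 algebra_simps del: vector_scaleR_component)
          then show ?thesis by (simp add: vec_eq_iff)
        qed
        then show ?thesis by (simp add: D_def)
      qed
      also have "\<dots> \<in> twistor_distribution g e (c t)"
        unfolding c_def by (rule unhat_deriv_distribution[OF T])
      finally show "\<exists>v\<in>twistor_distribution g e (c t). (c has_vector_derivative v) (at t)"
        using dc[OF t] by blast
    qed auto
  qed
  with \<delta> \<xi>W d\<xi> show ?thesis unfolding X_def by blast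
qed

text \<open>The function is constant along each orbit, so its derivative in every leaf direction is
  zero. This is the converse of \<open>leaf_locally_constant\<close>.\<close>

lemma leafwise_constant_twistor_fn:
  assumes W: "open W" "W \<subseteq> total" and f: "holo_on f W"
    and inv: "\<And>s s'. s \<in> W \<Longrightarrow> s' \<in> W \<Longrightarrow> (unhat s, unhat s') \<in> same_leaf U g e \<Longrightarrow> f s' = f s"
  shows "twistor_fn f W"
proof -
  have z: "(\<Sum>j\<in>UNIV. pd j f s * mk (vel \<kappa> s) (\<mu> *s sz s) $ j) = 0" if s: "s \<in> W" for s \<kappa> \<mu>
  proof -
    obtain \<delta> \<xi> where \<delta>: "\<delta> > 0" "\<xi> 0 = s" and \<xi>: "\<forall>t\<in>{0..\<delta>}. \<xi> t \<in> W \<and> (unhat s, unhat (\<xi> t)) \<in> same_leaf U g e \<and>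
      (\<xi> has_vector_derivative mk (vel \<kappa> (\<xi> t)) (\<mu> *s sz (\<xi> t))) (at t within {0..\<delta>})"
      using orbit[OF W s] by blast
    have 0: "(0::real) \<in> {0..\<delta>}" using \<delta> by simp
    have 1: "((\<lambda>t. f (\<xi> t)) has_vector_derivative (\<Sum>j\<in>UNIV. pd j f (\<xi> 0) * mk (vel \<kappa> (\<xi> 0)) (\<mu> *s sz (\<xi> 0)) $ j)) (at 0 within {0..\<delta>})"
      by (rule holo_on_curve[OF f]) (use \<xi> 0 in blast)+
    have 2: "((\<lambda>t. f (\<xi> t)) has_vector_derivative 0) (at 0 within {0..\<delta>})"
    proof (rule has_vector_derivative_transform[OF 0 _ has_vector_derivative_const])
      fix t assume "t \<in> {0..\<delta>}"
      then show "f (\<xi> t) = f s" using \<xi> inv[OF s] by blast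
    qed
    show ?thesis
      using vector_derivative_unique_within_closed_interval[OF \<delta>(1), of 0] 1 2 \<delta> by (simp add: cbox_interval)
  qed
  have "V A f s = 0" if s: "s \<in> W" for A s
  proof -
    have "(\<Sum>j\<in>UNIV. pd j f s * mk (vel (axis A 1) s) (0 *s sz s) $ j) = V A f s"
      by (cases A rule: exhaust_2_01)
         (simp_all add: sum_UNIV_Plus vel_def V_def along_def sum_2_01 axis_def sum_distrib_left sum_subtractf algebra_simps)
    with z[OF s] show ?thesis by metis
  qed
  moreover have "euler f s = 0" if s: "s \<in> W" for s
  proof -
    have "(\<Sum>j\<in>UNIV. pd j f s * mk (vel 0 s) (1 *s sz s) $ j) = euler f s"
      by (simp add: sum_UNIV_Plus vel_def euler_def mult_ac)
    with z[OF s] show ?thesis by metis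
  qed
  ultimately show ?thesis using W f by (simp add: twistor_fn_def)
qed

end

section \<open>The twistor function of a Killing spinor\<close>

lemma along_sz_fun: "along Y (\<lambda>s. F (sz s)) s = 0"
  by (simp add: along_def pd_Inl_mk)

locale killing_geometry = twistor_geometry +
  fixes k :: nat and L :: "complex^4 \<Rightarrow> 2 list \<Rightarrow> complex"
  assumes killing: "killing_spinor U g e k L"
begin

lemma holo_L: "length bs = k \<Longrightarrow> holo_on (\<lambda>x. L x bs) U"
  using killing unfolding killing_spinor_def by blast

definition Q :: "complex^(4+2) \<Rightarrow> complex" where
  "Q s = contract k (L (sx s)) (spinor_at (sx s) (sz s))"

text \<open>The quantities whose nonvanishing defines \<open>regular_twistors\<close>, in dyad
  coordinates.\<close>

definition grad_Q :: "2 \<Rightarrow> 2 \<Rightarrow> complex^(4+2) \<Rightarrow> complex" where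
  "grad_Q A A' s = contract k (\<lambda>bs. nabla_spinor g e L (sx s) A A' bs) (spinor_at (sx s) (sz s))"

lemma holo_Q: "S \<subseteq> total \<Longrightarrow> holo_on Q S"
  unfolding Q_def[abs_def] contract_def up_spinor_at
  by (intro holo_on_sum holo_on_mult holo_on_prod holo_on_diff holo_sz holo_on_sx[OF holo_d] holo_on_sx[OF holo_L] total_sx) auto

lemma Q_scale: "Q (mk x (c *s z)) = c ^ k * Q (mk x z)"
  by (simp add: Q_def spinor_at_scale contract_scale)

lemma along_eh_Q:
  assumes s: "s \<in> total"
  shows "along (eh A i) Q s = (\<Sum>A'\<in>UNIV. d (sx s) i $ A' * grad_Q A A' s)"
proof -
  let ?x = "sx s" and ?\<pi> = "spinor_at (sx s) (sz s)"
  have x: "?x \<in> U" using s by (simp add: total_def)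
  define N where "N a = contract k (\<lambda>bs. pd a (\<lambda>x. L x bs) ?x - (\<Sum>i<k. \<Sum>C\<in>UNIV. gam ?x a (bs!i) C * L ?x (bs[i := C]))) ?\<pi>" for a
  have 1: "pd (Inl a) Q s = N a" for a
    unfolding pd_Inl_mk N_def using pd_contract(2)[where a=a and z="sz s" and k=k and T=L, OF holo_L x] by (simp add: Q_def)
  have 2: "grad_Q A A' s = (\<Sum>a\<in>UNIV. e ?x A A' $ a * N a)" for A'
    unfolding grad_Q_def N_def contract_cmult[symmetric] contract_sum[symmetric]
    by (rule contract_cong) (simp add: nabla_spinor_def)
  have "along (eh A i) Q s = (\<Sum>a\<in>UNIV. (\<Sum>A'\<in>UNIV. d ?x i $ A' * e ?x A A' $ a) * N a)"
    by (simp add: along_def 1 eh_def)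
  also have "\<dots> = (\<Sum>A'\<in>UNIV. d ?x i $ A' * (\<Sum>a\<in>UNIV. e ?x A A' $ a * N a))"
    unfolding sum_distrib_left sum_distrib_right by (subst sum.swap) (simp add: mult_ac)
  finally show ?thesis by (simp only: 2)
qed

text \<open>\<open>V A\<close> contracts the derivative index with one more copy of the spinor. The
  resulting full contraction of the gradient depends on its symmetric part only, which is zero by
  the Killing equation.\<close>

lemma V_Q:
  assumes s: "s \<in> total"
  shows "V A Q s = 0"
proof -
  have x: "sx s \<in> U" using s by (simp add: total_def)
  let ?\<pi> = "spinor_at (sx s) (sz s)"
  let ?T = "\<lambda>cs. nabla_spinor g e L (sx s) A (hd cs) (tl cs)"
  have "V A Q s = (\<Sum>A'\<in>UNIV. up ?\<pi> A' * grad_Q A A' s)"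
    unfolding V_def along_eh_Q[OF s] up_spinor_at sum_2_01 by (simp add: algebra_simps)
  also have "\<dots> = contract (Suc k) ?T ?\<pi>"
    by (simp add: contract_Suc grad_Q_def)
  also have "\<dots> = contract (Suc k) (symmetrise (Suc k) ?T) ?\<pi>"
    by (rule contract_symmetrise[symmetric])
  also have "\<dots> = 0"
    by (rule contract_zero) (use killing x in \<open>simp add: killing_spinor_def\<close>)
  finally show ?thesis .
qed

definition patch :: "2 \<Rightarrow> (complex^(4+2)) set" where
  "patch i = {s \<in> total. sz s $ i \<noteq> 0}"

lemma patchD: "s \<in> patch i \<Longrightarrow> s \<in> total" "s \<in> patch i \<Longrightarrow> sz s $ i \<noteq> 0"
  by (simp_all add: patch_def)

lemma patch_total: "patch i \<subseteq> total" by (auto simp: patch_def)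

lemma open_patch: "open (patch i)"
proof -
  have "patch i = total \<inter> (\<lambda>s. sz s $ i) -` (- {0})" by (auto simp: patch_def)
  moreover have "open ((\<lambda>s. sz s $ i) -` (- {0}))"
    by (rule open_vimage) (auto intro: holo_on_imp_continuous_on[OF holo_sz])
  ultimately show ?thesis using open_total by (metis open_Int)
qed

lemma total_patch: "s \<in> total \<Longrightarrow> \<exists>i. s \<in> patch i"
  by (auto simp: total_def patch_def vec_eq_iff)

text \<open>The fibre coordinate of the line bundle of degree \<open>k\<close> over the patch
  \<open>i\<close>; \<open>zz\<close> below supplies the base coordinate.\<close>

definition qq :: "2 \<Rightarrow> complex^(4+2) \<Rightarrow> complex" where
  "qq i s = Q s / sz s $ i ^ k"

definition zz :: "2 \<Rightarrow> 2 \<Rightarrow> complex^(4+2) \<Rightarrow> complex" where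
  "zz i j s = sz s $ j / sz s $ i"

lemma holo_zz: "S \<subseteq> patch i \<Longrightarrow> holo_on (zz i j) S"
  unfolding zz_def[abs_def] by (intro holo_on_divide holo_sz) (auto simp: patch_def)

lemma holo_qq: "S \<subseteq> patch i \<Longrightarrow> holo_on (qq i) S"
  unfolding qq_def[abs_def]
  by (intro holo_on_divide holo_Q holo_on_power holo_sz) (auto simp: patch_def)

lemma twistor_fn_zz: "twistor_fn (zz i j) (patch i)"
proof -
  have "V A (zz i j) s = 0" for A s
    unfolding V_def zz_def[abs_def]
    using along_sz_fun[of "eh A 0" "\<lambda>z. z $ j / z $ i" s] along_sz_fun[of "eh A 1" "\<lambda>z. z $ j / z $ i" s] by simp
  moreover have "euler (zz i j) s = of_nat 0 * zz i j s" if "s \<in> patch i" for s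
    by (rule euler_homogeneous[OF holo_zz[OF order_refl] that]) (simp add: zz_def)
  ultimately show ?thesis
    by (simp add: twistor_fn_def open_patch patch_total holo_zz)
qed

lemma twistor_fn_qq: "twistor_fn (qq i) (patch i)"
proof -
  have "V A (qq i) s = 0" if s: "s \<in> patch i" for A s
  proof -
    have 1: "holo_on (\<lambda>s. sz s $ i ^ k) (patch i)" by (intro holo_on_power holo_sz)
    have "V A Q s = V A (\<lambda>s. qq i s * sz s $ i ^ k) s"
      unfolding V_def using along_cong[OF open_patch s, of Q "\<lambda>s. qq i s * sz s $ i ^ k"]
      by (simp add: qq_def patch_def)
    also have "\<dots> = qq i s * V A (\<lambda>s. sz s $ i ^ k) s + V A (qq i) s * sz s $ i ^ k"
      by (rule V_mult[OF holo_qq[OF order_refl] 1 s])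
    also have "V A (\<lambda>s. sz s $ i ^ k) s = 0"
      unfolding V_def using along_sz_fun[of _ "\<lambda>z. z $ i ^ k" s] by simp
    finally show ?thesis using V_Q[OF patchD(1)[OF s]] patchD(2)[OF s] by simp
  qed
  moreover have "euler (qq i) s = of_nat 0 * qq i s" if s: "s \<in> patch i" for s
  proof (rule euler_homogeneous[OF holo_qq[OF order_refl] s])
    fix c :: complex assume "c \<noteq> 0"
    then show "qq i (mk (sx s) (c *s sz s)) = c ^ 0 * qq i s"
      using patchD(2)[OF s] by (simp add: qq_def Q_scale power_mult_distrib)
  qed
  ultimately show ?thesis
    by (simp add: twistor_fn_def open_patch patch_total holo_qq)
qed

text \<open>Over a patch a point of the line bundle is fixed by the ratios \<open>zz i j\<close> and
  by \<open>qq i\<close>, which are twistor functions, so \<open>leaf_invariant\<close>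
  applies.\<close>

lemma O_point_invariant:
  assumes "(s, s') \<in> same_leaf U g e"
  shows "O_point (int k) (sz (hat s)) (Q (hat s)) = O_point (int k) (sz (hat s')) (Q (hat s'))"
proof (rule leaf_invariant[OF assms, of "\<lambda>y. O_point (int k) (sz y) (Q y)"])
  fix y assume "y \<in> total"
  then obtain i where y: "y \<in> patch i" using total_patch by blast
  show "\<exists>W Fs. y \<in> W \<and> open W \<and> W \<subseteq> total \<and> finite Fs \<and> (\<forall>f\<in>Fs. twistor_fn f W) \<and>
    (\<forall>y'\<in>W. (\<forall>f\<in>Fs. f y' = f y) \<longrightarrow> O_point (int k) (sz y') (Q y') = O_point (int k) (sz y) (Q y))"
  proof (intro exI conjI)
    show "finite {zz i 0, zz i 1, qq i}" by simp
    show "\<forall>f\<in>{zz i 0, zz i 1, qq i}. twistor_fn f (patch i)"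
      by (simp add: twistor_fn_zz twistor_fn_qq)
    show "\<forall>y'\<in>patch i. (\<forall>f\<in>{zz i 0, zz i 1, qq i}. f y' = f y) \<longrightarrow>
       O_point (int k) (sz y') (Q y') = O_point (int k) (sz y) (Q y)"
    proof (intro ballI impI)
      fix y' assume y': "y' \<in> patch i" and "\<forall>f\<in>{zz i 0, zz i 1, qq i}. f y' = f y"
      then have z: "zz i j y' = zz i j y" and q: "qq i y' = qq i y" for j
        by (cases j rule: exhaust_2_01; simp)+
      let ?c = "sz y' $ i / sz y $ i"
      note n = patchD(2)[OF y] patchD(2)[OF y']
      have "sz y' = ?c *s sz y"
        using z n by (simp add: vec_eq_iff zz_def field_simps)
      moreover have "Q y' = ?c powi int k * Q y"
        using q n by (simp add: qq_def field_simps power_divide)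
      moreover have "?c \<noteq> 0" using n by simp
      ultimately show "O_point (int k) (sz y') (Q y') = O_point (int k) (sz y) (Q y)"
        by (metis O_point_scale)
    qed
  qed (use y open_patch patch_total in auto)
qed

text \<open>The value does not depend on the chosen representative of the leaf, by
  \<open>O_point_invariant\<close>.\<close>

definition pmap :: "((complex^4) \<times> (complex^2)) set \<Rightarrow> ((complex^2) \<times> complex) set" where
  "pmap X = (let s = SOME s. s \<in> spin_bundle U \<and> twistor_point U g e s = X
     in O_point (int k) (sz (hat s)) (Q (hat s)))"

lemma pmap_hat:
  assumes "s \<in> spin_bundle U"
  shows "pmap (twistor_point U g e s) = O_point (int k) (sz (hat s)) (Q (hat s))"
proof -
  define s' where "s' = (SOME s'. s' \<in> spin_bundle U \<and> twistor_point U g e s' = twistor_point U g e s)"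
  have "s' \<in> spin_bundle U \<and> twistor_point U g e s' = twistor_point U g e s"
    unfolding s'_def by (rule someI[of _ s]) (use assms in simp)
  then have "(s', s) \<in> same_leaf U g e" using twistor_point_eq_iff[of s' U s g e] assms by blast
  from O_point_invariant[OF this] show ?thesis by (simp add: pmap_def s'_def)
qed

lemma pmap_spinor:
  assumes "x \<in> U" "\<pi> \<noteq> 0"
  shows "pmap (twistor_point U g e (x, \<pi>)) = O_point (int k) (dyad_coords (d x) \<pi>) (contract k (L x) \<pi>)"
  using pmap_hat[of "(x, \<pi>)"] assms
  by (simp add: spin_bundle_def hat_def Q_def spinor_at_dyad_coords)

end

section \<open>Local structure of twistor space\<close>

locale twistor_setting = killing_geometry +
  fixes \<A> :: "((complex^4) \<times> (complex^2)) set chart set"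
  assumes atlas: "twistor_atlas U g e \<A>" and conn: "connected U"
begin

abbreviation "TS \<equiv> twistor_space U g e"

definition tp :: "complex^(4+2) \<Rightarrow> ((complex^4) \<times> (complex^2)) set" where
  "tp s = twistor_point U g e (unhat s)"

text \<open>The union of the leaves in \<open>K\<close>, in dyad coordinates. Openness and
  holomorphy on twistor space are tested on such saturated sets.\<close>

definition sat :: "((complex^4) \<times> (complex^2)) set set \<Rightarrow> (complex^(4+2)) set" where
  "sat K = {s \<in> total. tp s \<in> K}"

lemma satD: "s \<in> sat K \<Longrightarrow> s \<in> total" "s \<in> sat K \<Longrightarrow> tp s \<in> K"
  by (auto simp: sat_def)

lemma sat_total: "sat K \<subseteq> total" by (auto simp: sat_def)

lemma sat_mono: "K \<subseteq> W \<Longrightarrow> sat K \<subseteq> sat W" by (auto simp: sat_def)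

lemma tp_in: "s \<in> total \<Longrightarrow> tp s \<in> TS"
  by (simp add: tp_def twistor_space_eq unhat_bundle)

lemma tp_onto: "p \<in> TS \<Longrightarrow> \<exists>s\<in>total. tp s = p"
proof -
  assume "p \<in> TS"
  then obtain s where s: "s \<in> spin_bundle U" "p = twistor_point U g e s" by (auto simp: twistor_space_eq)
  then have "tp (hat s) = p" using unhat_hat[of s] by (auto simp: tp_def spin_bundle_def)
  then show ?thesis using hat_total[OF s(1)] by blast
qed

lemma tp_eq_iff: "s \<in> total \<Longrightarrow> s' \<in> total \<Longrightarrow> tp s = tp s' \<longleftrightarrow> (unhat s, unhat s') \<in> same_leaf U g e"
  unfolding tp_def by (rule twistor_point_eq_iff[OF unhat_bundle unhat_bundle])

lemma pmap_tp: "s \<in> total \<Longrightarrow> pmap (tp s) = O_point (int k) (sz s) (Q s)"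
  unfolding tp_def using pmap_hat[OF unhat_bundle] by (simp add: hat_unhat)

lemma leafwise_constant_tp:
  assumes "open (sat K)" "holo_on (\<lambda>s. h (tp s)) (sat K)"
  shows "twistor_fn (\<lambda>s. h (tp s)) (sat K)"
proof (rule leafwise_constant_twistor_fn[OF assms(1) sat_total assms(2)])
  fix s s' assume "s \<in> sat K" "s' \<in> sat K" "(unhat s, unhat s') \<in> same_leaf U g e"
  then show "h (tp s') = h (tp s)" using tp_eq_iff[of s s'] satD(1) by metis
qed

text \<open>The curve that joins two points of a leaf stays in the saturated set, so the function
  can be followed along it. Thus twistor functions on saturated sets descend to twistor
  space.\<close>

lemma saturated_invariant:
  assumes f: "twistor_fn f (sat K)" and s: "s \<in> sat K" "s' \<in> sat K" "tp s = tp s'"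
  shows "f s = f s'"
proof -
  note t = satD(1)[OF s(1)] satD(1)[OF s(2)]
  have "f (hat (unhat s)) = f (hat (unhat s'))"
  proof (rule leaf_invariant[of "unhat s" "unhat s'" f])
    show "(unhat s, unhat s') \<in> same_leaf U g e" using tp_eq_iff[OF t] s(3) by blast
    fix y assume y: "y \<in> total" "(unhat s, unhat y) \<in> same_leaf U g e"
    then have "y \<in> sat K" using tp_eq_iff[OF t(1) y(1)] s(1) by (simp add: sat_def)
    then show "\<exists>W Fs. y \<in> W \<and> open W \<and> W \<subseteq> total \<and> finite Fs \<and> (\<forall>f\<in>Fs. twistor_fn f W) \<and>
       (\<forall>y'\<in>W. (\<forall>f\<in>Fs. f y' = f y) \<longrightarrow> f y' = f y)"
      using f twistor_fnD(1,2)[OF f] by (intro exI[of _ "sat K"] exI[of _ "{f}"]) simp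
  qed
  then show ?thesis by (simp add: hat_unhat t)
qed

lemma has_derivative_unhat:
  assumes s: "s \<in> total"
  shows "(unhat has_derivative unhat_deriv s) (at s)"
proof -
  have 1: "(sx has_derivative sx) (at s)"
    by (rule has_derivative_vec) (simp add: sx_nth bounded_linear_imp_has_derivative[OF bounded_linear_vec_nth])
  have 2: "((\<lambda>s. spinor_at (sx s) (sz s)) has_derivative (\<lambda>w. \<chi> B. \<Sum>j\<in>UNIV. pd j (\<lambda>s. spinor_at (sx s) (sz s) $ B) s * w $ j)) (at s)"
    by (rule has_derivative_vec) (simp add: holo_onD[OF holo_spinor_at[OF order_refl] s])
  show ?thesis
    unfolding unhat_def[abs_def] unhat_deriv_def[abs_def] by (rule has_derivative_Pair[OF 1 2])
qed

text \<open>The derivative is block triangular, with the identity on space-time and the invertible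
  linear map \<open>spinor_at\<close> on the fibre, so a preimage can be written down.\<close>

lemma surj_unhat_deriv:
  assumes s: "s \<in> total"
  shows "surj (unhat_deriv s)"
proof (rule surjI)
  fix y :: "(complex^4) \<times> (complex^2)"
  let ?x = "sx s"
  have x: "?x \<in> U" using s by (simp add: total_def)
  define m where "m = (\<chi> B. \<Sum>a\<in>UNIV. pd (Inl a) (\<lambda>s. spinor_at (sx s) (sz s) $ B) s * fst y $ a)"
  define z where "z = dyad_coords (d ?x) (snd y - m)"
  have pr: "pd (Inr i) (\<lambda>s. spinor_at (sx s) (sz s) $ B) s = spinor_at ?x (axis i 1) $ B" for i B
  proof -
    have sh: "s + z *s axis (Inr i) 1 = mk ?x (sz s + z *s axis i 1)" for z
    proof -
      have "(s + z *s axis (Inr i) 1) $ j = mk ?x (sz s + z *s axis i 1) $ j" for j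
        by (cases j) (simp_all add: sx_nth sz_nth axis_def)
      then show ?thesis by (simp add: vec_eq_iff)
    qed
    have "spinor_at ?x (sz s + z *s axis i 1) $ B = spinor_at ?x (sz s) $ B + z * spinor_at ?x (axis i 1) $ B" for z
      by (simp add: spinor_at_def algebra_simps)
    then have "pd (Inr i) (\<lambda>s. spinor_at (sx s) (sz s) $ B) s
      = deriv (\<lambda>z. spinor_at ?x (sz s) $ B + z * spinor_at ?x (axis i 1) $ B) 0"
      by (simp add: pd_def sh)
    also have "\<dots> = spinor_at ?x (axis i 1) $ B"
      by (rule DERIV_imp_deriv) (auto intro!: derivative_eq_intros)
    finally show ?thesis .
  qed
  have 1: "(\<Sum>i\<in>UNIV. spinor_at ?x (axis i 1) $ B * z $ i) = spinor_at ?x z $ B" for B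
    by (simp add: spinor_at_def sum_2_01 axis_def algebra_simps)
  have 2: "spinor_at ?x z = snd y - m" unfolding z_def by (rule spinor_at_dyad_coords[OF x])
  have "unhat_deriv s (mk (fst y) z) = y"
    by (simp add: unhat_deriv_def sum_UNIV_Plus pr 1 2 m_def vec_eq_iff prod_eq_iff)
  then show "unhat_deriv s (mk (fst y) z) = y" .
qed

lemma chart_props:
  assumes "(K, \<phi>) \<in> \<A>"
  shows "K \<subseteq> TS" "inj_on \<phi> K" "open (\<phi> ` K)" "open (sat K)"
proof -
  have "compatible_chart TS \<A> (K, \<phi>)"
    using atlas assms unfolding twistor_atlas_def complex_3_manifold_def by blast
  then show "K \<subseteq> TS" "inj_on \<phi> K" "open (\<phi> ` K)" by (simp_all add: compatible_chart_def)
  have "open {s \<in> spin_bundle U. twistor_point U g e s \<in> K}"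
    using atlas assms unfolding twistor_atlas_def by blast
  moreover have "continuous_on total unhat"
    by (rule continuous_at_imp_continuous_on, rule ballI, rule has_derivative_continuous, rule has_derivative_unhat)
  ultimately have "open (total \<inter> unhat -` {s \<in> spin_bundle U. twistor_point U g e s \<in> K})"
    by (intro continuous_open_preimage open_total)
  moreover have "total \<inter> unhat -` {s \<in> spin_bundle U. twistor_point U g e s \<in> K} = sat K"
    using unhat_bundle by (auto simp: sat_def tp_def)
  ultimately show "open (sat K)" by simp
qed

lemma chart_cover: "p \<in> TS \<Longrightarrow> \<exists>K \<phi>. (K, \<phi>) \<in> \<A> \<and> p \<in> K"
proof -
  assume p: "p \<in> TS"
  have "(\<Union>(K, \<phi>)\<in>\<A>. K) = TS"
    using atlas unfolding twistor_atlas_def complex_3_manifold_def by (elim conjE)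
  then have "p \<in> (\<Union>(K, \<phi>)\<in>\<A>. K)" using p by simp
  then show ?thesis by auto
qed

text \<open>Charts are submersions in the original frame; composition with the surjective derivative
  of \<open>unhat\<close> transfers this to dyad coordinates.\<close>

lemma chart_derivative:
  assumes c: "(K, \<phi>) \<in> \<A>" and s: "s \<in> sat K"
  shows "\<exists>M. ((\<lambda>s. \<phi> (tp s)) has_derivative (\<lambda>v. M *v v)) (at s) \<and> surj (\<lambda>v. M *v v)"
proof -
  note t = satD(1)[OF s]
  have "\<forall>s\<in>spin_bundle U. twistor_point U g e s \<in> K \<longrightarrow> (\<exists>(D :: complex^4^3) (E :: complex^2^3).
      ((\<lambda>s. \<phi> (twistor_point U g e s)) has_derivative (\<lambda>(u, w). D *v u + E *v w)) (at s) \<and>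
      surj (\<lambda>(u, w). D *v u + E *v w))"
    using atlas c unfolding twistor_atlas_def by blast
  with unhat_bundle[OF t] satD(2)[OF s] obtain D :: "complex^4^3" and E :: "complex^2^3" where
    D: "((\<lambda>s. \<phi> (twistor_point U g e s)) has_derivative (\<lambda>(u, w). D *v u + E *v w)) (at (unhat s))"
    and surj: "surj (\<lambda>(u, w). D *v u + E *v w)" unfolding tp_def by blast
  define C :: "complex^(4+2)^3" where "C = (\<chi> i j. case j of Inl a \<Rightarrow> D $ i $ a | Inr _ \<Rightarrow> 0)"
  define M :: "complex^(4+2)^3" where
    "M = (\<chi> i j. C $ i $ j + (\<Sum>B\<in>UNIV. E $ i $ B * pd j (\<lambda>s. spinor_at (sx s) (sz s) $ B) s))"
  have M: "(\<lambda>(u, w). D *v u + E *v w) (unhat_deriv s v) = M *v v" for v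
  proof -
    have "(M *v v) $ i = (\<Sum>j\<in>UNIV. C $ i $ j * v $ j) + (\<Sum>j\<in>UNIV. \<Sum>B\<in>UNIV. E $ i $ B * pd j (\<lambda>s. spinor_at (sx s) (sz s) $ B) s * v $ j)" for i
      by (simp add: M_def matrix_vector_mult_def distrib_right sum.distrib sum_distrib_right)
    moreover have "(\<Sum>j\<in>UNIV. C $ i $ j * v $ j) = (D *v sx v) $ i" for i
      by (simp add: C_def sum_UNIV_Plus matrix_vector_mult_def sx_nth)
    moreover have "(\<Sum>j\<in>UNIV. \<Sum>B\<in>UNIV. E $ i $ B * pd j (\<lambda>s. spinor_at (sx s) (sz s) $ B) s * v $ j)
       = (E *v (\<chi> B. \<Sum>j\<in>UNIV. pd j (\<lambda>s. spinor_at (sx s) (sz s) $ B) s * v $ j)) $ i" for i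
      unfolding matrix_vector_mult_def sum_distrib_left vec_lambda_beta by (subst sum.swap) (simp only: mult.assoc)
    ultimately show ?thesis by (simp add: unhat_deriv_def vec_eq_iff)
  qed
  have "((\<lambda>s. \<phi> (tp s)) has_derivative (\<lambda>v. M *v v)) (at s)"
    unfolding tp_def M[symmetric] by (rule has_derivative_compose[OF has_derivative_unhat[OF t] D])
  moreover have "surj (\<lambda>v. M *v v)"
    unfolding M[symmetric] using comp_surj[OF surj_unhat_deriv[OF t] surj] by (simp add: o_def)
  ultimately show ?thesis by blast
qed

lemma chart_hmap:
  assumes c: "(K, \<phi>) \<in> \<A>" shows "hmap_on (\<lambda>s. \<phi> (tp s)) (sat K)"
proof -
  have "\<forall>s. \<exists>M. s \<in> sat K \<longrightarrow> ((\<lambda>s. \<phi> (tp s)) has_derivative (\<lambda>v. M *v v)) (at s)"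
    using chart_derivative[OF c] by blast
  then obtain M where "\<And>s. s \<in> sat K \<Longrightarrow> ((\<lambda>s. \<phi> (tp s)) has_derivative (\<lambda>v. M s *v v)) (at s)" by metis
  then show ?thesis by (rule hmap_onI)
qed

lemma chart_surj:
  assumes c: "(K, \<phi>) \<in> \<A>" and s: "s \<in> sat K"
  shows "surj (\<lambda>v. jac (\<lambda>s. \<phi> (tp s)) s *v v)"
  using chart_derivative[OF c s] jac_eqI by blast

lemma chart_twistor_fn: "(K, \<phi>) \<in> \<A> \<Longrightarrow> twistor_fn (\<lambda>s. \<phi> (tp s) $ i) (sat K)"
  by (rule leafwise_constant_tp[OF chart_props(4) hmap_onD[OF chart_hmap]])

lemma open_sat_preimage:
  assumes c: "(K, \<phi>) \<in> \<A>" and B: "open B"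
  shows "open (sat {p \<in> K. \<phi> p \<in> B})"
proof -
  have "open (sat K \<inter> (\<lambda>s. \<phi> (tp s)) -` B)"
    by (rule continuous_open_preimage[OF hmap_on_continuous[OF chart_hmap[OF c]] chart_props(4)[OF c] B])
  moreover have "sat K \<inter> (\<lambda>s. \<phi> (tp s)) -` B = sat {p \<in> K. \<phi> p \<in> B}" by (auto simp: sat_def)
  ultimately show ?thesis by simp
qed

lemma open_sat:
  assumes W: "atlas_open TS \<A> W" shows "open (sat W)"
proof -
  have "sat W = (\<Union>(K, \<phi>)\<in>\<A>. sat {p \<in> K. \<phi> p \<in> \<phi> ` (W \<inter> K)})"
  proof (intro set_eqI iffI)
    fix s assume s: "s \<in> sat W"
    then obtain K \<phi> where "(K, \<phi>) \<in> \<A>" "tp s \<in> K" using chart_cover[OF tp_in[OF satD(1)[OF s]]] by blast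
    then show "s \<in> (\<Union>(K, \<phi>)\<in>\<A>. sat {p \<in> K. \<phi> p \<in> \<phi> ` (W \<inter> K)})" using s by (auto simp: sat_def)
  next
    fix s assume "s \<in> (\<Union>(K, \<phi>)\<in>\<A>. sat {p \<in> K. \<phi> p \<in> \<phi> ` (W \<inter> K)})"
    then obtain K \<phi> where c: "(K, \<phi>) \<in> \<A>" and s: "s \<in> total" "tp s \<in> K" "\<phi> (tp s) \<in> \<phi> ` (W \<inter> K)" by (auto simp: sat_def)
    then have "tp s \<in> W" using inj_on_image_mem_iff[OF chart_props(2)[OF c] s(2), of "W \<inter> K"] by blast
    then show "s \<in> sat W" using s by (simp add: sat_def)
  qed
  moreover have "open (\<phi> ` (W \<inter> K))" if "(K, \<phi>) \<in> \<A>" for K \<phi>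
    using W that by (auto simp: atlas_open_def)
  ultimately show ?thesis using open_sat_preimage by auto
qed

text \<open>The Hausdorff property in the form needed upstairs: disjoint families of leaves whose
  unions are open.\<close>

lemma separated:
  assumes "p \<in> TS" "q \<in> TS" "p \<noteq> q"
  shows "\<exists>N N'. open (sat N) \<and> open (sat N') \<and> p \<in> N \<and> q \<in> N' \<and> N \<inter> N' = {}"
proof -
  have "\<forall>p\<in>TS. \<forall>q\<in>TS. p \<noteq> q \<longrightarrow>
        (\<exists>V W. atlas_open TS \<A> V \<and> atlas_open TS \<A> W \<and> p \<in> V \<and> q \<in> W \<and> V \<inter> W = {})"
    using atlas unfolding twistor_atlas_def complex_3_manifold_def by (elim conjE)
  with assms obtain N N' where "atlas_open TS \<A> N" "atlas_open TS \<A> N'" "p \<in> N" "q \<in> N'" "N \<inter> N' = {}" by blast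
  then show ?thesis using open_sat by blast
qed

text \<open>A submersion has local sections: restrict it to the affine slice spanned by a right
  inverse \<open>B\<close> of its derivative, where the inverse function theorem applies.\<close>

lemma local_section:
  assumes c: "(K, \<phi>) \<in> \<A>" and s0: "s0 \<in> sat K"
  shows "\<exists>r \<sigma>. r > 0 \<and> ball (\<phi> (tp s0)) r \<subseteq> \<phi> ` K \<and> hmap_on \<sigma> (ball (\<phi> (tp s0)) r) \<and>
    (\<forall>w\<in>ball (\<phi> (tp s0)) r. \<sigma> w \<in> sat K \<and> \<phi> (tp (\<sigma> w)) = w) \<and> \<sigma> (\<phi> (tp s0)) = s0"
proof -
  define F where "F s = \<phi> (tp s)" for s
  have F: "hmap_on F (sat K)" unfolding F_def[abs_def] by (rule chart_hmap[OF c])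
  obtain B where B: "jac F s0 ** B = mat 1"
    using chart_surj[OF c s0] unfolding F_def[abs_def] matrix_right_invertible_surjective[symmetric] by blast
  define S where "S = {w. s0 + B *v w \<in> sat K}"
  have aff: "hmap_on (\<lambda>w. s0 + B *v w) T" for T by (rule hmap_on_affine)
  have S: "open S"
  proof -
    have "S = (\<lambda>w. s0 + B *v w) -` sat K" by (auto simp: S_def)
    then show ?thesis using open_vimage[OF chart_props(4)[OF c] hmap_on_continuous[OF aff]] by simp
  qed
  define H where "H w = F (s0 + B *v w)" for w
  have H: "hmap_on H S" unfolding H_def[abs_def] by (rule hmap_on_compose[OF F aff]) (simp add: S_def)
  have 0: "0 \<in> S" using s0 by (simp add: S_def)
  have "jac H 0 = jac F s0 ** B"
  proof (rule jac_eqI)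
    have "((\<lambda>w. s0 + B *v w) has_derivative (\<lambda>v. B *v v)) (at 0)"
      by (auto intro!: derivative_eq_intros bounded_linear_imp_has_derivative matrix_vector_mul_bounded_linear)
    from has_derivative_compose[OF this, of F "\<lambda>v. jac F s0 *v v"] hmap_on_derivative[OF F s0]
    show "(H has_derivative (\<lambda>v. (jac F s0 ** B) *v v)) (at 0)"
      by (simp add: H_def[abs_def] matrix_vector_mul_assoc)
  qed
  then have J: "mat 1 ** jac H 0 = mat 1" using B by simp
  obtain U' V' G where G: "0 \<in> U'" "U' \<subseteq> S" "open V'" "homeomorphism U' V' H G" "hmap_on G V'"
    by (rule holo_inverse_function[OF H S 0 J], rule that)
  have H0: "H 0 = F s0" by (simp add: H_def)
  have "F s0 \<in> V'" using G(1,4) H0 by (metis homeomorphism_image1 imageI)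
  then obtain r where r: "r > 0" "ball (F s0) r \<subseteq> V'" using G(3) open_contains_ball by blast
  define \<sigma> where "\<sigma> w = s0 + B *v G w" for w
  have \<sigma>: "\<sigma> w \<in> sat K" "F (\<sigma> w) = w" if "w \<in> ball (F s0) r" for w
  proof -
    have w: "w \<in> V'" using that r(2) by blast
    then have "G w \<in> U'" using G(4) by (metis homeomorphism_image2 imageI)
    then show "\<sigma> w \<in> sat K" using G(2) by (auto simp: \<sigma>_def S_def)
    show "F (\<sigma> w) = w" using homeomorphism_apply2[OF G(4) w] by (simp add: \<sigma>_def H_def)
  qed
  show ?thesis
    unfolding F_def[symmetric]
  proof (intro exI conjI ballI)
    show "hmap_on \<sigma> (ball (F s0) r)"
      unfolding \<sigma>_def[abs_def] by (rule hmap_on_compose[OF aff[of UNIV] hmap_on_subset[OF G(5) r(2)]]) simp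
    show "ball (F s0) r \<subseteq> \<phi> ` K"
    proof
      fix w assume w: "w \<in> ball (F s0) r"
      have "\<phi> (tp (\<sigma> w)) \<in> \<phi> ` K" by (rule imageI[OF satD(2)[OF \<sigma>(1)[OF w]]])
      then show "w \<in> \<phi> ` K" using \<sigma>(2)[OF w] by (simp add: F_def)
    qed
    show "\<sigma> (F s0) = s0" using homeomorphism_apply1[OF G(4,1)] H0 by (simp add: \<sigma>_def)
  qed (use r \<sigma> in auto)
qed

end

section \<open>Symmetric tensors as polynomials and the density of regular twistors\<close>

definition sym_tensor :: "nat \<Rightarrow> (2 list \<Rightarrow> complex) \<Rightarrow> bool" where
  "sym_tensor k T \<longleftrightarrow> (\<forall>bs cs. length bs = k \<and> mset cs = mset bs \<longrightarrow> T cs = T bs)"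

lemma sym_tensorD: "sym_tensor k T \<Longrightarrow> length bs = k \<Longrightarrow> mset cs = mset bs \<Longrightarrow> T cs = T bs"
  unfolding sym_tensor_def by blast

lemma sym_tensor_Cons: "sym_tensor (Suc k) T \<Longrightarrow> sym_tensor k (\<lambda>bs. T (c # bs))"
  unfolding sym_tensor_def by simp

lemma holo_up: "holo_on (\<lambda>\<pi>. up \<pi> c) S"
  unfolding up_def by (intro holo_on_sum holo_on_mult holo_on_const holo_on_nth)

lemma pd_up: "pd b (\<lambda>\<pi>. up \<pi> c) \<pi> = eps c b"
  by (cases c rule: exhaust_2_01; cases b rule: exhaust_2_01)
     (simp_all add: up_simps eps_def pd_minus[OF holo_on_nth UNIV_I])

lemma holo_contract: "holo_on (contract k T) S"
  unfolding contract_def[abs_def] by (intro holo_on_sum holo_on_mult holo_on_prod holo_on_const holo_up)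

text \<open>By symmetry the \<open>Suc k\<close> slots contribute equally when the polynomial of the
  tensor is differentiated.\<close>

lemma pd_contract_symmetric:
  "sym_tensor (Suc k) T \<Longrightarrow> pd b (contract (Suc k) T) \<pi>
    = of_nat (Suc k) * (\<Sum>c\<in>UNIV. eps c b * contract k (\<lambda>bs. T (c # bs)) \<pi>)"
proof (induction k arbitrary: T)
  case 0
  have "pd b (contract (Suc 0) T) \<pi> = pd b (\<lambda>\<pi>. \<Sum>c\<in>UNIV. up \<pi> c * T [c]) \<pi>"
    by (simp add: contract_Suc[abs_def])
  also have "\<dots> = (\<Sum>c\<in>UNIV. eps c b * T [c])"
    by (subst pd_sum[OF holo_on_mult[OF holo_up holo_on_const] UNIV_I])
       (simp add: pd_mult[OF holo_up holo_on_const UNIV_I] pd_up)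
  finally show ?case by simp
next
  case (Suc k)
  note s = sym_tensor_Cons[OF Suc.prems]
  have sw: "contract k (\<lambda>bs. T (c # c' # bs)) \<pi> = contract k (\<lambda>bs. T (c' # c # bs)) \<pi>" for c c'
    by (rule contract_cong, rule sym_tensorD[OF Suc.prems]) simp_all
  have "pd b (contract (Suc (Suc k)) T) \<pi> = pd b (\<lambda>\<pi>. \<Sum>c\<in>UNIV. up \<pi> c * contract (Suc k) (\<lambda>bs. T (c # bs)) \<pi>) \<pi>"
    by (simp only: contract_Suc[of "Suc k", abs_def])
  also have "\<dots> = (\<Sum>c\<in>UNIV. up \<pi> c * pd b (contract (Suc k) (\<lambda>bs. T (c # bs))) \<pi> + eps c b * contract (Suc k) (\<lambda>bs. T (c # bs)) \<pi>)"
    by (subst pd_sum[OF holo_on_mult[OF holo_up holo_contract] UNIV_I])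
       (simp only: pd_mult[OF holo_up holo_contract UNIV_I] pd_up)
  also have "\<dots> = of_nat (Suc (Suc k)) * (\<Sum>c\<in>UNIV. eps c b * contract (Suc k) (\<lambda>bs. T (c # bs)) \<pi>)"
    unfolding Suc.IH[OF s] contract_Suc[of k] sum_2_01 sw[of 1 0] by (simp add: algebra_simps)
  finally show ?case .
qed

text \<open>Polarisation by differentiation: the derivatives of the polynomial also vanish on the
  open set, and they give the polynomials of the tensor with one index fixed.\<close>

lemma contract_zero_open:
  assumes N: "open N" "N \<noteq> {}"
  shows "sym_tensor k T \<Longrightarrow> (\<And>\<pi>. \<pi> \<in> N \<Longrightarrow> contract k T \<pi> = 0) \<Longrightarrow> length bs = k \<Longrightarrow> T bs = 0"
proof (induction k arbitrary: T bs)
  case 0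
  then show ?case using N(2) by auto
next
  case (Suc k)
  obtain c bs' where bs: "bs = c # bs'" "length bs' = k" using Suc.prems(3) by (cases bs) auto
  have "contract k (\<lambda>bs. T (c # bs)) \<pi> = 0" if \<pi>: "\<pi> \<in> N" for \<pi>
  proof -
    have "pd b (contract (Suc k) T) \<pi> = 0" for b
      using pd_cong[OF N(1) \<pi>, where f="contract (Suc k) T" and g="\<lambda>_. 0"] Suc.prems(2) by simp
    then have "(\<Sum>c\<in>UNIV. eps c b * contract k (\<lambda>bs. T (c # bs)) \<pi>) = 0" for b
      unfolding pd_contract_symmetric[OF Suc.prems(1)] mult_eq_0_iff of_nat_eq_0_iff by blast
    from this[of 0] this[of 1] show ?thesis
      by (cases c rule: exhaust_2_01) (simp_all add: sum_2_01 eps_def)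
  qed
  from Suc.IH[OF sym_tensor_Cons[OF Suc.prems(1)] this bs(2)] show ?case by (simp add: bs)
qed

lemma hmap_mk: "hmap_on (\<lambda>x. mk x z) S" "hmap_on (\<lambda>z. mk x z) T"
proof -
  have "holo_on (\<lambda>x. mk x z $ j) S" "holo_on (\<lambda>z. mk x z $ j) T" for j
    by (cases j; simp)+
  then show "hmap_on (\<lambda>x. mk x z) S" "hmap_on (\<lambda>z. mk x z) T" by (simp_all add: hmap_on_def)
qed

context twistor_setting begin

lemma holo_nabla: "length bs = k \<Longrightarrow> holo_on (\<lambda>x. nabla_spinor g e L x A A' bs) U"
  unfolding nabla_spinor_def
  by (intro holo_on_sum holo_on_mult holo_on_diff holo_e holo_on_pd_holo[OF open_U] holo_L holo_gam) simp_all

text \<open>A permutation of the indices also permutes the slots in which the connection acts, so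
  the sum over slots is merely reordered.\<close>

lemma sym_tensor_nabla:
  assumes x: "x \<in> U" shows "sym_tensor k (nabla_spinor g e L x A A')"
  unfolding sym_tensor_def
proof (intro allI impI)
  fix bs cs :: "2 list" assume "length bs = k \<and> mset cs = mset bs"
  then have bs: "length bs = k" and cs: "mset cs = mset bs" by auto
  have Ls: "L y cs' = L y bs'" if "y \<in> U" "length bs' = k" "mset cs' = mset bs'" for y bs' cs'
    using killing that unfolding killing_spinor_def by blast
  obtain p where p: "p permutes {..<length bs}" "permute_list p bs = cs"
    by (rule mset_eq_permutation[OF cs])
  have len: "length cs = length bs" using mset_eq_length[OF cs] .
  have pd: "pd a (\<lambda>y. L y cs) x = pd a (\<lambda>y. L y bs) x" for a
    by (rule pd_cong[OF open_U x]) (rule Ls[OF _ bs cs])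
  have "(\<Sum>i<length cs. \<Sum>C\<in>UNIV. gam x a (cs!i) C * L x (cs[i := C]))
     = (\<Sum>i<length bs. \<Sum>C\<in>UNIV. gam x a (bs!(p i)) C * L x (bs[p i := C]))" for a
  proof (rule sum.cong)
    fix i assume "i \<in> {..<length bs}"
    then have i: "i < length bs" by simp
    have pi: "p i < length bs" using permutes_in_image[OF p(1)] i by auto
    have ci: "cs ! i = bs ! p i" using p i by (simp add: permute_list_nth[OF p(1)] p(2)[symmetric])
    have "L x (cs[i := C]) = L x (bs[p i := C])" for C
    proof (rule Ls[OF x])
      show "mset (cs[i := C]) = mset (bs[p i := C])"
        using i pi by (simp add: mset_update len cs ci)
    qed (use bs in simp)
    then show "(\<Sum>C\<in>UNIV. gam x a (cs!i) C * L x (cs[i := C])) = (\<Sum>C\<in>UNIV. gam x a (bs!(p i)) C * L x (bs[p i := C]))"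
      by (simp only: ci)
  qed (simp add: len)
  also have "(\<Sum>i<length bs. \<Sum>C\<in>UNIV. gam x a (bs!(p i)) C * L x (bs[p i := C]))
     = (\<Sum>i<length bs. \<Sum>C\<in>UNIV. gam x a (bs!i) C * L x (bs[i := C]))" for a
    by (rule sum.permute[OF p(1), unfolded o_def, symmetric])
  finally show "nabla_spinor g e L x A A' cs = nabla_spinor g e L x A A' bs"
    unfolding nabla_spinor_def pd by simp
qed

lemma regularI:
  assumes "s \<in> total" "grad_Q A A' s \<noteq> 0"
  shows "tp s \<in> regular_twistors U g e k L"
  unfolding regular_twistors_def
proof (intro CollectI exI conjI)
  show "tp s = twistor_point U g e (sx s, spinor_at (sx s) (sz s))" by (simp add: tp_def unhat_def)
  show "(sx s, spinor_at (sx s) (sz s)) \<in> spin_bundle U" using unhat_bundle[OF assms(1)] by (simp add: unhat_def)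
  show "contract k (nabla_spinor g e L (sx s) A A') (spinor_at (sx s) (sz s)) \<noteq> 0"
    using assms(2) by (simp add: grad_Q_def)
qed

lemma regularE:
  assumes "p \<in> regular_twistors U g e k L"
  obtains s A A' where "s \<in> total" "tp s = p" "grad_Q A A' s \<noteq> 0"
proof -
  obtain x \<pi> A A' where p: "p = twistor_point U g e (x, \<pi>)" "(x, \<pi>) \<in> spin_bundle U"
      "contract k (\<lambda>bs. nabla_spinor g e L x A A' bs) \<pi> \<noteq> 0"
    using assms unfolding regular_twistors_def by blast
  have x: "x \<in> U" using p(2) by (simp add: spin_bundle_def)
  show ?thesis
  proof (rule that[of "hat (x, \<pi>)" A A', OF hat_total[OF p(2)]])
    show "tp (hat (x, \<pi>)) = p" using p(1) unhat_hat[of "(x, \<pi>)"] x by (simp add: tp_def)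
    show "grad_Q A A' (hat (x, \<pi>)) \<noteq> 0" using p(3) by (simp add: grad_Q_def hat_def spinor_at_dyad_coords[OF x])
  qed
qed

text \<open>Otherwise the gradient of the Killing spinor contracts to zero over an open set of the
  spin bundle. By polarisation it vanishes on an open set of space-time, by the identity theorem
  everywhere, and the Killing spinor would be constant.\<close>

lemma regular_dense:
  assumes N: "atlas_open TS \<A> N" "N \<noteq> {}"
  shows "N \<inter> regular_twistors U g e k L \<noteq> {}"
proof
  assume empty: "N \<inter> regular_twistors U g e k L = {}"
  have oN: "open (sat N)" by (rule open_sat[OF N(1)])
  have z: "grad_Q A A' s = 0" if "s \<in> sat N" for A A' s
    using regularI[OF satD(1)[OF that]] satD(2)[OF that] empty by blast
  obtain s0 where s0: "s0 \<in> sat N"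
    using N tp_onto unfolding atlas_open_def sat_def by blast
  define X where "X = (\<lambda>x. mk x (sz s0)) -` sat N"
  have X: "open X" unfolding X_def by (rule open_vimage[OF oN hmap_on_continuous[OF hmap_mk(1)]])
  have sX: "sx s0 \<in> X" using s0 by (simp add: X_def)
  have XU: "X \<subseteq> U" using satD(1) by (fastforce simp: X_def total_def)
  have nz: "nabla_spinor g e L x A A' bs = 0" if x: "x \<in> X" and bs: "length bs = k" for x A A' bs
  proof -
    have xU: "x \<in> U" using XU x by blast
    define P where "P = {\<pi>. mk x (dyad_coords (d x) \<pi>) \<in> sat N}"
    have "hmap_on (\<lambda>\<pi>. dyad_coords (d x) \<pi>) UNIV"
      unfolding hmap_on_def dyad_coords_def by (simp add: holo_on_sum holo_on_mult)
    then have "hmap_on (\<lambda>\<pi>. mk x (dyad_coords (d x) \<pi>)) UNIV"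
      by (rule hmap_on_compose[OF hmap_mk(2)[of _ UNIV]]) simp
    from open_vimage[OF oN hmap_on_continuous[OF this]] have "open P" by (simp add: P_def vimage_def)
    moreover have "spinor_at x (sz s0) \<in> P"
      using x by (simp add: P_def X_def dyad_coords_spinor_at[OF xU])
    moreover have "contract k (nabla_spinor g e L x A A') \<pi> = 0" if "\<pi> \<in> P" for \<pi>
      using z[of "mk x (dyad_coords (d x) \<pi>)" A A'] that by (simp add: P_def grad_Q_def spinor_at_dyad_coords[OF xU])
    ultimately show ?thesis using contract_zero_open[OF _ _ sym_tensor_nabla[OF xU] _ bs, of P] by blast
  qed
  have "nabla_spinor g e L x A A' bs = 0" if "x \<in> U" "length bs = k" for x A A' bs
    by (rule holo_on_identity[OF holo_nabla[OF that(2)] open_U conn X _ XU _ that(1)]) (use sX nz that(2) in auto)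
  then show False using killing unfolding killing_spinor_def by blast
qed

end

section \<open>Darboux coordinates\<close>

text \<open>Integration in the direction \<open>i\<close> from the hyperplane through the centre,
  rescaled to the unit interval so that holomorphy follows from the theorem on integrals with a
  parameter.\<close>

lemma holo_primitive:
  fixes f :: "complex^'n \<Rightarrow> complex"
  assumes f: "holo_on f (ball c \<delta>)"
  shows "\<exists>S. holo_on S (ball c \<delta>) \<and> (\<forall>v\<in>ball c \<delta>. pd i S v = f v) \<and> S c = 0"
proof -
  let ?B = "ball c \<delta>"
  define seg where "seg v t = (\<chi> m. if m = i then c $ i + of_real t * (v $ i - c $ i) else v $ m)" for v :: "complex^'n" and t :: real
  have segB: "seg v t \<in> ?B" if v: "v \<in> ?B" and t: "t \<in> {0..1}" for v t
  proof -
    have "norm (seg v t - c) \<le> norm (v - c)"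
    proof (rule norm_le_componentwise_cart)
      fix m show "norm ((seg v t - c) $ m) \<le> norm ((v - c) $ m)"
        using t by (auto simp: seg_def norm_mult intro: mult_left_le_one_le)
    qed
    then show ?thesis using v by (simp add: dist_norm norm_minus_commute)
  qed
  have hseg: "hmap_on (\<lambda>v. seg v t) T" for t T
  proof -
    have "holo_on (\<lambda>v. seg v t $ m) T" for m
      by (cases "m = i") (simp_all add: seg_def holo_on_add holo_on_mult holo_on_diff)
    then show ?thesis by (simp add: hmap_on_def)
  qed
  have pseg: "pd i (\<lambda>v. seg v t $ m) v = (if m = i then of_real t else 0)" for t m v
    by (cases "m = i") (auto simp: seg_def pd_add[OF holo_on_const _ UNIV_I] pd_mult[OF holo_on_const _ UNIV_I]
        pd_diff[OF _ holo_on_const UNIV_I] holo_on_mult holo_on_diff)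
  have cseg: "continuous_on T (\<lambda>(v,t). seg v t)" for T
    unfolding case_prod_beta
  proof -
    have "continuous_on T (\<lambda>p. \<chi> m. if m = i then c $ i + of_real (snd p) * (fst p $ i - c $ i) else fst p $ m)"
    proof (rule continuous_on_vec_lambda)
      fix m show "continuous_on T (\<lambda>p. if m = i then c $ i + of_real (snd p) * (fst p $ i - c $ i) else fst p $ m)"
        by (cases "m = i") (simp_all, (intro continuous_intros)+)
    qed
    then show "continuous_on T (\<lambda>p. seg (fst p) (snd p))" by (simp only: seg_def)
  qed
  have cont: "continuous_on (?B \<times> {0..1}) (\<lambda>(v,t). F (seg v t))" if "continuous_on ?B F" for F :: "complex^'n \<Rightarrow> complex"
  proof -
    have "continuous_on (?B \<times> {0..1}) (\<lambda>p. F ((\<lambda>(v,t). seg v t) p))"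
      by (rule continuous_on_compose2[OF that cseg]) (use segB in auto)
    then show ?thesis by (simp add: case_prod_beta)
  qed
  have cont1: "continuous_on {0..1} (\<lambda>t. F (seg v t))" if "continuous_on ?B F" "v \<in> ?B" for F :: "complex^'n \<Rightarrow> complex" and v
  proof -
    have "continuous_on {0..1} (\<lambda>t. (\<lambda>(v,t). F (seg v t)) (v, t))"
      by (rule continuous_on_compose2[OF cont[OF that(1)] continuous_on_Pair[OF continuous_on_const continuous_on_id]])
         (use that(2) in auto)
    then show ?thesis by simp
  qed
  have hf: "holo_on (\<lambda>v. f (seg v t)) ?B" if "t \<in> {0..1}" for t
    by (rule holo_on_compose[OF f hseg]) (rule segB[OF _ that])
  note fc = holo_on_imp_continuous_on[OF f]
  define I where "I v = integral {0..1} (\<lambda>t. f (seg v t))" for v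
  have hI: "holo_on I ?B"
    unfolding I_def[abs_def] by (rule holo_on_integral[OF open_ball hf cont[OF fc]])
  define S where "S v = (v $ i - c $ i) * I v" for v
  have hd: "holo_on (\<lambda>v. v $ i - c $ i) T" for T by (intro holo_on_diff holo_on_nth holo_on_const)
  have hS: "holo_on S ?B" unfolding S_def[abs_def] by (rule holo_on_mult[OF hd hI])
  have "pd i S v = f v" if v: "v \<in> ?B" for v
  proof -
    have "pd i I v = integral {0..1} (\<lambda>t. pd i (\<lambda>v. f (seg v t)) v)"
      unfolding I_def[abs_def] by (rule pd_integral[OF open_ball hf cont[OF fc] v])
    also have "\<dots> = integral {0..1} (\<lambda>t. of_real t * pd i f (seg v t))"
    proof (rule integral_cong)
      fix t :: real assume t: "t \<in> {0..1}"
      have "pd i (\<lambda>v. f (seg v t)) v = (\<Sum>m\<in>UNIV. pd m f (seg v t) * pd i (\<lambda>v. seg v t $ m) v)"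
        by (rule pd_compose[OF f hseg[of _ UNIV] segB[OF v t] UNIV_I])
      also have "\<dots> = of_real t * pd i f (seg v t)"
        by (simp add: pseg if_distrib[of "\<lambda>t. _ * t"] cong: if_cong)
      finally show "pd i (\<lambda>v. f (seg v t)) v = of_real t * pd i f (seg v t)" .
    qed
    finally have pI: "pd i I v = integral {0..1} (\<lambda>t. of_real t * pd i f (seg v t))" .
    have ct: "continuous_on {0..1} (\<lambda>t. of_real t * pd i f (seg v t))"
      by (intro continuous_on_mult continuous_on_of_real continuous_on_id cont1[OF pd_continuous[OF open_ball f] v])
    have "pd i S v = (v $ i - c $ i) * pd i I v + I v"
      unfolding S_def[abs_def] pd_mult[OF hd hI v] by (simp add: pd_diff[OF holo_on_nth holo_on_const UNIV_I])
    also have "\<dots> = integral {0..1} (\<lambda>t. (v $ i - c $ i) * (of_real t * pd i f (seg v t)) + f (seg v t))"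
      unfolding pI I_def using ct cont1[OF fc v]
      by (simp add: integral_add integrable_continuous_real continuous_on_mult_left)
    \<comment> \<open>The integrand is the derivative of \<open>t * f (seg v t)\<close> with respect
      to \<open>t\<close>.\<close>
    also have "\<dots> = of_real 1 * f (seg v 1) - of_real 0 * f (seg v 0)"
    proof (rule integral_unique[OF fundamental_theorem_of_calculus])
      fix t :: real assume t: "t \<in> {0..1}"
      have ds: "((\<lambda>t. seg v t) has_vector_derivative axis i (v $ i - c $ i)) (at t within {0..1})"
      proof (rule has_vector_derivative_vec)
        fix m
        have "((\<lambda>t. c $ i + of_real t * (v $ i - c $ i)) has_vector_derivative (v $ i - c $ i)) (at t within {0..1})"
          by (auto intro!: derivative_eq_intros)
        then show "((\<lambda>t. seg v t $ m) has_vector_derivative axis i (v $ i - c $ i) $ m) (at t within {0..1})"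
          by (cases "m = i") (simp_all add: seg_def axis_def)
      qed
      have "((\<lambda>t. f (seg v t)) has_vector_derivative (\<Sum>j\<in>UNIV. pd j f (seg v t) * axis i (v $ i - c $ i) $ j)) (at t within {0..1})"
        by (rule holo_on_curve[OF f segB[OF v t] ds])
      moreover have "(\<Sum>j\<in>UNIV. pd j f (seg v t) * axis i (v $ i - c $ i) $ j) = pd i f (seg v t) * (v $ i - c $ i)"
        by (simp add: axis_def if_distrib[of "\<lambda>t. _ * t"] cong: if_cong)
      ultimately have 1: "((\<lambda>t. f (seg v t)) has_vector_derivative pd i f (seg v t) * (v $ i - c $ i)) (at t within {0..1})" by simp
      have 2: "((\<lambda>t. of_real t :: complex) has_vector_derivative 1) (at t within {0..1})"
        by (auto intro!: derivative_eq_intros)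
      show "((\<lambda>t. of_real t * f (seg v t)) has_vector_derivative (v $ i - c $ i) * (of_real t * pd i f (seg v t)) + f (seg v t)) (at t within {0..1})"
        using has_vector_derivative_mult[OF 2 1] by (simp add: mult_ac)
    qed simp
    also have "seg v 1 = v" by (simp add: seg_def vec_eq_iff)
    finally show ?thesis by simp
  qed
  then show ?thesis using hS by (intro exI[of _ S]) (simp add: S_def)
qed

lemma along_compose:
  assumes f: "holo_on f B" and F: "hmap_on F W" and s: "s \<in> W" "F s \<in> B"
  shows "along Y (\<lambda>s. f (F s)) s = (\<Sum>a\<in>UNIV. pd a f (F s) * along Y (\<lambda>s. F s $ a) s)"
  unfolding along_def pd_compose[OF f F s(2,1)] sum_distrib_left
  by (subst sum.swap) (simp only: mult_ac)

definition other :: "2 \<Rightarrow> 2" where "other i = (if i = 0 then 1 else 0)"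

lemma other_simps [simp]: "other 0 = 1" "other 1 = 0" "other i \<noteq> i" "i \<noteq> other i"
  by (cases i rule: exhaust_2_01; simp add: other_def)+

lemma sum_2_other: "(\<Sum>j\<in>UNIV. f j) = f i + f (other i)" for f :: "2 \<Rightarrow> complex"
  by (cases i rule: exhaust_2_01) (simp_all add: sum_2_01)

context twistor_geometry begin

lemma eh_expand:
  assumes x: "x \<in> U"
  shows "\<exists>c. v = (\<Sum>A\<in>UNIV. \<Sum>j\<in>UNIV. c A j *s eh A j x)"
proof -
  define b where "b I = (\<Sum>J\<in>UNIV. eta I J * bilin (g x) v (E x J))" for I
  have b: "v = (\<Sum>I\<in>UNIV. b I *s E x I)"
    unfolding b_def by (rule tetrad_expand[OF x])
  have e: "E x (A, 0) = d x 1 $ 1 *s eh A 0 x - d x 0 $ 1 *s eh A 1 x"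
    "E x (A, 1) = d x 0 $ 0 *s eh A 1 x - d x 1 $ 0 *s eh A 0 x" for A
    using d_unimodular[OF x]
    by (simp_all add: vec_eq_iff eh_nth sum_2_01, algebra+)
  define c :: "2 \<Rightarrow> 2 \<Rightarrow> complex" where "c A j = (if j = 0 then b (A, 0) * d x 1 $ 1 - b (A, 1) * d x 1 $ 0 else b (A, 1) * d x 0 $ 0 - b (A, 0) * d x 0 $ 1)" for A j
  have "v = (\<Sum>A\<in>UNIV. \<Sum>j\<in>UNIV. c A j *s eh A j x)"
    unfolding b sum_UNIV_prod sum_2_01 e c_def by (simp add: vec_eq_iff algebra_simps)
  then show ?thesis by blast
qed

definition frame_jac :: "2 \<Rightarrow> (complex^(4+2) \<Rightarrow> complex^3) \<Rightarrow> complex^(4+2) \<Rightarrow> complex^3^3" where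
  "frame_jac i F s = (\<chi> a m. if m = 1 then along (eh 0 i) (\<lambda>s. F s $ a) s
     else if m = 2 then along (eh 1 i) (\<lambda>s. F s $ a) s else pd (Inr (other i)) (\<lambda>s. F s $ a) s)"

text \<open>Modulo the leaf directions, the tangent space is spanned by three vectors at points where
  \<open>z\<^sub>i \<noteq> 0\<close>.\<close>

lemma surj_frame_jac:
  assumes x: "sx s \<in> U" and z: "sz s $ i \<noteq> 0"
    and V: "\<And>A a. V A (\<lambda>s. F s $ a) s = 0" and E: "\<And>a. euler (\<lambda>s. F s $ a) s = 0"
    and surj: "surj (\<lambda>v. jac F s *v v)"
  shows "surj (\<lambda>y. frame_jac i F s *v y)"
  unfolding surj_def
proof
  fix y :: "complex^3"
  obtain v where v: "jac F s *v v = y" using surj by (metis surjD)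
  obtain c where c: "sx v = (\<Sum>A\<in>UNIV. \<Sum>j\<in>UNIV. c A j *s eh A j (sx s))" using eh_expand[OF x] by (rule exE)
  define t where "t = sz s $ other i / sz s $ i"
  define al where "al A j a = along (eh A j) (\<lambda>s. F s $ a) s" for A j a
  define p where "p m a = pd (Inr m) (\<lambda>s. F s $ a) s" for m a
  \<comment> \<open>The equations of the \<open>V A\<close> express the derivatives in the other
    primed direction, and the Euler equation the one in the direction of \<open>sz s $ i\<close>,
    through those kept in \<open>frame_jac\<close>.\<close>
  have al: "al A (other i) a = t * al A i a" for A a
    using V[of A a] z unfolding al_def V_def t_def
    by (cases i rule: exhaust_2_01) (simp_all add: field_simps)
  have "sz s $ i * p i a + sz s $ other i * p (other i) a = 0" for a
    using E[of a] by (simp add: euler_def p_def sum_2_other[of _ i])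
  then have p: "p i a = - (t * p (other i) a)" for a
    using z unfolding t_def by (simp add: field_simps add_eq_0_iff)
  define y' :: "complex^3" where "y' = (\<chi> m. if m = 1 then c 0 i + c 0 (other i) * t
     else if m = 2 then c 1 i + c 1 (other i) * t else v $ Inr (other i) - v $ Inr i * t)"
  have "(frame_jac i F s *v y') $ a = y $ a" for a
  proof -
    have "y $ a = (\<Sum>b\<in>UNIV. pd (Inl b) (\<lambda>s. F s $ a) s * sx v $ b) + (\<Sum>m\<in>UNIV. p m a * v $ Inr m)"
      unfolding v[symmetric] by (simp add: matrix_vector_mult_def jac_def sum_UNIV_Plus p_def sx_nth)
    also have "(\<Sum>b\<in>UNIV. pd (Inl b) (\<lambda>s. F s $ a) s * sx v $ b) = (\<Sum>A\<in>UNIV. \<Sum>j\<in>UNIV. c A j * al A j a)"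
      unfolding c al_def along_def sum_2_01
      by (simp add: algebra_simps sum.distrib sum_distrib_left)
    finally have y: "y $ a = (\<Sum>A\<in>UNIV. \<Sum>j\<in>UNIV. c A j * al A j a) + (\<Sum>m\<in>UNIV. p m a * v $ Inr m)" .
    have "(\<Sum>j\<in>UNIV. c A j * al A j a) = (c A i + c A (other i) * t) * al A i a" for A
      by (simp add: sum_2_other[of _ i] al algebra_simps)
    moreover have "(\<Sum>m\<in>UNIV. p m a * v $ Inr m) = (v $ Inr (other i) - v $ Inr i * t) * p (other i) a"
      by (simp add: sum_2_other[of _ i] p algebra_simps)
    ultimately have "y $ a = (\<Sum>A\<in>UNIV. (c A i + c A (other i) * t) * al A i a) + (v $ Inr (other i) - v $ Inr i * t) * p (other i) a"
      unfolding y by simp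
    then show ?thesis
      by (simp add: matrix_vector_mult_def frame_jac_def y'_def sum_3 al_def p_def sum_2_01 algebra_simps)
  qed
  then have "y = frame_jac i F s *v y'" by (simp add: vec_eq_iff)
  then show "\<exists>x. y = frame_jac i F s *v x" by (rule exI)
qed

text \<open>Multiplied by the frame derivatives of \<open>F\<close>, the Jacobian becomes a matrix
  whose first row is zero except for the derivative of the ratio of the \<open>z\<close>. Its
  determinant is the bracket divided by \<open>sz s $ i\<close>.\<close>

lemma jac_left_inverse:
  fixes F :: "complex^(4+2) \<Rightarrow> complex^3" and \<Psi> :: "complex^3 \<Rightarrow> complex^3"
  assumes W: "open W" and F: "hmap_on F W" and \<Psi>: "hmap_on \<Psi> B" and FB: "\<And>s. s \<in> W \<Longrightarrow> F s \<in> B" and s: "s \<in> W"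
    and z: "sz s $ i \<noteq> 0" and \<zeta>: "\<And>s. s \<in> W \<Longrightarrow> \<Psi> (F s) $ 1 = sz s $ other i / sz s $ i"
    and nz: "bracket i (\<lambda>s. \<Psi> (F s) $ 2) (\<lambda>s. \<Psi> (F s) $ 3) s \<noteq> 0"
  shows "\<exists>N. N ** jac \<Psi> (F s) = mat 1"
proof -
  let ?N = "jac \<Psi> (F s)" and ?M = "frame_jac i F s"
  have R: "(?N ** ?M) $ m $ 1 = along (eh 0 i) (\<lambda>s. \<Psi> (F s) $ m) s"
    "(?N ** ?M) $ m $ 2 = along (eh 1 i) (\<lambda>s. \<Psi> (F s) $ m) s"
    "(?N ** ?M) $ m $ 3 = pd (Inr (other i)) (\<lambda>s. \<Psi> (F s) $ m) s" for m
    by (simp_all add: matrix_matrix_mult_def frame_jac_def jac_def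
        along_compose[OF hmap_onD[OF \<Psi>] F s FB[OF s]] pd_compose[OF hmap_onD[OF \<Psi>] F FB[OF s] s])
  have 0: "along Y (\<lambda>s. \<Psi> (F s) $ 1) s = 0" for Y
  proof -
    have "along Y (\<lambda>s. \<Psi> (F s) $ 1) s = along Y (\<lambda>s. sz s $ other i / sz s $ i) s" by (rule along_cong[OF W s \<zeta>])
    then show ?thesis using along_sz_fun[of Y "\<lambda>z. z $ other i / z $ i"] by simp
  qed
  have 1: "pd (Inr (other i)) (\<lambda>s. \<Psi> (F s) $ 1) s = 1 / sz s $ i"
  proof -
    have "pd (Inr (other i)) (\<lambda>s. \<Psi> (F s) $ 1) s = pd (Inr (other i)) (\<lambda>s. sz s $ other i / sz s $ i) s" by (rule pd_cong[OF W s \<zeta>])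
    also have "\<dots> = deriv (\<lambda>w. (sz s $ other i + w) / sz s $ i) 0"
      by (simp add: pd_def sz_nth axis_def)
    also have "\<dots> = 1 / sz s $ i"
      by (rule DERIV_imp_deriv) (use z in \<open>auto intro!: derivative_eq_intros\<close>)
    finally show ?thesis .
  qed
  have "det (?N ** ?M) = bracket i (\<lambda>s. \<Psi> (F s) $ 2) (\<lambda>s. \<Psi> (F s) $ 3) s / sz s $ i"
    unfolding det_3 R 0 1 bracket_def by (simp add: diff_divide_distrib mult_ac)
  then have "det ?N \<noteq> 0" using nz z by (auto simp: det_mul)
  then have "invertible ?N" by (simp add: invertible_det_nz)
  then show ?thesis unfolding invertible_def by blast
qed

end

section \<open>Discs and adapted charts\<close>

definition pdisc :: "complex^3 \<Rightarrow> real \<Rightarrow> real \<Rightarrow> (complex^3) set" where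
  "pdisc c r R = {v. norm (v $ 1 - c $ 1) < r \<and> norm (v $ 2 - c $ 2) < r \<and> norm (v $ 3) < R}"

lemma open_pdisc: "open (pdisc c r R)"
  unfolding pdisc_def by (intro open_Collect_conj open_Collect_less continuous_intros)

lemma pdisc_ball:
  assumes "c $ 3 = 0" "\<epsilon> > 0" shows "pdisc c (\<epsilon> / 4) (\<epsilon> / 4) \<subseteq> ball c \<epsilon>"
proof
  fix v assume v: "v \<in> pdisc c (\<epsilon> / 4) (\<epsilon> / 4)"
  have "norm (v - c) \<le> (\<Sum>m\<in>UNIV. norm ((v - c) $ m))"
    unfolding norm_vec_def by (rule L2_set_le_sum) simp
  also have "\<dots> < \<epsilon>" using v assms by (simp add: sum_3 pdisc_def)
  finally show "v \<in> ball c \<epsilon>" by (simp add: dist_norm norm_minus_commute)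
qed

lemma hmap_vector_3:
  assumes "holo_on f S" "holo_on h S" "holo_on l S"
  shows "hmap_on (\<lambda>w. vector [f w, h w, l w] :: complex^3) S"
  unfolding hmap_on_def forall_3 using assms by simp

context twistor_geometry begin

lemma twistor_fn_subset: "twistor_fn f S \<Longrightarrow> open T \<Longrightarrow> T \<subseteq> S \<Longrightarrow> twistor_fn f T"
  unfolding twistor_fn_def by (blast intro: holo_on_subset)

lemma twistor_fn_bracket:
  assumes f: "twistor_fn f S" and h: "twistor_fn h S" shows "twistor_fn (bracket i f h) S"
  unfolding twistor_fn_def
  using twistor_fnD[OF f] twistor_fnD[OF h]
  by (intro conjI ballI allI holo_bracket V_bracket[of S f h] euler_bracket[of S f h]) simp_all

lemma bracket_cong:
  assumes "open S" "s \<in> S" "\<And>s. s \<in> S \<Longrightarrow> f s = f' s" "\<And>s. s \<in> S \<Longrightarrow> h s = h' s"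
  shows "bracket i f h s = bracket i f' h' s"
  unfolding bracket_def by (simp only: along_cong[OF assms(1,2,3)] along_cong[OF assms(1,2,4)])

end

context killing_geometry begin

lemma along_Q_qq:
  assumes s: "s \<in> patch i" shows "along Y Q s = along Y (qq i) s * sz s $ i ^ k"
proof -
  have "along Y Q s = along Y (\<lambda>s. qq i s * sz s $ i ^ k) s"
    by (rule along_cong[OF open_patch s]) (simp add: qq_def patch_def)
  also have "\<dots> = qq i s * along Y (\<lambda>s. sz s $ i ^ k) s + along Y (qq i) s * sz s $ i ^ k"
    by (rule along_mult[OF holo_qq[OF order_refl] holo_on_power[OF holo_sz] s])
  finally show ?thesis using along_sz_fun[of Y "\<lambda>z. z $ i ^ k" s] by simp
qed

text \<open>Since the \<open>V A\<close> annihilate \<open>Q\<close>, its derivatives in the two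
  primed directions are proportional, and where \<open>sz s $ i\<close> is nonzero the direction
  \<open>i\<close> detects both. The unimodular dyad then recovers the components in the original
  frame.\<close>

lemma along_qq_regular:
  assumes s: "s \<in> patch i"
  shows "(\<exists>A A'. grad_Q A A' s \<noteq> 0) \<longleftrightarrow> (\<exists>A. along (eh A i) (qq i) s \<noteq> 0)"
proof -
  note t = patchD[OF s]
  have u: "sx s \<in> U" using t(1) by (simp add: total_def)
  have "(\<exists>A'. grad_Q A A' s \<noteq> 0) \<longleftrightarrow> along (eh A i) (qq i) s \<noteq> 0" for A
  proof
    assume "along (eh A i) (qq i) s \<noteq> 0"
    then have "along (eh A i) Q s \<noteq> 0" using t(2) by (simp add: along_Q_qq[OF s])
    then show "\<exists>A'. grad_Q A A' s \<noteq> 0" unfolding along_eh_Q[OF t(1)] by (rule contrapos_np) simp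
  next
    assume g: "\<exists>A'. grad_Q A A' s \<noteq> 0"
    show "along (eh A i) (qq i) s \<noteq> 0"
    proof
      assume "along (eh A i) (qq i) s = 0"
      then have "along (eh A i) Q s = 0" by (simp add: along_Q_qq[OF s])
      moreover have "sz s $ 1 * along (eh A 0) Q s = sz s $ 0 * along (eh A 1) Q s"
        using V_Q[OF t(1), of A] by (simp add: V_def)
      ultimately have "along (eh A j) Q s = 0" for j
        using t(2) by (cases i rule: exhaust_2_01; cases j rule: exhaust_2_01) simp_all
      then have "d (sx s) j $ 0 * grad_Q A 0 s + d (sx s) j $ 1 * grad_Q A 1 s = 0" for j
        unfolding along_eh_Q[OF t(1)] sum_2_01 .
      from this[of 0] this[of 1] have "grad_Q A 0 s = 0" "grad_Q A 1 s = 0"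
        using d_unimodular[OF u] by algebra+
      then have "grad_Q A A' s = 0" for A' by (cases A' rule: exhaust_2_01) simp_all
      then show False using g by blast
    qed
  qed
  then show ?thesis by blast
qed

end

context twistor_setting begin

lemma tp_patch:
  assumes s: "s \<in> total" "s' \<in> patch i" and eq: "tp s = tp s'"
  shows "s \<in> patch i" "zz i j s = zz i j s'" "qq i s = qq i s'"
proof -
  have "O_point (int k) (sz s') (Q s') = O_point (int k) (sz s) (Q s)"
    using pmap_tp[OF s(1)] pmap_tp[OF patchD(1)[OF s(2)]] eq by simp
  then obtain c where c: "c \<noteq> 0" "sz s = c *s sz s'" "Q s = c powi int k * Q s'" by (rule O_point_eqD)
  then show "s \<in> patch i" "zz i j s = zz i j s'" "qq i s = qq i s'"
    using s patchD(2)[OF s(2)] by (simp_all add: patch_def zz_def qq_def power_mult_distrib)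
qed

text \<open>Charts downstairs are obtained from data upstairs: coordinates with holomorphic
  pull-back and a holomorphic section over their range. The section yields one transition map, local
  sections of the given chart yield the other.\<close>

lemma compatible_chartI:
  assumes G: "G \<subseteq> TS" "inj_on \<phi> G" "open (\<phi> ` G)" "open (sat G)"
    and \<phi>: "hmap_on (\<lambda>s. \<phi> (tp s)) (sat G)"
    and \<sigma>: "hmap_on \<sigma> (\<phi> ` G)" "\<And>v. v \<in> \<phi> ` G \<Longrightarrow> \<sigma> v \<in> sat G" "\<And>v. v \<in> \<phi> ` G \<Longrightarrow> \<phi> (tp (\<sigma> v)) = v"
  shows "compatible_chart TS \<A> (G, \<phi>)"
proof -
  have inv: "inv_into G \<phi> v = tp (\<sigma> v)" if "v \<in> \<phi> ` G" for v
    using inv_into_f_f[OF G(2) satD(2)[OF \<sigma>(2)[OF that]]] \<sigma>(3)[OF that] by simp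
  have "compatible (G, \<phi>) (W, \<psi>)" if c: "(W, \<psi>) \<in> \<A>" for W \<psi>
  proof -
    have e: "\<phi> ` (G \<inter> W) = \<phi> ` G \<inter> \<sigma> -` sat W"
    proof (intro set_eqI iffI)
      fix v assume "v \<in> \<phi> ` (G \<inter> W)"
      then obtain p where p: "p \<in> G" "p \<in> W" "v = \<phi> p" by blast
      then have "tp (\<sigma> v) = p" using inv[of v] inv_into_f_f[OF G(2) p(1)] by auto
      then show "v \<in> \<phi> ` G \<inter> \<sigma> -` sat W" using p \<sigma>(2)[of v] by (auto simp: sat_def)
    next
      fix v assume v: "v \<in> \<phi> ` G \<inter> \<sigma> -` sat W"
      then have "\<phi> (tp (\<sigma> v)) \<in> \<phi> ` (G \<inter> W)" using \<sigma>(2)[of v] by (intro imageI) (auto simp: sat_def)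
      then show "v \<in> \<phi> ` (G \<inter> W)" using v \<sigma>(3) by simp
    qed
    have o1: "open (\<phi> ` (G \<inter> W))"
      unfolding e by (rule continuous_open_preimage[OF hmap_on_continuous[OF \<sigma>(1)] G(3) chart_props(4)[OF c]])
    have loc: "\<exists>T \<tau>. open T \<and> w \<in> T \<and> T \<subseteq> \<psi> ` (G \<inter> W) \<and> hmap_on \<tau> T \<and> (\<forall>w\<in>T. \<tau> w \<in> sat G \<and> inv_into W \<psi> w = tp (\<tau> w))"
      if w: "w \<in> \<psi> ` (G \<inter> W)" for w
    proof -
      obtain p where p: "p \<in> G" "p \<in> W" "w = \<psi> p" using w by blast
      obtain s where s: "s \<in> total" "tp s = p" using tp_onto G(1) p(1) by blast
      have sW: "s \<in> sat W" using s p by (simp add: sat_def)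
      obtain r \<tau> where r: "r > 0" and \<tau>: "hmap_on \<tau> (ball (\<psi> (tp s)) r)"
        and \<tau>s: "\<forall>w\<in>ball (\<psi> (tp s)) r. \<tau> w \<in> sat W \<and> \<psi> (tp (\<tau> w)) = w" "\<tau> (\<psi> (tp s)) = s"
        using local_section[OF c sW] by blast
      let ?T = "ball (\<psi> (tp s)) r \<inter> \<tau> -` sat G"
      have "open ?T" by (rule continuous_open_preimage[OF hmap_on_continuous[OF \<tau>] open_ball G(4)])
      moreover have "w \<in> ?T" using r \<tau>s s p by (simp add: sat_def)
      moreover have i: "inv_into W \<psi> v = tp (\<tau> v)" if "v \<in> ?T" for v
        using inv_into_f_f[OF chart_props(2)[OF c], of "tp (\<tau> v)"] \<tau>s(1) that satD(2) by (metis IntD1)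
      moreover have "?T \<subseteq> \<psi> ` (G \<inter> W)"
      proof
        fix v assume v: "v \<in> ?T"
        then have "\<psi> (tp (\<tau> v)) \<in> \<psi> ` (G \<inter> W)" using \<tau>s(1) by (intro imageI) (auto simp: sat_def)
        then show "v \<in> \<psi> ` (G \<inter> W)" using v \<tau>s(1) by simp
      qed
      ultimately show ?thesis using hmap_on_subset[OF \<tau>, of ?T] by (intro exI[of _ ?T] exI[of _ \<tau>]) auto
    qed
    have o2: "open (\<psi> ` (G \<inter> W))"
      unfolding open_subopen[of "\<psi> ` (G \<inter> W)"] using loc by blast
    have h1: "holo_on (\<lambda>w. \<psi> (inv_into G \<phi> w) $ i) (\<phi> ` (G \<inter> W))" for i
    proof (rule holo_on_transform[OF _ o1])
      show "holo_on (\<lambda>w. \<psi> (tp (\<sigma> w)) $ i) (\<phi> ` (G \<inter> W))"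
        by (rule holo_on_compose[OF hmap_onD[OF chart_hmap[OF c]] hmap_on_subset[OF \<sigma>(1)]]) (auto simp: e)
      show "\<psi> (tp (\<sigma> w)) $ i = \<psi> (inv_into G \<phi> w) $ i" if "w \<in> \<phi> ` (G \<inter> W)" for w
        using that by (auto simp: inv e)
    qed
    have h2: "holo_on (\<lambda>w. \<phi> (inv_into W \<psi> w) $ i) (\<psi> ` (G \<inter> W))" for i
    proof (rule holo_on_UN)
      fix w assume "w \<in> \<psi> ` (G \<inter> W)"
      from loc[OF this] obtain T \<tau> where T: "open T" "w \<in> T" "hmap_on \<tau> T"
        "\<forall>w\<in>T. \<tau> w \<in> sat G \<and> inv_into W \<psi> w = tp (\<tau> w)" by blast
      have "holo_on (\<lambda>w. \<phi> (tp (\<tau> w)) $ i) T"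
        by (rule holo_on_compose[OF hmap_onD[OF \<phi>] T(3)]) (use T(4) in blast)
      then have "holo_on (\<lambda>w. \<phi> (inv_into W \<psi> w) $ i) T"
        by (rule holo_on_transform[OF _ T(1)]) (use T(4) in simp)
      then show "\<exists>T. w \<in> T \<and> holo_on (\<lambda>w. \<phi> (inv_into W \<psi> w) $ i) T" using T(2) by blast
    qed
    show ?thesis unfolding compatible_def using o1 o2 h1 h2 by simp
  qed
  then show ?thesis unfolding compatible_chart_def using G by auto
qed

text \<open>The chart covers the extended disc of radius \<open>4 * \<rho>\<close> in the affine
  coordinate, centred at zero; the trivialisation will use the inner disc of radius
  \<open>\<rho>\<close> only.\<close>

definition darboux_chart :: "2 \<Rightarrow> ((complex^4) \<times> (complex^2)) set set \<Rightarrow> (((complex^4) \<times> (complex^2)) set \<Rightarrow> complex^3) \<Rightarrow>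
    complex^3 \<Rightarrow> real \<Rightarrow> real \<Rightarrow> (complex^3 \<Rightarrow> complex^(4+2)) \<Rightarrow> bool" where
  "darboux_chart i G \<phi> c r \<rho> \<sigma> \<longleftrightarrow> G \<subseteq> TS \<and> inj_on \<phi> G \<and> 0 < r \<and> 0 < \<rho> \<and> \<phi> ` G = pdisc c r (4 * \<rho>) \<and>
     open (sat G) \<and> sat G \<subseteq> patch i \<and> hmap_on (\<lambda>s. \<phi> (tp s)) (sat G) \<and> hmap_on \<sigma> (pdisc c r (4 * \<rho>)) \<and>
     (\<forall>v\<in>pdisc c r (4 * \<rho>). \<sigma> v \<in> sat G \<and> \<phi> (tp (\<sigma> v)) = v) \<and>
     (\<forall>s\<in>sat G. \<phi> (tp s) $ 1 = zz i (other i) s \<and> \<phi> (tp s) $ 2 = qq i s \<and>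
        bracket i (qq i) (\<lambda>s. \<phi> (tp s) $ 3) s = 1)"

end

context twistor_setting begin

text \<open>At a regular twistor some coordinate of the atlas has nonzero bracket with
  \<open>qq i\<close> and serves as a provisional third coordinate. Integrating the reciprocal of
  that bracket in its direction, with the other two coordinates fixed, gives a third coordinate with
  bracket one.\<close>

lemma darboux_exists:
  assumes p: "p \<in> regular_twistors U g e k L"
  shows "\<exists>i G \<phi> c r \<rho> \<sigma>. darboux_chart i G \<phi> c r \<rho> \<sigma> \<and> p \<in> G \<and> norm (\<phi> p $ 3) < \<rho>"
proof -
  obtain s0 A0 A0' where s0: "s0 \<in> total" "tp s0 = p" "grad_Q A0 A0' s0 \<noteq> 0" using p by (rule regularE)
  obtain i where s0i: "s0 \<in> patch i" using total_patch[OF s0(1)] by blast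
  have q0: "\<exists>A. along (eh A i) (qq i) s0 \<noteq> 0" using along_qq_regular[OF s0i] s0(3) by blast
  obtain K \<phi>0 where c: "(K, \<phi>0) \<in> \<A>" and pK: "p \<in> K" using chart_cover[OF tp_in[OF s0(1)]] s0(2) by blast
  have s0K: "s0 \<in> sat K" using s0 pK by (simp add: sat_def)
  define F where "F s = \<phi>0 (tp s)" for s
  define w0 where "w0 = F s0"
  obtain r0 \<sigma>0 where r0: "r0 > 0" and h\<sigma>0: "hmap_on \<sigma>0 (ball w0 r0)" and ballK: "ball w0 r0 \<subseteq> \<phi>0 ` K"
    and \<sigma>0: "\<And>w. w \<in> ball w0 r0 \<Longrightarrow> \<sigma>0 w \<in> sat K" "\<And>w. w \<in> ball w0 r0 \<Longrightarrow> F (\<sigma>0 w) = w" and \<sigma>0w0: "\<sigma>0 w0 = s0"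
    using local_section[OF c s0K] unfolding F_def w0_def by blast
  define B where "B = ball w0 r0 \<inter> \<sigma>0 -` patch i"
  have oB: "open B" unfolding B_def
    by (rule continuous_open_preimage[OF hmap_on_continuous[OF h\<sigma>0] open_ball open_patch])
  have w0B: "w0 \<in> B" using r0 \<sigma>0w0 s0i by (simp add: B_def)
  have Bball: "B \<subseteq> ball w0 r0" by (auto simp: B_def)
  have h\<sigma>B: "hmap_on \<sigma>0 T" if "T \<subseteq> B" for T by (rule hmap_on_subset[OF h\<sigma>0]) (use that Bball in blast)
  define N where "N T = {p \<in> K. \<phi>0 p \<in> T}" for T
  have satN: "s \<in> sat (N T) \<longleftrightarrow> s \<in> sat K \<and> F s \<in> T" for s T by (auto simp: sat_def N_def F_def)
  have oN: "open (sat (N T))" if "open T" for T unfolding N_def by (rule open_sat_preimage[OF c that])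
  have \<sigma>N: "\<sigma>0 w \<in> sat (N T)" if "w \<in> T" "T \<subseteq> B" for w T
    using \<sigma>0[of w] that Bball by (auto simp: satN)
  define W where "W = sat (N B)"
  have oW: "open W" unfolding W_def by (rule oN[OF oB])
  have hF: "hmap_on F T" if "T \<subseteq> sat K" for T
    unfolding F_def[abs_def] by (rule hmap_on_subset[OF chart_hmap[OF c] that])
  have WK: "W \<subseteq> sat K" by (auto simp: W_def satN)
  \<comment> \<open>The section may return another point than \<open>s\<close>, but one on the same
    leaf.\<close>
  have tpF: "tp (\<sigma>0 (F s)) = tp s" if "s \<in> W" for s
  proof (rule inj_onD[OF chart_props(2)[OF c]])
    have Fs: "F s \<in> ball w0 r0" using that Bball by (auto simp: W_def satN)
    show "\<phi>0 (tp (\<sigma>0 (F s))) = \<phi>0 (tp s)" using \<sigma>0(2)[OF Fs] by (simp add: F_def)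
    show "tp (\<sigma>0 (F s)) \<in> K" by (rule satD(2)[OF \<sigma>0(1)[OF Fs]])
    show "tp s \<in> K" using that WK satD(2) by blast
  qed
  have \<sigma>F: "\<sigma>0 (F s) \<in> patch i" if "s \<in> W" for s using that by (auto simp: W_def satN B_def)
  have Wpatch: "W \<subseteq> patch i"
  proof
    fix s assume s: "s \<in> W"
    have "s \<in> total" using s WK satD(1) by blast
    then show "s \<in> patch i" by (rule tp_patch(1)[OF _ \<sigma>F[OF s] tpF[OF s, symmetric]])
  qed
  have W\<sigma>: "\<sigma>0 (F s) \<in> W" if "s \<in> W" for s
    unfolding W_def by (rule \<sigma>N[OF _ order_refl]) (use that in \<open>simp add: W_def satN\<close>)
  \<comment> \<open>Twistor functions on \<open>W\<close> are therefore functions of the atlas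
    coordinates.\<close>
  have desc: "f (\<sigma>0 (F s)) = f s" if "twistor_fn f W" "s \<in> W" for f s
    by (rule saturated_invariant[of f "N B", folded W_def, OF that(1) W\<sigma>[OF that(2)] that(2) tpF[OF that(2)]])
  have s0W: "s0 \<in> W" using s0K w0B by (simp add: W_def satN w0_def)
  have tz: "twistor_fn (zz i j) W" for j by (rule twistor_fn_subset[OF twistor_fn_zz oW Wpatch])
  have tq: "twistor_fn (qq i) W" by (rule twistor_fn_subset[OF twistor_fn_qq oW Wpatch])
  have tF: "twistor_fn (\<lambda>s. F s $ a) W" for a
    unfolding F_def by (rule twistor_fn_subset[OF chart_twistor_fn[OF c] oW WK])
  \<comment> \<open>The atlas coordinates have invertible derivative on the three frame directions.
    If all brackets vanished, the Hamiltonian vector of \<open>qq i\<close>, which is nonzero, would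
    lie in the kernel.\<close>
  have nz: "\<exists>a. bracket i (qq i) (\<lambda>s. F s $ a) s0 \<noteq> 0"
  proof (rule ccontr)
    assume "\<not> ?thesis"
    then have z: "bracket i (qq i) (\<lambda>s. F s $ a) s0 = 0" for a by blast
    have "surj (\<lambda>y. frame_jac i F s0 *v y)"
    proof (rule surj_frame_jac)
      show "sx s0 \<in> U" using s0(1) by (simp add: total_def)
      show "sz s0 $ i \<noteq> 0" by (rule patchD(2)[OF s0i])
      show "V A (\<lambda>s. F s $ a) s0 = 0" "euler (\<lambda>s. F s $ a) s0 = 0" for A a
        using twistor_fnD(4,5)[OF tF s0W] by blast+
      show "surj (\<lambda>v. jac F s0 *v v)" unfolding F_def[abs_def] by (rule chart_surj[OF c s0K])
    qed
    then obtain M' where "frame_jac i F s0 ** M' = mat 1"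
      unfolding matrix_right_invertible_surjective[symmetric] by blast
    then have M': "M' ** frame_jac i F s0 = mat 1" by (simp add: matrix_left_right_inverse)
    define y :: "complex^3" where "y = (\<chi> m. if m = 1 then - along (eh 1 i) (qq i) s0 else if m = 2 then along (eh 0 i) (qq i) s0 else 0)"
    have "(frame_jac i F s0 *v y) $ a = 0" for a
      using z[of a] by (simp add: matrix_vector_mult_def frame_jac_def y_def sum_3 bracket_def mult_ac)
    then have "frame_jac i F s0 *v y = 0" by (simp add: vec_eq_iff)
    then have "(M' ** frame_jac i F s0) *v y = 0" by (simp add: matrix_vector_mul_assoc[symmetric])
    then have "y = 0" by (simp add: M')
    then have "y $ 1 = 0" "y $ 2 = 0" by simp_all
    then have "along (eh A i) (qq i) s0 = 0" for A by (cases A rule: exhaust_2_01) (simp_all add: y_def)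
    then show False using q0 by blast
  qed
  then obtain a where a: "bracket i (qq i) (\<lambda>s. F s $ a) s0 \<noteq> 0" by blast
  define P where "P = bracket i (qq i) (\<lambda>s. F s $ a)"
  have tP: "twistor_fn P W" unfolding P_def by (rule twistor_fn_bracket[OF tq tF])
  have hol\<sigma>: "holo_on (\<lambda>w. f (\<sigma>0 w)) T" if "twistor_fn f W" "T \<subseteq> B" for f T
    by (rule holo_on_compose[OF twistor_fnD(3)[OF that(1)] h\<sigma>B[OF that(2)]]) (use \<sigma>N[of _ B] that(2) in \<open>auto simp: W_def\<close>)
  define \<Psi>1 :: "complex^3 \<Rightarrow> complex^3" where "\<Psi>1 w = vector [zz i (other i) (\<sigma>0 w), qq i (\<sigma>0 w), w $ a]" for w
  have h\<Psi>1: "hmap_on \<Psi>1 T" if "T \<subseteq> B" for T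
    unfolding \<Psi>1_def[abs_def] by (rule hmap_vector_3[OF hol\<sigma>[OF tz that] hol\<sigma>[OF tq that] holo_on_nth])
  have \<Psi>1F: "\<Psi>1 (F s) $ 1 = zz i (other i) s" "\<Psi>1 (F s) $ 2 = qq i s" "\<Psi>1 (F s) $ 3 = F s $ a" if "s \<in> W" for s
    using desc[OF tz that] desc[OF tq that] by (simp_all add: \<Psi>1_def)
  have FB: "F s \<in> B" if "s \<in> W" for s using that by (simp add: W_def satN)
  have "\<exists>N1. N1 ** jac \<Psi>1 (F s0) = mat 1"
  proof (rule jac_left_inverse[OF oW hF[OF WK] h\<Psi>1[OF order_refl] FB s0W patchD(2)[OF s0i]])
    show "\<Psi>1 (F s) $ 1 = sz s $ other i / sz s $ i" if "s \<in> W" for s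
      using \<Psi>1F(1)[OF that] by (simp add: zz_def)
    have "bracket i (\<lambda>s. \<Psi>1 (F s) $ 2) (\<lambda>s. \<Psi>1 (F s) $ 3) s0 = P s0"
      unfolding P_def by (rule bracket_cong[OF oW s0W \<Psi>1F(2,3)])
    then show "bracket i (\<lambda>s. \<Psi>1 (F s) $ 2) (\<lambda>s. \<Psi>1 (F s) $ 3) s0 \<noteq> 0" using a by (simp add: P_def)
  qed
  then obtain N1 where N1: "N1 ** jac \<Psi>1 w0 = mat 1" by (auto simp: w0_def)
  obtain U1 V1 G1 where U1: "open U1" "U1 \<subseteq> B" "w0 \<in> U1" "open V1" "\<Psi>1 w0 \<in> V1" "homeomorphism U1 V1 \<Psi>1 G1" "hmap_on G1 V1"
    by (rule holo_inverse_function[OF h\<Psi>1[OF order_refl] oB w0B N1], rule that)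
  \<comment> \<open>The bracket of \<open>qq i\<close> with the provisional coordinate, as a
    function of the provisional coordinates.\<close>
  define Ph where "Ph v = P (\<sigma>0 (G1 v))" for v
  have G1U: "G1 v \<in> U1" if "v \<in> V1" for v using U1(6) that by (metis homeomorphism_image2 imageI)
  have hPh: "holo_on Ph V1"
    unfolding Ph_def[abs_def] by (rule holo_on_compose[OF hol\<sigma>[OF tP order_refl] U1(7)]) (use G1U U1(2) in blast)
  have G1\<Psi>: "G1 (\<Psi>1 w) = w" if "w \<in> U1" for w by (rule homeomorphism_apply1[OF U1(6) that])
  have "Ph (\<Psi>1 w0) \<noteq> 0" using a by (simp add: Ph_def G1\<Psi>[OF U1(3)] \<sigma>0w0 P_def)
  moreover have "open (V1 \<inter> Ph -` (- {0}))"
    by (rule continuous_open_preimage[OF holo_on_imp_continuous_on[OF hPh] U1(4)]) auto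
  ultimately obtain \<delta> where \<delta>: "\<delta> > 0" "ball (\<Psi>1 w0) \<delta> \<subseteq> V1 \<inter> Ph -` (- {0})"
    using open_contains_ball U1(5) by (metis ComplI IntI singletonD vimageI)
  have "holo_on (\<lambda>v. 1 / Ph v) (ball (\<Psi>1 w0) \<delta>)"
    by (rule holo_on_divide[OF holo_on_const holo_on_subset[OF hPh]]) (use \<delta>(2) in auto)
  \<comment> \<open>The bracket with \<open>qq i\<close> annihilates the first two coordinates and
    acts on the third as \<open>Ph\<close> times the partial derivative, so this derivative of
    \<open>S\<close> has to be the reciprocal of \<open>Ph\<close>.\<close>
  from holo_primitive[OF this, of 3] obtain S where hS: "holo_on S (ball (\<Psi>1 w0) \<delta>)"
    and pS: "\<And>v. v \<in> ball (\<Psi>1 w0) \<delta> \<Longrightarrow> pd 3 S v = 1 / Ph v" and S0: "S (\<Psi>1 w0) = 0" by blast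
  define B1 where "B1 = U1 \<inter> \<Psi>1 -` ball (\<Psi>1 w0) \<delta>"
  have oB1: "open B1"
    unfolding B1_def by (rule continuous_open_preimage[OF hmap_on_continuous[OF h\<Psi>1[OF U1(2)]] U1(1) open_ball])
  have B1B: "B1 \<subseteq> B" using U1(2) by (auto simp: B1_def)
  have w0B1: "w0 \<in> B1" using U1(3) \<delta>(1) by (simp add: B1_def)
  define \<Psi> :: "complex^3 \<Rightarrow> complex^3" where "\<Psi> w = vector [zz i (other i) (\<sigma>0 w), qq i (\<sigma>0 w), S (\<Psi>1 w)]" for w
  have h\<Psi>: "hmap_on \<Psi> B1"
    unfolding \<Psi>_def[abs_def]
    by (rule hmap_vector_3[OF hol\<sigma>[OF tz B1B] hol\<sigma>[OF tq B1B] holo_on_compose[OF hS h\<Psi>1[OF B1B]]]) (simp add: B1_def)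
  define W1 where "W1 = sat (N B1)"
  have oW1: "open W1" unfolding W1_def by (rule oN[OF oB1])
  have W1W: "W1 \<subseteq> W" using B1B by (auto simp: W1_def W_def satN)
  have FB1: "F s \<in> B1" if "s \<in> W1" for s using that by (simp add: W1_def satN)
  have \<Psi>F: "\<Psi> (F s) $ 1 = zz i (other i) s" "\<Psi> (F s) $ 2 = qq i s" "\<Psi> (F s) $ 3 = S (\<Psi>1 (F s))" if "s \<in> W1" for s
    using desc[OF tz] desc[OF tq] that W1W by (auto simp: \<Psi>_def)
  have br: "bracket i (qq i) (\<lambda>s. \<Psi> (F s) $ 3) s = 1" if s: "s \<in> W1" for s
  proof -
    have sW: "s \<in> W" using s W1W by blast
    have FU: "F s \<in> U1" and F\<delta>: "\<Psi>1 (F s) \<in> ball (\<Psi>1 w0) \<delta>" using FB1[OF s] by (auto simp: B1_def)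
    have h1: "hmap_on (\<lambda>s. \<Psi>1 (F s)) W1"
      by (rule hmap_on_compose[OF h\<Psi>1[OF B1B] hF FB1]) (use W1W WK in auto)
    have al: "along (eh A i) (\<lambda>s. \<Psi> (F s) $ 3) s = pd 2 S (\<Psi>1 (F s)) * along (eh A i) (qq i) s + pd 3 S (\<Psi>1 (F s)) * along (eh A i) (\<lambda>s. F s $ a) s" for A
    proof -
      have "along (eh A i) (\<lambda>s. \<Psi> (F s) $ 3) s = along (eh A i) (\<lambda>s. S (\<Psi>1 (F s))) s"
        by (rule along_cong[OF oW1 s \<Psi>F(3)])
      also have "\<dots> = (\<Sum>m\<in>UNIV. pd m S (\<Psi>1 (F s)) * along (eh A i) (\<lambda>s. \<Psi>1 (F s) $ m) s)"
        by (rule along_compose[OF hS h1 s F\<delta>])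
      also have "\<dots> = pd 1 S (\<Psi>1 (F s)) * along (eh A i) (zz i (other i)) s + pd 2 S (\<Psi>1 (F s)) * along (eh A i) (qq i) s + pd 3 S (\<Psi>1 (F s)) * along (eh A i) (\<lambda>s. F s $ a) s"
        by (simp only: sum_3 along_cong[OF oW sW \<Psi>1F(1)] along_cong[OF oW sW \<Psi>1F(2)] along_cong[OF oW sW \<Psi>1F(3)])
      also have "along (eh A i) (zz i (other i)) s = 0"
        unfolding zz_def[abs_def] using along_sz_fun[of _ "\<lambda>z. z $ other i / z $ i" s] by simp
      finally show ?thesis by simp
    qed
    have "bracket i (qq i) (\<lambda>s. \<Psi> (F s) $ 3) s = pd 3 S (\<Psi>1 (F s)) * P s"
      unfolding bracket_def[of i "qq i" "\<lambda>s. \<Psi> (F s) $ 3"] al P_def bracket_def by (simp add: algebra_simps)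
    also have "pd 3 S (\<Psi>1 (F s)) = 1 / P s"
      unfolding pS[OF F\<delta>] Ph_def G1\<Psi>[OF FU] desc[OF tP sW] by (rule refl)
    also have "Ph (\<Psi>1 (F s)) \<noteq> 0" using \<delta>(2) F\<delta> by blast
    then have "P s \<noteq> 0" unfolding Ph_def G1\<Psi>[OF FU] desc[OF tP sW] .
    then have "1 / P s * P s = 1" by simp
    finally show ?thesis .
  qed
  have s0W1: "s0 \<in> W1" using w0B1 s0K by (simp add: W1_def satN w0_def)
  have "\<exists>N2. N2 ** jac \<Psi> (F s0) = mat 1"
  proof (rule jac_left_inverse[OF oW1 hF h\<Psi> FB1 s0W1 patchD(2)[OF s0i]])
    show "W1 \<subseteq> sat K" using W1W WK by blast
    show "\<Psi> (F s) $ 1 = sz s $ other i / sz s $ i" if "s \<in> W1" for s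
      using \<Psi>F(1)[OF that] by (simp add: zz_def)
    have "bracket i (\<lambda>s. \<Psi> (F s) $ 2) (\<lambda>s. \<Psi> (F s) $ 3) s0 = bracket i (qq i) (\<lambda>s. \<Psi> (F s) $ 3) s0"
      by (rule bracket_cong[OF oW1 s0W1 \<Psi>F(2) refl])
    then show "bracket i (\<lambda>s. \<Psi> (F s) $ 2) (\<lambda>s. \<Psi> (F s) $ 3) s0 \<noteq> 0" using br[OF s0W1] by simp
  qed
  then obtain N2 where N2: "N2 ** jac \<Psi> w0 = mat 1" by (auto simp: w0_def)
  obtain U2 V2 G2 where U2: "open U2" "U2 \<subseteq> B1" "w0 \<in> U2" "open V2" "\<Psi> w0 \<in> V2" "homeomorphism U2 V2 \<Psi> G2" "hmap_on G2 V2"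
    by (rule holo_inverse_function[OF h\<Psi> oB1 w0B1 N2], rule that)
  define cc where "cc = \<Psi> w0"
  \<comment> \<open>The primitive vanishes at the centre, which puts the given twistor at affine
    coordinate zero.\<close>
  have cc3: "cc $ 3 = 0" by (simp add: cc_def \<Psi>_def S0)
  obtain \<epsilon> where \<epsilon>: "\<epsilon> > 0" "ball cc \<epsilon> \<subseteq> V2" using U2(4,5) open_contains_ball cc_def by blast
  \<comment> \<open>By \<open>pdisc_ball\<close> all three radii may be
    \<open>\<epsilon> / 4\<close>; the inner affine radius is a quarter of that.\<close>
  define r \<rho> where "r = \<epsilon> / 4" and "\<rho> = \<epsilon> / 16"
  have D: "pdisc cc r (4 * \<rho>) \<subseteq> V2" using pdisc_ball[OF cc3 \<epsilon>(1)] \<epsilon>(2) by (simp add: r_def \<rho>_def)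
  define B2 where "B2 = U2 \<inter> \<Psi> -` pdisc cc r (4 * \<rho>)"
  have oB2: "open B2"
    unfolding B2_def by (rule continuous_open_preimage[OF hmap_on_continuous[OF hmap_on_subset[OF h\<Psi> U2(2)]] U2(1) open_pdisc])
  have B2B1: "B2 \<subseteq> B1" using U2(2) by (auto simp: B2_def)
  define G where "G = N B2"
  define \<phi> where "\<phi> p = \<Psi> (\<phi>0 p)" for p
  define \<sigma> where "\<sigma> v = \<sigma>0 (G2 v)" for v
  have \<phi>F: "\<phi> (tp s) = \<Psi> (F s)" for s by (simp add: \<phi>_def F_def)
  have satG: "s \<in> sat G \<longleftrightarrow> s \<in> sat K \<and> F s \<in> B2" for s by (simp add: G_def satN)
  have GW1: "sat G \<subseteq> W1" using B2B1 by (auto simp: satG W1_def satN)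
  have G2: "G2 v \<in> B2" "\<Psi> (G2 v) = v" if v: "v \<in> pdisc cc r (4 * \<rho>)" for v
  proof -
    have vV: "v \<in> V2" using D v by blast
    show 1: "\<Psi> (G2 v) = v" by (rule homeomorphism_apply2[OF U2(6) vV])
    have "G2 v \<in> U2" using U2(6) vV by (metis homeomorphism_image2 imageI)
    then show "G2 v \<in> B2" using 1 v by (simp add: B2_def)
  qed
  have \<sigma>: "\<sigma> v \<in> sat G" "\<phi> (tp (\<sigma> v)) = v" if v: "v \<in> pdisc cc r (4 * \<rho>)" for v
  proof -
    have gb: "G2 v \<in> ball w0 r0" using G2(1)[OF v] B2B1 B1B Bball by blast
    show "\<sigma> v \<in> sat G" using \<sigma>0[OF gb] G2(1)[OF v] by (simp add: \<sigma>_def satG)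
    show "\<phi> (tp (\<sigma> v)) = v" using \<sigma>0(2)[OF gb] G2(2)[OF v] by (simp add: \<sigma>_def \<phi>F)
  qed
  have "darboux_chart i G \<phi> cc r \<rho> \<sigma>"
    unfolding darboux_chart_def
  proof (intro conjI ballI)
    show "G \<subseteq> TS" using chart_props(1)[OF c] by (auto simp: G_def N_def)
    show "inj_on \<phi> G"
    proof (rule inj_onI)
      fix x y assume x: "x \<in> G" and y: "y \<in> G" and eq: "\<phi> x = \<phi> y"
      have "\<phi>0 x \<in> U2" "\<phi>0 y \<in> U2" using x y by (auto simp: G_def N_def B2_def)
      then have "\<phi>0 x = \<phi>0 y" using eq homeomorphism_apply1[OF U2(6)] unfolding \<phi>_def by metis
      then show "x = y" using inj_onD[OF chart_props(2)[OF c]] x y by (auto simp: G_def N_def)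
    qed
    show "\<phi> ` G = pdisc cc r (4 * \<rho>)"
    proof (intro set_eqI iffI)
      fix v assume v: "v \<in> pdisc cc r (4 * \<rho>)"
      have "\<phi> (tp (\<sigma> v)) \<in> \<phi> ` G" by (rule imageI[OF satD(2)[OF \<sigma>(1)[OF v]]])
      then show "v \<in> \<phi> ` G" by (simp only: \<sigma>(2)[OF v])
    qed (auto simp: G_def N_def B2_def \<phi>_def)
    show "open (sat G)" unfolding G_def by (rule oN[OF oB2])
    show "sat G \<subseteq> patch i" using GW1 W1W Wpatch by blast
    show "hmap_on (\<lambda>s. \<phi> (tp s)) (sat G)"
      unfolding \<phi>F by (rule hmap_on_compose[OF h\<Psi> hF]) (use B2B1 in \<open>auto simp: satG\<close>)
    have "hmap_on G2 (pdisc cc r (4 * \<rho>))" by (rule hmap_on_subset[OF U2(7) D])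
    then show "hmap_on \<sigma> (pdisc cc r (4 * \<rho>))"
      unfolding \<sigma>_def[abs_def] by (rule hmap_on_compose[OF h\<sigma>B[OF order_refl]]) (use G2(1) B2B1 B1B in blast)
  next
    fix s assume "s \<in> sat G"
    then have s: "s \<in> W1" using GW1 by blast
    show "\<phi> (tp s) $ 1 = zz i (other i) s" "\<phi> (tp s) $ 2 = qq i s" unfolding \<phi>F by (rule \<Psi>F[OF s])+
    show "bracket i (qq i) (\<lambda>s. \<phi> (tp s) $ 3) s = 1" unfolding \<phi>F by (rule br[OF s])
  qed (use \<epsilon> \<sigma> in \<open>auto simp: r_def \<rho>_def\<close>)
  moreover have "\<phi> p = cc" using s0(2) by (simp add: \<phi>F[of s0, unfolded s0(2)] cc_def w0_def)
  then have "norm (\<phi> p $ 3) < \<rho>" using cc3 \<epsilon> by (simp add: \<rho>_def)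
  moreover have "p \<in> G"
  proof -
    have "cc \<in> pdisc cc r (4 * \<rho>)" using \<epsilon> cc3 by (simp add: pdisc_def r_def \<rho>_def)
    then have "s0 \<in> sat G" using s0K U2(3) by (simp add: satG B2_def cc_def w0_def)
    then show ?thesis using satD(2) s0(2) by blast
  qed
  ultimately show ?thesis by blast
qed

end

section \<open>The affine line bundle\<close>

lemma affine_rep_zz: "sz s $ i \<noteq> 0 \<Longrightarrow> affine_rep i (sz s $ other i / sz s $ i) = (1 / sz s $ i) *s sz s"
proof -
  assume z: "sz s $ i \<noteq> 0"
  have "j = i \<or> j = other i" for j
    by (cases i rule: exhaust_2_01; cases j rule: exhaust_2_01) simp_all
  then show ?thesis using z by (auto simp: affine_rep_def vec_eq_iff)
qed

text \<open>Representatives whose component \<open>i\<close> is one leave no freedom of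
  rescaling.\<close>

lemma O_point_affine_inj:
  assumes "O_point m (affine_rep i b) l = O_point m (affine_rep i b') l'"
  shows "b' = b" "l' = l"
proof -
  obtain c where c: "affine_rep i b' = c *s affine_rep i b" "l' = c powi m * l"
    using assms by (rule O_point_eqD)
  have "affine_rep i b' $ j = c * affine_rep i b $ j" for j by (simp add: c(1))
  from this[of i] this[of "other i"] have "c = 1" "b' = c * b" by (simp_all add: affine_rep_def)
  then show "b' = b" "l' = l" using c(2) by simp_all
qed

context twistor_setting begin

lemma darboux_chartD:
  assumes "darboux_chart i G \<phi> c r \<rho> \<sigma>"
  shows "G \<subseteq> TS" "inj_on \<phi> G" "0 < \<rho>" "\<phi> ` G = pdisc c r (4 * \<rho>)" "open (sat G)" "sat G \<subseteq> patch i"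
    "hmap_on (\<lambda>s. \<phi> (tp s)) (sat G)" "hmap_on \<sigma> (pdisc c r (4 * \<rho>))"
    "\<And>v. v \<in> pdisc c r (4 * \<rho>) \<Longrightarrow> \<sigma> v \<in> sat G" "\<And>v. v \<in> pdisc c r (4 * \<rho>) \<Longrightarrow> \<phi> (tp (\<sigma> v)) = v"
    "\<And>s. s \<in> sat G \<Longrightarrow> \<phi> (tp s) $ 1 = zz i (other i) s" "\<And>s. s \<in> sat G \<Longrightarrow> \<phi> (tp s) $ 2 = qq i s"
    "\<And>s. s \<in> sat G \<Longrightarrow> bracket i (qq i) (\<lambda>s. \<phi> (tp s) $ 3) s = 1"
  using assms unfolding darboux_chart_def by blast+

lemma darboux_point: "darboux_chart i G \<phi> c r \<rho> \<sigma> \<Longrightarrow> p \<in> G \<Longrightarrow> \<exists>s\<in>sat G. tp s = p"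
  using darboux_chartD(1) tp_onto unfolding sat_def by blast

lemma darboux_section: "darboux_chart i G \<phi> c r \<rho> \<sigma> \<Longrightarrow> p \<in> G \<Longrightarrow> tp (\<sigma> (\<phi> p)) = p"
proof -
  assume g: "darboux_chart i G \<phi> c r \<rho> \<sigma>" and p: "p \<in> G"
  have v: "\<phi> p \<in> pdisc c r (4 * \<rho>)" using darboux_chartD(4)[OF g] p by blast
  show ?thesis
    by (rule inj_onD[OF darboux_chartD(2)[OF g] darboux_chartD(10)[OF g v] satD(2)[OF darboux_chartD(9)[OF g v]] p])
qed

text \<open>A bracket equal to one forces a nonzero derivative of \<open>qq i\<close>.\<close>

lemma darboux_regular:
  assumes g: "darboux_chart i G \<phi> c r \<rho> \<sigma>" and p: "p \<in> G"
  shows "p \<in> regular_twistors U g e k L"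
proof -
  obtain s where s: "s \<in> sat G" "tp s = p" using darboux_point[OF g p] by blast
  have si: "s \<in> patch i" using darboux_chartD(6)[OF g] s(1) by blast
  have "\<exists>A. along (eh A i) (qq i) s \<noteq> 0"
  proof (rule ccontr)
    assume "\<not> ?thesis"
    then have "bracket i (qq i) (\<lambda>s. \<phi> (tp s) $ 3) s = 0" by (simp add: bracket_def)
    then show False using darboux_chartD(13)[OF g s(1)] by simp
  qed
  then obtain A A' where "grad_Q A A' s \<noteq> 0" using along_qq_regular[OF si] by blast
  then show ?thesis using regularI[OF satD(1)[OF s(1)]] s(2) by blast
qed

lemma darboux_pmap:
  assumes g: "darboux_chart i G \<phi> c r \<rho> \<sigma>" and p: "p \<in> G"
  shows "pmap p = O_point (int k) (affine_rep i (\<phi> p $ 1)) (\<phi> p $ 2)"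
proof -
  obtain s where s: "s \<in> sat G" "tp s = p" using darboux_point[OF g p] by blast
  have z: "sz s $ i \<noteq> 0" using darboux_chartD(6)[OF g] s(1) patchD(2) by blast
  have "pmap p = O_point (int k) (sz s) (Q s)" using pmap_tp[OF satD(1)[OF s(1)]] s(2) by simp
  also have "\<dots> = O_point (int k) ((1 / sz s $ i) *s sz s) ((1 / sz s $ i) powi int k * Q s)"
    by (rule O_point_scale[symmetric]) (use z in simp)
  also have "(1 / sz s $ i) powi int k * Q s = qq i s" by (simp add: qq_def power_divide)
  also have "(1 / sz s $ i) *s sz s = affine_rep i (zz i (other i) s)" unfolding zz_def by (rule affine_rep_zz[OF z, symmetric])
  finally show ?thesis using darboux_chartD(11,12)[OF g s(1)] s(2) by simp
qed

lemma darboux_disc: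
  assumes g: "darboux_chart i G \<phi> c r \<rho> \<sigma>"
  defines "V' \<equiv> {p \<in> G. norm (\<phi> p $ 3) < \<rho>}"
  shows "\<phi> ` V' = pdisc c r \<rho>" "pdisc c r \<rho> \<subseteq> pdisc c r (4 * \<rho>)" "open (sat V')"
    "\<And>v. v \<in> pdisc c r \<rho> \<Longrightarrow> \<sigma> v \<in> sat V'" "compatible_chart TS \<A> (V', \<phi>)"
proof -
  show sub: "pdisc c r \<rho> \<subseteq> pdisc c r (4 * \<rho>)" using darboux_chartD(3)[OF g] by (auto simp: pdisc_def)
  have VG: "V' \<subseteq> G" by (auto simp: V'_def)
  have V': "p \<in> V' \<longleftrightarrow> p \<in> G \<and> \<phi> p \<in> pdisc c r \<rho>" for p
    using darboux_chartD(4)[OF g] by (auto simp: V'_def pdisc_def)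
  show \<sigma>: "\<sigma> v \<in> sat V'" if v: "v \<in> pdisc c r \<rho>" for v
    using darboux_chartD(9,10)[OF g, of v] v sub by (auto simp: sat_def V')
  show img: "\<phi> ` V' = pdisc c r \<rho>"
  proof (intro set_eqI iffI)
    fix v assume v: "v \<in> pdisc c r \<rho>"
    have "\<phi> (tp (\<sigma> v)) \<in> \<phi> ` V'" by (rule imageI[OF satD(2)[OF \<sigma>[OF v]]])
    then show "v \<in> \<phi> ` V'" by (simp only: darboux_chartD(10)[OF g subsetD[OF sub v]])
  qed (auto simp: V')
  have "sat V' = sat G \<inter> (\<lambda>s. \<phi> (tp s)) -` pdisc c r \<rho>" by (auto simp: sat_def V')
  then show o: "open (sat V')"
    using continuous_open_preimage[OF hmap_on_continuous[OF darboux_chartD(7)[OF g]] darboux_chartD(5)[OF g] open_pdisc] by simp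
  show "compatible_chart TS \<A> (V', \<phi>)"
  proof (rule compatible_chartI[where \<sigma>=\<sigma>])
    show "V' \<subseteq> TS" using VG darboux_chartD(1)[OF g] by blast
    show "inj_on \<phi> V'" by (rule inj_on_subset[OF darboux_chartD(2)[OF g] VG])
    show "hmap_on (\<lambda>s. \<phi> (tp s)) (sat V')" by (rule hmap_on_subset[OF darboux_chartD(7)[OF g] sat_mono[OF VG]])
    show "hmap_on \<sigma> (\<phi> ` V')" unfolding img by (rule hmap_on_subset[OF darboux_chartD(8)[OF g] sub])
    show "open (\<phi> ` V')" unfolding img by (rule open_pdisc)
    show "\<sigma> v \<in> sat V'" "\<phi> (tp (\<sigma> v)) = v" if "v \<in> \<phi> ` V'" for v
      using \<sigma> darboux_chartD(10)[OF g] that sub by (auto simp: img)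
  qed (rule o)
qed

text \<open>The affine coordinates are normalised by the symplectic form on the fibres of twistor space,
  which has values in \<open>\<O>(2)\<close>, whereas the base coordinate \<open>q\<close> has values in
  \<open>\<O>(k)\<close>.\<close>

lemma transition_derivative:
  assumes g: "darboux_chart i G \<phi> c r \<rho> \<sigma>" and g': "darboux_chart j G' \<phi>' c' r' \<rho>' \<sigma>'"
    and v: "v \<in> pdisc c r (4 * \<rho>)" "\<sigma> v \<in> sat G'"
  shows "holo_on (\<lambda>v. \<phi>' (tp (\<sigma> v)) $ 3) (pdisc c r (4 * \<rho>) \<inter> \<sigma> -` sat G')"
    and "pd 3 (\<lambda>v. \<phi>' (tp (\<sigma> v)) $ 3) v = O_trans (2 - int k) i j (v $ 1)"
proof -
  define f where "f v = \<phi>' (tp (\<sigma> v)) $ 3" for v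
  define B where "B = pdisc c r (4 * \<rho>) \<inter> \<sigma> -` sat G'"
  have f: "holo_on f B"
    unfolding f_def[abs_def]
    by (rule holo_on_compose[OF hmap_onD[OF darboux_chartD(7)[OF g']] hmap_on_subset[OF darboux_chartD(8)[OF g]]]) (auto simp: B_def)
  then show "holo_on (\<lambda>v. \<phi>' (tp (\<sigma> v)) $ 3) (pdisc c r (4 * \<rho>) \<inter> \<sigma> -` sat G')"
    by (simp add: f_def[abs_def] B_def)
  define W where "W = sat G \<inter> sat G'"
  have oW: "open W" unfolding W_def by (rule open_Int[OF darboux_chartD(5)[OF g] darboux_chartD(5)[OF g']])
  define s where "s = \<sigma> v"
  have s: "s \<in> W" using darboux_chartD(9)[OF g v(1)] v(2) by (simp add: W_def s_def)
  have sv: "\<phi> (tp s) = v" unfolding s_def by (rule darboux_chartD(10)[OF g v(1)])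
  define fn where "fn s = \<phi>' (tp s) $ 3" for s
  have F: "hmap_on (\<lambda>s. \<phi> (tp s)) W" by (rule hmap_on_subset[OF darboux_chartD(7)[OF g]]) (simp add: W_def)
  have fnf: "fn s = f (\<phi> (tp s))" if "s \<in> W" for s
    using darboux_section[OF g satD(2), of s] that by (simp add: W_def fn_def f_def)
  have sG: "s \<in> sat G" "s \<in> sat G'" using s by (auto simp: W_def)
  have Fs: "\<phi> (tp s) \<in> B" using v by (simp add: sv B_def)
  have si: "s \<in> patch i" "s \<in> patch j" using darboux_chartD(6)[OF g] darboux_chartD(6)[OF g'] s by (auto simp: W_def)
  note zi = patchD(2)[OF si(1)] and zj = patchD(2)[OF si(2)]
  have al: "along (eh A i) fn s = pd 2 f v * along (eh A i) (qq i) s + pd 3 f v * along (eh A i) (\<lambda>s. \<phi> (tp s) $ 3) s" for A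
  proof -
    have "along (eh A i) fn s = along (eh A i) (\<lambda>s. f (\<phi> (tp s))) s" by (rule along_cong[OF oW s fnf])
    also have "\<dots> = (\<Sum>m\<in>UNIV. pd m f (\<phi> (tp s)) * along (eh A i) (\<lambda>s. \<phi> (tp s) $ m) s)"
      by (rule along_compose[OF f F s Fs])
    also have "\<dots> = pd 1 f v * along (eh A i) (zz i (other i)) s + pd 2 f v * along (eh A i) (qq i) s + pd 3 f v * along (eh A i) (\<lambda>s. \<phi> (tp s) $ 3) s"
      by (simp only: sum_3 sv along_cong[OF darboux_chartD(5)[OF g] sG(1) darboux_chartD(11)[OF g]] along_cong[OF darboux_chartD(5)[OF g] sG(1) darboux_chartD(12)[OF g]])
    also have "along (eh A i) (zz i (other i)) s = 0"
      unfolding zz_def[abs_def] using along_sz_fun[of _ "\<lambda>z. z $ other i / z $ i" s] by simp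
    finally show ?thesis by simp
  qed
  \<comment> \<open>The bracket is antisymmetric, so the derivative of \<open>f\<close> in the
    direction of \<open>qq i\<close> does not contribute.\<close>
  have "bracket i (qq i) fn s = pd 3 f v * bracket i (qq i) (\<lambda>s. \<phi> (tp s) $ 3) s"
    unfolding bracket_def al by (simp add: algebra_simps)
  then have 1: "bracket i (qq i) fn s = pd 3 f v" using darboux_chartD(13)[OF g sG(1)] by simp
  have 2: "bracket j (qq j) fn s = 1" unfolding fn_def[abs_def] by (rule darboux_chartD(13)[OF g' sG(2)])
  have "along Y (qq i) s * sz s $ i ^ k = along Y (qq j) s * sz s $ j ^ k" for Y
    using along_Q_qq[OF si(1)] along_Q_qq[OF si(2)] by simp
  then have aq: "along Y (qq i) s = along Y (qq j) s * (sz s $ j / sz s $ i) ^ k" for Y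
    using zi by (simp add: power_divide field_simps)
  have 3: "bracket i (qq i) fn s = (sz s $ j / sz s $ i) ^ k * bracket i (qq j) fn s"
    unfolding bracket_def aq by (simp add: algebra_simps)
  have tfn: "twistor_fn fn (sat G')"
    unfolding fn_def[abs_def]
    by (rule leafwise_constant_tp[OF darboux_chartD(5)[OF g'] hmap_onD[OF darboux_chartD(7)[OF g']]])
  have "(sz s $ i)\<^sup>2 * bracket j (qq j) fn s = (sz s $ j)\<^sup>2 * bracket i (qq j) fn s"
    by (rule bracket_patch) (use twistor_fnD(4)[OF tfn sG(2)] twistor_fnD(4)[OF twistor_fn_qq si(2)] in simp_all)
  then have 4: "bracket i (qq j) fn s = (sz s $ i / sz s $ j)\<^sup>2"
    using zj 2 by (simp add: power_divide field_simps)
  define x where "x = sz s $ i / sz s $ j"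
  have x: "x \<noteq> 0" using zi zj by (simp add: x_def)
  have "pd 3 f v = x\<^sup>2 / x ^ k"
    using 1 3 4 zi zj by (simp add: x_def power_divide field_simps)
  also have "\<dots> = x powi (2 - int k)"
    by (subst power_int_diff) (use x in simp_all)
  also have "x = 1 / affine_rep i (v $ 1) $ j"
  proof -
    have "v $ 1 = sz s $ other i / sz s $ i" using darboux_chartD(11)[OF g sG(1)] by (simp add: sv zz_def)
    then show ?thesis using affine_rep_zz[OF zi] by (simp add: x_def)
  qed
  finally show "pd 3 (\<lambda>v. \<phi>' (tp (\<sigma> v)) $ 3) v = O_trans (2 - int k) i j (v $ 1)"
    by (simp add: f_def[abs_def] O_trans_def)
qed

end

section \<open>Fibres of the projection in two charts\<close>

context twistor_setting begin

text \<open>Follow the segment from \<open>z\<close> to \<open>z'\<close> in the fibre disc of the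
  first chart and the segment predicted by the transition factor in the second. The twistors with
  these coordinates agree at the start. The times of agreement form an open set by
  \<open>transition_derivative\<close> and a closed set by separation of points, so they agree at
  the end. The bound \<open>T\<close> keeps the second segment in its extended disc.\<close>

lemma fibre_affine_aux:
  assumes g: "darboux_chart i G \<phi> c r \<rho> \<sigma>" and g': "darboux_chart j G' \<phi>' c' r' \<rho>' \<sigma>'"
    and z: "z \<in> G" "z \<in> G'" "norm (\<phi> z $ 3) < \<rho>" "norm (\<phi>' z $ 3) < \<rho>'"
    and z': "z' \<in> G" "norm (\<phi> z' $ 3) < \<rho>" and p: "pmap z' = pmap z"
    and T: "norm (O_trans (2 - int k) i j (\<phi> z $ 1)) * \<rho> \<le> \<rho>'"
  shows "\<phi>' z' $ 3 = \<phi>' z $ 3 + O_trans (2 - int k) i j (\<phi> z $ 1) * (\<phi> z' $ 3 - \<phi> z $ 3)"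
proof -
  define \<Delta> where "\<Delta> = \<phi> z' $ 3 - \<phi> z $ 3"
  define T0 where "T0 = O_trans (2 - int k) i j (\<phi> z $ 1)"
  define v where "v \<tau> = \<phi> z + (of_real \<tau> * \<Delta>) *s axis 3 1" for \<tau> :: real
  define u where "u \<tau> = \<phi>' z + (of_real \<tau> * (T0 * \<Delta>)) *s axis 3 1" for \<tau> :: real
  have vc: "v \<tau> $ 1 = \<phi> z $ 1" "v \<tau> $ 2 = \<phi> z $ 2" "v \<tau> $ 3 = \<phi> z $ 3 + of_real \<tau> * \<Delta>" for \<tau>
    by (simp_all add: v_def axis_def)
  have uc: "u \<tau> $ 1 = \<phi>' z $ 1" "u \<tau> $ 2 = \<phi>' z $ 2" "u \<tau> $ 3 = \<phi>' z $ 3 + of_real \<tau> * (T0 * \<Delta>)" for \<tau>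
    by (simp_all add: u_def axis_def)
  have fz: "\<phi> z \<in> pdisc c r (4 * \<rho>)" "\<phi>' z \<in> pdisc c' r' (4 * \<rho>')"
    using darboux_chartD(4)[OF g] darboux_chartD(4)[OF g'] z by blast+
  have \<Delta>: "norm \<Delta> \<le> 2 * \<rho>"
    using norm_triangle_ineq4[of "\<phi> z' $ 3" "\<phi> z $ 3"] z(3) z'(2) by (simp add: \<Delta>_def)
  \<comment> \<open>A start below \<open>\<rho>\<close> and a length of at most
    \<open>2 * \<rho>\<close> keep the segment within the extended disc, although not within the
    inner one a priori.\<close>
  have v: "v \<tau> \<in> pdisc c r (4 * \<rho>)" if \<tau>: "\<tau> \<in> {0..1}" for \<tau>
  proof -
    have "norm (of_real \<tau> * \<Delta>) \<le> 2 * \<rho>"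
      using \<tau> \<Delta> mult_left_le_one_le[of "norm \<Delta>" \<tau>] by (simp add: norm_mult)
    then have "norm (v \<tau> $ 3) < 4 * \<rho>"
      using norm_triangle_ineq[of "\<phi> z $ 3" "of_real \<tau> * \<Delta>"] z(3) darboux_chartD(3)[OF g] by (simp add: vc)
    then show ?thesis using fz(1) by (simp add: pdisc_def vc)
  qed
  have u: "u \<tau> \<in> pdisc c' r' (4 * \<rho>')" if \<tau>: "\<tau> \<in> {0..1}" for \<tau>
  proof -
    have "norm (T0 * \<Delta>) \<le> norm T0 * (2 * \<rho>)"
      unfolding norm_mult by (rule mult_left_mono[OF \<Delta>]) simp
    also have "\<dots> \<le> 2 * \<rho>'" using T by (simp add: T0_def)
    finally have "norm (of_real \<tau> * (T0 * \<Delta>)) \<le> 2 * \<rho>'"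
      using \<tau> mult_left_le_one_le[of "norm (T0 * \<Delta>)" \<tau>] by (simp add: norm_mult)
    then have "norm (u \<tau> $ 3) < 4 * \<rho>'"
      using norm_triangle_ineq[of "\<phi>' z $ 3" "of_real \<tau> * (T0 * \<Delta>)"] z(4) darboux_chartD(3)[OF g'] by (simp add: uc)
    then show ?thesis using fz(2) by (simp add: pdisc_def uc)
  qed
  define a where "a \<tau> = tp (\<sigma> (v \<tau>))" for \<tau>
  define b where "b \<tau> = tp (\<sigma>' (u \<tau>))" for \<tau>
  have aG: "a \<tau> \<in> G" "\<phi> (a \<tau>) = v \<tau>" if "\<tau> \<in> {0..1}" for \<tau>
    unfolding a_def by (rule satD(2)[OF darboux_chartD(9)[OF g v[OF that]]], rule darboux_chartD(10)[OF g v[OF that]])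
  have bG: "b \<tau> \<in> G'" "\<phi>' (b \<tau>) = u \<tau>" if "\<tau> \<in> {0..1}" for \<tau>
    unfolding b_def by (rule satD(2)[OF darboux_chartD(9)[OF g' u[OF that]]], rule darboux_chartD(10)[OF g' u[OF that]])
  have hv: "continuous_on S v" and hu: "continuous_on S u" for S
    unfolding v_def[abs_def] u_def[abs_def] by (intro continuous_intros)+
  have cv: "continuous_on {0..1} (\<lambda>\<tau>. \<sigma> (v \<tau>))"
    by (rule continuous_on_compose2[OF hmap_on_continuous[OF darboux_chartD(8)[OF g]] hv]) (use v in blast)
  have cu: "continuous_on {0..1} (\<lambda>\<tau>. \<sigma>' (u \<tau>))"
    by (rule continuous_on_compose2[OF hmap_on_continuous[OF darboux_chartD(8)[OF g']] hu]) (use u in blast)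
  have ev: "\<forall>\<^sub>F \<tau> in at t within {0..1}. f \<tau> \<in> S"
    if "continuous_on {0..1} f" "open S" "t \<in> {0..1}" "f t \<in> S" for f :: "real \<Rightarrow> complex^(4+2)" and S t
  proof -
    have "(f \<longlongrightarrow> f t) (at t within {0..1})" using that(1,3) by (simp add: continuous_on_def)
    then show ?thesis by (rule topological_tendstoD[OF _ that(2,4)])
  qed
  have "(a 0 = b 0) = (a 1 = b 1)"
  proof (rule connected_local_const[of "{0..1::real}" 0 1 "\<lambda>\<tau>. a \<tau> = b \<tau>"])
    show "\<forall>t\<in>{0..1}. \<forall>\<^sub>F \<tau> in at t within {0..1}. (a t = b t) = (a \<tau> = b \<tau>)"
    proof
      fix t :: real assume t: "t \<in> {0..1}"
      show "\<forall>\<^sub>F \<tau> in at t within {0..1}. (a t = b t) = (a \<tau> = b \<tau>)"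
      proof (cases "a t = b t")
        case False
        \<comment> \<open>Distinct twistors have disjoint neighbourhoods, so they stay distinct at
          nearby times.\<close>
        have "a t \<in> TS" "b t \<in> TS" using aG(1)[OF t] bG(1)[OF t] darboux_chartD(1)[OF g] darboux_chartD(1)[OF g'] by auto
        from separated[OF this False] obtain N N' where N: "open (sat N)" "open (sat N')" "a t \<in> N" "b t \<in> N'" "N \<inter> N' = {}" by blast
        have "\<sigma> (v t) \<in> sat N" "\<sigma>' (u t) \<in> sat N'"
          using N(3,4) satD(1)[OF darboux_chartD(9)[OF g v[OF t]]] satD(1)[OF darboux_chartD(9)[OF g' u[OF t]]] by (simp_all add: sat_def a_def b_def)
        from ev[OF cv N(1) t this(1)] ev[OF cu N(2) t this(2)] show ?thesis
        proof eventually_elim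
          case (elim \<tau>)
          have "a \<tau> \<in> N" "b \<tau> \<in> N'" unfolding a_def b_def by (rule satD(2)[OF elim(1)], rule satD(2)[OF elim(2)])
          then have "a \<tau> \<noteq> b \<tau>" using N(5) by (auto simp only: disjoint_iff)
          then show ?case using False by simp
        qed
      next
        case True
        have "\<sigma> (v t) \<in> sat G'"
          using bG(1)[OF t] True satD(1)[OF darboux_chartD(9)[OF g v[OF t]]] by (simp add: sat_def a_def[symmetric])
        define f where "f w = \<phi>' (tp (\<sigma> w)) $ 3" for w
        obtain N where N: "open N" "t \<in> N" and NG: "\<And>\<tau>. \<tau> \<in> {0..1} \<Longrightarrow> \<tau> \<in> N \<Longrightarrow> \<sigma> (v \<tau>) \<in> sat G'"
          using cv[unfolded continuous_on_topological, rule_format, OF t darboux_chartD(5)[OF g'] \<open>\<sigma> (v t) \<in> sat G'\<close>] by blast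
        obtain \<delta> where \<delta>: "\<delta> > 0" "ball t \<delta> \<subseteq> N" using N open_contains_ball by blast
        let ?J = "{0..1} \<inter> ball t \<delta>"
        have J: "\<sigma> (v \<tau>) \<in> sat G'" "v \<tau> \<in> pdisc c r (4 * \<rho>)" if "\<tau> \<in> ?J" for \<tau>
          using NG v \<delta>(2) that by blast+
        obtain C where C: "\<And>\<tau>. \<tau> \<in> ?J \<Longrightarrow> f (v \<tau>) - of_real \<tau> * (T0 * \<Delta>) = C"
        proof (rule has_vector_derivative_zero_constant)
          show "convex ?J" by (intro convex_Int convex_ball) simp
          fix \<tau> assume \<tau>: "\<tau> \<in> ?J"
          have dv: "(v has_vector_derivative axis 3 \<Delta>) (at \<tau> within ?J)"
          proof (rule has_vector_derivative_vec)
            fix m :: 3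
            have "((\<lambda>\<tau>. \<phi> z $ 3 + of_real \<tau> * \<Delta>) has_vector_derivative \<Delta>) (at \<tau> within ?J)"
              by (auto intro!: derivative_eq_intros)
            then show "((\<lambda>\<tau>. v \<tau> $ m) has_vector_derivative axis 3 \<Delta> $ m) (at \<tau> within ?J)"
              by (cases "m = 3") (simp_all add: v_def axis_def)
          qed
          have vB: "v \<tau> \<in> pdisc c r (4 * \<rho>) \<inter> \<sigma> -` sat G'" using J[OF \<tau>] by blast
          have "((\<lambda>\<tau>. f (v \<tau>)) has_vector_derivative (\<Sum>m\<in>UNIV. pd m f (v \<tau>) * axis 3 \<Delta> $ m)) (at \<tau> within ?J)"
            unfolding f_def
            by (rule holo_on_curve[OF transition_derivative(1)[OF g g' J(2)[OF \<tau>] J(1)[OF \<tau>]] vB dv])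
          moreover have "(\<Sum>m\<in>UNIV. pd m f (v \<tau>) * axis 3 \<Delta> $ m) = T0 * \<Delta>"
            using transition_derivative(2)[OF g g' J(2)[OF \<tau>] J(1)[OF \<tau>]]
            by (simp add: f_def[abs_def] vc T0_def axis_def if_distrib[of "\<lambda>t. _ * t"] cong: if_cong)
          moreover have "((\<lambda>\<tau>. of_real \<tau> * (T0 * \<Delta>)) has_vector_derivative T0 * \<Delta>) (at \<tau> within ?J)"
            by (auto intro!: derivative_eq_intros)
          ultimately show "((\<lambda>\<tau>. f (v \<tau>) - of_real \<tau> * (T0 * \<Delta>)) has_vector_derivative 0) (at \<tau> within ?J)"
            using has_vector_derivative_diff by fastforce
        qed (rule that)
        have tJ: "t \<in> ?J" using t \<delta>(1) by simp
        have "f (v t) = u t $ 3"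
          using bG(2)[OF t] True by (simp add: f_def a_def[symmetric])
        then have C': "C = \<phi>' z $ 3" using C[OF tJ] by (simp add: uc)
        have "a \<tau> = b \<tau>" if \<tau>: "\<tau> \<in> ?J" for \<tau>
        proof -
          have \<tau>1: "\<tau> \<in> {0..1}" using \<tau> by blast
          have aG': "a \<tau> \<in> G'" unfolding a_def by (rule satD(2)[OF J(1)[OF \<tau>]])
          \<comment> \<open>The projection is constant along the segment, which fixes the first two
            coordinates in the second chart; only the affine coordinate needs the derivative
            formula.\<close>
          have "pmap (a \<tau>) = pmap z"
            unfolding darboux_pmap[OF g aG(1)[OF \<tau>1]] darboux_pmap[OF g z(1)] aG(2)[OF \<tau>1] vc by (rule refl)
          then have "O_point (int k) (affine_rep j (\<phi>' z $ 1)) (\<phi>' z $ 2)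
             = O_point (int k) (affine_rep j (\<phi>' (a \<tau>) $ 1)) (\<phi>' (a \<tau>) $ 2)"
            unfolding darboux_pmap[OF g' aG'] darboux_pmap[OF g' z(2)] by (rule sym)
          note 12 = O_point_affine_inj[OF this]
          have "\<phi>' (a \<tau>) $ 3 = u \<tau> $ 3"
            using C[OF \<tau>] C' by (simp add: uc f_def a_def diff_eq_eq)
          then have "\<phi>' (a \<tau>) = \<phi>' (b \<tau>)"
            using 12 by (simp add: vec_eq_iff forall_3 bG(2)[OF \<tau>1] uc)
          then show ?thesis by (rule inj_onD[OF darboux_chartD(2)[OF g'] _ aG' bG(1)[OF \<tau>1]])
        qed
        then show ?thesis
          using \<delta>(1) True unfolding eventually_at by (intro exI[of _ \<delta>]) (auto simp: dist_commute)
      qed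
    qed
  qed auto
  moreover have "a 0 = b 0"
    using darboux_section[OF g z(1)] darboux_section[OF g' z(2)] by (simp add: a_def b_def v_def u_def)
  ultimately have ab: "a 1 = b 1" by blast
  have one: "(1::real) \<in> {0..1}" by simp
  have "\<phi> z' = v 1"
  proof -
    have "O_point (int k) (affine_rep i (\<phi> z $ 1)) (\<phi> z $ 2) = O_point (int k) (affine_rep i (\<phi> z' $ 1)) (\<phi> z' $ 2)"
      using p unfolding darboux_pmap[OF g z(1)] darboux_pmap[OF g z'(1)] by (rule sym)
    from O_point_affine_inj[OF this] show ?thesis by (simp add: vec_eq_iff forall_3 vc \<Delta>_def)
  qed
  then have "\<phi> z' = \<phi> (a 1)" by (simp only: aG(2)[OF one])
  then have "z' = a 1" by (rule inj_onD[OF darboux_chartD(2)[OF g] _ z'(1) aG(1)[OF one]])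
  then have "\<phi>' z' = u 1" using ab bG(2)[OF one] by simp
  then show ?thesis by (simp add: uc T0_def \<Delta>_def)
qed

lemma O_trans_inverse:
  assumes "darboux_chart i G \<phi> c r \<rho> \<sigma>" "darboux_chart j G' \<phi>' c' r' \<rho>' \<sigma>'" "z \<in> G" "z \<in> G'"
  shows "affine_rep i (\<phi> z $ 1) $ j \<noteq> 0"
    and "O_trans m i j (\<phi> z $ 1) * O_trans m j i (\<phi>' z $ 1) = 1"
proof -
  obtain s where s: "s \<in> total" "tp s = z" using darboux_point[OF assms(1,3)] satD(1) by blast
  have sG: "s \<in> sat G" "s \<in> sat G'" using s assms(3,4) by (auto simp: sat_def)
  have n: "sz s $ i \<noteq> 0" "sz s $ j \<noteq> 0"
    using darboux_chartD(6)[OF assms(1)] darboux_chartD(6)[OF assms(2)] sG patchD(2) by blast+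
  have r: "affine_rep i (\<phi> z $ 1) $ j = sz s $ j / sz s $ i" "affine_rep j (\<phi>' z $ 1) $ i = sz s $ i / sz s $ j"
    using darboux_chartD(11)[OF assms(1) sG(1)] darboux_chartD(11)[OF assms(2) sG(2)] affine_rep_zz[OF n(1)] affine_rep_zz[OF n(2)] s(2)
    by (simp_all add: zz_def)
  show "affine_rep i (\<phi> z $ 1) $ j \<noteq> 0" using n by (simp add: r)
  show "O_trans m i j (\<phi> z $ 1) * O_trans m j i (\<phi>' z $ 1) = 1"
    unfolding O_trans_def r using n by (simp add: power_int_mult_distrib[symmetric])
qed

text \<open>Either the first disc rescaled by the transition factor fits into the second, or the
  second rescaled by the inverse factor fits into the first. The segment argument runs from the
  smaller disc, and the resulting relation can be inverted.\<close>

lemma fibre_affine: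
  assumes g: "darboux_chart i G \<phi> c r \<rho> \<sigma>" and g': "darboux_chart j G' \<phi>' c' r' \<rho>' \<sigma>'"
    and z: "z \<in> G" "z \<in> G'" "norm (\<phi> z $ 3) < \<rho>" "norm (\<phi>' z $ 3) < \<rho>'"
    and z': "z' \<in> G" "z' \<in> G'" "norm (\<phi> z' $ 3) < \<rho>" "norm (\<phi>' z' $ 3) < \<rho>'" and p: "pmap z' = pmap z"
  shows "\<phi>' z' $ 3 - O_trans (2 - int k) i j (\<phi> z' $ 1) * \<phi> z' $ 3 = \<phi>' z $ 3 - O_trans (2 - int k) i j (\<phi> z $ 1) * \<phi> z $ 3"
proof -
  let ?T = "O_trans (2 - int k) i j (\<phi> z $ 1)" and ?T' = "O_trans (2 - int k) j i (\<phi>' z $ 1)"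
  have "O_point (int k) (affine_rep i (\<phi> z $ 1)) (\<phi> z $ 2) = O_point (int k) (affine_rep i (\<phi> z' $ 1)) (\<phi> z' $ 2)"
    using p unfolding darboux_pmap[OF g z(1)] darboux_pmap[OF g z'(1)] by (rule sym)
  note e = O_point_affine_inj(1)[OF this]
  have TT: "?T * ?T' = 1" by (rule O_trans_inverse(2)[OF g g' z(1,2)])
  show ?thesis
  proof (cases "norm ?T * \<rho> \<le> \<rho>'")
    case True
    then show ?thesis using fibre_affine_aux[OF g g' z z'(1,3) p] by (simp add: e algebra_simps)
  next
    case False
    have "norm ?T * norm ?T' = 1" using TT by (metis norm_mult norm_one)
    moreover have "norm ?T' * \<rho>' \<le> norm ?T' * (norm ?T * \<rho>)" by (rule mult_left_mono) (use False in auto)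
    moreover have "norm ?T' * (norm ?T * \<rho>) = (norm ?T * norm ?T') * \<rho>" by (simp only: mult_ac)
    ultimately have "norm ?T' * \<rho>' \<le> \<rho>" by simp
    then have "\<phi> z' $ 3 = \<phi> z $ 3 + ?T' * (\<phi>' z' $ 3 - \<phi>' z $ 3)"
      by (rule fibre_affine_aux[OF g' g z(2,1,4,3) z'(2,4) p])
    then have "?T * (\<phi> z' $ 3 - \<phi> z $ 3) = ?T * ?T' * (\<phi>' z' $ 3 - \<phi>' z $ 3)" by simp
    then show ?thesis by (simp add: TT e algebra_simps)
  qed
qed

text \<open>The difference of the affine coordinates after rescaling is constant on the fibres of
  \<open>pmap\<close> and so descends to the base. Near a given base point it can be read off on the
  slice where the affine coordinate of the first chart is constant, which shows that it is
  holomorphic.\<close>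

lemma transition_function:
  assumes g: "darboux_chart i G \<phi> c r \<rho> \<sigma>" and g': "darboux_chart j G' \<phi>' c' r' \<rho>' \<sigma>'"
    and Ve: "Ve = {p \<in> G. norm (\<phi> p $ 3) < \<rho>}" and Ve': "Ve' = {p \<in> G'. norm (\<phi>' p $ 3) < \<rho>'}"
  shows "\<exists>h. holo_on (\<lambda>b. h (O_point (int k) (affine_rep i (b $ 1)) (b $ 2)))
             {b :: complex^2. O_point (int k) (affine_rep i (b $ 1)) (b $ 2) \<in> pmap ` (Ve \<inter> Ve')} \<and>
           (\<forall>z\<in>Ve \<inter> Ve'. \<phi>' z $ 3 = O_trans (2 - int k) i j (\<phi> z $ 1) * \<phi> z $ 3 + h (pmap z))"
proof -
  define D where "D z = \<phi>' z $ 3 - O_trans (2 - int k) i j (\<phi> z $ 1) * \<phi> z $ 3" for z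
  define h where "h y = D (SOME z. z \<in> Ve \<inter> Ve' \<and> pmap z = y)" for y
  have h: "h (pmap z) = D z" if z: "z \<in> Ve \<inter> Ve'" for z
  proof -
    define z' where "z' = (SOME z'. z' \<in> Ve \<inter> Ve' \<and> pmap z' = pmap z)"
    have "z' \<in> Ve \<inter> Ve' \<and> pmap z' = pmap z" unfolding z'_def by (rule someI[of _ z]) (use z in simp)
    then have "D z' = D z" unfolding D_def using z fibre_affine[OF g g', of z z'] by (auto simp: Ve Ve')
    then show ?thesis by (simp add: h_def z'_def)
  qed
  let ?b = "\<lambda>b :: complex^2. O_point (int k) (affine_rep i (b $ 1)) (b $ 2)"
  have "holo_on (\<lambda>b. h (?b b)) {b. ?b b \<in> pmap ` (Ve \<inter> Ve')}"
  proof (rule holo_on_UN)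
    fix b0 :: "complex^2" assume "b0 \<in> {b. ?b b \<in> pmap ` (Ve \<inter> Ve')}"
    then obtain z0 where z0: "z0 \<in> Ve" "z0 \<in> Ve'" "?b b0 = pmap z0" by auto
    have z0G: "z0 \<in> G" using z0(1) by (simp add: Ve)
    define s where "s = \<phi> z0 $ 3"
    define \<iota> :: "complex^2 \<Rightarrow> complex^3" where "\<iota> b = vector [b $ 1, b $ 2, s]" for b
    have h\<iota>: "hmap_on \<iota> S" for S
      unfolding \<iota>_def[abs_def] by (rule hmap_vector_3) simp_all
    have "\<phi> z0 $ 1 = b0 $ 1" "\<phi> z0 $ 2 = b0 $ 2"
      using z0(3) unfolding darboux_pmap[OF g z0G] by (rule O_point_affine_inj)+
    then have \<iota>0: "\<iota> b0 = \<phi> z0" by (simp add: \<iota>_def s_def vec_eq_iff forall_3)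
    note disc = darboux_disc[OF g, folded Ve] and disc' = darboux_disc[OF g', folded Ve']
    define R where "R = pdisc c r \<rho> \<inter> \<sigma> -` sat Ve'"
    have oR: "open R"
      unfolding R_def
      by (rule continuous_open_preimage[OF hmap_on_continuous[OF hmap_on_subset[OF darboux_chartD(8)[OF g] disc(2)]] open_pdisc disc'(3)])
    define S where "S = \<iota> -` R"
    have oS: "open S" unfolding S_def by (rule open_vimage[OF oR hmap_on_continuous[OF h\<iota>]])
    have b0S: "b0 \<in> S"
    proof -
      have v: "\<phi> z0 \<in> pdisc c r \<rho>" using disc(1) z0(1) by blast
      have "tp (\<sigma> (\<phi> z0)) = z0" by (rule darboux_section[OF g z0G])
      then have "\<sigma> (\<phi> z0) \<in> sat Ve'" using z0(2) satD(1)[OF disc(4)[OF v]] by (simp add: sat_def)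
      then show ?thesis using v by (simp add: S_def R_def \<iota>0)
    qed
    have pt: "tp (\<sigma> (\<iota> b)) \<in> Ve \<inter> Ve'" "\<phi> (tp (\<sigma> (\<iota> b))) = \<iota> b" "?b b = pmap (tp (\<sigma> (\<iota> b)))" if b: "b \<in> S" for b
    proof -
      have v: "\<iota> b \<in> pdisc c r \<rho>" "\<sigma> (\<iota> b) \<in> sat Ve'" using b by (auto simp: S_def R_def)
      show 1: "tp (\<sigma> (\<iota> b)) \<in> Ve \<inter> Ve'" using satD(2)[OF disc(4)[OF v(1)]] satD(2)[OF v(2)] by blast
      show 2: "\<phi> (tp (\<sigma> (\<iota> b))) = \<iota> b" by (rule darboux_chartD(10)[OF g subsetD[OF disc(2) v(1)]])
      have G: "tp (\<sigma> (\<iota> b)) \<in> G" using 1 by (simp add: Ve)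
      show "?b b = pmap (tp (\<sigma> (\<iota> b)))" unfolding darboux_pmap[OF g G] 2 by (simp add: \<iota>_def)
    qed
    have "holo_on (\<lambda>b. \<phi>' (tp (\<sigma> (\<iota> b))) $ 3 - O_trans (2 - int k) i j (b $ 1) * s) S"
    proof (intro holo_on_diff holo_on_mult holo_on_const)
      have "hmap_on (\<lambda>b. \<sigma> (\<iota> b)) S"
        by (rule hmap_on_compose[OF darboux_chartD(8)[OF g] h\<iota>]) (use disc(2) in \<open>auto simp: S_def R_def\<close>)
      then show "holo_on (\<lambda>b. \<phi>' (tp (\<sigma> (\<iota> b))) $ 3) S"
        by (rule holo_on_compose[OF hmap_onD[OF darboux_chartD(7)[OF g']]]) (auto simp: S_def R_def Ve' sat_def)
      have "holo_on (\<lambda>b :: complex^2. affine_rep i (b $ 1) $ j) S"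
        by (cases "j = i") (simp_all add: affine_rep_def)
      moreover have "affine_rep i (b $ 1) $ j \<noteq> 0" if "b \<in> S" for b
      proof -
        have "tp (\<sigma> (\<iota> b)) \<in> G" "tp (\<sigma> (\<iota> b)) \<in> G'" using pt(1)[OF that] by (auto simp: Ve Ve')
        from O_trans_inverse(1)[OF g g' this, unfolded pt(2)[OF that]] show ?thesis by (simp add: \<iota>_def)
      qed
      ultimately show "holo_on (\<lambda>b. O_trans (2 - int k) i j (b $ 1)) S"
        unfolding O_trans_def by (intro holo_on_powi holo_on_divide holo_on_const) simp_all
    qed
    then have "holo_on (\<lambda>b. h (?b b)) S"
    proof (rule holo_on_transform[OF _ oS])
      fix b assume b: "b \<in> S"
      show "\<phi>' (tp (\<sigma> (\<iota> b))) $ 3 - O_trans (2 - int k) i j (b $ 1) * s = h (?b b)"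
        unfolding pt(3)[OF b] h[OF pt(1)[OF b]] D_def pt(2)[OF b] by (simp add: \<iota>_def)
    qed
    then show "\<exists>T. b0 \<in> T \<and> holo_on (\<lambda>b. h (?b b)) T" using b0S by blast
  qed
  moreover have "\<phi>' z $ 3 = O_trans (2 - int k) i j (\<phi> z $ 1) * \<phi> z $ 3 + h (pmap z)" if "z \<in> Ve \<inter> Ve'" for z
    using h[OF that] by (simp add: D_def)
  ultimately show ?thesis by blast
qed

lemma affine_bundle: "affine_line_bundle TS \<A> (regular_twistors U g e k L) (int k) (2 - int k) pmap"
proof -
  \<comment> \<open>All Darboux charts at once, each cut down to its inner disc.\<close>
  define \<T> where "\<T> = {(i, Ve, \<phi>). \<exists>G c r \<rho> \<sigma>. darboux_chart i G \<phi> c r \<rho> \<sigma> \<and> Ve = {p \<in> G. norm (\<phi> p $ 3) < \<rho>}}"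
  have A: "(\<Union>(i, Ve, \<phi>)\<in>\<T>. Ve) = regular_twistors U g e k L"
  proof (intro set_eqI iffI)
    fix p assume "p \<in> (\<Union>(i, Ve, \<phi>)\<in>\<T>. Ve)"
    then show "p \<in> regular_twistors U g e k L" using darboux_regular by (auto simp: \<T>_def)
  next
    fix p assume "p \<in> regular_twistors U g e k L"
    from darboux_exists[OF this] obtain i G \<phi> c r \<rho> \<sigma> where g: "darboux_chart i G \<phi> c r \<rho> \<sigma>" "p \<in> G" "norm (\<phi> p $ 3) < \<rho>" by blast
    then have "(i, {p \<in> G. norm (\<phi> p $ 3) < \<rho>}, \<phi>) \<in> \<T>" unfolding \<T>_def by blast
    then show "p \<in> (\<Union>(i, Ve, \<phi>)\<in>\<T>. Ve)" using g(2,3) by blast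
  qed
  have B: "compatible_chart TS \<A> (Ve, \<phi>) \<and> (\<forall>z\<in>Ve. pmap z = O_point (int k) (affine_rep i (\<phi> z $ 1)) (\<phi> z $ 2))"
    if "(i, Ve, \<phi>) \<in> \<T>" for i Ve \<phi>
  proof -
    from that obtain G c r \<rho> \<sigma> where g: "darboux_chart i G \<phi> c r \<rho> \<sigma>" and Ve: "Ve = {p \<in> G. norm (\<phi> p $ 3) < \<rho>}" unfolding \<T>_def by blast
    show ?thesis using darboux_disc(5)[OF g] darboux_pmap[OF g] by (simp add: Ve)
  qed
  have C: "\<exists>h. holo_on (\<lambda>b. h (O_point (int k) (affine_rep i (b $ 1)) (b $ 2)))
             {b :: complex^2. O_point (int k) (affine_rep i (b $ 1)) (b $ 2) \<in> pmap ` (Ve \<inter> Ve')} \<and>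
           (\<forall>z\<in>Ve \<inter> Ve'. \<phi>' z $ 3 = O_trans (2 - int k) i j (\<phi> z $ 1) * \<phi> z $ 3 + h (pmap z))"
    if "(i, Ve, \<phi>) \<in> \<T>" "(j, Ve', \<phi>') \<in> \<T>" for i Ve \<phi> j Ve' \<phi>'
  proof -
    from that(1) obtain G c r \<rho> \<sigma> where g: "darboux_chart i G \<phi> c r \<rho> \<sigma>" "Ve = {p \<in> G. norm (\<phi> p $ 3) < \<rho>}" unfolding \<T>_def by blast
    from that(2) obtain G' c' r' \<rho>' \<sigma>' where g': "darboux_chart j G' \<phi>' c' r' \<rho>' \<sigma>'" "Ve' = {p \<in> G'. norm (\<phi>' p $ 3) < \<rho>'}" unfolding \<T>_def by blast
    show ?thesis by (rule transition_function[OF g(1) g'(1) g(2) g'(2)])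
  qed
  show ?thesis
    unfolding affine_line_bundle_def
  proof (intro exI[of _ \<T>] conjI)
    show "(\<Union>(i, Ve, \<phi>)\<in>\<T>. Ve) = regular_twistors U g e k L" by (rule A)
  qed (clarify, erule B, clarify, erule (1) C)
qed

end

theorem lemma4p3:
  fixes U :: "(complex^4) set"
    and g :: "complex^4 \<Rightarrow> complex^4^4"
    and vol :: "complex^4 \<Rightarrow> complex"
    and e :: "complex^4 \<Rightarrow> 2 \<Rightarrow> 2 \<Rightarrow> complex^4"
    and k :: nat
    and L :: "complex^4 \<Rightarrow> 2 list \<Rightarrow> complex"
    and \<A> :: "((complex^4) \<times> (complex^2)) set chart set"
  assumes "spacetime U g vol e" and "simply_connected U"
    and "asd_vacuum U g e"
    and "killing_spinor U g e k L"
    and "twistor_atlas U g e \<A>"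
  shows "\<exists>d p. parallel_dyad U g e d \<and>
      (\<forall>x\<in>U. \<forall>\<pi>. \<pi> \<noteq> 0 \<longrightarrow>
         p (twistor_point U g e (x, \<pi>)) = O_point (int k) (dyad_coords (d x) \<pi>) (contract k (L x) \<pi>)) \<and>
      (\<forall>V. atlas_open (twistor_space U g e) \<A> V \<and> V \<noteq> {} \<longrightarrow>
         V \<inter> regular_twistors U g e k L \<noteq> {}) \<and>
      affine_line_bundle (twistor_space U g e) \<A> (regular_twistors U g e k L) (int k) (2 - int k) p"
proof -
  interpret tetrad U g e by (rule spacetime_tetrad[OF assms(1)])
  have "U \<noteq> {}" using assms(4) by (auto simp: killing_spinor_def)
  then obtain d where d: "parallel_dyad U g e d"
    using parallel_dyad_exists[OF assms(3,2)] by blast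
  interpret twistor_setting U g e d k L \<A>
    by unfold_locales (use d assms(4,5) simply_connected_imp_connected[OF assms(2)] in auto)
  show ?thesis
    by (rule exI[of _ d], rule exI[of _ pmap]) (use d pmap_spinor regular_dense affine_bundle in blast)
qed

end
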